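(* For every $1<r<\infty$ there exist constants $m_r,M_r>0$ such that for all $f\in L^r(\mathbb{R})$, $$m_r\|f\|_r\le\Big\|\Big(\sum_{j\in\mathbb{Z}}|S_jf|^2\Big)^{1/2}\Big\|_r\le M_r\|f\|_r,$$ where $S_j$ is given by $\mathcal{F}_A(S_jf)(\omega)=\chi_{\Delta_j}(\omega)\mathcal{F}_A(f)(\omega)$ with $\Delta_j=[-2^{j+1},-2^j]\cup[2^j,2^{j+1}]$.
   Context: $A=\{a,b,c,d,p,q\}$ are real parameters with $ad-bc=1$ and $b\neq0$. The special affine Fourier transform is $\mathcal{F}_Af(\omega)=\frac{1}{\sqrt{|b|}}\int_{\mathbb{R}}f(t)e^{\frac{\pi i}{b}(at^2+2pt-2\omega t+2(bq-dp)\omega+d\omega^2)}\,dt$ for $f\in L^1(\mathbb{R})$, extended to a unitary operator on $L^2(\mathbb{R})$. The operators $S_j$ are defined by the stated formula on $L^2(\mathbb{R})\cap L^r(\mathbb{R})$ and extended to bounded operators on $L^r(\mathbb{R})$. $\chi_E$ is the indicator function of $E$. *)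

theory Defs
  imports "HOL-Analysis.Analysis"
begin

section \<open>The spaces $L^r$ of the real line\<close>

definition ennreal_powr :: "ennreal \<Rightarrow> real \<Rightarrow> ennreal"  (* intended for a positive exponent *)
  where "ennreal_powr x s = (if x = \<infinity> then \<infinity> else ennreal (enn2real x powr s))"

definition nn_norm :: "real \<Rightarrow> (real \<Rightarrow> ennreal) \<Rightarrow> ennreal"
  where "nn_norm r g = ennreal_powr (\<integral>\<^sup>+ x. ennreal_powr (g x) r \<partial>lebesgue) (1 / r)"

definition Lr_norm :: "real \<Rightarrow> (real \<Rightarrow> complex) \<Rightarrow> ennreal"
  where "Lr_norm r f = nn_norm r (\<lambda>x. ennreal (cmod (f x)))"

text \<open>Elements are functions, not classes modulo almost everywhere equality.\<close>

definition Lr :: "real \<Rightarrow> (real \<Rightarrow> complex) set"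
  where "Lr r = {f \<in> borel_measurable lebesgue. Lr_norm r f < \<infinity>}"

text \<open>
  The value at \<open>f\<close> of the continuous extension to \<open>Lr r\<close> of an operator \<open>T\<close> given on a subset \<open>D\<close>
  that is dense in \<open>Lr r\<close>: the common limit in \<open>Lr r\<close> of \<open>T (u n)\<close> over all sequences \<open>u\<close> in \<open>D\<close>
  converging to \<open>f\<close>. As \<open>D\<close> is dense, the limit is unique up to a null set, and \<open>SOME\<close> picks a
  representative of it.
\<close>

definition continuous_ext ::
  "real \<Rightarrow> (real \<Rightarrow> complex) set \<Rightarrow> ((real \<Rightarrow> complex) \<Rightarrow> real \<Rightarrow> complex) \<Rightarrow>
    (real \<Rightarrow> complex) \<Rightarrow> real \<Rightarrow> complex"
  where "continuous_ext r D T f = (SOME g. g \<in> Lr r \<and>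
    (\<forall>u :: nat \<Rightarrow> real \<Rightarrow> complex.
       (\<forall>n. u n \<in> D) \<longrightarrow> (\<lambda>n. Lr_norm r (\<lambda>x. u n x - f x)) \<longlonglongrightarrow> 0 \<longrightarrow>
       (\<lambda>n. Lr_norm r (\<lambda>x. T (u n) x - g x)) \<longlonglongrightarrow> 0))"

section \<open>The special affine Fourier transform\<close>

type_synonym saft_param = "real \<times> real \<times> real \<times> real \<times> real \<times> real"

fun SAFT_L1 :: "saft_param \<Rightarrow> (real \<Rightarrow> complex) \<Rightarrow> real \<Rightarrow> complex"
  where "SAFT_L1 (a, b, c, d, p, q) f \<omega> =
    complex_of_real (1 / sqrt \<bar>b\<bar>) *
    (LINT t|lebesgue. f t *
       exp (\<i> * complex_of_real (pi / b *
         (a * t\<^sup>2 + 2 * p * t - 2 * \<omega> * t + 2 * (b * q - d * p) * \<omega> + d * \<omega>\<^sup>2))))"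

definition SAFT :: "saft_param \<Rightarrow> (real \<Rightarrow> complex) \<Rightarrow> real \<Rightarrow> complex"
  where "SAFT A = continuous_ext 2 (Lr 1 \<inter> Lr 2) (SAFT_L1 A)"

section \<open>The dyadic frequency projections and the square function\<close>

definition Delta :: "int \<Rightarrow> real set"
  where "Delta j = {- (2 powi (j + 1)) .. - (2 powi j)} \<union> {2 powi j .. 2 powi (j + 1)}"

text \<open>
  On \<open>Lr 2\<close> the function \<open>h\<close> below is determined up to a null set, because \<open>SAFT A\<close> is unitary.
\<close>

definition S_L2 :: "saft_param \<Rightarrow> int \<Rightarrow> (real \<Rightarrow> complex) \<Rightarrow> real \<Rightarrow> complex"
  where "S_L2 A j f = (SOME h. h \<in> Lr 2 \<and>
    (AE \<omega> in lebesgue. SAFT A h \<omega> = indicator (Delta j) \<omega> * SAFT A f \<omega>))"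

definition S_op :: "saft_param \<Rightarrow> real \<Rightarrow> int \<Rightarrow> (real \<Rightarrow> complex) \<Rightarrow> real \<Rightarrow> complex"
  where "S_op A r j = continuous_ext r (Lr 2 \<inter> Lr r) (S_L2 A j)"

text \<open>The square function is \<open>ennreal\<close>-valued, so that a divergent sum counts as infinite.\<close>

definition square_fun :: "saft_param \<Rightarrow> real \<Rightarrow> (real \<Rightarrow> complex) \<Rightarrow> real \<Rightarrow> ennreal"
  where "square_fun A r f x =
    ennreal_powr (\<Sum>\<^sub>\<infinity>j\<in>UNIV. ennreal ((cmod (S_op A r j f x))\<^sup>2)) (1 / 2)"

end

theory Submission
  imports Defs "HOL-Probability.Probability" "HOL-Real_Asymp.Real_Asymp"
begin

text \<open>
  Up to unimodular factors (chirps) the special affine Fourier transform is the Fourier transform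
  with frequency unit \<open>2 * pi / b\<close>, so each \<open>S\<^sub>j\<close> is, up to a chirp, the Fourier multiplier of a dyadic
  annulus, and the claim is the Littlewood-Paley theorem. For random signs, the signed sums of the
  smoothed annuli are Fourier multipliers whose kernels satisfy Hormander's condition uniformly, so
  Calderon-Zygmund theory and Khintchine's inequality bound the smooth square function. A sharp
  annulus is a combination of modulated half-line multipliers applied to the smooth one; these act
  boundedly on square functions, again by Khintchine's inequality. The lower bound follows by
  duality from the upper bound for the conjugate exponent.
\<close>

text \<open>Even a single sharp annulus violates Hormander's condition: its kernel oscillates and
  decays only like 1/|x|. The trapezoids \<open>psi\<close> have kernels decaying like 1/x^2, so the
  scale 2^j contributes only min(t, 1/t) with t = 2^j |y|, which is summable over j. They overlap,
  so sharp annuli have to be recovered: all half-line projections are modulations of one operator,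
  and factors of modulus one disappear inside a square function. There Khintchine's inequality is
  used in both directions, while the smooth square function takes one. Calderon-Zygmund theory
  covers 1 < p < 2, Plancherel p = 2, and duality of multipliers p > 2. The operators are continuous
  extensions, determined up to null sets. Estimates are therefore proved on step functions, or on
  the intersection of L^2 and L^r, for finitely many annuli and with constants independent of their
  number, and only then passed to limits; the full square function is a supremum over symmetric
  finite ranges of j.\<close>

section \<open>Powers of extended nonnegative reals\<close>

lemma ennreal_powr_ennreal [simp]: "0 \<le> x \<Longrightarrow> ennreal_powr (ennreal x) s = ennreal (x powr s)"
  by (simp add: ennreal_powr_def)

lemma ennreal_powr_top [simp]: "ennreal_powr \<top> s = \<top>"
  by (simp add: ennreal_powr_def)

lemma ennreal_powr_0 [simp]: "ennreal_powr 0 s = 0"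
  by (simp add: ennreal_powr_def)

lemma ennreal_powr_mono:
  assumes "x \<le> y" "0 \<le> s" shows "ennreal_powr x s \<le> ennreal_powr y s"
proof (cases y)
  case (real b)
  with assms obtain a where "x = ennreal a" "0 \<le> a" by (cases x) (auto simp: top_unique)
  with real assms show ?thesis by (auto intro!: ennreal_leI powr_mono2)
qed auto

lemma ennreal_powr_powr:
  assumes "0 < s" "0 < t" shows "ennreal_powr (ennreal_powr x s) t = ennreal_powr x (s * t)"
  using assms by (cases x) (auto simp: powr_powr)

lemma ennreal_powr_1 [simp]: "ennreal_powr x 1 = x"
  by (cases x) auto

lemma ennreal_powr_inverse [simp]:
  assumes "0 < s" shows "ennreal_powr (ennreal_powr x s) (1 / s) = x"
    "ennreal_powr (ennreal_powr x (1 / s)) s = x"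
  using assms by (simp_all add: ennreal_powr_powr)

lemma ennreal_powr_le_iff:
  assumes "0 < s" shows "ennreal_powr x s \<le> ennreal_powr y s \<longleftrightarrow> x \<le> y"
  using ennreal_powr_mono[of x y s] ennreal_powr_mono[of "ennreal_powr x s" "ennreal_powr y s" "1/s"] assms
  by auto

lemma ennreal_powr_mult:
  "ennreal_powr (x * y) s = ennreal_powr x s * ennreal_powr y s"
proof (cases "x = 0 \<or> y = 0")
  case True then show ?thesis by auto
next
  case False
  show ?thesis
  proof (cases x; cases y)
    fix a b assume "0 \<le> a" "x = ennreal a" "0 \<le> b" "y = ennreal b"
    then show ?thesis by (simp add: ennreal_mult[symmetric] powr_mult)
  qed (use False in \<open>auto simp: ennreal_top_mult ennreal_mult_top ennreal_powr_def ennreal_mult_eq_top_iff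
      enn2real_eq_0_iff\<close>)
qed

lemma ennreal_powr_eq_0_iff [simp]: "ennreal_powr x s = 0 \<longleftrightarrow> x = 0"
  by (cases x) (auto simp: ennreal_eq_0_iff)

lemma ennreal_powr_eq_top_iff [simp]: "ennreal_powr x s = \<top> \<longleftrightarrow> x = \<top>"
  by (cases x) auto

lemma ennreal_powr_less_top_iff [simp]: "ennreal_powr x s < \<top> \<longleftrightarrow> x < \<top>"
  by (simp add: less_top[symmetric])

lemma ennreal_powr_SUP:
  assumes "0 < s" shows "ennreal_powr (SUP i\<in>I. f i) s = (SUP i\<in>I. ennreal_powr (f i) s)"
proof (rule antisym)
  have "f i \<le> ennreal_powr (SUP i\<in>I. ennreal_powr (f i) s) (1 / s)" if "i \<in> I" for i
    using ennreal_powr_mono[OF SUP_upper[OF that, of "\<lambda>i. ennreal_powr (f i) s"], of "1/s"] assms by simp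
  then have "(SUP i\<in>I. f i) \<le> ennreal_powr (SUP i\<in>I. ennreal_powr (f i) s) (1 / s)"
    by (rule SUP_least)
  from ennreal_powr_mono[OF this, of s] assms
  show "ennreal_powr (SUP i\<in>I. f i) s \<le> (SUP i\<in>I. ennreal_powr (f i) s)" by simp
qed (auto intro!: SUP_least ennreal_powr_mono SUP_upper simp: assms less_imp_le)

text \<open>The threshold is pulled back: arguments below \<open>ennreal_powr a (1 / s)\<close> have
  powers below \<open>a\<close>.\<close>

lemma ennreal_powr_tendsto_0:
  assumes "(f \<longlongrightarrow> 0) F" "0 < s" shows "((\<lambda>x. ennreal_powr (f x) s) \<longlongrightarrow> 0) F"
proof (rule order_tendstoI)
  fix a :: ennreal assume "0 < a"
  then have "0 < ennreal_powr a (1 / s)" by (simp add: zero_less_iff_neq_zero)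
  from order_tendstoD(2)[OF assms(1) this]
  show "\<forall>\<^sub>F x in F. ennreal_powr (f x) s < a"
  proof eventually_elim
    case (elim x)
    then have "\<not> ennreal_powr a (1 / s) \<le> f x" by simp
    then show ?case using ennreal_powr_mono[of a "ennreal_powr (f x) s" "1/s"] assms(2)
      by (auto simp: not_le[symmetric])
  qed
qed auto

lemma ennreal_powr_measurable [measurable]:
  "f \<in> borel_measurable M \<Longrightarrow> (\<lambda>x. ennreal_powr (f x) s) \<in> borel_measurable M"
proof -
  assume [measurable]: "f \<in> borel_measurable M"
  have "{x \<in> space M. f x = \<top>} = f -` {\<top>} \<inter> space M" by auto
  then have "{x \<in> space M. f x = \<top>} \<in> sets M" by simp
  moreover have "(\<lambda>x. ennreal (enn2real (f x) powr s)) \<in> borel_measurable M" by measurable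
  ultimately show ?thesis unfolding ennreal_powr_def infinity_ennreal_def
    by (intro measurable_If measurable_const) auto
qed

section \<open>The spaces of $r$-integrable functions\<close>

text \<open>The r-th power of the norm. As a plain integral it can be summed over signs and passed
  to limits without handling roots; \<open>Lr_norm_En\<close> and \<open>En_Lr_norm\<close>
  translate back and forth.\<close>

definition En :: "real \<Rightarrow> (real \<Rightarrow> complex) \<Rightarrow> ennreal"
  where "En r f = (\<integral>\<^sup>+ x. ennreal (cmod (f x) powr r) \<partial>lebesgue)"

lemma Lr_norm_En: "Lr_norm r f = ennreal_powr (En r f) (1 / r)"
  by (simp add: Lr_norm_def nn_norm_def En_def)

lemma En_Lr_norm: "0 < r \<Longrightarrow> En r f = ennreal_powr (Lr_norm r f) r"
  by (simp add: Lr_norm_En)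

lemma Lr_measurable: "f \<in> Lr r \<Longrightarrow> f \<in> borel_measurable lebesgue"
  by (simp add: Lr_def)

lemma Lr_iff_En: "f \<in> Lr r \<longleftrightarrow> f \<in> borel_measurable lebesgue \<and> En r f < \<top>"
  by (simp add: Lr_def Lr_norm_En)

lemma Lr_norm_lt_top: "f \<in> Lr r \<Longrightarrow> Lr_norm r f < \<top>"
  by (simp add: Lr_def)

lemma En_cong_AE: "AE x in lebesgue. cmod (f x) = cmod (g x) \<Longrightarrow> En r f = En r g"
  unfolding En_def by (rule nn_integral_cong_AE) (elim eventually_mono, simp)

lemma Lr_norm_cong_AE: "AE x in lebesgue. cmod (f x) = cmod (g x) \<Longrightarrow> Lr_norm r f = Lr_norm r g"
  by (simp add: Lr_norm_En En_cong_AE)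

lemma En_mono_AE: "0 \<le> r \<Longrightarrow> AE x in lebesgue. cmod (f x) \<le> cmod (g x) \<Longrightarrow> En r f \<le> En r g"
  unfolding En_def by (intro nn_integral_mono_AE) (auto elim!: eventually_mono intro!: ennreal_leI powr_mono2)

lemma Lr_norm_mono_AE:
  "0 \<le> r \<Longrightarrow> AE x in lebesgue. cmod (f x) \<le> cmod (g x) \<Longrightarrow> Lr_norm r f \<le> Lr_norm r g"
  by (simp add: Lr_norm_En En_mono_AE ennreal_powr_mono)

lemma Lr_norm_cmult:
  assumes "f \<in> borel_measurable lebesgue" "0 < r"
  shows "Lr_norm r (\<lambda>x. a * f x) = ennreal (cmod a) * Lr_norm r f"
proof -
  have "En r (\<lambda>x. a * f x) = (\<integral>\<^sup>+x. ennreal (cmod a powr r) * ennreal (cmod (f x) powr r) \<partial>lebesgue)"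
    by (simp add: En_def norm_mult powr_mult ennreal_mult)
  also have "\<dots> = ennreal (cmod a powr r) * En r f"
    unfolding En_def using assms by (subst nn_integral_cmult) auto
  finally show ?thesis using assms by (simp add: Lr_norm_En ennreal_powr_mult powr_powr)
qed

lemma Lr_norm_minus_commute: "Lr_norm r (\<lambda>x. f x - g x) = Lr_norm r (\<lambda>x. g x - f x)"
  by (simp add: Lr_norm_def norm_minus_commute)

lemma Lr_norm_zero [simp]: "Lr_norm r (\<lambda>x. 0) = 0"
  by (simp add: Lr_norm_En En_def)

lemma Lr_norm_eq_0_AE:
  assumes "f \<in> borel_measurable lebesgue" "Lr_norm r f = 0" shows "AE x in lebesgue. f x = 0"
proof -
  have "En r f = 0" using assms(2) by (simp add: Lr_norm_En)
  then have "AE x in lebesgue. ennreal (cmod (f x) powr r) = 0"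
    unfolding En_def using assms(1) by (subst (asm) nn_integral_0_iff_AE) auto
  then show ?thesis by (auto elim!: eventually_mono simp: ennreal_eq_0_iff)
qed

text \<open>Convexity of the r-th power at (x + y) / (s + t), a convex combination of x / s and y /
  t. With s and t the norms of two functions this is the pointwise form of Minkowski's
  inequality.\<close>

lemma convex_combination_powr:
  fixes x y :: real
  assumes "0 \<le> x" "0 \<le> y" "0 < s" "0 < t" "1 \<le> r"
  shows "(x + y) powr r \<le> (s + t) powr r * (s / (s + t) * (x / s) powr r + t / (s + t) * (y / t) powr r)"
proof -
  have le: "u powr r \<le> u" if "0 \<le> u" "u \<le> 1" for u :: real
    using powr_mono'[of 1 r u] that assms by simp
  have eq: "(s / (s+t)) *\<^sub>R (x / s) + (t / (s+t)) *\<^sub>R (y / t) = (x + y) / (s + t)"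
    using assms by (simp add: add_divide_distrib)
  have "((x + y) / (s + t)) powr r \<le> s/(s+t) * (x/s) powr r + t/(s+t) * (y/t) powr r"
  \<comment> \<open>The convexity used is that on the positive half-line, so a vanishing argument is
    treated by hand with \<open>u powr r <= u\<close> on [0, 1].\<close>
  proof (cases "x = 0 \<or> y = 0")
    case True
    have "(t / (s+t) * (y / t)) powr r \<le> t/(s+t) * (y/t) powr r"
      "(s / (s+t) * (x / s)) powr r \<le> s/(s+t) * (x/s) powr r"
      unfolding powr_mult using assms by (intro mult_right_mono le; simp)+
    with True show ?thesis using assms by auto
  next
    case False
    have "((1 - t / (s+t)) *\<^sub>R (x / s) + (t / (s+t)) *\<^sub>R (y / t)) powr r
       \<le> (1 - t/(s+t)) * (x/s) powr r + t/(s+t) * (y/t) powr r"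
      by (rule convex_onD[OF powr_convex]) (use assms False in auto)
    moreover have "1 - t / (s+t) = s / (s+t)" using assms by (simp add: field_simps)
    ultimately show ?thesis using eq by simp
  qed
  then have "(s + t) powr r * ((x + y) / (s + t)) powr r
      \<le> (s + t) powr r * (s/(s+t) * (x/s) powr r + t/(s+t) * (y/t) powr r)"
    by (intro mult_left_mono) auto
  moreover have "(s + t) powr r * ((x + y) / (s + t)) powr r = (x + y) powr r"
    using assms by (simp add: powr_mult[symmetric])
  ultimately show ?thesis by simp
qed

text \<open>Minkowski's inequality: with s and t the two norms, the pointwise convexity estimate
  integrates to \<open>(s + t) powr r\<close>. A zero norm cannot be divided by and means vanishing
  almost everywhere.\<close>

lemma Lr_norm_triangle:
  assumes [measurable]: "f \<in> borel_measurable lebesgue" "g \<in> borel_measurable lebesgue" and r: "1 \<le> r"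
  shows "Lr_norm r (\<lambda>x. f x + g x) \<le> Lr_norm r f + Lr_norm r g"
proof -
  consider "Lr_norm r f = \<top> \<or> Lr_norm r g = \<top>" | "Lr_norm r f = 0" | "Lr_norm r g = 0"
    | s t where "Lr_norm r f = ennreal s" "Lr_norm r g = ennreal t" "0 < s" "0 < t"
    by (cases "Lr_norm r f"; cases "Lr_norm r g") (force simp: less_le)+
  then show ?thesis
  proof cases
    case 1 then show ?thesis by auto
  next
    case 2
    then have "AE x in lebesgue. f x = 0" by (rule Lr_norm_eq_0_AE[rotated]) auto
    then have "Lr_norm r (\<lambda>x. f x + g x) = Lr_norm r g"
      by (intro Lr_norm_cong_AE) (auto elim!: eventually_mono)
    then show ?thesis by simp
  next
    case 3
    then have "AE x in lebesgue. g x = 0" by (rule Lr_norm_eq_0_AE[rotated]) auto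
    then have "Lr_norm r (\<lambda>x. f x + g x) = Lr_norm r f"
      by (intro Lr_norm_cong_AE) (auto elim!: eventually_mono)
    then show ?thesis by simp
  next
    case 4
    have Ef: "En r f = ennreal (s powr r)" "En r g = ennreal (t powr r)"
      using 4 r by (simp_all add: En_Lr_norm)
    have "En r (\<lambda>x. f x + g x) \<le> (\<integral>\<^sup>+x. ennreal ((s+t) powr r * (s/(s+t) / s powr r)) * ennreal (cmod (f x) powr r)
        + ennreal ((s+t) powr r * (t/(s+t) / t powr r)) * ennreal (cmod (g x) powr r) \<partial>lebesgue)"
      unfolding En_def
    proof (rule nn_integral_mono)
      fix x
      have "cmod (f x + g x) powr r \<le> (cmod (f x) + cmod (g x)) powr r"
        using r by (intro powr_mono2 norm_triangle_ineq) auto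
      also have "\<dots> \<le> (s + t) powr r * (s / (s + t) * (cmod (f x) / s) powr r + t / (s + t) * (cmod (g x) / t) powr r)"
        using 4 r by (intro convex_combination_powr) auto
      also have "\<dots> = (s+t) powr r * (s/(s+t) / s powr r) * (cmod (f x) powr r)
         + (s+t) powr r * (t/(s+t) / t powr r) * (cmod (g x) powr r)"
        using 4 by (simp add: powr_divide algebra_simps)
      finally show "ennreal (cmod (f x + g x) powr r) \<le> ennreal ((s+t) powr r * (s/(s+t) / s powr r)) * ennreal (cmod (f x) powr r)
        + ennreal ((s+t) powr r * (t/(s+t) / t powr r)) * ennreal (cmod (g x) powr r)"
        using 4 by (simp add: ennreal_mult[symmetric] ennreal_plus[symmetric] ennreal_leI del: ennreal_plus)
    qed
    also have "\<dots> = ennreal ((s+t) powr r * (s/(s+t) / s powr r)) * En r f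
        + ennreal ((s+t) powr r * (t/(s+t) / t powr r)) * En r g"
      unfolding En_def by (subst nn_integral_add) (auto simp: nn_integral_cmult)
    also have "\<dots> = ennreal ((s+t) powr r * (s/(s+t)) + (s+t) powr r * (t/(s+t)))"
      unfolding Ef using 4 by (simp add: ennreal_mult[symmetric] ennreal_plus[symmetric] del: ennreal_plus)
    also have "(s+t) powr r * (s/(s+t)) + (s+t) powr r * (t/(s+t)) = (s+t) powr r"
      using 4 by (simp add: distrib_left[symmetric] add_divide_distrib[symmetric])
    finally have "En r (\<lambda>x. f x + g x) \<le> ennreal ((s+t) powr r)" .
    then have "Lr_norm r (\<lambda>x. f x + g x) \<le> ennreal_powr (ennreal ((s+t) powr r)) (1/r)"
      unfolding Lr_norm_En using r by (intro ennreal_powr_mono) auto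
    also have "\<dots> = ennreal (s + t)" using 4 r by (simp add: powr_powr)
    finally show ?thesis using 4 by simp
  qed
qed

lemma Lr_norm_diff_triangle:
  assumes "f \<in> borel_measurable lebesgue" "g \<in> borel_measurable lebesgue" "h \<in> borel_measurable lebesgue" "1 \<le> r"
  shows "Lr_norm r (\<lambda>x. f x - h x) \<le> Lr_norm r (\<lambda>x. f x - g x) + Lr_norm r (\<lambda>x. g x - h x)"
  using Lr_norm_triangle[of "\<lambda>x. f x - g x" "\<lambda>x. g x - h x" r] assms by simp

lemma Lr_norm_le_diff:
  assumes "f \<in> borel_measurable lebesgue" "g \<in> borel_measurable lebesgue" "1 \<le> r"
  shows "Lr_norm r f \<le> Lr_norm r g + Lr_norm r (\<lambda>x. f x - g x)"
  using Lr_norm_triangle[of g "\<lambda>x. f x - g x" r] assms by simp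

lemma Lr_lincomb:
  assumes "f \<in> Lr r" "g \<in> Lr r" "1 \<le> r" shows "(\<lambda>x. f x + a * g x) \<in> Lr r"
proof -
  have m: "f \<in> borel_measurable lebesgue" "g \<in> borel_measurable lebesgue" using assms by (auto simp: Lr_def)
  then have "Lr_norm r (\<lambda>x. f x + a * g x) \<le> Lr_norm r f + ennreal (cmod a) * Lr_norm r g"
    using Lr_norm_triangle[of f "\<lambda>x. a * g x" r] assms Lr_norm_cmult[of g r a] by simp
  also have "\<dots> < \<top>" using assms by (auto simp: Lr_def ennreal_mult_less_top)
  finally show ?thesis using m by (auto simp: Lr_def)
qed

lemma Lr_zero [simp]: "(\<lambda>x. 0) \<in> Lr r"
  by (simp add: Lr_def)

lemma Lr_cmult: "f \<in> Lr r \<Longrightarrow> 1 \<le> r \<Longrightarrow> (\<lambda>x. a * f x) \<in> Lr r"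
  using Lr_lincomb[of "\<lambda>x. 0" r f a] by simp

lemma Lr_add: "f \<in> Lr r \<Longrightarrow> g \<in> Lr r \<Longrightarrow> 1 \<le> r \<Longrightarrow> (\<lambda>x. f x + g x) \<in> Lr r"
  using Lr_lincomb[of f r g 1] by simp

lemma Lr_diff: "f \<in> Lr r \<Longrightarrow> g \<in> Lr r \<Longrightarrow> 1 \<le> r \<Longrightarrow> (\<lambda>x. f x - g x) \<in> Lr r"
  using Lr_lincomb[of f r g "-1"] by simp

lemma Lr_sum: "(\<And>i. i \<in> I \<Longrightarrow> f i \<in> Lr r) \<Longrightarrow> 1 \<le> r \<Longrightarrow> (\<lambda>x. \<Sum>i\<in>I. f i x) \<in> Lr r"
  by (induction I rule: infinite_finite_induct) (auto intro: Lr_add)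

lemma Lr_bounded_by:
  assumes "f \<in> borel_measurable lebesgue" "g \<in> Lr r" "AE x in lebesgue. cmod (f x) \<le> cmod (g x)" "0 \<le> r"
  shows "f \<in> Lr r"
  using assms Lr_norm_mono_AE[of r f g] by (auto simp: Lr_def)

lemma Lr_mult_bounded:
  assumes m: "m \<in> borel_measurable lebesgue" and b: "\<And>x. cmod (m x) \<le> B" and f: "f \<in> Lr r" and r: "1 \<le> r"
  shows "(\<lambda>x. m x * f x) \<in> Lr r" "Lr_norm r (\<lambda>x. m x * f x) \<le> ennreal B * Lr_norm r f"
proof -
  have B: "0 \<le> B" using b[of 0] norm_ge_zero[of "m 0"] by linarith
  have [measurable]: "m \<in> borel_measurable lebesgue" "f \<in> borel_measurable lebesgue" using m f by (auto simp: Lr_def)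
  have "cmod (m x * f x) \<le> cmod (of_real B * f x)" for x
    using b[of x] B by (simp add: norm_mult mult_right_mono)
  then have "Lr_norm r (\<lambda>x. m x * f x) \<le> Lr_norm r (\<lambda>x. of_real B * f x)"
    using r by (intro Lr_norm_mono_AE) auto
  also have "\<dots> = ennreal B * Lr_norm r f" using r B by (subst Lr_norm_cmult) auto
  finally show "Lr_norm r (\<lambda>x. m x * f x) \<le> ennreal B * Lr_norm r f" .
  also have "\<dots> < \<top>" using f by (simp add: Lr_def ennreal_mult_less_top)
  finally show "(\<lambda>x. m x * f x) \<in> Lr r" by (simp add: Lr_def)
qed

text \<open>Young's inequality for |f| / s and |g| / t with s and t the norms; the weights 1 / p and
  1 / q add up to one. Vanishing norms come first, because 0 times an infinite norm is 0 and the
  left side must then be shown to vanish.\<close>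

lemma Holder_Lr:
  assumes [measurable]: "f \<in> borel_measurable lebesgue" "g \<in> borel_measurable lebesgue"
    and pq: "1 < p" "1 < q" "1 / p + 1 / q = 1"
  shows "(\<integral>\<^sup>+x. ennreal (cmod (f x) * cmod (g x)) \<partial>lebesgue) \<le> Lr_norm p f * Lr_norm q g"
proof -
  consider "Lr_norm p f = 0" | "Lr_norm q g = 0" | "Lr_norm p f \<noteq> 0 \<and> Lr_norm q g \<noteq> 0 \<and> (Lr_norm p f = \<top> \<or> Lr_norm q g = \<top>)"
    | s t where "Lr_norm p f = ennreal s" "Lr_norm q g = ennreal t" "0 < s" "0 < t"
    by (cases "Lr_norm p f"; cases "Lr_norm q g") (force simp: less_le)+
  then show ?thesis
  proof cases
    case 1
    then have "AE x in lebesgue. f x = 0" by (rule Lr_norm_eq_0_AE[rotated]) auto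
    then have "(\<integral>\<^sup>+x. ennreal (cmod (f x) * cmod (g x)) \<partial>lebesgue) = (\<integral>\<^sup>+(x::real). 0 \<partial>lebesgue)"
      by - (rule nn_integral_cong_AE, elim eventually_mono, simp)
    then show ?thesis by simp
  next
    case 2
    then have "AE x in lebesgue. g x = 0" by (rule Lr_norm_eq_0_AE[rotated]) auto
    then have "(\<integral>\<^sup>+x. ennreal (cmod (f x) * cmod (g x)) \<partial>lebesgue) = (\<integral>\<^sup>+(x::real). 0 \<partial>lebesgue)"
      by - (rule nn_integral_cong_AE, elim eventually_mono, simp)
    then show ?thesis by simp
  next
    case 3 then show ?thesis by (auto simp: ennreal_top_mult ennreal_mult_top)
  next
    case 4
    have Ef: "En p f = ennreal (s powr p)" "En q g = ennreal (t powr q)"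
      using 4 pq by (simp_all add: En_Lr_norm)
    have "(\<integral>\<^sup>+x. ennreal (cmod (f x) * cmod (g x)) \<partial>lebesgue) \<le>
       (\<integral>\<^sup>+x. ennreal (s * t / p / s powr p) * ennreal (cmod (f x) powr p)
        + ennreal (s * t / q / t powr q) * ennreal (cmod (g x) powr q) \<partial>lebesgue)"
    proof (rule nn_integral_mono)
      fix x
      have "(cmod (f x) / s) * (cmod (g x) / t) \<le> (cmod (f x) / s) powr p / p + (cmod (g x) / t) powr q / q"
        using pq 4 by (intro Youngs_inequality) auto
      then have "s * t * ((cmod (f x) / s) * (cmod (g x) / t)) \<le> s * t * ((cmod (f x) / s) powr p / p + (cmod (g x) / t) powr q / q)"
        using 4 by (intro mult_left_mono) auto
      also have "s * t * ((cmod (f x) / s) * (cmod (g x) / t)) = cmod (f x) * cmod (g x)" using 4 by simp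
      also have "s * t * ((cmod (f x) / s) powr p / p + (cmod (g x) / t) powr q / q) =
        s * t / p / s powr p * cmod (f x) powr p + s * t / q / t powr q * cmod (g x) powr q"
        using 4 by (simp add: powr_divide algebra_simps)
      finally show "ennreal (cmod (f x) * cmod (g x)) \<le> ennreal (s * t / p / s powr p) * ennreal (cmod (f x) powr p)
        + ennreal (s * t / q / t powr q) * ennreal (cmod (g x) powr q)"
        using 4 pq by (simp add: ennreal_mult[symmetric] ennreal_plus[symmetric] ennreal_leI del: ennreal_plus)
    qed
    also have "\<dots> = ennreal (s * t / p / s powr p) * En p f + ennreal (s * t / q / t powr q) * En q g"
      unfolding En_def by (subst nn_integral_add) (auto simp: nn_integral_cmult)
    also have "\<dots> = ennreal (s * t / p + s * t / q)"
      unfolding Ef using 4 pq by (simp add: ennreal_mult[symmetric] ennreal_plus[symmetric] del: ennreal_plus)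
    also have "s * t / p + s * t / q = s * t * (1 / p + 1 / q)" by (simp add: algebra_simps)
    finally show ?thesis using 4 pq(3) by (simp add: ennreal_mult)
  qed
qed

section \<open>Convergence in $L^r$\<close>

lemma Fatou_En:
  assumes [measurable]: "\<And>n. u n \<in> borel_measurable lebesgue"
    and lim: "AE x in lebesgue. (\<lambda>n. u n x) \<longlonglongrightarrow> f x" and r: "0 < r"
    and b: "\<And>n. En r (u n) \<le> B"
  shows "En r f \<le> B"
proof -
  have "En r f = (\<integral>\<^sup>+x. liminf (\<lambda>n. ennreal (cmod (u n x) powr r)) \<partial>lebesgue)"
    unfolding En_def
  proof (rule nn_integral_cong_AE)
    from lim show "AE x in lebesgue. ennreal (cmod (f x) powr r) = liminf (\<lambda>n. ennreal (cmod (u n x) powr r))"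
    proof eventually_elim
      case (elim x)
      have "(\<lambda>n. ennreal (cmod (u n x) powr r)) \<longlonglongrightarrow> ennreal (cmod (f x) powr r)"
        by (intro tendsto_ennrealI tendsto_powr' tendsto_norm elim tendsto_const) (use r in auto)
      then show ?case by (rule lim_imp_Liminf[OF sequentially_bot, symmetric])
    qed
  qed
  also have "\<dots> \<le> liminf (\<lambda>n. En r (u n))"
    unfolding En_def by (intro nn_integral_liminf) auto
  also have "\<dots> \<le> B"
    by (rule Liminf_le) (use b in auto)
  finally show ?thesis .
qed

lemma Fatou_Lr_norm:
  assumes "\<And>n. u n \<in> borel_measurable lebesgue"
    and "AE x in lebesgue. (\<lambda>n. u n x) \<longlonglongrightarrow> f x" and r: "0 < r"
    and b: "\<And>n. Lr_norm r (u n) \<le> B"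
  shows "Lr_norm r f \<le> B"
proof -
  have "En r f \<le> ennreal_powr B r"
    by (rule Fatou_En[OF assms(1-3)]) (use b r in \<open>simp add: En_Lr_norm ennreal_powr_mono\<close>)
  then have "ennreal_powr (En r f) (1/r) \<le> ennreal_powr (ennreal_powr B r) (1/r)"
    using r by (intro ennreal_powr_mono) auto
  then show ?thesis using r by (simp add: Lr_norm_En)
qed

lemma dominated_Lr_norm:
  assumes [measurable]: "\<And>n. u n \<in> borel_measurable lebesgue"
    and lim: "AE x in lebesgue. (\<lambda>n. u n x) \<longlonglongrightarrow> 0" and r: "0 < r"
    and g: "g \<in> Lr r" and b: "\<And>n. AE x in lebesgue. cmod (u n x) \<le> cmod (g x)"
  shows "(\<lambda>n. Lr_norm r (u n)) \<longlonglongrightarrow> 0"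
proof -
  have [measurable]: "g \<in> borel_measurable lebesgue" using g by (simp add: Lr_def)
  have "(\<lambda>n. \<integral>\<^sup>+x. ennreal (cmod (u n x) powr r) \<partial>lebesgue) \<longlonglongrightarrow> (\<integral>\<^sup>+(x::real). ennreal 0 \<partial>lebesgue)"
  proof (rule nn_integral_dominated_convergence[where w="\<lambda>x. ennreal (cmod (g x) powr r)"])
    show "AE x in lebesgue. ennreal (cmod (u n x) powr r) \<le> ennreal (cmod (g x) powr r)" for n
      using b[of n] by eventually_elim (use r in \<open>auto intro!: ennreal_leI powr_mono2\<close>)
    show "(\<integral>\<^sup>+ x. ennreal (cmod (g x) powr r) \<partial>lebesgue) < \<infinity>"
      using g by (simp add: Lr_iff_En En_def)
    show "AE x in lebesgue. (\<lambda>n. ennreal (cmod (u n x) powr r)) \<longlonglongrightarrow> ennreal 0"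
      using lim
    proof eventually_elim
      case (elim x)
      have "(\<lambda>n. cmod (u n x) powr r) \<longlonglongrightarrow> cmod 0 powr r"
        by (intro tendsto_powr' tendsto_norm elim tendsto_const) (use r in auto)
      then show ?case by (intro tendsto_ennrealI) simp
    qed
  qed auto
  then have "(\<lambda>n. En r (u n)) \<longlonglongrightarrow> 0" by (simp add: En_def)
  from ennreal_powr_tendsto_0[OF this, of "1/r"] show ?thesis using r by (simp add: Lr_norm_En)
qed

lemma Lr_tendsto_AE_subseq:
  assumes m: "\<And>n. u n \<in> borel_measurable lebesgue" "f \<in> borel_measurable lebesgue"
    and lim: "(\<lambda>n. Lr_norm r (\<lambda>x. u n x - f x)) \<longlonglongrightarrow> 0" and r: "0 < r"
  obtains s :: "nat \<Rightarrow> nat" where "strict_mono s" "AE x in lebesgue. (\<lambda>n. u (s n) x) \<longlonglongrightarrow> f x"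
proof -
  note m[measurable]
  define v where "v n x = cmod (u n x - f x) powr r" for n x
  have [measurable]: "v n \<in> borel_measurable lebesgue" for n unfolding v_def by measurable
  have lE: "(\<lambda>n. En r (\<lambda>x. u n x - f x)) \<longlonglongrightarrow> 0"
    using ennreal_powr_tendsto_0[OF lim r] r by (simp add: En_Lr_norm)
  \<comment> \<open>The almost everywhere subsequence theorem for L^1 is applied to the powers |u n
    - f|^r, which are known to be integrable only from some index \<open>N\<close> on; hence the
    shift.\<close>
  then have "eventually (\<lambda>n. En r (\<lambda>x. u n x - f x) < 1) sequentially"
    by (rule order_tendstoD) simp
  then obtain N where N: "\<And>n. n \<ge> N \<Longrightarrow> En r (\<lambda>x. u n x - f x) < 1" by (auto simp: eventually_sequentially)
  have En_eq: "En r (\<lambda>x. u n x - f x) = (\<integral>\<^sup>+x. ennreal (norm (v n x)) \<partial>lebesgue)" for n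
    by (simp add: En_def v_def)
  have int: "integrable lebesgue (v (n + N))" for n
    using N[of "n + N"] less_trans[OF _ ennreal_one_less_top]
    by (intro integrableI_bounded) (auto simp: En_eq)
  have "(\<lambda>n. \<integral>x. norm (v (n + N) x) \<partial>lebesgue) \<longlonglongrightarrow> 0"
  proof -
    have "ennreal (\<integral>x. norm (v (n + N) x) \<partial>lebesgue) = En r (\<lambda>x. u (n + N) x - f x)" for n
      unfolding En_eq using int[of n] by (intro nn_integral_eq_integral[symmetric]) auto
    moreover have "(\<lambda>n. En r (\<lambda>x. u (n + N) x - f x)) \<longlonglongrightarrow> ennreal 0"
      using LIMSEQ_ignore_initial_segment[OF lE, of N] by simp
    ultimately have "(\<lambda>n. ennreal (\<integral>x. norm (v (n + N) x) \<partial>lebesgue)) \<longlonglongrightarrow> ennreal 0" by simp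
    then show ?thesis by (subst (asm) tendsto_ennreal_iff) auto
  qed
  from tendsto_L1_AE_subseq[OF int this] obtain s :: "nat \<Rightarrow> nat"
    where s: "strict_mono s" "AE x in lebesgue. (\<lambda>n. v (s n + N) x) \<longlonglongrightarrow> 0" by auto
  show ?thesis
  proof
    show "strict_mono (\<lambda>n. s n + N)" using s(1) by (simp add: strict_mono_def)
    show "AE x in lebesgue. (\<lambda>n. u (s n + N) x) \<longlonglongrightarrow> f x"
      using s(2)
    proof eventually_elim
      case (elim x)
      have "(\<lambda>n. (v (s n + N) x) powr (1/r)) \<longlonglongrightarrow> 0 powr (1/r)"
        by (rule tendsto_powr'[OF elim tendsto_const]) (use r in \<open>auto simp: v_def\<close>)
      then have "(\<lambda>n. cmod (u (s n + N) x - f x)) \<longlonglongrightarrow> 0" using r by (simp add: v_def powr_powr)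
      then show ?case using LIM_zero_iff[of "\<lambda>n. u (s n + N) x" "f x"] by (simp add: tendsto_norm_zero_iff)
    qed
  qed
qed

text \<open>Riesz-Fischer. Along a subsequence with increments of norm at most (1/2)^k, the sums
  \<open>G\<close> of absolute increments have norm at most 2, so they stay bounded almost
  everywhere and the subsequence converges. Fatou's lemma turns the Cauchy bounds into bounds for
  the distance to the limit.\<close>

lemma Lr_complete:
  assumes u: "\<And>n. u n \<in> Lr r" and r: "1 \<le> r"
    and C: "\<And>e. 0 < e \<Longrightarrow> \<exists>N. \<forall>m\<ge>N. \<forall>n\<ge>N. Lr_norm r (\<lambda>x. u m x - u n x) \<le> e"
  obtains g where "g \<in> Lr r" "(\<lambda>n. Lr_norm r (\<lambda>x. u n x - g x)) \<longlonglongrightarrow> 0"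
proof -
  have m[measurable]: "u n \<in> borel_measurable lebesgue" for n using u by (auto simp: Lr_def)
  have "\<exists>N. \<forall>m\<ge>N. \<forall>n\<ge>N. Lr_norm r (\<lambda>x. u m x - u n x) \<le> ennreal ((1/2)^k)" for k
    by (rule C) simp
  then obtain N where N: "\<And>k m n. m \<ge> N k \<Longrightarrow> n \<ge> N k \<Longrightarrow> Lr_norm r (\<lambda>x. u m x - u n x) \<le> ennreal ((1/2)^k)"
    by metis
  define s where "s k = (\<Sum>i\<le>k. N i + 1)" for k
  have sN: "s k \<ge> N k" for k
    unfolding s_def using member_le_sum[of k "{..k}" "\<lambda>i. N i + 1"] by simp
  have smono: "s k \<le> s l" if "k \<le> l" for k l unfolding s_def using that by (intro sum_mono2) auto
  define d where "d k x = cmod (u (s (Suc k)) x - u (s k) x)" for k x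
  have dm[measurable]: "d k \<in> borel_measurable lebesgue" for k unfolding d_def by measurable
  define G where "G n x = (\<Sum>k<n. d k x)" for n x
  have Gm[measurable]: "G n \<in> borel_measurable lebesgue" for n unfolding G_def by measurable
  have dn: "Lr_norm r (\<lambda>x. complex_of_real (d k x)) \<le> ennreal ((1/2)^k)" for k
  proof -
    have "Lr_norm r (\<lambda>x. complex_of_real (d k x)) = Lr_norm r (\<lambda>x. u (s (Suc k)) x - u (s k) x)"
      by (intro Lr_norm_cong_AE) (simp add: d_def)
    then show ?thesis using N[of k "s (Suc k)" "s k"] sN[of k] smono[of k "Suc k"] by simp
  qed
  have Gn: "Lr_norm r (\<lambda>x. complex_of_real (G n x)) \<le> ennreal (\<Sum>k<n. (1/2)^k)" for n
  proof (induction n)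
    case (Suc n)
    have "Lr_norm r (\<lambda>x. complex_of_real (G (Suc n) x)) \<le> Lr_norm r (\<lambda>x. complex_of_real (G n x)) + Lr_norm r (\<lambda>x. complex_of_real (d n x))"
      using Lr_norm_triangle[of "\<lambda>x. complex_of_real (G n x)" "\<lambda>x. complex_of_real (d n x)" r] r by (simp add: G_def)
    also have "\<dots> \<le> ennreal (\<Sum>k<n. (1/2)^k) + ennreal ((1/2)^n)" by (intro add_mono Suc dn)
    finally show ?case by (simp add: ennreal_plus[symmetric] sum_nonneg del: ennreal_plus)
  qed (simp add: G_def)
  have Gn2: "Lr_norm r (\<lambda>x. complex_of_real (G n x)) \<le> ennreal 2" for n
  proof -
    have "(\<Sum>k<n. (1/2::real)^k) \<le> 2"
      by (subst geometric_sum) (auto simp: field_simps)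
    then show ?thesis using Gn[of n] by (meson ennreal_leI order_trans)
  qed
  have "AE x in lebesgue. (SUP n. ennreal (G n x powr r)) \<noteq> \<top>"
  proof -
    have "(\<integral>\<^sup>+x. (SUP n. ennreal (G n x powr r)) \<partial>lebesgue) = (SUP n. \<integral>\<^sup>+x. ennreal (G n x powr r) \<partial>lebesgue)"
    proof (rule nn_integral_monotone_convergence_SUP)
      show "incseq (\<lambda>n x. ennreal (G n x powr r))"
        using r by (auto simp: incseq_def le_fun_def G_def d_def intro!: ennreal_leI powr_mono2 sum_mono2 sum_nonneg)
    qed measurable
    also have "\<dots> = (SUP n. En r (\<lambda>x. complex_of_real (G n x)))"
      by (simp add: En_def abs_of_nonneg G_def d_def sum_nonneg del: of_real_sum)
    also have "\<dots> \<le> ennreal_powr (ennreal 2) r"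
    proof (rule SUP_least)
      show "En r (\<lambda>x. complex_of_real (G n x)) \<le> ennreal_powr (ennreal 2) r" for n
        unfolding En_Lr_norm[OF less_le_trans[OF zero_less_one r]] using r by (intro ennreal_powr_mono Gn2) auto
    qed
    finally have "(\<integral>\<^sup>+x. (SUP n. ennreal (G n x powr r)) \<partial>lebesgue) \<noteq> \<infinity>"
      by (auto simp: top_unique)
    then show ?thesis using nn_integral_noteq_infinite[of "\<lambda>x. SUP n. ennreal (G n x powr r)" lebesgue] by simp
  qed
  then have conv: "AE x in lebesgue. convergent (\<lambda>k. u (s k) x)"
  proof eventually_elim
    case (elim x)
    then obtain B where B: "(SUP n. ennreal (G n x powr r)) = ennreal B" "0 \<le> B"
      by (cases "SUP n. ennreal (G n x powr r)") auto
    have "G n x \<le> B powr (1/r)" for n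
    proof -
      have "ennreal (G n x powr r) \<le> ennreal B" unfolding B(1)[symmetric] by (rule SUP_upper) simp
      then have "G n x powr r \<le> B" using B by simp
      then have "(G n x powr r) powr (1/r) \<le> B powr (1/r)" using r by (intro powr_mono2) auto
      then show ?thesis using r by (simp add: powr_powr G_def d_def sum_nonneg)
    qed
    then have "(\<Sum>k\<le>n. d k x) \<le> B powr (1/r)" for n
      unfolding lessThan_Suc_atMost[symmetric] by (simp only: G_def)
    then have "summable (\<lambda>k. d k x)"
      by (rule bounded_imp_summable[rotated]) (simp add: d_def)
    then have "summable (\<lambda>k. u (s (Suc k)) x - u (s k) x)"
      unfolding d_def by (rule summable_norm_cancel)
    then have "convergent (\<lambda>n. \<Sum>k<n. u (s (Suc k)) x - u (s k) x)"
      by (simp add: summable_iff_convergent)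
    then have "convergent (\<lambda>n. u (s n) x - u (s 0) x)"
      using sum_lessThan_telescope[of "\<lambda>k. u (s k) x"] by simp
    then have "convergent (\<lambda>n. (u (s n) x - u (s 0) x) + u (s 0) x)"
      by (rule convergent_add[OF _ convergent_const])
    then show ?case by simp
  qed
  define g where "g x = lim (\<lambda>k. u (s k) x)" for x
  have gm[measurable]: "g \<in> borel_measurable lebesgue" unfolding g_def by measurable
  have glim: "AE x in lebesgue. (\<lambda>k. u (s k) x) \<longlonglongrightarrow> g x"
    using conv by eventually_elim (simp add: g_def convergent_LIMSEQ_iff)
  have smono': "k \<le> s k" for k
  proof (induction k)
    case (Suc k) then show ?case by (simp add: s_def)
  qed simp
  have lim: "Lr_norm r (\<lambda>x. u m x - g x) \<le> ennreal ((1/2)^K)" if "m \<ge> s K" for m K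
  proof (rule Fatou_Lr_norm[where u="\<lambda>k x. u m x - u (s (k + K)) x"])
    show "AE x in lebesgue. (\<lambda>k. u m x - u (s (k + K)) x) \<longlonglongrightarrow> u m x - g x"
      using glim by eventually_elim (intro tendsto_diff tendsto_const LIMSEQ_ignore_initial_segment)
    show "Lr_norm r (\<lambda>x. u m x - u (s (n + K)) x) \<le> ennreal ((1/2)^K)" for n
      using that sN[of K] smono[of K "n + K"] by (intro N) auto
  qed (use r in auto)
  show ?thesis
  proof
    have "(\<lambda>n. ennreal ((1/2)^n)) \<longlonglongrightarrow> ennreal 0"
      by (intro tendsto_ennrealI LIMSEQ_realpow_zero) auto
    show "(\<lambda>n. Lr_norm r (\<lambda>x. u n x - g x)) \<longlonglongrightarrow> 0"
    proof (rule order_tendstoI)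
      fix a :: ennreal assume "0 < a"
      with \<open>(\<lambda>n. ennreal ((1/2)^n)) \<longlonglongrightarrow> ennreal 0\<close> have "eventually (\<lambda>K. ennreal ((1/2)^K) < a) sequentially"
        by (intro order_tendstoD) auto
      then obtain K where "ennreal ((1/2)^K) < a" by (auto simp: eventually_sequentially)
      then show "\<forall>\<^sub>F n in sequentially. Lr_norm r (\<lambda>x. u n x - g x) < a"
        using lim by (auto simp: eventually_sequentially intro!: exI[of _ "s K"] dest: le_less_trans)
    qed auto
    have "Lr_norm r g \<le> Lr_norm r (u (s 0)) + Lr_norm r (\<lambda>x. g x - u (s 0) x)"
      using r by (intro Lr_norm_le_diff) auto
    also have "\<dots> < \<top>" using lim[of 0 "s 0"] u[of "s 0"] 
      by (auto simp: Lr_norm_minus_commute[of r g] Lr_def intro: le_less_trans)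
    finally show "g \<in> Lr r" by (simp add: Lr_def)
  qed
qed

section \<open>Step functions\<close>

definition stepf :: "real \<Rightarrow> (int \<Rightarrow> complex) \<Rightarrow> real \<Rightarrow> complex"
  where "stepf h c x = c \<lfloor>x / h\<rfloor>"

text \<open>Dyadic mesh sizes give any two of these functions a common mesh, so the set is closed
  under linear combinations.\<close>

definition stepfs :: "(real \<Rightarrow> complex) set"
  where "stepfs = {stepf ((1/2)^n) c | n c. finite {i. c i \<noteq> 0}}"

lemma stepf_borel [measurable]: "stepf h c \<in> borel_measurable borel"
  unfolding stepf_def[abs_def] by measurable

lemma borel_imp_lebesgue: "f \<in> borel_measurable borel \<Longrightarrow> f \<in> borel_measurable lebesgue"
  by (rule measurable_completion) simp

lemma stepf_lebesgue [measurable]: "stepf h c \<in> borel_measurable lebesgue"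
  by (rule borel_imp_lebesgue) simp

lemma floor_divide_eq_iff:
  assumes "0 < h" shows "\<lfloor>x / h\<rfloor> = i \<longleftrightarrow> x \<in> {of_int i * h ..< (of_int i + 1) * h}"
  using assms by (auto simp: floor_eq_iff pos_le_divide_eq pos_divide_less_eq)

lemma stepf_eq_sum:
  assumes "finite S" "{i. c i \<noteq> 0} \<subseteq> S" "0 < h"
  shows "stepf h c x = (\<Sum>i\<in>S. c i * indicator {of_int i * h ..< (of_int i + 1) * h} x)"
proof -
  have "(\<Sum>i\<in>S. c i * indicator {of_int i * h ..< (of_int i + 1) * h} x) = (\<Sum>i\<in>S. if i = \<lfloor>x/h\<rfloor> then c i else 0)"
    unfolding indicator_def floor_divide_eq_iff[OF assms(3), symmetric] by (intro sum.cong refl) simp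
  also have "\<dots> = stepf h c x" using assms(1,2) by (auto simp: stepf_def sum.delta)
  finally show ?thesis by simp
qed

lemma En_stepf:
  assumes S: "finite S" "{i. c i \<noteq> 0} \<subseteq> S" and h: "0 < h"
  shows "En r (stepf h c) = ennreal (h * (\<Sum>i\<in>S. cmod (c i) powr r))"
proof -
  have eq: "ennreal (cmod (stepf h c x) powr r) =
      (\<Sum>i\<in>S. ennreal (cmod (c i) powr r) * indicator {of_int i * h ..< (of_int i + 1) * h} x)" for x
  proof -
    have "(\<Sum>i\<in>S. ennreal (cmod (c i) powr r) * indicator {of_int i * h ..< (of_int i + 1) * h} x)
      = (\<Sum>i\<in>S. if i = \<lfloor>x/h\<rfloor> then ennreal (cmod (c i) powr r) else 0)"
      unfolding indicator_def floor_divide_eq_iff[OF h, symmetric] by (intro sum.cong refl) simp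
    also have "\<dots> = ennreal (cmod (stepf h c x) powr r)"
    proof -
      have "c \<lfloor>x/h\<rfloor> = 0" if "\<lfloor>x/h\<rfloor> \<notin> S" using S(2) that by blast
      then show ?thesis using S(1) by (simp add: stepf_def)
    qed
    finally show ?thesis by simp
  qed
  have "En r (stepf h c) = (\<Sum>i\<in>S. ennreal (cmod (c i) powr r) * emeasure lebesgue {of_int i * h ..< (of_int i + 1) * h})"
    unfolding En_def eq
  proof (subst nn_integral_sum)
    have I: "{of_int i * h ..< (of_int i + 1) * h} \<in> sets lebesgue" for i :: int by simp
    show "(\<lambda>x. ennreal (cmod (c i) powr r) * indicator {of_int i * h ..< (of_int i + 1) * h} x) \<in> borel_measurable lebesgue" for i
      by (intro borel_measurable_times_ennreal borel_measurable_const borel_measurable_indicator I)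
    show "(\<Sum>i\<in>S. \<integral>\<^sup>+x. ennreal (cmod (c i) powr r) * indicator {of_int i * h ..< (of_int i + 1) * h} x \<partial>lebesgue) =
      (\<Sum>i\<in>S. ennreal (cmod (c i) powr r) * emeasure lebesgue {of_int i * h ..< (of_int i + 1) * h})"
      by (intro sum.cong refl nn_integral_cmult_indicator I)
  qed
  also have "\<dots> = (\<Sum>i\<in>S. ennreal (h * cmod (c i) powr r))"
  proof (intro sum.cong refl)
    fix i
    have "of_int i * h \<le> (of_int i + 1) * h" "(of_int i + 1) * h - of_int i * h = h"
      using h by (auto simp: algebra_simps)
    then show "ennreal (cmod (c i) powr r) * emeasure lebesgue {of_int i * h ..< (of_int i + 1) * h} = ennreal (h * cmod (c i) powr r)"
      using h by (simp add: ennreal_mult[symmetric] mult.commute)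
  qed
  also have "\<dots> = ennreal (h * (\<Sum>i\<in>S. cmod (c i) powr r))"
    using h by (subst sum_ennreal) (auto simp: sum_distrib_left)
  finally show ?thesis .
qed

lemma stepf_Lr: "finite {i. c i \<noteq> 0} \<Longrightarrow> 0 < h \<Longrightarrow> stepf h c \<in> Lr r"
  by (simp add: Lr_iff_En En_stepf[OF _ order_refl])

lemma stepfs_Lr: "u \<in> stepfs \<Longrightarrow> u \<in> Lr r"
  by (auto simp: stepfs_def intro: stepf_Lr)

lemma stepf_refine:
  obtains c' where "stepf ((1/2)^n) c = stepf ((1/2)^(n+m)) c'" "finite {i. c i \<noteq> 0} \<Longrightarrow> finite {i. c' i \<noteq> 0}"
proof
  \<comment> \<open>Cell \<open>i\<close> of the fine mesh lies in cell \<open>i div 2^m\<close> of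
    the coarse one, also for negative \<open>i\<close>, because \<open>div\<close> rounds
    down.\<close>
  let ?c' = "\<lambda>i. c (i div 2^m)"
  have "\<lfloor>x / (1/2)^n\<rfloor> = \<lfloor>x / (1/2)^(n+m)\<rfloor> div 2^m" for x :: real
  proof -
    have "\<lfloor>(x / (1/2)^(n+m)) / of_int (2^m)\<rfloor> = \<lfloor>x / (1/2)^(n+m)\<rfloor> div 2^m"
      by (rule floor_divide_real_eq_div) simp
    then show ?thesis by (simp add: power_add power_divide)
  qed
  then show "stepf ((1/2)^n) c = stepf ((1/2)^(n+m)) ?c'" by (simp add: stepf_def fun_eq_iff)
  assume f: "finite {i. c i \<noteq> 0}"
  have "{i. ?c' i \<noteq> 0} \<subseteq> (\<Union>j\<in>{i. c i \<noteq> 0}. {j * 2^m ..< (j+1) * 2^m})"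
  proof
    fix i assume "i \<in> {i. ?c' i \<noteq> 0}"
    moreover have "i \<in> {(i div 2^m) * 2^m ..< (i div 2^m + 1) * 2^m}"
    proof -
      have "2^m * (i div 2^m) + i mod 2^m = i" "0 \<le> i mod 2^m" "i mod 2^m < 2^m" by simp_all
      then have "2^m * (i div 2^m) \<le> i" "i < 2^m * (i div 2^m) + 2^m" by linarith+
      then show ?thesis by (simp add: algebra_simps)
    qed
    ultimately show "i \<in> (\<Union>j\<in>{i. c i \<noteq> 0}. {j * 2^m ..< (j+1) * 2^m})" by blast
  qed
  then show "finite {i. ?c' i \<noteq> 0}" using f by (elim finite_subset) auto
qed

lemma stepfs_lincomb:
  assumes "u \<in> stepfs" "v \<in> stepfs" shows "(\<lambda>x. u x + a * v x) \<in> stepfs"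
proof -
  obtain n c m d where u: "u = stepf ((1/2)^n) c" "finite {i. c i \<noteq> 0}"
    and v: "v = stepf ((1/2)^m) d" "finite {i. d i \<noteq> 0}"
    using assms by (auto simp: stepfs_def)
  obtain c' where c': "u = stepf ((1/2)^(n+m)) c'" "finite {i. c' i \<noteq> 0}"
    using stepf_refine[of n c m] u by metis
  obtain d' where d': "v = stepf ((1/2)^(n+m)) d'" "finite {i. d' i \<noteq> 0}"
    using stepf_refine[of m d n] v by (metis add.commute)
  have "finite {i. c' i + a * d' i \<noteq> 0}"
    by (rule finite_subset[of _ "{i. c' i \<noteq> 0} \<union> {i. d' i \<noteq> 0}"]) (use c' d' in auto)
  moreover have "(\<lambda>x. u x + a * v x) = stepf ((1/2)^(n+m)) (\<lambda>i. c' i + a * d' i)"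
    by (simp add: c' d' stepf_def fun_eq_iff)
  ultimately show ?thesis unfolding stepfs_def by blast
qed

lemma stepfs_zero: "(\<lambda>x. 0) \<in> stepfs"
proof -
  have "(\<lambda>x. 0) = stepf ((1/2)^0) (\<lambda>i. 0)" by (simp add: stepf_def fun_eq_iff)
  then show ?thesis unfolding stepfs_def by fastforce
qed

section \<open>Density of step functions\<close>

lemma ennreal_squeeze_0:
  fixes a b d :: "nat \<Rightarrow> ennreal"
  assumes "\<And>n. a n \<le> C * b n + d n" "b \<longlonglongrightarrow> 0" "d \<longlonglongrightarrow> 0" "C < \<top>"
  shows "a \<longlonglongrightarrow> 0"
proof (rule tendsto_sandwich[OF _ _ tendsto_const])
  have "(\<lambda>n. C * b n + d n) \<longlonglongrightarrow> C * 0 + 0"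
    using assms by (intro tendsto_add ennreal_tendsto_cmult) auto
  then show "(\<lambda>n. C * b n + d n) \<longlonglongrightarrow> 0" by simp
qed (use assms in auto)

lemma ennreal_tendsto_0_le:
  fixes a d :: "nat \<Rightarrow> ennreal"
  assumes "\<And>n. a n \<le> d n" "d \<longlonglongrightarrow> 0" shows "a \<longlonglongrightarrow> 0"
  by (rule ennreal_squeeze_0[where C=0 and b="\<lambda>n. 0" and d=d]) (use assms in auto)

text \<open>One sequence has to serve both norms: the operators live on L^2, the estimates concern
  L^p, and a limit argument needs both convergences at once.\<close>

definition appr :: "real \<Rightarrow> real \<Rightarrow> (real \<Rightarrow> complex) \<Rightarrow> bool"
  where "appr s t f \<longleftrightarrow> f \<in> borel_measurable lebesgue \<and> (\<exists>u. (\<forall>n. u n \<in> stepfs) \<and>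
     (\<lambda>n. Lr_norm s (\<lambda>x. u n x - f x)) \<longlonglongrightarrow> 0 \<and> (\<lambda>n. Lr_norm t (\<lambda>x. u n x - f x)) \<longlonglongrightarrow> 0)"

lemma apprI:
  assumes "f \<in> borel_measurable lebesgue"
    "\<And>n. u n \<in> stepfs" "(\<lambda>n. Lr_norm s (\<lambda>x. u n x - f x)) \<longlonglongrightarrow> 0" "(\<lambda>n. Lr_norm t (\<lambda>x. u n x - f x)) \<longlonglongrightarrow> 0"
  shows "appr s t f"
  using assms unfolding appr_def by blast

lemma appr_lincomb:
  assumes "appr s t f" "appr s t g" "1 \<le> s" "1 \<le> t" shows "appr s t (\<lambda>x. f x + a * g x)"
proof -
  from assms(1) obtain u where u: "f \<in> borel_measurable lebesgue" "\<And>n. u n \<in> stepfs"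
     "(\<lambda>n. Lr_norm s (\<lambda>x. u n x - f x)) \<longlonglongrightarrow> 0" "(\<lambda>n. Lr_norm t (\<lambda>x. u n x - f x)) \<longlonglongrightarrow> 0"
    unfolding appr_def by blast
  from assms(2) obtain v where v: "g \<in> borel_measurable lebesgue" "\<And>n. v n \<in> stepfs"
     "(\<lambda>n. Lr_norm s (\<lambda>x. v n x - g x)) \<longlonglongrightarrow> 0" "(\<lambda>n. Lr_norm t (\<lambda>x. v n x - g x)) \<longlonglongrightarrow> 0"
    unfolding appr_def by blast
  have m[measurable]: "u n \<in> borel_measurable lebesgue" "v n \<in> borel_measurable lebesgue"
    "f \<in> borel_measurable lebesgue" "g \<in> borel_measurable lebesgue" for n
    using u v stepfs_Lr by (auto intro: Lr_measurable)
  have *: "Lr_norm r (\<lambda>x. (u n x + a * v n x) - (f x + a * g x)) \<le>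
      ennreal (cmod a) * Lr_norm r (\<lambda>x. v n x - g x) + Lr_norm r (\<lambda>x. u n x - f x)" if "1 \<le> r" for r n
  proof -
    have "Lr_norm r (\<lambda>x. (u n x + a * v n x) - (f x + a * g x)) = Lr_norm r (\<lambda>x. a * (v n x - g x) + (u n x - f x))"
      by (simp add: algebra_simps)
    also have "\<dots> \<le> Lr_norm r (\<lambda>x. a * (v n x - g x)) + Lr_norm r (\<lambda>x. u n x - f x)"
      using that by (intro Lr_norm_triangle) auto
    also have "Lr_norm r (\<lambda>x. a * (v n x - g x)) = ennreal (cmod a) * Lr_norm r (\<lambda>x. v n x - g x)"
      using that by (intro Lr_norm_cmult) auto
    finally show ?thesis .
  qed
  show ?thesis
  proof (rule apprI)
    show "(\<lambda>x. u n x + a * v n x) \<in> stepfs" for n by (intro stepfs_lincomb u v)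
    show "(\<lambda>n. Lr_norm s (\<lambda>x. u n x + a * v n x - (f x + a * g x))) \<longlonglongrightarrow> 0"
      by (rule ennreal_squeeze_0[OF *[OF assms(3)] v(3) u(3)]) simp
    show "(\<lambda>n. Lr_norm t (\<lambda>x. u n x + a * v n x - (f x + a * g x))) \<longlonglongrightarrow> 0"
      by (rule ennreal_squeeze_0[OF *[OF assms(4)] v(4) u(4)]) simp
  qed measurable
qed

lemma appr_sum:
  assumes "finite I" "\<And>i. i \<in> I \<Longrightarrow> appr s t (f i)" "1 \<le> s" "1 \<le> t"
  shows "appr s t (\<lambda>x. \<Sum>i\<in>I. a i * f i x)"
  using assms(1,2)
proof (induction I rule: finite_induct)
  case empty
  show ?case by (rule apprI[where u="\<lambda>n x. 0"]) (auto simp: stepfs_zero)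
next
  case (insert i I)
  have "appr s t (\<lambda>x. (\<Sum>i\<in>I. a i * f i x) + a i * f i x)"
    using appr_lincomb[OF insert.IH insert.prems[of i] assms(3,4), of "a i"] insert.prems by simp
  then show ?case using insert by (simp add: add.commute)
qed

text \<open>A diagonal choice: for each n a step function within 1 / (n + 1) of \<open>g n\<close>
  in both norms.\<close>

lemma appr_limit:
  assumes g: "\<And>n. appr s t (g n)" and f: "f \<in> borel_measurable lebesgue" and st: "1 \<le> s" "1 \<le> t"
    and lim: "(\<lambda>n. Lr_norm s (\<lambda>x. g n x - f x)) \<longlonglongrightarrow> 0" "(\<lambda>n. Lr_norm t (\<lambda>x. g n x - f x)) \<longlonglongrightarrow> 0"
  shows "appr s t f"
proof -
  have gm: "g n \<in> borel_measurable lebesgue" for n using g by (auto simp: appr_def)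
  have "\<exists>v\<in>stepfs. Lr_norm s (\<lambda>x. v x - g n x) < ennreal (1 / Suc n) \<and> Lr_norm t (\<lambda>x. v x - g n x) < ennreal (1 / Suc n)" for n
  proof -
    obtain u where u: "\<And>n. u n \<in> stepfs"
       "(\<lambda>k. Lr_norm s (\<lambda>x. u k x - g n x)) \<longlonglongrightarrow> 0" "(\<lambda>k. Lr_norm t (\<lambda>x. u k x - g n x)) \<longlonglongrightarrow> 0"
      using g[of n] unfolding appr_def by blast
    have "0 < ennreal (1 / Suc n)" by simp
    from eventually_conj[OF order_tendstoD(2)[OF u(2) this] order_tendstoD(2)[OF u(3) this]] u(1)
    show ?thesis by (auto simp: eventually_sequentially)
  qed
  then obtain v where v: "\<And>n. v n \<in> stepfs" "\<And>n. Lr_norm s (\<lambda>x. v n x - g n x) < ennreal (1 / Suc n)"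
     "\<And>n. Lr_norm t (\<lambda>x. v n x - g n x) < ennreal (1 / Suc n)" by metis
  have z: "(\<lambda>n. ennreal (1 / Suc n)) \<longlonglongrightarrow> 0"
    using tendsto_ennrealI[OF lim_inverse_n'[THEN LIMSEQ_Suc]] by (simp del: of_nat_Suc)
  have vm: "v n \<in> borel_measurable lebesgue" for n using v(1)[THEN stepfs_Lr] by (rule Lr_measurable)
  have tri: "Lr_norm r (\<lambda>x. v n x - f x) \<le> 1 * Lr_norm r (\<lambda>x. g n x - f x) + Lr_norm r (\<lambda>x. v n x - g n x)" if "1 \<le> r" for r n
    using Lr_norm_diff_triangle[OF vm gm f that] by (simp add: add.commute)
  show ?thesis
  proof (rule apprI)
    show "(\<lambda>n. Lr_norm s (\<lambda>x. v n x - f x)) \<longlonglongrightarrow> 0"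
      by (rule ennreal_squeeze_0[OF order_trans[OF tri[OF st(1)] add_left_mono[OF less_imp_le[OF v(2)]]] lim(1) z]) simp
    show "(\<lambda>n. Lr_norm t (\<lambda>x. v n x - f x)) \<longlonglongrightarrow> 0"
      by (rule ennreal_squeeze_0[OF order_trans[OF tri[OF st(2)] add_left_mono[OF less_imp_le[OF v(3)]]] lim(2) z]) simp
  qed (use f v in auto)
qed

lemma En_indicator: "A \<in> sets lebesgue \<Longrightarrow> En r (indicator A) = emeasure lebesgue A"
proof -
  assume A: "A \<in> sets lebesgue"
  have "En r (indicator A) = (\<integral>\<^sup>+x. indicator A x \<partial>lebesgue)"
    unfolding En_def by (intro nn_integral_cong) (auto simp: indicator_def)
  then show ?thesis using A by simp
qed

lemma indicator_Lr: "A \<in> lmeasurable \<Longrightarrow> indicator A \<in> Lr r"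
  by (auto simp: Lr_iff_En En_indicator fmeasurable_def)

lemma appr_indicator_open:
  assumes U: "open U" "bounded U" and st: "1 \<le> s" "1 \<le> t"
  shows "appr s t (indicator U)"
proof -
  obtain b where b: "\<And>x. x \<in> U \<Longrightarrow> \<bar>x\<bar> \<le> b" using U(2) by (auto simp: bounded_iff)
  \<comment> \<open>Inner approximation by the mesh cells contained in \<open>U\<close>. The error
    is dominated by the indicator of \<open>U\<close>, and openness gives pointwise
    convergence.\<close>
  define c :: "nat \<Rightarrow> int \<Rightarrow> complex"
    where "c n i = (if {of_int i * (1/2)^n ..< (of_int i + 1) * (1/2)^n} \<subseteq> U then 1 else 0)" for n i
  have fin: "finite {i. c n i \<noteq> 0}" for n
  proof (rule finite_subset)
    show "{i. c n i \<noteq> 0} \<subseteq> {- \<lceil>b * 2^n\<rceil> .. \<lceil>b * 2^n\<rceil>}"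
    proof
      fix i assume "i \<in> {i. c n i \<noteq> 0}"
      then have "{of_int i * (1/2)^n ..< (of_int i + 1) * (1/2::real)^n} \<subseteq> U" by (auto simp: c_def split: if_splits)
      moreover have "of_int i * (1/2)^n \<in> {of_int i * (1/2)^n ..< (of_int i + 1) * (1/2::real)^n}"
        by (auto simp: algebra_simps)
      ultimately have "\<bar>of_int i * (1/2::real)^n\<bar> \<le> b" using b by blast
      then have "\<bar>of_int i\<bar> \<le> b * 2^n" by (simp add: abs_mult field_simps)
      then show "i \<in> {- \<lceil>b * 2^n\<rceil> .. \<lceil>b * 2^n\<rceil>}" by (auto simp: abs_le_iff) linarith+
    qed
  qed simp
  define u where "u n = stepf ((1/2)^n) (c n)" for n
  have mem: "x \<in> {of_int \<lfloor>x / (1/2)^n\<rfloor> * (1/2)^n ..< (of_int \<lfloor>x / (1/2)^n\<rfloor> + 1) * (1/2)^n}" for x :: real and n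
    using floor_divide_eq_iff[of "(1/2)^n" x "\<lfloor>x / (1/2)^n\<rfloor>"] by simp
  have u01: "u n x = (if {of_int \<lfloor>x / (1/2)^n\<rfloor> * (1/2)^n ..< (of_int \<lfloor>x / (1/2)^n\<rfloor> + 1) * (1/2)^n} \<subseteq> U then 1 else 0)" for n x
    by (simp add: u_def stepf_def c_def)
  have out: "u n x = 0" if "x \<notin> U" for n x
    using mem[of x n] that by (auto simp: u01)
  have lim: "(\<lambda>n. u n x) \<longlonglongrightarrow> indicator U x" for x
  proof (cases "x \<in> U")
    case True
    then obtain e where e: "0 < e" "ball x e \<subseteq> U" using U(1) openE by blast
    have "(\<lambda>n. (1/2::real)^n) \<longlonglongrightarrow> 0" by (intro LIMSEQ_realpow_zero) auto
    then have "eventually (\<lambda>n. (1/2)^n < e) sequentially" by (rule order_tendstoD) (use e in auto)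
    then have "eventually (\<lambda>n. u n x = 1) sequentially"
    proof eventually_elim
      case (elim n)
      have "{of_int \<lfloor>x / (1/2)^n\<rfloor> * (1/2)^n ..< (of_int \<lfloor>x / (1/2)^n\<rfloor> + 1) * (1/2)^n} \<subseteq> ball x e"
        using mem[of x n] elim by (auto simp: dist_real_def algebra_simps)
      then show ?case using e by (auto simp: u01)
    qed
    then show ?thesis using True by (simp add: tendsto_eventually)
  qed (simp add: out)
  have bd: "cmod (u n x - indicator U x) \<le> cmod (indicator U x)" for n x
    using out[of x n] u01[of n x] by (auto simp: indicator_def)
  have UL: "indicator U \<in> Lr r" for r
    using U by (intro indicator_Lr lmeasurable_open)
  have um: "u n \<in> borel_measurable lebesgue" for n unfolding u_def by measurable
  have UM[measurable]: "(indicator U :: real \<Rightarrow> complex) \<in> borel_measurable lebesgue"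
    using UL by (rule Lr_measurable)
  have "(\<lambda>n. Lr_norm r (\<lambda>x. u n x - indicator U x)) \<longlonglongrightarrow> 0" if "1 \<le> r" for r
  proof (rule dominated_Lr_norm[where g="indicator U"])
    show "AE x in lebesgue. (\<lambda>n. u n x - indicator U x) \<longlonglongrightarrow> 0"
      using lim by (auto intro!: AE_I2 simp: LIM_zero_iff)
  qed (use that um UL bd in auto)
  then show ?thesis
    using st fin by (intro apprI[where u=u]) (auto simp: u_def stepfs_def)
qed

text \<open>Outer regularity reduces this to open sets; intersecting them with (-b, b) keeps them
  bounded.\<close>

lemma appr_indicator:
  assumes A: "A \<in> sets lebesgue" "A \<subseteq> {-b<..<b}" and st: "1 \<le> s" "1 \<le> t"
  shows "appr s t (indicator A)"
proof -
  have "\<exists>T. open T \<and> A \<subseteq> T \<and> (T - A) \<in> lmeasurable \<and> emeasure lebesgue (T - A) < ennreal (1 / Suc n)" for n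
    by (rule sets_lebesgue_outer_open[OF A(1), of "1 / Suc n"]) auto
  then obtain T where T: "\<And>n. open (T n)" "\<And>n. A \<subseteq> T n" "\<And>n. (T n - A) \<in> lmeasurable"
    "\<And>n. emeasure lebesgue (T n - A) < ennreal (1 / Suc n)" by metis
  define U where "U n = T n \<inter> {-b<..<b}" for n
  have U: "open (U n)" "bounded (U n)" "A \<subseteq> U n" for n
    using T(1,2)[of n] A(2) bounded_subset[OF bounded_box[of "-b" b], of "U n"] by (auto simp: U_def)
  have UA: "U n - A \<in> sets lebesgue" for n using U(1)[of n] A by auto
  have z: "(\<lambda>n. ennreal (1 / Suc n)) \<longlonglongrightarrow> 0"
    using tendsto_ennrealI[OF lim_inverse_n'[THEN LIMSEQ_Suc]] by (simp del: of_nat_Suc)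
  have "(\<lambda>n. Lr_norm r (\<lambda>x. indicator (U n) x - indicator A x)) \<longlonglongrightarrow> 0" if "1 \<le> r" for r
  proof -
    have le: "Lr_norm r (\<lambda>x. indicator (U n) x - indicator A x) \<le> ennreal_powr (ennreal (1 / Suc n)) (1/r)" for n
    proof -
      have "(\<lambda>x. indicator (U n) x - indicator A x) = (indicator (U n - A) :: real \<Rightarrow> complex)"
        using U(3)[of n] by (auto simp: fun_eq_iff indicator_def)
      then have "En r (\<lambda>x. indicator (U n) x - indicator A x) = emeasure lebesgue (U n - A)"
        using UA by (simp add: En_indicator)
      also have "\<dots> \<le> emeasure lebesgue (T n - A)"
        using T(3)[of n] by (intro emeasure_mono) (auto simp: U_def)
      also have "\<dots> \<le> ennreal (1 / Suc n)" using T(4)[of n] by simp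
      finally show ?thesis unfolding Lr_norm_En using that by (intro ennreal_powr_mono) auto
    qed
    have "(\<lambda>n. ennreal_powr (ennreal (1 / Suc n)) (1/r)) \<longlonglongrightarrow> 0"
      by (rule ennreal_powr_tendsto_0[OF z]) (use that in simp)
    show ?thesis
      by (rule ennreal_tendsto_0_le[OF le]) fact
  qed
  then show ?thesis
    using st A(1) by (intro appr_limit[where g="\<lambda>n. indicator (U n)" and f="indicator A"] appr_indicator_open U) simp_all
qed

text \<open>Simple functions cut off outside (-n, n) are combinations of indicators of bounded sets.
  Dominated convergence with majorant 3|f| works for both exponents.\<close>

theorem stepfs_dense:
  assumes f: "f \<in> Lr s" "f \<in> Lr t" and st: "1 \<le> s" "1 \<le> t"
  obtains u where "\<And>n. u n \<in> stepfs" "(\<lambda>n. Lr_norm s (\<lambda>x. u n x - f x)) \<longlonglongrightarrow> 0"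
    "(\<lambda>n. Lr_norm t (\<lambda>x. u n x - f x)) \<longlonglongrightarrow> 0"
proof -
  have fm[measurable]: "f \<in> borel_measurable lebesgue" using f by (auto simp: Lr_def)
  obtain F where F: "\<And>i. simple_function lebesgue (F i)" "\<And>x. (\<lambda>i. F i x) \<longlonglongrightarrow> f x"
    "\<And>i x. cmod (F i x) \<le> 2 * cmod (f x)"
    using borel_measurable_implies_sequence_metric[OF fm, of 0] by auto
  define I where "I n = {-real n<..<real n}" for n
  define g where "g n x = F n x * indicator (I n) x" for n x
  have [measurable]: "F n \<in> borel_measurable lebesgue" for n using F(1) by (rule borel_measurable_simple_function)
  have [measurable]: "I n \<in> sets lebesgue" for n by (simp add: I_def)
  have gm: "g n \<in> borel_measurable lebesgue" for n unfolding g_def by measurable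
  have "appr s t (g n)" for n
  proof -
    have fin: "finite (range (F n))" using F(1)[of n] by (auto simp: simple_function_def)
    have "g n x = (\<Sum>y\<in>range (F n). y * indicator (F n -` {y} \<inter> I n) x)" for x
    proof -
      have "(\<Sum>y\<in>range (F n). y * indicator (F n -` {y} \<inter> I n) x) = (\<Sum>y\<in>range (F n). if y = F n x then y * indicator (I n) x else 0)"
        by (intro sum.cong refl) (auto simp: indicator_def)
      then show ?thesis using fin by (simp add: g_def sum.delta)
    qed
    moreover have "F n -` {y} \<in> sets lebesgue" for y
      using simple_functionD(2)[OF F(1), of n "{y}"] by simp
    then have "appr s t (\<lambda>x. \<Sum>y\<in>range (F n). y * indicator (F n -` {y} \<inter> I n) x)"
      using fin st by (intro appr_sum appr_indicator[where b="real n"]) (auto simp: I_def)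
    moreover have "g n = (\<lambda>x. \<Sum>y\<in>range (F n). y * indicator (F n -` {y} \<inter> I n) x)"
      using calculation(1) by (simp add: fun_eq_iff)
    ultimately show ?thesis by simp
  qed
  note appr_g = this
  have lim_g: "(\<lambda>n. Lr_norm r (\<lambda>x. g n x - f x)) \<longlonglongrightarrow> 0" if "f \<in> Lr r" "1 \<le> r" for r
  proof (rule dominated_Lr_norm[where g="\<lambda>x. 3 * f x"])
    show "AE x in lebesgue. (\<lambda>n. g n x - f x) \<longlonglongrightarrow> 0"
    proof (rule AE_I2)
      fix x
      have "eventually (\<lambda>n. indicator (I n) x = (1::complex)) sequentially"
        using eventually_gt_at_top[of "nat \<lceil>\<bar>x\<bar>\<rceil>"] by eventually_elim (auto simp: I_def indicator_def; linarith)
      then have "(\<lambda>n. indicator (I n) x :: complex) \<longlonglongrightarrow> 1" by (rule tendsto_eventually)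
      from tendsto_mult[OF F(2)[of x] this] show "(\<lambda>n. g n x - f x) \<longlonglongrightarrow> 0"
        by (simp add: g_def LIM_zero_iff)
    qed
    show "AE x in lebesgue. cmod (g n x - f x) \<le> cmod (3 * f x)" for n
    proof (rule AE_I2)
      fix x
      have "cmod (g n x - f x) \<le> cmod (g n x) + cmod (f x)" by (rule norm_triangle_ineq4)
      also have "cmod (g n x) \<le> 2 * cmod (f x)" using F(3)[of n x] by (auto simp: g_def indicator_def)
      finally show "cmod (g n x - f x) \<le> cmod (3 * f x)" by (simp add: norm_mult)
    qed
  qed (use that gm Lr_cmult[of f r 3] in auto)
  have "appr s t f" by (rule appr_limit[OF appr_g fm st lim_g[OF f(1) st(1)] lim_g[OF f(2) st(2)]])
  then show ?thesis using that unfolding appr_def by blast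
qed

lemma ennreal_le_lim_0:
  fixes c :: ennreal
  assumes "\<And>n. a \<le> c + d n" "d \<longlonglongrightarrow> 0" shows "a \<le> c"
proof (rule LIMSEQ_le_const)
  show "(\<lambda>n. c + d n) \<longlonglongrightarrow> c" using tendsto_add[OF tendsto_const assms(2), of c] by simp
qed (use assms in auto)

lemma Lr_limit_unique:
  assumes m: "\<And>n. u n \<in> borel_measurable lebesgue" "f \<in> borel_measurable lebesgue" "g \<in> borel_measurable lebesgue"
    and r: "1 \<le> r"
    and l: "(\<lambda>n. Lr_norm r (\<lambda>x. u n x - f x)) \<longlonglongrightarrow> 0" "(\<lambda>n. Lr_norm r (\<lambda>x. u n x - g x)) \<longlonglongrightarrow> 0"
  shows "AE x in lebesgue. f x = g x"
proof -
  have "Lr_norm r (\<lambda>x. f x - g x) \<le> 0"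
  proof (rule ennreal_le_lim_0)
    show "Lr_norm r (\<lambda>x. f x - g x) \<le> 0 + (Lr_norm r (\<lambda>x. u n x - f x) + Lr_norm r (\<lambda>x. u n x - g x))" for n
      using Lr_norm_diff_triangle[OF m(2) m(1) m(3) r, of n] by (simp add: Lr_norm_minus_commute[of r f])
    show "(\<lambda>n. Lr_norm r (\<lambda>x. u n x - f x) + Lr_norm r (\<lambda>x. u n x - g x)) \<longlonglongrightarrow> 0"
      using tendsto_add[OF l] by simp
  qed
  then have "AE x in lebesgue. f x - g x = 0"
    using m by (intro Lr_norm_eq_0_AE) auto
  then show ?thesis by simp
qed

lemma tendsto_Lr_lincomb:
  assumes m[measurable]: "\<And>n. u n \<in> borel_measurable lebesgue" "f \<in> borel_measurable lebesgue"
      "\<And>n. v n \<in> borel_measurable lebesgue" "g \<in> borel_measurable lebesgue"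
    and r: "1 \<le> r"
    and l: "(\<lambda>n. Lr_norm r (\<lambda>x. u n x - f x)) \<longlonglongrightarrow> 0" "(\<lambda>n. Lr_norm r (\<lambda>x. v n x - g x)) \<longlonglongrightarrow> 0"
  shows "(\<lambda>n. Lr_norm r (\<lambda>x. (u n x + a * v n x) - (f x + a * g x))) \<longlonglongrightarrow> 0"
proof (rule ennreal_squeeze_0[OF _ l(2) l(1)])
  fix n
  have "Lr_norm r (\<lambda>x. (u n x + a * v n x) - (f x + a * g x)) = Lr_norm r (\<lambda>x. a * (v n x - g x) + (u n x - f x))"
    by (simp add: algebra_simps)
  also have "\<dots> \<le> Lr_norm r (\<lambda>x. a * (v n x - g x)) + Lr_norm r (\<lambda>x. u n x - f x)"
    using r by (intro Lr_norm_triangle) auto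
  also have "Lr_norm r (\<lambda>x. a * (v n x - g x)) = ennreal (cmod a) * Lr_norm r (\<lambda>x. v n x - g x)"
    using r by (intro Lr_norm_cmult) auto
  finally show "Lr_norm r (\<lambda>x. (u n x + a * v n x) - (f x + a * g x)) \<le>
    ennreal (cmod a) * Lr_norm r (\<lambda>x. v n x - g x) + Lr_norm r (\<lambda>x. u n x - f x)" .
qed simp

section \<open>Continuous extension of bounded linear operators\<close>

text \<open>Linearity is required only almost everywhere, because the values of a continuous
  extension are representatives chosen by \<open>SOME\<close>. Closure of \<open>D\<close> under
  combinations is included so that differences of arguments stay in \<open>D\<close>.\<close>

definition lbd :: "real \<Rightarrow> (real \<Rightarrow> complex) set \<Rightarrow> ((real \<Rightarrow> complex) \<Rightarrow> real \<Rightarrow> complex) \<Rightarrow> real \<Rightarrow> bool"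
  where "lbd r D T C \<longleftrightarrow>
    (\<forall>u\<in>D. \<forall>v\<in>D. \<forall>a. (\<lambda>x. u x + a * v x) \<in> D \<and>
       (AE x in lebesgue. T (\<lambda>x. u x + a * v x) x = T u x + a * T v x)) \<and>
    (\<forall>u\<in>D. u \<in> Lr r \<and> T u \<in> Lr r \<and> Lr_norm r (T u) \<le> ennreal C * Lr_norm r u)"

definition Lr_dense :: "real \<Rightarrow> (real \<Rightarrow> complex) set \<Rightarrow> bool"
  where "Lr_dense r D \<longleftrightarrow> (\<forall>f\<in>Lr r. \<exists>u. (\<forall>n. u n \<in> D) \<and> (\<lambda>n. Lr_norm r (\<lambda>x. u n x - f x)) \<longlonglongrightarrow> 0)"

lemma lbdD:
  assumes "lbd r D T C"
  shows "u \<in> D \<Longrightarrow> v \<in> D \<Longrightarrow> (\<lambda>x. u x + a * v x) \<in> D"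
    "u \<in> D \<Longrightarrow> v \<in> D \<Longrightarrow> AE x in lebesgue. T (\<lambda>x. u x + a * v x) x = T u x + a * T v x"
    "u \<in> D \<Longrightarrow> u \<in> Lr r" "u \<in> D \<Longrightarrow> T u \<in> Lr r"
    "u \<in> D \<Longrightarrow> Lr_norm r (T u) \<le> ennreal C * Lr_norm r u"
  using assms unfolding lbd_def by blast+

lemma lbd_diff:
  assumes T: "lbd r D T C" and uv: "u \<in> D" "v \<in> D"
  shows "Lr_norm r (\<lambda>x. T u x - T v x) \<le> ennreal C * Lr_norm r (\<lambda>x. u x - v x)"
proof -
  have "Lr_norm r (\<lambda>x. T u x - T v x) = Lr_norm r (T (\<lambda>x. u x + (-1) * v x))"
    using lbdD(2)[OF T uv, of "-1"] by (intro Lr_norm_cong_AE) (elim eventually_mono, simp)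
  also have "\<dots> \<le> ennreal C * Lr_norm r (\<lambda>x. u x + (-1) * v x)"
    by (intro lbdD(5)[OF T] lbdD(1)[OF T] uv)
  finally show ?thesis by simp
qed

lemma lbd_tendsto:
  assumes T: "lbd r D T C" and "\<And>n. u n \<in> D" "f \<in> D" "(\<lambda>n. Lr_norm r (\<lambda>x. u n x - f x)) \<longlonglongrightarrow> 0"
  shows "(\<lambda>n. Lr_norm r (\<lambda>x. T (u n) x - T f x)) \<longlonglongrightarrow> 0"
proof (rule ennreal_squeeze_0[OF _ assms(4)])
  show "Lr_norm r (\<lambda>x. T (u n) x - T f x) \<le> ennreal C * Lr_norm r (\<lambda>x. u n x - f x) + 0" for n
    using lbd_diff[OF T assms(2,3)] by simp
qed auto

text \<open>Functions are not identified modulo null sets, so compatibility with almost everywhere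
  equality has to be derived; boundedness applied to the difference gives it.\<close>

lemma lbd_cong_AE:
  assumes T: "lbd r D T C" and uv: "u \<in> D" "v \<in> D" and r: "0 < r" and e: "AE x in lebesgue. u x = v x"
  shows "AE x in lebesgue. T u x = T v x"
proof -
  have "Lr_norm r (\<lambda>x. u x - v x) = Lr_norm r (\<lambda>x. 0)"
    using e by (intro Lr_norm_cong_AE) (elim eventually_mono, simp)
  then have "Lr_norm r (\<lambda>x. T u x - T v x) = 0" using lbd_diff[OF T uv] by simp
  then have "AE x in lebesgue. T u x - T v x = 0"
    using lbdD(4)[OF T uv(1)] lbdD(4)[OF T uv(2)] by (intro Lr_norm_eq_0_AE) (auto simp: Lr_def)
  then show ?thesis by simp
qed

lemma lbd_cmult:
  assumes T: "lbd r D T C" and uv: "u \<in> D" "(\<lambda>x. 0) \<in> D" and r: "0 < r"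
  shows "AE x in lebesgue. T (\<lambda>x. a * u x) x = a * T u x"
proof -
  have "Lr_norm r (T (\<lambda>x. 0)) = 0" using lbdD(5)[OF T uv(2)] by simp
  then have "AE x in lebesgue. T (\<lambda>x. 0) x = 0"
    using lbdD(4)[OF T uv(2)] by (intro Lr_norm_eq_0_AE) (auto simp: Lr_def)
  with lbdD(2)[OF T uv(2) uv(1), of a] show ?thesis by eventually_elim simp
qed

context
  fixes r C :: real and D T
  assumes T: "lbd r D T C" and dense: "Lr_dense r D" and r: "1 \<le> r"
begin

lemma continuous_ext_tendsto:
  assumes f: "f \<in> Lr r"
  shows "continuous_ext r D T f \<in> Lr r"
    "(\<And>n. u n \<in> D) \<Longrightarrow> (\<lambda>n. Lr_norm r (\<lambda>x. u n x - f x)) \<longlonglongrightarrow> 0 \<Longrightarrow>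
      (\<lambda>n. Lr_norm r (\<lambda>x. T (u n) x - continuous_ext r D T f x)) \<longlonglongrightarrow> 0"
proof -
  define P where "P g \<longleftrightarrow> g \<in> Lr r \<and>
    (\<forall>u :: nat \<Rightarrow> real \<Rightarrow> complex.
       (\<forall>n. u n \<in> D) \<longrightarrow> (\<lambda>n. Lr_norm r (\<lambda>x. u n x - f x)) \<longlonglongrightarrow> 0 \<longrightarrow>
       (\<lambda>n. Lr_norm r (\<lambda>x. T (u n) x - g x)) \<longlonglongrightarrow> 0)" for g
  have Dm: "u \<in> borel_measurable lebesgue" "T u \<in> borel_measurable lebesgue" if "u \<in> D" for u
    using lbdD(3,4)[OF T that] by (auto simp: Lr_def)
  have fm: "f \<in> borel_measurable lebesgue" using f by (simp add: Lr_def)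
  from dense f obtain u :: "nat \<Rightarrow> real \<Rightarrow> complex" where u: "\<And>n. u n \<in> D" "(\<lambda>n. Lr_norm r (\<lambda>x. u n x - f x)) \<longlonglongrightarrow> 0"
    unfolding Lr_dense_def by blast
  \<comment> \<open>The images of one approximating sequence are Cauchy. Their limit is then shown
    to have the defining property for every approximating sequence, so that \<open>SOME\<close> has
    something to choose.\<close>
  obtain g where g: "g \<in> Lr r" "(\<lambda>n. Lr_norm r (\<lambda>x. T (u n) x - g x)) \<longlonglongrightarrow> 0"
  proof (rule Lr_complete[of "\<lambda>n. T (u n)" r])
    show "T (u n) \<in> Lr r" for n by (rule lbdD(4)[OF T u(1)])
    fix e :: ennreal assume e: "0 < e"
    have "(\<lambda>n. ennreal C * Lr_norm r (\<lambda>x. u n x - f x)) \<longlonglongrightarrow> ennreal C * 0"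
      by (intro ennreal_tendsto_cmult u) simp
    then have "eventually (\<lambda>n. ennreal C * Lr_norm r (\<lambda>x. u n x - f x) < e / 2) sequentially"
      using e by (intro order_tendstoD) (auto simp: ennreal_zero_less_divide)
    then obtain N where N: "\<And>n. n \<ge> N \<Longrightarrow> ennreal C * Lr_norm r (\<lambda>x. u n x - f x) < e / 2"
      by (auto simp: eventually_sequentially)
    have "Lr_norm r (\<lambda>x. T (u m) x - T (u n) x) \<le> e" if "m \<ge> N" "n \<ge> N" for m n
    proof -
      have "Lr_norm r (\<lambda>x. T (u m) x - T (u n) x) \<le> ennreal C * Lr_norm r (\<lambda>x. u m x - u n x)"
        by (rule lbd_diff[OF T u(1) u(1)])
      also have "\<dots> \<le> ennreal C * (Lr_norm r (\<lambda>x. u m x - f x) + Lr_norm r (\<lambda>x. u n x - f x))"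
        using Lr_norm_diff_triangle[OF Dm(1)[OF u(1)] fm Dm(1)[OF u(1)] r, of m n]
        by (intro mult_left_mono) (auto simp: Lr_norm_minus_commute[of r f])
      also have "\<dots> \<le> e / 2 + e / 2"
        using N[OF that(1)] N[OF that(2)] by (simp add: distrib_left add_mono less_imp_le)
      also have "\<dots> = e" by (cases e) (auto simp: divide_ennreal ennreal_plus[symmetric] ennreal_top_divide simp del: ennreal_plus simp flip: ennreal_numeral)
      finally show ?thesis .
    qed
    then show "\<exists>N. \<forall>m\<ge>N. \<forall>n\<ge>N. Lr_norm r (\<lambda>x. T (u m) x - T (u n) x) \<le> e" by blast
  qed (use r in auto)
  have gm: "g \<in> borel_measurable lebesgue" using g by (simp add: Lr_def)
  have "P g"
    unfolding P_def
  proof (intro conjI allI impI g(1))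
    fix v :: "nat \<Rightarrow> real \<Rightarrow> complex" assume v: "\<forall>n. v n \<in> D" "(\<lambda>n. Lr_norm r (\<lambda>x. v n x - f x)) \<longlonglongrightarrow> 0"
    show "(\<lambda>n. Lr_norm r (\<lambda>x. T (v n) x - g x)) \<longlonglongrightarrow> 0"
    proof (rule ennreal_squeeze_0)
      fix n
      have vn: "v n \<in> D" using v by blast
      have "Lr_norm r (\<lambda>x. T (v n) x - g x) \<le> Lr_norm r (\<lambda>x. T (v n) x - T (u n) x) + Lr_norm r (\<lambda>x. T (u n) x - g x)"
        by (intro Lr_norm_diff_triangle Dm vn u gm r)
      also have "Lr_norm r (\<lambda>x. T (v n) x - T (u n) x) \<le> ennreal C * Lr_norm r (\<lambda>x. v n x - u n x)"
        by (rule lbd_diff[OF T vn u(1)])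
      also have "\<dots> \<le> ennreal C * (Lr_norm r (\<lambda>x. v n x - f x) + Lr_norm r (\<lambda>x. u n x - f x))"
        using Lr_norm_diff_triangle[OF Dm(1)[OF vn] fm Dm(1)[OF u(1)[of n]] r]
        by (intro mult_left_mono) (auto simp: Lr_norm_minus_commute[of r f])
      finally show "Lr_norm r (\<lambda>x. T (v n) x - g x) \<le>
         ennreal C * (Lr_norm r (\<lambda>x. v n x - f x) + Lr_norm r (\<lambda>x. u n x - f x)) + Lr_norm r (\<lambda>x. T (u n) x - g x)"
        by simp
    next
      show "(\<lambda>n. Lr_norm r (\<lambda>x. v n x - f x) + Lr_norm r (\<lambda>x. u n x - f x)) \<longlonglongrightarrow> 0"
        using tendsto_add[OF v(2) u(2)] by simp
    qed (use g in auto)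
  qed
  then have "P (SOME g. P g)" using someI[of P g] by blast
  then have "P (continuous_ext r D T f)" by (simp add: continuous_ext_def P_def)
  then show "continuous_ext r D T f \<in> Lr r"
    "(\<And>n. u n \<in> D) \<Longrightarrow> (\<lambda>n. Lr_norm r (\<lambda>x. u n x - f x)) \<longlonglongrightarrow> 0 \<Longrightarrow>
      (\<lambda>n. Lr_norm r (\<lambda>x. T (u n) x - continuous_ext r D T f x)) \<longlonglongrightarrow> 0" for u
    unfolding P_def by blast+
qed

text \<open>A single approximating sequence identifies the value, because limits in L^r are unique
  up to null sets.\<close>

lemma continuous_ext_eqI:
  assumes f: "f \<in> Lr r" and g: "g \<in> Lr r" and u: "\<And>n. u n \<in> D" "(\<lambda>n. Lr_norm r (\<lambda>x. u n x - f x)) \<longlonglongrightarrow> 0"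
    "(\<lambda>n. Lr_norm r (\<lambda>x. T (u n) x - g x)) \<longlonglongrightarrow> 0"
  shows "AE x in lebesgue. continuous_ext r D T f x = g x"
  by (rule Lr_limit_unique[of "\<lambda>n. T (u n)", OF _ _ _ r continuous_ext_tendsto(2)[OF f u(1,2)] u(3)])
    (use continuous_ext_tendsto(1)[OF f] g lbdD(4)[OF T u(1)] in \<open>auto simp: Lr_def\<close>)

lemma continuous_ext_eq:
  assumes f: "f \<in> D" shows "AE x in lebesgue. continuous_ext r D T f x = T f x"
  by (rule continuous_ext_eqI[where u="\<lambda>n. f"]) (use lbdD[OF T f] f lbdD(3,4)[OF T f] in auto)

lemma continuous_ext_lbd: "lbd r (Lr r) (continuous_ext r D T) C"
  unfolding lbd_def
proof (intro conjI ballI allI)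
  let ?X = "continuous_ext r D T"
  fix f a assume f: "f \<in> Lr r"
  from dense f obtain u :: "nat \<Rightarrow> real \<Rightarrow> complex" where u: "\<And>n. u n \<in> D" "(\<lambda>n. Lr_norm r (\<lambda>x. u n x - f x)) \<longlonglongrightarrow> 0"
    unfolding Lr_dense_def by blast
  have um: "u n \<in> borel_measurable lebesgue" "T (u n) \<in> borel_measurable lebesgue" for n
    using lbdD(3,4)[OF T u(1)] by (auto simp: Lr_def)
  have Xf: "?X f \<in> Lr r" by (rule continuous_ext_tendsto(1)[OF f])
  have fm: "f \<in> borel_measurable lebesgue" "?X f \<in> borel_measurable lebesgue" using f Xf by (auto simp: Lr_def)
  note lim = continuous_ext_tendsto(2)[OF f u]
  show "Lr_norm r (?X f) \<le> ennreal C * Lr_norm r f"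
  proof (rule ennreal_le_lim_0)
    fix n
    have "Lr_norm r (?X f) \<le> Lr_norm r (T (u n)) + Lr_norm r (\<lambda>x. T (u n) x - ?X f x)"
      using Lr_norm_le_diff[OF fm(2) um(2) r] by (simp add: Lr_norm_minus_commute[of r "?X f"])
    also have "Lr_norm r (T (u n)) \<le> ennreal C * Lr_norm r (u n)" by (rule lbdD(5)[OF T u(1)])
    also have "\<dots> \<le> ennreal C * (Lr_norm r f + Lr_norm r (\<lambda>x. u n x - f x))"
      by (intro mult_left_mono Lr_norm_le_diff um fm r) auto
    finally show "Lr_norm r (?X f) \<le> ennreal C * Lr_norm r f +
      (ennreal C * Lr_norm r (\<lambda>x. u n x - f x) + Lr_norm r (\<lambda>x. T (u n) x - ?X f x))"
      by (simp add: distrib_left add.assoc)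
  next
    have "(\<lambda>n. ennreal C * Lr_norm r (\<lambda>x. u n x - f x) + Lr_norm r (\<lambda>x. T (u n) x - ?X f x)) \<longlonglongrightarrow> ennreal C * 0 + 0"
      by (intro tendsto_add ennreal_tendsto_cmult u lim) auto
    then show "(\<lambda>n. ennreal C * Lr_norm r (\<lambda>x. u n x - f x) + Lr_norm r (\<lambda>x. T (u n) x - ?X f x)) \<longlonglongrightarrow> 0" by simp
  qed
  show "?X f \<in> Lr r" "f \<in> Lr r" by fact+
  fix g assume g: "g \<in> Lr r"
  from dense g obtain v :: "nat \<Rightarrow> real \<Rightarrow> complex" where v: "\<And>n. v n \<in> D" "(\<lambda>n. Lr_norm r (\<lambda>x. v n x - g x)) \<longlonglongrightarrow> 0"
    unfolding Lr_dense_def by blast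
  have vm: "v n \<in> borel_measurable lebesgue" "T (v n) \<in> borel_measurable lebesgue" for n
    using lbdD(3,4)[OF T v(1)] by (auto simp: Lr_def)
  have Xg: "?X g \<in> Lr r" by (rule continuous_ext_tendsto(1)[OF g])
  have gm: "g \<in> borel_measurable lebesgue" "?X g \<in> borel_measurable lebesgue" using g Xg by (auto simp: Lr_def)
  show fg: "(\<lambda>x. f x + a * g x) \<in> Lr r" by (intro Lr_lincomb f g r)
  show "AE x in lebesgue. ?X (\<lambda>x. f x + a * g x) x = ?X f x + a * ?X g x"
  proof (rule continuous_ext_eqI[where u="\<lambda>n x. u n x + a * v n x"])
    show "(\<lambda>n. Lr_norm r (\<lambda>x. u n x + a * v n x - (f x + a * g x))) \<longlonglongrightarrow> 0"
      by (rule tendsto_Lr_lincomb[OF um(1) fm(1) vm(1) gm(1) r u(2) v(2)])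
    have "(\<lambda>n. Lr_norm r (\<lambda>x. T (u n) x + a * T (v n) x - (?X f x + a * ?X g x))) \<longlonglongrightarrow> 0"
      by (rule tendsto_Lr_lincomb[OF um(2) fm(2) vm(2) gm(2) r lim continuous_ext_tendsto(2)[OF g v]])
    moreover have "Lr_norm r (\<lambda>x. T (\<lambda>x. u n x + a * v n x) x - (?X f x + a * ?X g x)) =
        Lr_norm r (\<lambda>x. T (u n) x + a * T (v n) x - (?X f x + a * ?X g x))" for n
      using lbdD(2)[OF T u(1) v(1), of n a n] by (intro Lr_norm_cong_AE) (elim eventually_mono, simp)
    ultimately show "(\<lambda>n. Lr_norm r (\<lambda>x. T (\<lambda>x. u n x + a * v n x) x - (?X f x + a * ?X g x))) \<longlonglongrightarrow> 0" by simp
  qed (use fg Xf Xg r lbdD(1)[OF T u(1) v(1)] in \<open>auto intro: Lr_lincomb\<close>)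
qed

end

section \<open>The dual pairing\<close>

definition ip :: "(real \<Rightarrow> complex) \<Rightarrow> (real \<Rightarrow> complex) \<Rightarrow> complex"
  where "ip f g = (LINT x|lebesgue. f x * cnj (g x))"

lemma cnj_measurable [measurable]: "f \<in> borel_measurable M \<Longrightarrow> (\<lambda>x. cnj (f x)) \<in> borel_measurable M"
  by (rule measurable_compose[OF _ borel_measurable_continuous_onI[OF continuous_on_cnj[OF continuous_on_id]]])

lemma ip_integrable:
  assumes "f \<in> Lr p" "g \<in> Lr q" and pq: "1 < p" "1 < q" "1 / p + 1 / q = 1"
  shows "integrable lebesgue (\<lambda>x. f x * cnj (g x))" "ennreal (cmod (ip f g)) \<le> Lr_norm p f * Lr_norm q g"
proof -
  have [measurable]: "f \<in> borel_measurable lebesgue" "g \<in> borel_measurable lebesgue" using assms by (auto simp: Lr_def)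
  have le: "(\<integral>\<^sup>+x. ennreal (norm (f x * cnj (g x))) \<partial>lebesgue) \<le> Lr_norm p f * Lr_norm q g"
    using Holder_Lr[OF _ _ pq, of f g] by (simp add: norm_mult)
  also have "\<dots> < \<infinity>" using assms by (simp add: Lr_def ennreal_mult_less_top)
  finally show i: "integrable lebesgue (\<lambda>x. f x * cnj (g x))" by (intro integrableI_bounded) auto
  have "ennreal (cmod (ip f g)) \<le> (\<integral>\<^sup>+x. ennreal (norm (f x * cnj (g x))) \<partial>lebesgue)"
    unfolding ip_def by (rule integral_norm_bound_ennreal[OF i])
  with le show "ennreal (cmod (ip f g)) \<le> Lr_norm p f * Lr_norm q g" by (rule order_trans[rotated])
qed

lemma ip_lincomb:
  assumes "f \<in> Lr p" "f' \<in> Lr p" "g \<in> Lr q" and pq: "1 < p" "1 < q" "1 / p + 1 / q = 1"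
  shows "ip (\<lambda>x. f x + a * f' x) g = ip f g + a * ip f' g"
proof -
  have "ip (\<lambda>x. f x + a * f' x) g = (LINT x|lebesgue. f x * cnj (g x) + a * (f' x * cnj (g x)))"
    unfolding ip_def by (simp add: algebra_simps)
  also have "\<dots> = ip f g + a * ip f' g"
    unfolding ip_def using ip_integrable(1)[OF assms(1,3) pq] ip_integrable(1)[OF assms(2,3) pq]
    by (subst Bochner_Integration.integral_add) auto
  finally show ?thesis .
qed

lemma ip_cnj: "ip g f = cnj (ip f g)"
  using Bochner_Integration.integral_cnj[of lebesgue "\<lambda>x. f x * cnj (g x)"] by (simp add: ip_def mult.commute)

lemma ip_cong_AE:
  assumes "AE x in lebesgue. f x = f' x" "AE x in lebesgue. g x = g' x"
    "f \<in> borel_measurable lebesgue" "f' \<in> borel_measurable lebesgue" "g \<in> borel_measurable lebesgue" "g' \<in> borel_measurable lebesgue"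
  shows "ip f g = ip f' g'"
  unfolding ip_def
proof (rule integral_cong_AE)
  show "AE x in lebesgue. f x * cnj (g x) = f' x * cnj (g' x)" using assms(1,2) by eventually_elim simp
qed (use assms(3-) in measurable)

lemma ip_self:
  assumes "f \<in> Lr 2" shows "ip f f = of_real (Re (ip f f))" "ennreal (Re (ip f f)) = En 2 f" "0 \<le> Re (ip f f)"
proof -
  have eq: "f x * cnj (f x) = of_real ((cmod (f x))\<^sup>2)" for x by (rule complex_norm_square[symmetric])
  have i: "integrable lebesgue (\<lambda>x. f x * cnj (f x))"
    using ip_integrable(1)[OF assms assms] by simp
  then have "integrable lebesgue (\<lambda>x. complex_of_real ((cmod (f x))\<^sup>2))" by (simp only: eq)
  then have i2: "integrable lebesgue (\<lambda>x. (cmod (f x))\<^sup>2)" by (simp only: complex_of_real_integrable_eq)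
  have e: "ip f f = of_real (\<integral>x. (cmod (f x))\<^sup>2 \<partial>lebesgue)"
    unfolding ip_def eq by (rule integral_complex_of_real)
  show "ip f f = of_real (Re (ip f f))" "0 \<le> Re (ip f f)" unfolding e by simp_all
  have "ennreal (Re (ip f f)) = (\<integral>\<^sup>+x. ennreal ((cmod (f x))\<^sup>2) \<partial>lebesgue)"
    unfolding e using i2 by (simp add: nn_integral_eq_integral)
  then show "ennreal (Re (ip f f)) = En 2 f" by (simp add: En_def powr_numeral)
qed

lemma ip_tendsto:
  assumes u: "\<And>n. u n \<in> Lr p" "f \<in> Lr p" "(\<lambda>n. Lr_norm p (\<lambda>x. u n x - f x)) \<longlonglongrightarrow> 0"
    and v: "\<And>n. v n \<in> Lr q" "g \<in> Lr q" "(\<lambda>n. Lr_norm q (\<lambda>x. v n x - g x)) \<longlonglongrightarrow> 0"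
    and pq: "1 < p" "1 < q" "1 / p + 1 / q = 1"
  shows "(\<lambda>n. ip (u n) (v n)) \<longlonglongrightarrow> ip f g"
proof -
  have "1 / q + 1 / p = 1" using pq by simp
  note qp = pq(2,1) this
  have eq: "ip (u n) (v n) - ip f g = ip (\<lambda>x. u n x - f x) (\<lambda>x. v n x - g x) + (ip (\<lambda>x. u n x - f x) g + ip f (\<lambda>x. v n x - g x))" for n
  proof -
    have d: "(\<lambda>x. v n x - g x) \<in> Lr q" using u v pq by (auto intro: Lr_diff)
    have "ip (\<lambda>x. u n x - f x) h = ip (u n) h - ip f h" if "h \<in> Lr q" for h
      using ip_lincomb[OF u(1) u(2) that pq, of n "-1"] by simp
    moreover have "ip h (\<lambda>x. v n x - g x) = ip h (v n) - ip h g" if "h \<in> Lr p" for h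
      using ip_lincomb[OF v(1) v(2) that qp, of n "-1"] by (simp add: ip_cnj[of _ h] complex_cnj_diff[symmetric] del: complex_cnj_diff)
    ultimately show ?thesis using u v d by simp
  qed
  have "(\<lambda>n. ennreal (cmod (ip (u n) (v n) - ip f g))) \<longlonglongrightarrow> 0"
  proof (rule ennreal_tendsto_0_le)
    fix n
    have du: "(\<lambda>x. u n x - f x) \<in> Lr p" and dv: "(\<lambda>x. v n x - g x) \<in> Lr q" using u v pq by (auto intro: Lr_diff)
    have "cmod (ip (u n) (v n) - ip f g) \<le> cmod (ip (\<lambda>x. u n x - f x) (\<lambda>x. v n x - g x)) +
        (cmod (ip (\<lambda>x. u n x - f x) g) + cmod (ip f (\<lambda>x. v n x - g x)))"
      unfolding eq by (meson norm_triangle_ineq norm_add_rule_thm add_left_mono order_trans)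
    then have "ennreal (cmod (ip (u n) (v n) - ip f g)) \<le> ennreal (cmod (ip (\<lambda>x. u n x - f x) (\<lambda>x. v n x - g x))) +
        (ennreal (cmod (ip (\<lambda>x. u n x - f x) g)) + ennreal (cmod (ip f (\<lambda>x. v n x - g x))))"
      by (simp add: ennreal_plus[symmetric] ennreal_leI del: ennreal_plus)
    also have "\<dots> \<le> Lr_norm p (\<lambda>x. u n x - f x) * Lr_norm q (\<lambda>x. v n x - g x) + (Lr_norm p (\<lambda>x. u n x - f x) * Lr_norm q g
         + Lr_norm p f * Lr_norm q (\<lambda>x. v n x - g x))"
      by (intro add_mono ip_integrable(2)[OF _ _ pq] du dv u v)
    finally show "ennreal (cmod (ip (u n) (v n) - ip f g)) \<le> Lr_norm p (\<lambda>x. u n x - f x) * Lr_norm q (\<lambda>x. v n x - g x) + (Lr_norm q g * Lr_norm p (\<lambda>x. u n x - f x)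
         + Lr_norm p f * Lr_norm q (\<lambda>x. v n x - g x))" by (simp add: mult.commute)
  next
    have "(\<lambda>n. Lr_norm p (\<lambda>x. u n x - f x) * Lr_norm q (\<lambda>x. v n x - g x) + (Lr_norm q g * Lr_norm p (\<lambda>x. u n x - f x)
         + Lr_norm p f * Lr_norm q (\<lambda>x. v n x - g x))) \<longlonglongrightarrow> 0 * 0 + (Lr_norm q g * 0 + Lr_norm p f * 0)"
      using u v by (intro tendsto_add ennreal_tendsto_cmult tendsto_mult_ennreal) (auto simp: Lr_def)
    then show "(\<lambda>n. Lr_norm p (\<lambda>x. u n x - f x) * Lr_norm q (\<lambda>x. v n x - g x) + (Lr_norm q g * Lr_norm p (\<lambda>x. u n x - f x)
         + Lr_norm p f * Lr_norm q (\<lambda>x. v n x - g x))) \<longlonglongrightarrow> 0" by simp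
  qed
  then have "(\<lambda>n. ennreal (cmod (ip (u n) (v n) - ip f g))) \<longlonglongrightarrow> ennreal 0" by simp
  then have "(\<lambda>n. cmod (ip (u n) (v n) - ip f g)) \<longlonglongrightarrow> 0" by (subst (asm) tendsto_ennreal_iff) auto
  then show ?thesis by (simp add: LIM_zero_iff tendsto_norm_zero_iff)
qed

text \<open>Converse of Hoelder's inequality, tested with truncations of |h|^(q-2) h. These are
  bounded with bounded support, which is why \<open>B\<close> is demanded only against functions
  lying in every L^s with s >= 1.\<close>

lemma Lr_norm_dual:
  assumes h[measurable]: "h \<in> borel_measurable lebesgue" and pq: "1 < p" "1 < q" "1 / p + 1 / q = 1"
    and B: "\<And>g. (\<And>s. 1 \<le> s \<Longrightarrow> g \<in> Lr s) \<Longrightarrow> ennreal (cmod (ip h g)) \<le> B * Lr_norm p g"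
  shows "Lr_norm q h \<le> B"
proof -
  \<comment> \<open>Truncating both in position and in size makes the tested quantity finite, so
    that it can be cancelled later.\<close>
  define E where "E n = {x. \<bar>x\<bar> \<le> real n \<and> cmod (h x) \<le> real n}" for n :: nat
  have Em[measurable]: "E n \<in> sets lebesgue" for n
  proof -
    have "{x \<in> space lebesgue. cmod (h x) \<le> real n} \<in> sets lebesgue" by measurable
    moreover have "E n = {-real n..real n} \<inter> {x \<in> space lebesgue. cmod (h x) \<le> real n}" by (auto simp: E_def)
    ultimately show ?thesis by auto
  qed
  define g where "g n x = indicator (E n) x * of_real (cmod (h x) powr (q - 2)) * h x" for n x
  have gm[measurable]: "g n \<in> borel_measurable lebesgue" for n unfolding g_def by measurable
  have cg: "cmod (g n x) = indicator (E n) x * cmod (h x) powr (q - 1)" for n x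
  proof (cases "h x = 0")
    case False
    then have "cmod (h x) powr (q - 2) * cmod (h x) = cmod (h x) powr (q - 2 + 1)"
      by (subst powr_add) auto
    then show ?thesis by (simp add: g_def norm_mult indicator_def)
  qed (simp add: g_def)
  have gL: "g n \<in> Lr s" if "1 \<le> s" for n s
  proof (rule Lr_bounded_by[of _ "\<lambda>x. of_real (real n powr (q - 1)) * indicator {-real n..real n} x"])
    show "AE x in lebesgue. cmod (g n x) \<le> cmod (of_real (real n powr (q - 1)) * indicator {-real n..real n} x)"
      using pq by (intro AE_I2) (auto simp: cg norm_mult indicator_def E_def intro!: powr_mono2)
  qed (use that in \<open>auto intro!: Lr_cmult indicator_Lr\<close>)
  let ?h = "\<lambda>n x. indicator (E n) x * h x"
  have pq': "(q - 1) * p = q" using pq by (simp add: field_simps)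
  have Eg: "En p (g n) = En q (?h n)" for n
    unfolding En_def using pq by (intro nn_integral_cong) (auto simp: cg powr_powr pq' norm_mult indicator_def)
  have iph: "ennreal (cmod (ip h (g n))) = En q (?h n)" for n
  proof -
    have e: "h x * cnj (g n x) = of_real (cmod (?h n x) powr q)" for x
    proof (cases "x \<in> E n \<and> h x \<noteq> 0")
      case True
      have "h x * cnj (g n x) = of_real (cmod (h x) powr (q - 2)) * (h x * cnj (h x))" using True by (simp add: g_def)
      also have "h x * cnj (h x) = of_real (cmod (h x) powr 2)"
        using True complex_norm_square[of "h x"] by (simp add: powr_numeral)
      also have "of_real (cmod (h x) powr (q - 2)) * complex_of_real (cmod (h x) powr 2) = of_real (cmod (h x) powr (q - 2 + 2))"
        by (subst powr_add) simp
      finally show ?thesis using True by simp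
    qed (auto simp: g_def)
    have "En q (?h n) < \<top>"
      using gL[of p n] pq by (simp add: Lr_iff_En Eg[symmetric])
    then have i: "integrable lebesgue (\<lambda>x. cmod (?h n x) powr q)"
      unfolding En_def by (intro integrableI_bounded) (auto simp: measurable)
    have "ip h (g n) = of_real (\<integral>x. cmod (?h n x) powr q \<partial>lebesgue)"
      unfolding ip_def e by simp
    then show ?thesis using i by (simp add: En_def nn_integral_eq_integral)
  qed
  have *: "Lr_norm q (?h n) \<le> B" for n
  proof -
    let ?J = "En q (?h n)"
    \<comment> \<open>Testing gives J <= B * J^(1/p) for the truncated energy J. As J is finite,
      cancellation leaves J^(1/q) <= B.\<close>
    have J: "?J \<le> B * ennreal_powr ?J (1/p)"
      using B[OF gL, of n] by (simp add: iph Lr_norm_En Eg)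
    have "?J < \<top>" using gL[of p n] pq by (simp add: Lr_iff_En Eg[symmetric])
    then obtain j where j: "?J = ennreal j" "0 \<le> j" by (cases ?J) auto
    show ?thesis
    proof (cases "j = 0 \<or> B = \<top>")
      case True then show ?thesis using j by (auto simp: Lr_norm_En)
    next
      case False
      then obtain b where b: "B = ennreal b" "0 \<le> b" by (cases B) auto
      have "j \<le> b * j powr (1/p)" using J j b by (simp add: ennreal_mult[symmetric])
      moreover have "j = j powr (1/q) * j powr (1/p)"
        using False j pq(3) by (simp add: powr_add[symmetric] add.commute)
      ultimately have "j powr (1/q) * j powr (1/p) \<le> b * j powr (1/p)" by simp
      then have "j powr (1/q) \<le> b" using False j by simp
      then show ?thesis using j b by (simp add: Lr_norm_En ennreal_leI)
    qed
  qed
  show ?thesis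
  proof (rule Fatou_Lr_norm[where u="?h"])
    show "AE x in lebesgue. (\<lambda>n. ?h n x) \<longlonglongrightarrow> h x"
    proof (rule AE_I2)
      fix x
      have "eventually (\<lambda>n. ?h n x = h x) sequentially"
        using eventually_ge_at_top[of "nat \<lceil>max \<bar>x\<bar> (cmod (h x))\<rceil>"]
        by eventually_elim (auto simp: E_def indicator_def; linarith)
      then show "(\<lambda>n. ?h n x) \<longlonglongrightarrow> h x" by (rule tendsto_eventually)
    qed
  qed (use * pq in auto)
qed

section \<open>Fourier transforms of intervals\<close>

lemma nn_integral_inverse_square_tail:
  assumes "0 < a"
  shows "(\<integral>\<^sup>+x. ennreal (1 / x\<^sup>2) * indicator {x. a \<le> \<bar>x\<bar>} x \<partial>lborel) = ennreal (2 / a)"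
proof -
  have *: "(\<integral>\<^sup>+x. ennreal (1 / x\<^sup>2) * indicator {a..} x \<partial>lborel) = ennreal (0 - (- 1 / a))"
  proof (rule nn_integral_FTC_atLeast)
    show "DERIV (\<lambda>x. - 1 / x) x :> 1 / x\<^sup>2" if "a \<le> x" for x
      using that assms by (auto intro!: derivative_eq_intros simp: power2_eq_square)
    show "((\<lambda>x::real. - 1 / x) \<longlongrightarrow> 0) at_top" by real_asymp
  qed auto
  have "(\<integral>\<^sup>+x. ennreal (1 / x\<^sup>2) * indicator {..-a} x \<partial>lborel) = (\<integral>\<^sup>+x. ennreal (1 / x\<^sup>2) * indicator {a..} x \<partial>lborel)"
    by (subst nn_integral_real_affine[where c="-1" and t=0])
      (auto intro!: nn_integral_cong simp: indicator_def)
  moreover have "(\<integral>\<^sup>+x. ennreal (1 / x\<^sup>2) * indicator {x. a \<le> \<bar>x\<bar>} x \<partial>lborel) =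
      (\<integral>\<^sup>+x. ennreal (1 / x\<^sup>2) * indicator {a..} x + ennreal (1 / x\<^sup>2) * indicator {..-a} x \<partial>lborel)"
    using assms by (intro nn_integral_cong) (auto simp: indicator_def)
  ultimately show ?thesis
    using assms * by (subst (asm) nn_integral_add) (auto simp: ennreal_plus[symmetric] simp del: ennreal_plus)
qed

text \<open>The unnormalised Fourier transform of an interval, half-open to fit the mesh cells of
  step functions.\<close>

definition cint :: "real \<Rightarrow> real \<Rightarrow> real \<Rightarrow> complex"
  where "cint a b t = (LINT x|lborel. indicator {a..<b} x * cis (- (t * x)))"

lemma cis_measurable [measurable]: "cis \<in> borel_measurable borel"
  by (intro borel_measurable_continuous_onI continuous_intros)

lemma cint_bound1: "a \<le> b \<Longrightarrow> cmod (cint a b t) \<le> b - a"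
proof -
  assume ab: "a \<le> b"
  have "cmod (cint a b t) \<le> (LINT x|lborel. cmod (indicator {a..<b} x * cis (- (t * x))))"
    unfolding cint_def by (rule integral_norm_bound)
  also have "\<dots> = (LINT x|lborel. indicator {a..<b} x)"
    by (intro Bochner_Integration.integral_cong) (auto simp: norm_mult indicator_def)
  also have "\<dots> = b - a" using ab by simp
  finally show ?thesis .
qed

lemma cint_eq:
  assumes "a \<le> b" "t \<noteq> 0"
  shows "cint a b t = (cis (- (t * a)) - cis (- (t * b))) / (\<i> * of_real t)"
proof -
  let ?F = "\<lambda>x. \<i> * cis (- (t * x)) / of_real t"
  have "(LINT x|lborel. indicator {a..b} x *\<^sub>R cis (- (t * x))) = ?F b - ?F a"
  proof (rule integral_FTC_atLeastAtMost)
    show "(?F has_vector_derivative cis (- (t * x))) (at x within {a..b})" for x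
      unfolding has_vector_derivative_def
      using assms(2) by (auto intro!: derivative_eq_intros simp: scaleR_conv_of_real field_simps)
  qed (use assms in \<open>auto intro!: continuous_intros\<close>)
  moreover have "cint a b t = (LINT x|lborel. indicator {a..b} x *\<^sub>R cis (- (t * x)))"
    unfolding cint_def
  proof (rule integral_cong_AE)
    show "AE x in lborel. indicator {a..<b} x * cis (- (t * x)) = indicator {a..b} x *\<^sub>R cis (- (t * x))"
      using AE_lborel_singleton[of b] by eventually_elim (auto simp: indicator_def)
  qed measurable
  ultimately have e: "of_real t * cint a b t = \<i> * cis (- (t * b)) - \<i> * cis (- (t * a))"
    using assms(2) by (simp add: right_diff_distrib)
  have "\<i> * (of_real t * cint a b t) = cis (- (t * a)) - cis (- (t * b))"
    unfolding e by (simp add: right_diff_distrib mult.assoc[symmetric])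
  then show ?thesis using assms(2) by (simp add: field_simps)
qed

lemma cint_bound2: 
  assumes "a \<le> b" "t \<noteq> 0" shows "cmod (cint a b t) \<le> 2 / \<bar>t\<bar>"
proof -
  have "cmod (cis (- (t * a)) - cis (- (t * b))) \<le> 1 + 1"
    using norm_triangle_ineq4[of "cis (- (t * a))" "cis (- (t * b))"] by simp
  then show ?thesis using assms by (simp add: cint_eq norm_divide norm_mult divide_right_mono)
qed

lemma cint_measurable [measurable]: "cint a b \<in> borel_measurable borel"
  unfolding cint_def[abs_def] by measurable

text \<open>On [-1, 1] the trivial bound b - a is used, outside it the decay 2 / |t|.\<close>

lemma cint_square_integrable: 
  assumes "a \<le> b" shows "(\<integral>\<^sup>+t. ennreal ((cmod (cint a b t))\<^sup>2) \<partial>lborel) < \<top>"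
proof -
  have "(\<integral>\<^sup>+t. ennreal ((cmod (cint a b t))\<^sup>2) \<partial>lborel) \<le>
    (\<integral>\<^sup>+t. ennreal ((b - a)\<^sup>2) * indicator {-1..1} t + 4 * (ennreal (1 / t\<^sup>2) * indicator {t. 1 \<le> \<bar>t\<bar>} t) \<partial>lborel)"
  proof (rule nn_integral_mono)
    fix t :: real
    show "ennreal ((cmod (cint a b t))\<^sup>2) \<le> ennreal ((b - a)\<^sup>2) * indicator {-1..1} t + 4 * (ennreal (1 / t\<^sup>2) * indicator {t. 1 \<le> \<bar>t\<bar>} t)"
    proof (cases "\<bar>t\<bar> \<le> 1")
      case True
      have "(cmod (cint a b t))\<^sup>2 \<le> (b - a)\<^sup>2" by (intro power_mono cint_bound1 assms) simp
      then have "ennreal ((cmod (cint a b t))\<^sup>2) \<le> ennreal ((b - a)\<^sup>2) * indicator {-1..1} t"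
        using True by (auto simp: abs_le_iff intro!: ennreal_leI)
      then show ?thesis by (rule order_trans) simp
    next
      case False
      then have "(cmod (cint a b t))\<^sup>2 \<le> (2 / \<bar>t\<bar>)\<^sup>2" by (intro power_mono cint_bound2 assms) auto
      also have "\<dots> = 4 * (1 / t\<^sup>2)" by (simp add: power_divide)
      finally have "ennreal ((cmod (cint a b t))\<^sup>2) \<le> ennreal (4 * (1 / t\<^sup>2))" by (rule ennreal_leI)
      also have "ennreal (4 * (1 / t\<^sup>2)) = 4 * ennreal (1 / t\<^sup>2)" by (subst ennreal_mult) auto
      finally have "ennreal ((cmod (cint a b t))\<^sup>2) \<le> 4 * (ennreal (1 / t\<^sup>2) * indicator {t. 1 \<le> \<bar>t\<bar>} t)"
        using False by simp
      then show ?thesis by (rule order_trans) simp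
    qed
  qed
  also have "\<dots> = ennreal ((b - a)\<^sup>2) * emeasure lborel {-1..1::real} + 4 * ennreal (2 / 1)"
    by (subst nn_integral_add) (auto simp: nn_integral_cmult nn_integral_inverse_square_tail nn_integral_cmult_indicator)
  also have "\<dots> < \<top>" by (simp add: ennreal_mult_less_top)
  finally show ?thesis .
qed

lemma integrable_mult_of_square:
  fixes f g :: "real \<Rightarrow> complex"
  assumes [measurable]: "f \<in> borel_measurable M" "g \<in> borel_measurable M"
    and "(\<integral>\<^sup>+t. ennreal ((cmod (f t))\<^sup>2) \<partial>M) < \<top>" "(\<integral>\<^sup>+t. ennreal ((cmod (g t))\<^sup>2) \<partial>M) < \<top>"
  shows "integrable M (\<lambda>t. f t * g t)"
proof (rule integrableI_bounded)
  have "(\<integral>\<^sup>+t. ennreal (norm (f t * g t)) \<partial>M) \<le> (\<integral>\<^sup>+t. ennreal ((cmod (f t))\<^sup>2) + ennreal ((cmod (g t))\<^sup>2) \<partial>M)"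
  proof (rule nn_integral_mono)
    fix t
    have "2 * (cmod (f t) * cmod (g t)) \<le> (cmod (f t))\<^sup>2 + (cmod (g t))\<^sup>2"
      using sum_squares_bound[of "cmod (f t)" "cmod (g t)"] by simp
    moreover have "0 \<le> cmod (f t) * cmod (g t)" by simp
    ultimately have "norm (f t * g t) \<le> (cmod (f t))\<^sup>2 + (cmod (g t))\<^sup>2" unfolding norm_mult by linarith
    then show "ennreal (norm (f t * g t)) \<le> ennreal ((cmod (f t))\<^sup>2) + ennreal ((cmod (g t))\<^sup>2)"
      by (simp add: ennreal_plus[symmetric] ennreal_leI del: ennreal_plus)
  qed
  also have "\<dots> < \<infinity>" using assms by (subst nn_integral_add) auto
  finally show "(\<integral>\<^sup>+t. ennreal (norm (f t * g t)) \<partial>M) < \<infinity>" .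
qed measurable

text \<open>Levy's inversion formula for the uniform distribution on $[c,d]$ is Parseval's identity for two intervals.\<close>

lemma cint_parseval:
  assumes ab: "a < b" and cd: "c < d"
  shows "(LINT t|lborel. cint a b t * cnj (cint c d t)) = 2 * pi * measure lborel ({a..<b} \<inter> {c..<d})"
proof -
  define M where "M = density lborel (\<lambda>x. ennreal (indicator {c..<d} x / (d - c)))"
  have Mset: "emeasure M A = ennreal (measure lborel (A \<inter> {c..<d}) / (d - c))" if [measurable]: "A \<in> sets borel" for A
  proof -
    have "emeasure M A = (\<integral>\<^sup>+x. ennreal (1 / (d - c)) * indicator (A \<inter> {c..<d}) x \<partial>lborel)"
      unfolding M_def using cd by (subst emeasure_density) (auto intro!: nn_integral_cong simp: indicator_def)
    also have "\<dots> = ennreal (1 / (d - c)) * emeasure lborel (A \<inter> {c..<d})"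
      by (subst nn_integral_cmult_indicator) auto
    also have "emeasure lborel (A \<inter> {c..<d}) = ennreal (measure lborel (A \<inter> {c..<d}))"
    proof (rule emeasure_eq_ennreal_measure)
      have "emeasure lborel (A \<inter> {c..<d}) \<le> emeasure lborel {c..<d}" by (intro emeasure_mono) auto
      also have "\<dots> < \<top>" using cd by simp
      finally show "emeasure lborel (A \<inter> {c..<d}) \<noteq> \<top>" by simp
    qed
    finally show ?thesis using cd by (simp add: ennreal_mult[symmetric])
  qed
  have "emeasure M UNIV = 1" using cd by (subst Mset) auto
  then have "prob_space M" by (intro prob_spaceI) (simp add: M_def)
  then interpret prob_space M .
  interpret real_distribution M by standard (simp add: M_def)
  have mM: "measure M A = measure lborel (A \<inter> {c..<d}) / (d - c)" if "A \<in> sets borel" for A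
    using Mset[OF that] cd by (simp add: measure_def)
  have sing: "measure M {x} = 0" for x
  proof -
    have "emeasure lborel ({x} \<inter> {c..<d}) \<le> emeasure lborel {x}" by (intro emeasure_mono) auto
    then have "measure lborel ({x} \<inter> {c..<d}) = 0" by (simp add: measure_def)
    then show ?thesis by (simp add: mM)
  qed
  have char_eq: "char M t = cnj (cint c d t) / (d - c)" for t
  proof -
    have "char M t = (LINT x|lborel. (indicator {c..<d} x / (d - c)) *\<^sub>R iexp (t * x))"
      unfolding char_def M_def using cd by (subst integral_density) (auto intro!: AE_I2)
    also have "\<dots> = (LINT x|lborel. cnj (indicator {c..<d} x * cis (- (t * x))) / (d - c))"
    proof -
      have "iexp y = cnj (cis (- y))" for y by (simp add: cis_cnj flip: cis_conv_exp)
      then show ?thesis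
        by (intro Bochner_Integration.integral_cong) (auto simp: indicator_def scaleR_conv_of_real simp del: of_real_mult)
    qed
    also have "\<dots> = cnj (cint c d t) / (d - c)"
      unfolding cint_def by (subst Bochner_Integration.integral_cnj[symmetric]) (simp only: integral_divide_zero)
    finally show ?thesis .
  qed
  let ?g = "\<lambda>t. cint a b t * cnj (cint c d t)"
  have int: "integrable lborel ?g"
    using ab cd by (intro integrable_mult_of_square) (auto intro!: cint_square_integrable)
  have lev: "(\<lambda>T::nat. 1 / (2 * pi) * (CLBINT t=-real T..real T. (iexp (-(t * a)) - iexp (-(t * b))) / (\<i> * t) * char M t))
      \<longlonglongrightarrow> complex_of_real (measure M {a<..b})"
    using Levy_Inversion[of a b] ab sing by simp
  have inner: "(CLBINT t=-real T..real T. (iexp (-(t * a)) - iexp (-(t * b))) / (\<i> * t) * char M t)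
     = (LINT t|lborel. indicator {-real T..real T} t *\<^sub>R (?g t / (d - c)))" for T :: nat
  proof -
    have "(CLBINT t=-real T..real T. (iexp (-(t * a)) - iexp (-(t * b))) / (\<i> * t) * char M t)
      = (CLBINT t:{-real T..real T}. (iexp (-(t * a)) - iexp (-(t * b))) / (\<i> * t) * char M t)"
      by (subst interval_integral_Icc) auto
    also have "\<dots> = (LINT t|lborel. indicator {-real T..real T} t *\<^sub>R (?g t / (d - c)))"
      unfolding set_lebesgue_integral_def
    proof (rule integral_cong_AE)
      show "AE t in lborel. indicator {-real T..real T} t *\<^sub>R ((iexp (-(t * a)) - iexp (-(t * b))) / (\<i> * t) * char M t) =
        indicator {-real T..real T} t *\<^sub>R (?g t / (d - c))"
        using AE_lborel_singleton[of 0]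
        by eventually_elim (use ab in \<open>auto simp: char_eq cint_eq cis_conv_exp\<close>)
    qed (auto simp: char_eq)
    finally show ?thesis .
  qed
  \<comment> \<open>The inversion formula provides only a symmetric limit. The product of two square
    integrable functions is integrable, so this limit is the integral over the whole line.\<close>
  have "(\<lambda>T::nat. LINT t|lborel. indicator {-real T..real T} t *\<^sub>R (?g t / (d - c))) \<longlonglongrightarrow> (LINT t|lborel. ?g t / (d - c))"
  proof (rule integral_dominated_convergence[where w="\<lambda>t. norm (?g t / (d - c))"])
    show "AE t in lborel. (\<lambda>T. indicator {-real T..real T} t *\<^sub>R (?g t / (d - c))) \<longlonglongrightarrow> ?g t / (d - c)"
    proof (rule AE_I2, rule tendsto_eventually)
      fix t :: real
      show "\<forall>\<^sub>F T in sequentially. indicator {-real T..real T} t *\<^sub>R (?g t / (d - c)) = ?g t / (d - c)"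
        using eventually_ge_at_top[of "nat \<lceil>\<bar>t\<bar>\<rceil>"] by eventually_elim (auto simp: indicator_def; linarith)
    qed
  qed (use int in \<open>auto simp: indicator_def norm_mult\<close>)
  then have "(\<lambda>T::nat. 1 / (2 * pi) * (CLBINT t=-real T..real T. (iexp (-(t * a)) - iexp (-(t * b))) / (\<i> * t) * char M t))
      \<longlonglongrightarrow> 1 / (2 * pi) * (LINT t|lborel. ?g t / (d - c))"
    unfolding inner by (intro tendsto_mult tendsto_const)
  from LIMSEQ_unique[OF this lev]
  have "1 / (2 * pi) * ((LINT t|lborel. ?g t) / (d - c)) = measure M {a<..b}"
    by (simp add: integral_divide_zero)
  \<comment> \<open>The inversion formula measures (a, b] and the claim concerns [a, b); the
    endpoints are null sets.\<close>
  moreover have "measure M {a<..b} = measure M {a..<b}"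
  proof -
    have "measure lborel ({a<..b} \<inter> {c..<d}) = measure lborel ({a..<b} \<inter> {c..<d})"
      using AE_lborel_singleton[of a] AE_lborel_singleton[of b]
      by (intro measure_eq_AE) (auto elim!: eventually_elim2)
    then show ?thesis by (simp add: mM)
  qed
  ultimately have e: "1 / (2 * pi) * ((LINT t|lborel. ?g t) / (d - c)) = complex_of_real (measure lborel ({a..<b} \<inter> {c..<d}) / (d - c))"
    by (simp only: mM[of "{a..<b}"] atLeastLessThan_borel)
  have "complex_of_real (d - c) \<noteq> 0" using cd by (simp flip: of_real_diff)
  then have "(LINT t|lborel. ?g t) = 2 * pi * (d - c) * (1 / (2 * pi) * ((LINT t|lborel. ?g t) / (d - c)))"
    by simp
  also have "\<dots> = 2 * pi * measure lborel ({a..<b} \<inter> {c..<d})"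
    unfolding e of_real_mult[symmetric] of_real_eq_iff using cd by simp
  finally show ?thesis .
qed

section \<open>The Fourier transform on $L^2$\<close>

text \<open>Working with the frequency unit \<open>k\<close> avoids dilations: the special affine Fourier transform uses \<open>k = 2 * pi / b\<close>,
  and the inverse transform is obtained by changing the sign of \<open>k\<close>.\<close>

definition FT :: "real \<Rightarrow> (real \<Rightarrow> complex) \<Rightarrow> real \<Rightarrow> complex"
  where "FT k f \<omega> = of_real (sqrt (\<bar>k\<bar> / (2 * pi))) * (LINT t|lebesgue. f t * cis (- (k * \<omega> * t)))"

lemma id_lebesgue [measurable]: "(\<lambda>x. x) \<in> borel_measurable (lebesgue :: real measure)"
  by (rule borel_imp_lebesgue) simp

lemma Lr_1_integrable: "f \<in> Lr 1 \<longleftrightarrow> integrable lebesgue f"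
  by (auto simp: Lr_iff_En En_def integrable_iff_bounded)

lemma FT_integrable: 
  assumes "f \<in> Lr 1" shows "integrable lebesgue (\<lambda>t. f t * cis (- (k * \<omega> * t)))"
proof -
  have f: "integrable lebesgue f" using assms by (simp add: Lr_1_integrable)
  then have [measurable]: "f \<in> borel_measurable lebesgue" by simp
  show ?thesis
  proof (rule Bochner_Integration.integrable_bound[OF f])
    show "(\<lambda>t. f t * cis (- (k * \<omega> * t))) \<in> borel_measurable lebesgue"
      by (intro borel_measurable_times measurable_compose[OF _ cis_measurable]) measurable
  qed (auto simp: norm_mult)
qed

lemma FT_lincomb:
  assumes "f \<in> Lr 1" "g \<in> Lr 1" shows "FT k (\<lambda>x. f x + a * g x) \<omega> = FT k f \<omega> + a * FT k g \<omega>"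
proof -
  have "(LINT t|lebesgue. (f t + a * g t) * cis (- (k * \<omega> * t))) =
    (LINT t|lebesgue. f t * cis (- (k * \<omega> * t)) + a * (g t * cis (- (k * \<omega> * t))))"
    by (simp add: algebra_simps)
  also have "\<dots> = (LINT t|lebesgue. f t * cis (- (k * \<omega> * t))) + a * (LINT t|lebesgue. g t * cis (- (k * \<omega> * t)))"
    using FT_integrable[OF assms(1)] FT_integrable[OF assms(2)] by (subst Bochner_Integration.integral_add) auto
  finally show ?thesis by (simp add: FT_def algebra_simps)
qed

lemma FT_bound:
  assumes "f \<in> Lr 1" shows "ennreal (cmod (FT k f \<omega>)) \<le> ennreal (sqrt (\<bar>k\<bar> / (2 * pi))) * Lr_norm 1 f"
proof -
  have "ennreal (cmod (LINT t|lebesgue. f t * cis (- (k * \<omega> * t)))) \<le> (\<integral>\<^sup>+t. ennreal (norm (f t * cis (- (k * \<omega> * t)))) \<partial>lebesgue)"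
    by (intro integral_norm_bound_ennreal FT_integrable assms)
  also have "\<dots> = Lr_norm 1 f" by (simp add: Lr_norm_En En_def norm_mult)
  finally show ?thesis
    by (simp add: FT_def norm_mult ennreal_mult mult_left_mono)
qed

text \<open>Induction on the number of mesh intervals. Membership of the current function in every
  L^s is what linearity of the transform asks for at each step.\<close>

lemma stepfs_induct [consumes 1, case_names zero step]:
  assumes u: "u \<in> stepfs" and zero: "P (\<lambda>x. 0)"
    and step: "\<And>u a l r. (\<And>s. u \<in> Lr s) \<Longrightarrow> P u \<Longrightarrow> l < r \<Longrightarrow> P (\<lambda>x. u x + a * indicator {l..<r} x)"
  shows "P u"
proof -
  obtain n c where u: "u = stepf ((1/2)^n) c" and fin: "finite {i. c i \<noteq> 0}" using u by (auto simp: stepfs_def)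
  define h :: real where "h = (1/2)^n"
  have h: "0 < h" by (simp add: h_def)
  define I where "I i = {of_int i * h ..< (of_int i + 1) * h}" for i
  have Ilt: "of_int i * h < (of_int i + 1) * h" for i :: int using h by (simp add: algebra_simps)
  have "(\<forall>s. (\<lambda>x. \<Sum>i\<in>S. c i * indicator (I i) x) \<in> Lr s) \<and> P (\<lambda>x. \<Sum>i\<in>S. c i * indicator (I i) x)" if "finite S" for S
    using that
  proof (induction S rule: finite_induct)
    case empty then show ?case using zero by simp
  next
    case (insert i S)
    have "P (\<lambda>x. (\<Sum>i\<in>S. c i * indicator (I i) x) + c i * indicator (I i) x)"
      unfolding I_def[of i] by (rule step) (use insert Ilt in auto)
    moreover have "(\<lambda>x. \<Sum>i\<in>insert i S. c i * indicator (I i) x) \<in> Lr s" for s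
    proof -
      \<comment> \<open>Rewriting the partial sum as a step function again gives its membership in
        L^s for every s, including s below 1, where sums are not covered by the triangle
        inequality.\<close>
      define c' where "c' j = (if j \<in> insert i S then c j else 0)" for j
      have "(\<lambda>x. \<Sum>i\<in>insert i S. c i * indicator (I i) x) = stepf h c'"
      proof (rule ext)
        fix x
        have "stepf h c' x = (\<Sum>j\<in>insert i S. c' j * indicator {of_int j * h ..< (of_int j + 1) * h} x)"
          using insert(1) h by (intro stepf_eq_sum) (auto simp: c'_def)
        then show "(\<Sum>i\<in>insert i S. c i * indicator (I i) x) = stepf h c' x"
          by (simp only: I_def) (intro sum.cong, auto simp: c'_def)
      qed
      moreover have "finite {i. c' i \<noteq> 0}" by (rule finite_subset[of _ "insert i S"]) (use insert in \<open>auto simp: c'_def\<close>)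
      ultimately show ?thesis using h by (simp add: stepf_Lr)
    qed
    moreover have "(\<lambda>x. \<Sum>i\<in>insert i S. c i * indicator (I i) x) = (\<lambda>x. (\<Sum>i\<in>S. c i * indicator (I i) x) + c i * indicator (I i) x)"
      unfolding sum.insert[OF insert(1,2)] by (rule ext, rule add.commute)
    ultimately show ?case by metis
  qed
  from this[OF fin] have "P (\<lambda>x. \<Sum>i\<in>{i. c i \<noteq> 0}. c i * indicator (I i) x)" by blast
  moreover have "(\<lambda>x. \<Sum>i\<in>{i. c i \<noteq> 0}. c i * indicator (I i) x) = u"
    using stepf_eq_sum[OF fin order_refl h] by (simp add: u I_def h_def fun_eq_iff)
  ultimately show ?thesis by simp
qed

lemma interval_Lr: "indicator {l..<r::real} \<in> Lr s"
  by (intro indicator_Lr fmeasurableI) (cases "l \<le> r"; simp)+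

lemma FT_interval: "FT k (indicator {a..<b}) \<omega> = of_real (sqrt (\<bar>k\<bar> / (2 * pi))) * cint a b (k * \<omega>)"
  unfolding FT_def cint_def by (subst integral_completion) auto

lemma ip2_lincomb: "f \<in> Lr 2 \<Longrightarrow> f' \<in> Lr 2 \<Longrightarrow> g \<in> Lr 2 \<Longrightarrow> ip (\<lambda>x. f x + a * f' x) g = ip f g + a * ip f' g"
  by (rule ip_lincomb[where p=2 and q=2]) auto

lemma ip2_lincomb_right: "f \<in> Lr 2 \<Longrightarrow> f' \<in> Lr 2 \<Longrightarrow> g \<in> Lr 2 \<Longrightarrow> ip g (\<lambda>x. f x + a * f' x) = ip g f + cnj a * ip g f'"
  using ip2_lincomb[of f f' g a] by (simp add: ip_cnj[of g])

text \<open>By sesquilinearity an identity of pairings need be checked only on pairs of intervals.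
  Parseval's identity has the transform on the left and identities on the right; adjointness has one
  transform on each side. Four operators cover both.\<close>

lemma FT_stepfs_bilinear:
  assumes u: "u \<in> stepfs" and v: "v \<in> stepfs"
    and F: "\<And>a b. a < b \<Longrightarrow> F (indicator {a..<b}) \<in> Lr 2" "F (\<lambda>x. 0) = (\<lambda>x. 0)"
      "\<And>u v a. u \<in> Lr 1 \<Longrightarrow> v \<in> Lr 1 \<Longrightarrow> F (\<lambda>x. u x + a * v x) = (\<lambda>x. F u x + a * F v x)"
    and G: "\<And>a b. a < b \<Longrightarrow> G (indicator {a..<b}) \<in> Lr 2" "G (\<lambda>x. 0) = (\<lambda>x. 0)"
      "\<And>u v a. u \<in> Lr 1 \<Longrightarrow> v \<in> Lr 1 \<Longrightarrow> G (\<lambda>x. u x + a * v x) = (\<lambda>x. G u x + a * G v x)"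
    and H: "\<And>a b. a < b \<Longrightarrow> H (indicator {a..<b}) \<in> Lr 2" "H (\<lambda>x. 0) = (\<lambda>x. 0)"
      "\<And>u v a. u \<in> Lr 1 \<Longrightarrow> v \<in> Lr 1 \<Longrightarrow> H (\<lambda>x. u x + a * v x) = (\<lambda>x. H u x + a * H v x)"
    and K: "\<And>a b. a < b \<Longrightarrow> K (indicator {a..<b}) \<in> Lr 2" "K (\<lambda>x. 0) = (\<lambda>x. 0)"
      "\<And>u v a. u \<in> Lr 1 \<Longrightarrow> v \<in> Lr 1 \<Longrightarrow> K (\<lambda>x. u x + a * v x) = (\<lambda>x. K u x + a * K v x)"
    and eq: "\<And>a b c d. a < b \<Longrightarrow> c < d \<Longrightarrow> ip (F (indicator {a..<b})) (G (indicator {c..<d})) = ip (H (indicator {a..<b})) (K (indicator {c..<d}))"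
  shows "ip (F u) (G v) = ip (H u) (K v)"
proof -
  have z: "ip (\<lambda>x. 0) f = 0" "ip f (\<lambda>x. 0) = 0" for f by (simp_all add: ip_def)
  have 1: "F u \<in> Lr 2 \<and> H u \<in> Lr 2 \<and> ip (F u) (G (indicator {c..<d})) = ip (H u) (K (indicator {c..<d}))" if "c < d" for c d
    using u
  proof (induction u rule: stepfs_induct)
    case zero then show ?case by (simp add: F H z)
  next
    case (step u a l r)
    then show ?case using that
      by (auto simp: F(3) H(3) interval_Lr ip2_lincomb F(1) G(1) H(1) K(1) eq intro!: Lr_lincomb)
  qed
  from 1[of 0 1] have FH: "F u \<in> Lr 2" "H u \<in> Lr 2" by auto
  have "G v \<in> Lr 2 \<and> K v \<in> Lr 2 \<and> ip (F u) (G v) = ip (H u) (K v)"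
    using v
  proof (induction v rule: stepfs_induct)
    case zero then show ?case by (simp add: G K z)
  next
    case (step v a l r)
    then show ?case
      by (auto simp: G(3) K(3) interval_Lr ip2_lincomb_right FH F(1) G(1) H(1) K(1) 1 intro!: Lr_lincomb)
  qed
  then show ?thesis by blast
qed

context
  fixes k :: real
  assumes k: "k \<noteq> 0"
begin

lemma FT_interval_L2: "a < b \<Longrightarrow> FT k (indicator {a..<b}) \<in> Lr 2"
proof -
  assume ab: "a < b"
  have [measurable]: "(\<lambda>\<omega>. cint a b (k * \<omega>)) \<in> borel_measurable borel" by measurable
  have "(\<integral>\<^sup>+t. ennreal ((cmod (cint a b t))\<^sup>2) \<partial>lborel) = ennreal \<bar>k\<bar> * (\<integral>\<^sup>+\<omega>. ennreal ((cmod (cint a b (k * \<omega>)))\<^sup>2) \<partial>lborel)"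
    using k by (subst nn_integral_real_affine[where c=k and t=0]) auto
  then have "(\<integral>\<^sup>+\<omega>. ennreal ((cmod (cint a b (k * \<omega>)))\<^sup>2) \<partial>lborel) < \<top>"
    using cint_square_integrable[of a b] ab k by (auto simp: ennreal_mult_less_top)
  then have "(\<lambda>\<omega>. cint a b (k * \<omega>)) \<in> Lr 2"
    by (simp add: Lr_iff_En En_def nn_integral_completion powr_numeral borel_imp_lebesgue)
  then have "(\<lambda>\<omega>. of_real (sqrt (\<bar>k\<bar> / (2 * pi))) * cint a b (k * \<omega>)) \<in> Lr 2" by (rule Lr_cmult) simp
  then show ?thesis by (simp add: FT_interval[abs_def])
qed

text \<open>Substitute t = k * omega: the Jacobian |k| and the square |k| / (2 * pi) of the
  normalising constant absorb the factor 2 * pi of \<open>cint_parseval\<close>.\<close>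

lemma FT_interval_parseval:
  assumes "a < b" "c < d"
  shows "ip (FT k (indicator {a..<b})) (FT k (indicator {c..<d})) = ip (indicator {a..<b}) (indicator {c..<d})"
proof -
  have "ip (FT k (indicator {a..<b})) (FT k (indicator {c..<d}))
    = (LINT \<omega>|lborel. of_real (\<bar>k\<bar> / (2 * pi)) * (cint a b (k * \<omega>) * cnj (cint c d (k * \<omega>))))"
    unfolding ip_def FT_interval
    by (subst integral_completion) (auto simp: mult_ac simp flip: of_real_mult intro!: Bochner_Integration.integral_cong)
  also have "\<dots> = of_real (1 / (2 * pi)) * (\<bar>k\<bar> *\<^sub>R (LINT \<omega>|lborel. cint a b (k * \<omega>) * cnj (cint c d (k * \<omega>))))"
    by (simp add: scaleR_conv_of_real)
  also have "\<bar>k\<bar> *\<^sub>R (LINT \<omega>|lborel. cint a b (k * \<omega>) * cnj (cint c d (k * \<omega>))) = (LINT t|lborel. cint a b t * cnj (cint c d t))"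
    using lborel_integral_real_affine[OF k, of "\<lambda>t. cint a b t * cnj (cint c d t)" 0] by simp
  also have "\<dots> = 2 * pi * measure lborel ({a..<b} \<inter> {c..<d})" by (rule cint_parseval[OF assms])
  also have "of_real (1 / (2 * pi)) * complex_of_real (2 * pi * measure lborel ({a..<b} \<inter> {c..<d})) = measure lborel ({a..<b} \<inter> {c..<d})"
    unfolding of_real_mult[symmetric] by simp
  also have "complex_of_real (measure lborel ({a..<b} \<inter> {c..<d})) = (LINT x|lborel. complex_of_real (indicator ({a..<b} \<inter> {c..<d}) x))"
    by simp
  also have "\<dots> = (LINT x|lborel. indicator {a..<b} x * cnj (indicator {c..<d} x))"
    by (intro Bochner_Integration.integral_cong) (auto simp: indicator_def)
  also have "\<dots> = ip (indicator {a..<b}) (indicator {c..<d})"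
    unfolding ip_def by (subst integral_completion) auto
  finally show ?thesis .
qed

lemma FT_stepfs_L2: 
  assumes "u \<in> stepfs" shows "FT k u \<in> Lr 2"
  using assms
proof (induction u rule: stepfs_induct)
  case zero then show ?case by (simp add: FT_def[abs_def])
next
  case (step u a l r)
  have "FT k (\<lambda>x. u x + a * indicator {l..<r} x) = (\<lambda>\<omega>. FT k u \<omega> + a * FT k (indicator {l..<r}) \<omega>)"
    using FT_lincomb[OF step(1) interval_Lr] by (simp add: fun_eq_iff)
  then show ?case using step FT_interval_L2 by (auto intro: Lr_lincomb)
qed

lemma FT_zero: "FT k (\<lambda>x. 0) = (\<lambda>x. 0)" by (simp add: FT_def[abs_def])

lemma FT_stepfs_parseval:
  assumes "u \<in> stepfs" "v \<in> stepfs" shows "ip (FT k u) (FT k v) = ip u v"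
  by (rule FT_stepfs_bilinear[where F="FT k" and G="FT k" and H="\<lambda>x. x" and K="\<lambda>x. x", OF assms])
    (auto simp: FT_interval_L2 FT_zero FT_lincomb interval_Lr FT_interval_parseval fun_eq_iff)

end

text \<open>Fubini for a bounded kernel on a rectangle; conjugating the exponential changes the sign
  of k.\<close>

lemma FT_interval_adjoint:
  "ip (FT k (indicator {a..<b})) (indicator {c..<d}) = ip (indicator {a..<b}) (FT (-k) (indicator {c..<d}))"
proof -
  let ?\<kappa> = "complex_of_real (sqrt (\<bar>k\<bar> / (2 * pi)))"
  let ?f = "\<lambda>t \<omega>. indicator {a..<b} t * indicator {c..<d} \<omega> * cis (- (k * \<omega> * t))"
  have eq1: "(LINT t|lborel. ?f t \<omega>) = indicator {c..<d} \<omega> * (LINT t|lborel. indicator {a..<b} t * cis (- (k * \<omega> * t)))" for \<omega>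
    unfolding Bochner_Integration.integral_mult_right_zero[symmetric] by (simp add: mult_ac)
  have "ip (FT k (indicator {a..<b})) (indicator {c..<d}) = (LINT \<omega>|lborel. ?\<kappa> * (LINT t|lborel. ?f t \<omega>))"
    unfolding ip_def FT_interval cint_def eq1 
  proof (subst integral_completion, measurable, intro Bochner_Integration.integral_cong refl)
    fix \<omega> :: real
    have "cnj (indicator {c..<d} \<omega>) = indicator {c..<d} \<omega>" by (auto simp: indicator_def)
    then show "?\<kappa> * (LINT x|lborel. indicator {a..<b} x * cis (- (k * \<omega> * x))) * cnj (indicator {c..<d} \<omega>) =
      ?\<kappa> * (indicator {c..<d} \<omega> * (LINT t|lborel. indicator {a..<b} t * cis (- (k * \<omega> * t))))"
      by (simp only: mult_ac)
  qed
  also have "\<dots> = ?\<kappa> * (LINT \<omega>|lborel. (LINT t|lborel. ?f t \<omega>))" by simp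
  also have "(LINT \<omega>|lborel. (LINT t|lborel. ?f t \<omega>)) = (LINT t|lborel. (LINT \<omega>|lborel. ?f t \<omega>))"
  proof (rule lborel_pair.Fubini_integral)
    show "integrable (lborel \<Otimes>\<^sub>M lborel) (\<lambda>(t, \<omega>). ?f t \<omega>)"
    proof (rule integrableI_bounded_set[where A="{a..<b} \<times> {c..<d}" and B=1])
      show "emeasure (lborel \<Otimes>\<^sub>M lborel) ({a..<b} \<times> {c..<d}) < \<infinity>"
      proof -
        have "emeasure lborel {x..<y::real} < \<top>" for x y by (cases "x \<le> y") auto
        then show ?thesis by (subst lborel.emeasure_pair_measure_Times) (auto simp: ennreal_mult_less_top)
      qed
      show "{a..<b} \<times> {c..<d} \<in> sets (lborel \<Otimes>\<^sub>M lborel)" by auto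
    qed (auto simp: norm_mult indicator_def)
  qed
  also have "?\<kappa> * (LINT t|lborel. (LINT \<omega>|lborel. ?f t \<omega>)) = (LINT t|lborel. ?\<kappa> * (LINT \<omega>|lborel. ?f t \<omega>))" by simp
  also have "\<dots> = ip (indicator {a..<b}) (FT (-k) (indicator {c..<d}))"
    unfolding ip_def FT_interval cint_def
  proof (subst integral_completion, measurable, intro Bochner_Integration.integral_cong refl)
    fix t :: real
    have "cnj (LINT x|lborel. indicator {c..<d} x * cis (- (- k * t * x))) = (LINT x|lborel. indicator {c..<d} x * cis (- (k * x * t)))"
      unfolding Bochner_Integration.integral_cnj[symmetric] by (intro Bochner_Integration.integral_cong) (auto simp: indicator_def cis_cnj mult_ac)
    moreover have "(LINT x|lborel. ?f t x) = indicator {a..<b} t * (LINT x|lborel. indicator {c..<d} x * cis (- (k * x * t)))"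
      by (simp add: mult.assoc)
    ultimately show "?\<kappa> * (LINT \<omega>|lborel. ?f t \<omega>) = indicator {a..<b} t *
       cnj (complex_of_real (sqrt (\<bar>- k\<bar> / (2 * pi))) * (LINT x|lborel. indicator {c..<d} x * cis (- (- k * t * x))))"
      by simp
  qed
  finally show ?thesis .
qed

lemma FT_stepfs_adjoint:
  assumes "k \<noteq> 0" "u \<in> stepfs" "v \<in> stepfs" shows "ip (FT k u) v = ip u (FT (-k) v)"
proof -
  have k': "- k \<noteq> 0" using assms by simp
  show ?thesis
    by (rule FT_stepfs_bilinear[where F="FT k" and G="\<lambda>x. x" and H="\<lambda>x. x" and K="FT (-k)", OF assms(2,3)])
      (auto simp: FT_interval_L2[OF assms(1)] FT_interval_L2[OF k'] FT_zero[OF assms(1)] FT_zero[OF k']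
        FT_lincomb interval_Lr FT_interval_adjoint fun_eq_iff)
qed

lemma cis_lebesgue [measurable]: "f \<in> borel_measurable M \<Longrightarrow> (\<lambda>x. cis (f x)) \<in> borel_measurable M"
  by (rule measurable_compose[OF _ cis_measurable])

text \<open>On step functions the transform is isometric by Parseval. For f in L^1 and L^2,
  approximation in L^1 gives pointwise convergence of the transforms, and Fatou's lemma transfers
  the L^2 bound. Isometry of the extension comes later, from \<open>ip_FF\<close>.\<close>

lemma FT_lbd:
  assumes k: "k \<noteq> 0" shows "lbd 2 (Lr 1 \<inter> Lr 2) (FT k) 1"
proof -
  have main: "FT k f \<in> Lr 2 \<and> Lr_norm 2 (FT k f) \<le> Lr_norm 2 f" if f: "f \<in> Lr 1" "f \<in> Lr 2" for f
  proof -
    obtain u where u: "\<And>n. u n \<in> stepfs" "(\<lambda>n. Lr_norm 1 (\<lambda>x. u n x - f x)) \<longlonglongrightarrow> 0"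
      "(\<lambda>n. Lr_norm 2 (\<lambda>x. u n x - f x)) \<longlonglongrightarrow> 0"
      by (rule stepfs_dense[OF f]) auto
    have u1: "u n \<in> Lr r" for n r by (rule stepfs_Lr[OF u(1)])
    have lim: "(\<lambda>n. FT k (u n) \<omega>) \<longlonglongrightarrow> FT k f \<omega>" for \<omega>
    proof -
      have "(\<lambda>n. ennreal (cmod (FT k (u n) \<omega> - FT k f \<omega>))) \<longlonglongrightarrow> 0"
      proof (rule ennreal_tendsto_0_le)
        fix n
        have "FT k (u n) \<omega> - FT k f \<omega> = FT k (\<lambda>x. u n x + (-1) * f x) \<omega>"
          using FT_lincomb[OF u1 f(1), where a="-1"] by simp
        then show "ennreal (cmod (FT k (u n) \<omega> - FT k f \<omega>)) \<le> ennreal (sqrt (\<bar>k\<bar> / (2 * pi))) * Lr_norm 1 (\<lambda>x. u n x - f x)"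
          using FT_bound[of "\<lambda>x. u n x + (-1) * f x" k \<omega>] Lr_lincomb[OF u1 f(1), where a="-1"] by simp
        show "(\<lambda>n. ennreal (sqrt (\<bar>k\<bar> / (2 * pi))) * Lr_norm 1 (\<lambda>x. u n x - f x)) \<longlonglongrightarrow> 0"
          using ennreal_tendsto_cmult[OF _ u(2), of "ennreal (sqrt (\<bar>k\<bar> / (2 * pi)))"] by simp
      qed
      then have "(\<lambda>n. ennreal (cmod (FT k (u n) \<omega> - FT k f \<omega>))) \<longlonglongrightarrow> ennreal 0" by simp
      then have "(\<lambda>n. cmod (FT k (u n) \<omega> - FT k f \<omega>)) \<longlonglongrightarrow> 0" by (subst (asm) tendsto_ennreal_iff) auto
      then show ?thesis by (simp add: LIM_zero_iff tendsto_norm_zero_iff)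
    qed
    have Fu: "FT k (u n) \<in> Lr 2" for n by (rule FT_stepfs_L2[OF k u(1)])
    then have Fum: "FT k (u n) \<in> borel_measurable lebesgue" for n by (rule Lr_measurable)
    have Fm: "FT k f \<in> borel_measurable lebesgue"
      by (rule borel_measurable_LIMSEQ_metric[OF Fum lim])
    have iso: "Lr_norm 2 (FT k (u n)) = Lr_norm 2 (u n)" for n
      using ip_self(2)[OF Fu] ip_self(2)[OF u1] FT_stepfs_parseval[OF k u(1) u(1)] by (simp add: Lr_norm_En)
    have le: "Lr_norm 2 (FT k f) \<le> Lr_norm 2 f"
    proof (rule ennreal_le_epsilon)
      fix e :: real assume e: "0 < e"
      have "eventually (\<lambda>n. Lr_norm 2 (\<lambda>x. u n x - f x) < ennreal e) sequentially"
        by (rule order_tendstoD[OF u(3)]) (use e in simp)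
      then obtain N where N: "\<And>n. n \<ge> N \<Longrightarrow> Lr_norm 2 (\<lambda>x. u n x - f x) < ennreal e" by (auto simp: eventually_sequentially)
      show "Lr_norm 2 (FT k f) \<le> Lr_norm 2 f + ennreal e"
      proof (rule Fatou_Lr_norm[where u="\<lambda>n. FT k (u (n + N))"])
        show "AE x in lebesgue. (\<lambda>n. FT k (u (n + N)) x) \<longlonglongrightarrow> FT k f x"
          by (intro AE_I2 LIMSEQ_ignore_initial_segment lim)
        show "Lr_norm 2 (FT k (u (n + N))) \<le> Lr_norm 2 f + ennreal e" for n
          unfolding iso using Lr_norm_le_diff[OF Lr_measurable[OF u1] Lr_measurable[OF f(2)], of 2 "n + N"] N[of "n + N"]
          by (meson add_left_mono le_add2 less_imp_le one_le_numeral order_trans)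
      qed (use Fum in auto)
    qed
    also have "\<dots> < \<top>" using f by (simp add: Lr_def)
    finally show ?thesis using le Fm by (simp add: Lr_def)
  qed
  show ?thesis
    unfolding lbd_def
  proof (intro conjI ballI allI AE_I2)
    fix u v :: "real \<Rightarrow> complex" and a x assume uv: "u \<in> Lr 1 \<inter> Lr 2" "v \<in> Lr 1 \<inter> Lr 2"
    show "(\<lambda>x. u x + a * v x) \<in> Lr 1 \<inter> Lr 2" using uv by (simp add: Lr_lincomb)
    show "FT k (\<lambda>x. u x + a * v x) x = FT k u x + a * FT k v x" using uv by (simp add: FT_lincomb)
  qed (use main in simp_all)
qed

lemma Lr_dense_2: "Lr_dense 2 (Lr 1 \<inter> Lr 2)"
  unfolding Lr_dense_def
proof
  fix f :: "real \<Rightarrow> complex" assume f: "f \<in> Lr 2"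
  show "\<exists>u. (\<forall>n. u n \<in> Lr 1 \<inter> Lr 2) \<and> (\<lambda>n. Lr_norm 2 (\<lambda>x. u n x - f x)) \<longlonglongrightarrow> 0"
    by (rule stepfs_dense[OF f f]) (use stepfs_Lr in auto)
qed

definition FF :: "real \<Rightarrow> (real \<Rightarrow> complex) \<Rightarrow> real \<Rightarrow> complex"
  where "FF k = continuous_ext 2 (Lr 1 \<inter> Lr 2) (FT k)"

context
  fixes k :: real
  assumes k: "k \<noteq> 0"
begin

lemma FF_lbd: "lbd 2 (Lr 2) (FF k) 1"
  unfolding FF_def by (rule continuous_ext_lbd[OF FT_lbd[OF k] Lr_dense_2]) simp

lemma FF_L2: "f \<in> Lr 2 \<Longrightarrow> FF k f \<in> Lr 2"
  by (rule lbdD(4)[OF FF_lbd])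

lemma FF_eq_FT: "f \<in> Lr 1 \<Longrightarrow> f \<in> Lr 2 \<Longrightarrow> AE x in lebesgue. FF k f x = FT k f x"
  unfolding FF_def by (rule continuous_ext_eq[OF FT_lbd[OF k] Lr_dense_2]) auto

end

text \<open>Both sides are continuous in L^2, so Parseval's identity extends from step
  functions.\<close>

lemma ip_FF:
  assumes k: "k \<noteq> 0" and f: "f \<in> Lr 2" and g: "g \<in> Lr 2" shows "ip (FF k f) (FF k g) = ip f g"
proof -
  obtain u where u: "\<And>n. u n \<in> stepfs" "(\<lambda>n. Lr_norm 2 (\<lambda>x. u n x - f x)) \<longlonglongrightarrow> 0"
    by (rule stepfs_dense[OF f f]) auto
  obtain v where v: "\<And>n. v n \<in> stepfs" "(\<lambda>n. Lr_norm 2 (\<lambda>x. v n x - g x)) \<longlonglongrightarrow> 0"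
    by (rule stepfs_dense[OF g g]) auto
  have L: "u n \<in> Lr r" "v n \<in> Lr r" for n r using u v by (auto intro: stepfs_Lr)
  have eq: "ip (FF k (u n)) (FF k (v n)) = ip (u n) (v n)" for n
  proof -
    have "ip (FF k (u n)) (FF k (v n)) = ip (FT k (u n)) (FT k (v n))"
      by (intro ip_cong_AE FF_eq_FT k L Lr_measurable[OF FF_L2] Lr_measurable[OF FT_stepfs_L2] u v)
    then show ?thesis using FT_stepfs_parseval[OF k u(1) v(1)] by simp
  qed
  have "(\<lambda>n. ip (FF k (u n)) (FF k (v n))) \<longlonglongrightarrow> ip (FF k f) (FF k g)"
    by (rule ip_tendsto[where p=2 and q=2])
      (auto intro!: FF_L2 k L f g lbd_tendsto[OF FF_lbd[OF k]] u v)
  moreover have "(\<lambda>n. ip (u n) (v n)) \<longlonglongrightarrow> ip f g"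
    by (rule ip_tendsto[where p=2 and q=2]) (auto intro!: L f g u v)
  ultimately show ?thesis unfolding eq by (rule LIMSEQ_unique)
qed

lemma ip_FF_adjoint:
  assumes k: "k \<noteq> 0" and f: "f \<in> Lr 2" and g: "g \<in> Lr 2" shows "ip (FF k f) g = ip f (FF (-k) g)"
proof -
  have k': "- k \<noteq> 0" using k by simp
  obtain u where u: "\<And>n. u n \<in> stepfs" "(\<lambda>n. Lr_norm 2 (\<lambda>x. u n x - f x)) \<longlonglongrightarrow> 0"
    by (rule stepfs_dense[OF f f]) auto
  obtain v where v: "\<And>n. v n \<in> stepfs" "(\<lambda>n. Lr_norm 2 (\<lambda>x. v n x - g x)) \<longlonglongrightarrow> 0"
    by (rule stepfs_dense[OF g g]) auto
  have L: "u n \<in> Lr r" "v n \<in> Lr r" for n r using u v by (auto intro: stepfs_Lr)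
  have eq: "ip (FF k (u n)) (v n) = ip (u n) (FF (-k) (v n))" for n
  proof -
    have "ip (FF k (u n)) (v n) = ip (FT k (u n)) (v n)"
      by (intro ip_cong_AE FF_eq_FT k L Lr_measurable[OF FF_L2] Lr_measurable[OF FT_stepfs_L2] Lr_measurable[OF L(2)] AE_I2 refl u v)
    also have "\<dots> = ip (u n) (FT (-k) (v n))" by (rule FT_stepfs_adjoint[OF k u(1) v(1)])
    also have "\<dots> = ip (u n) (FF (-k) (v n))"
      by (rule sym, intro ip_cong_AE FF_eq_FT k' L Lr_measurable[OF FF_L2] Lr_measurable[OF FT_stepfs_L2] Lr_measurable[OF L(1)] AE_I2 refl u v)
    finally show ?thesis .
  qed
  have "(\<lambda>n. ip (FF k (u n)) (v n)) \<longlonglongrightarrow> ip (FF k f) g"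
    by (rule ip_tendsto[where p=2 and q=2])
      (auto intro!: FF_L2 k L f g lbd_tendsto[OF FF_lbd[OF k]] u v)
  moreover have "(\<lambda>n. ip (u n) (FF (-k) (v n))) \<longlonglongrightarrow> ip f (FF (-k) g)"
    by (rule ip_tendsto[where p=2 and q=2]) (use k in \<open>auto intro!: FF_L2 L f g u v lbd_tendsto[OF FF_lbd[OF k']]\<close>)
  ultimately show ?thesis unfolding eq by (rule LIMSEQ_unique)
qed

lemma L2_eq_AE_if_ip:
  assumes f: "f \<in> Lr 2" and g: "g \<in> Lr 2" and eq: "\<And>h. h \<in> Lr 2 \<Longrightarrow> ip f h = ip g h"
  shows "AE x in lebesgue. f x = g x"
proof -
  let ?d = "\<lambda>x. f x + (-1) * g x"
  have d: "?d \<in> Lr 2" by (intro Lr_lincomb f g) simp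
  have "ip ?d ?d = 0" using ip2_lincomb[OF f g d, of "-1"] eq[OF d] by simp
  then have "En 2 ?d = 0" using ip_self(2)[OF d] by simp
  then have "AE x in lebesgue. ?d x = 0" using d by (intro Lr_norm_eq_0_AE[of _ 2]) (auto simp: Lr_def Lr_norm_En)
  then show ?thesis by simp
qed

text \<open>An isometry followed by its adjoint is the identity, and the adjoint of
  \<open>FF k\<close> is \<open>FF (-k)\<close>. Read with -k in place of k this is
  surjectivity.\<close>

lemma FF_inverse:
  assumes k: "k \<noteq> 0" and f: "f \<in> Lr 2" shows "AE x in lebesgue. FF (-k) (FF k f) x = f x"
proof (rule L2_eq_AE_if_ip)
  have k': "- k \<noteq> 0" using k by simp
  show "FF (-k) (FF k f) \<in> Lr 2" by (intro FF_L2 k k' f)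
  show "ip (FF (-k) (FF k f)) h = ip f h" if "h \<in> Lr 2" for h
    using ip_FF_adjoint[OF k' FF_L2[OF k f] that] ip_FF[OF k f that] by simp
qed (rule f)

lemma FF_inverse':
  assumes k: "k \<noteq> 0" and f: "f \<in> Lr 2" shows "AE x in lebesgue. FF k (FF (-k) f) x = f x"
  using FF_inverse[of "-k" f] assms by simp

section \<open>Fourier multipliers\<close>

text \<open>The bound holds everywhere rather than almost everywhere and is carried as a parameter,
  since uniformity over families of multipliers matters.\<close>

definition bm :: "real \<Rightarrow> (real \<Rightarrow> complex) \<Rightarrow> bool"
  where "bm B m \<longleftrightarrow> m \<in> borel_measurable lebesgue \<and> (\<forall>x. cmod (m x) \<le> B)"

definition mult :: "real \<Rightarrow> (real \<Rightarrow> complex) \<Rightarrow> (real \<Rightarrow> complex) \<Rightarrow> real \<Rightarrow> complex"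
  where "mult k m f = FF (-k) (\<lambda>\<omega>. m \<omega> * FF k f \<omega>)"

lemma bm_L2: "bm B m \<Longrightarrow> f \<in> Lr 2 \<Longrightarrow> (\<lambda>x. m x * f x) \<in> Lr 2"
  by (rule Lr_mult_bounded(1)[of m B]) (auto simp: bm_def)

lemma bm_mult: "bm B m \<Longrightarrow> bm C n \<Longrightarrow> bm (B * C) (\<lambda>x. m x * n x)"
  unfolding bm_def norm_mult by (auto intro!: mult_mono order_trans[OF norm_ge_zero])

lemma bm_cnj: "bm B m \<Longrightarrow> bm B (\<lambda>x. cnj (m x))"
  by (auto simp: bm_def)

lemma bm_nonneg: "bm B m \<Longrightarrow> 0 \<le> B"
  unfolding bm_def by (meson norm_ge_zero order_trans)

lemma bm_lincomb: "bm B m \<Longrightarrow> bm C n \<Longrightarrow> bm (B + cmod a * C) (\<lambda>x. m x + a * n x)"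
  unfolding bm_def by (auto intro!: norm_triangle_le add_mono mult_left_mono simp: norm_mult)

context
  fixes k :: real
  assumes k: "k \<noteq> 0"
begin

lemma k': "- k \<noteq> 0" using k by simp

lemma mult_L2: "bm B m \<Longrightarrow> f \<in> Lr 2 \<Longrightarrow> mult k m f \<in> Lr 2"
  unfolding mult_def by (intro FF_L2 k' bm_L2 k)

lemma mult_lbd:
  assumes m: "bm B m" shows "lbd 2 (Lr 2) (mult k m) B"
  unfolding lbd_def
proof (intro conjI ballI allI)
  fix f assume f: "f \<in> Lr 2"
  show "f \<in> Lr 2" "mult k m f \<in> Lr 2" by (auto intro: f mult_L2 m)
  have "Lr_norm 2 (mult k m f) \<le> ennreal 1 * Lr_norm 2 (\<lambda>\<omega>. m \<omega> * FF k f \<omega>)"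
    unfolding mult_def by (intro lbdD(5)[OF FF_lbd] k' bm_L2[OF m] FF_L2 k f)
  also have "\<dots> \<le> ennreal B * Lr_norm 2 (FF k f)"
    using Lr_mult_bounded(2)[of m B "FF k f" 2] m FF_L2[OF k f] by (simp add: bm_def)
  also have "\<dots> \<le> ennreal B * (ennreal 1 * Lr_norm 2 f)"
    by (intro mult_left_mono lbdD(5)[OF FF_lbd] k f) simp
  finally show "Lr_norm 2 (mult k m f) \<le> ennreal B * Lr_norm 2 f" by simp
  fix g a assume g: "g \<in> Lr 2"
  show fg: "(\<lambda>x. f x + a * g x) \<in> Lr 2" by (intro Lr_lincomb f g) simp
  have mf: "(\<lambda>\<omega>. m \<omega> * FF k f \<omega>) \<in> Lr 2" "(\<lambda>\<omega>. m \<omega> * FF k g \<omega>) \<in> Lr 2"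
    by (intro bm_L2[OF m] FF_L2 k f g)+
  have "AE \<omega> in lebesgue. m \<omega> * FF k (\<lambda>x. f x + a * g x) \<omega> = m \<omega> * FF k f \<omega> + a * (m \<omega> * FF k g \<omega>)"
    using lbdD(2)[OF FF_lbd[OF k] f g, of a] by eventually_elim (simp add: algebra_simps)
  then have "AE x in lebesgue. mult k m (\<lambda>x. f x + a * g x) x = FF (-k) (\<lambda>\<omega>. m \<omega> * FF k f \<omega> + a * (m \<omega> * FF k g \<omega>)) x"
    unfolding mult_def
    by (rule lbd_cong_AE[OF FF_lbd[OF k'], rotated 3]) (auto intro!: bm_L2[OF m] FF_L2 k fg Lr_lincomb mf)
  with lbdD(2)[OF FF_lbd[OF k'] mf, of a]
  show "AE x in lebesgue. mult k m (\<lambda>x. f x + a * g x) x = mult k m f x + a * mult k m g x"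
    unfolding mult_def by eventually_elim simp
qed

lemma FF_mult: "bm B m \<Longrightarrow> f \<in> Lr 2 \<Longrightarrow> AE \<omega> in lebesgue. FF k (mult k m f) \<omega> = m \<omega> * FF k f \<omega>"
  unfolding mult_def by (intro FF_inverse' k bm_L2 FF_L2)

text \<open>Injectivity of the transform lets an L^2 function be recognised as a multiplier image
  from its frequency side. The operators S_j, given only by such an equation, are identified in this
  way.\<close>

lemma mult_eqI:
  assumes m: "bm B m" and f: "f \<in> Lr 2" and h: "h \<in> Lr 2" and eq: "AE \<omega> in lebesgue. FF k h \<omega> = m \<omega> * FF k f \<omega>"
  shows "AE x in lebesgue. h x = mult k m f x"
proof -
  have "AE x in lebesgue. FF (-k) (FF k h) x = mult k m f x"
    unfolding mult_def by (rule lbd_cong_AE[OF FF_lbd[OF k'] _ _ _ eq]) (auto intro!: FF_L2 k h bm_L2[OF m] f)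
  with FF_inverse[OF k h] show ?thesis by eventually_elim simp
qed

lemma mult_comp:
  assumes m: "bm B m" and n: "bm C n" and f: "f \<in> Lr 2"
  shows "AE x in lebesgue. mult k m (mult k n f) x = mult k (\<lambda>\<omega>. m \<omega> * n \<omega>) f x"
proof (rule mult_eqI[OF bm_mult[OF m n] f])
  show "mult k m (mult k n f) \<in> Lr 2" by (intro mult_L2[OF m] mult_L2[OF n] f)
  show "AE \<omega> in lebesgue. FF k (mult k m (mult k n f)) \<omega> = m \<omega> * n \<omega> * FF k f \<omega>"
    using FF_mult[OF m mult_L2[OF n f]] FF_mult[OF n f] by eventually_elim simp
qed

lemma mult_lincomb:
  assumes m: "bm B m" and n: "bm C n" and f: "f \<in> Lr 2"
  shows "AE x in lebesgue. mult k (\<lambda>\<omega>. m \<omega> + a * n \<omega>) f x = mult k m f x + a * mult k n f x"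
proof -
  have "(\<lambda>x. mult k m f x + a * mult k n f x) \<in> Lr 2" by (intro Lr_lincomb mult_L2[OF m] mult_L2[OF n] f) simp
  moreover have "AE \<omega> in lebesgue. FF k (\<lambda>x. mult k m f x + a * mult k n f x) \<omega> = (m \<omega> + a * n \<omega>) * FF k f \<omega>"
    using FF_mult[OF m f] FF_mult[OF n f] lbdD(2)[OF FF_lbd[OF k] mult_L2[OF m f] mult_L2[OF n f], of a]
    by eventually_elim (simp add: algebra_simps)
  ultimately have "AE x in lebesgue. mult k m f x + a * mult k n f x = mult k (\<lambda>\<omega>. m \<omega> + a * n \<omega>) f x"
    by (rule mult_eqI[OF bm_lincomb[OF m n] f])
  then show ?thesis by eventually_elim simp
qed

lemma mult_zero: "f \<in> Lr 2 \<Longrightarrow> AE x in lebesgue. mult k (\<lambda>\<omega>. 0) f x = 0"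
  using mult_lincomb[of 0 "\<lambda>\<omega>. 0" 0 "\<lambda>\<omega>. 0" f 1] by (simp add: bm_def)

lemma bm_sum: "finite J \<Longrightarrow> (\<And>j. j \<in> J \<Longrightarrow> \<exists>B. bm B (m j)) \<Longrightarrow> \<exists>B. bm B (\<lambda>\<omega>. \<Sum>j\<in>J. a j * m j \<omega>)"
proof (induction J rule: finite_induct)
  case empty then show ?case by (auto simp: bm_def)
next
  case (insert i J)
  then obtain B C where "bm B (\<lambda>\<omega>. \<Sum>j\<in>J. a j * m j \<omega>)" "bm C (m i)" by blast
  from bm_lincomb[OF this, of "a i"] insert show ?case by (auto simp: add.commute)
qed

lemma mult_sum:
  assumes "finite J" "\<And>j. j \<in> J \<Longrightarrow> \<exists>B. bm B (m j)" and f: "f \<in> Lr 2"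
  shows "AE x in lebesgue. mult k (\<lambda>\<omega>. \<Sum>j\<in>J. a j * m j \<omega>) f x = (\<Sum>j\<in>J. a j * mult k (m j) f x)"
  using assms(1,2)
proof (induction J rule: finite_induct)
  case empty then show ?case using mult_zero[OF f] by simp
next
  case (insert i J)
  then obtain C where C: "bm C (m i)" by blast
  from bm_sum[of J m a] insert obtain B where B: "bm B (\<lambda>\<omega>. \<Sum>j\<in>J. a j * m j \<omega>)" by blast
  from insert.IH insert.prems mult_lincomb[OF B C f, of "a i"] insert(1,2) 
  show ?case by (auto simp: add.commute elim!: eventually_elim2)
qed

lemma mult_adjoint:
  assumes m: "bm B m" and f: "f \<in> Lr 2" and g: "g \<in> Lr 2"
  shows "ip (mult k m f) g = ip f (mult k (\<lambda>x. cnj (m x)) g)"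
proof -
  have "ip (mult k m f) g = ip (\<lambda>\<omega>. m \<omega> * FF k f \<omega>) (FF k g)"
    unfolding mult_def using ip_FF_adjoint[OF k' bm_L2[OF m FF_L2[OF k f]] g] by simp
  also have "\<dots> = ip (FF k f) (\<lambda>\<omega>. cnj (m \<omega>) * FF k g \<omega>)"
    by (simp add: ip_def mult_ac)
  also have "\<dots> = ip f (mult k (\<lambda>x. cnj (m x)) g)"
    unfolding mult_def using ip_FF_adjoint[OF k f bm_L2[OF bm_cnj[OF m] FF_L2[OF k g]]] by simp
  finally show ?thesis .
qed

text \<open>Dominated convergence on the frequency side, with majorant 2B times the transform of
  f.\<close>

lemma mult_tendsto:
  assumes m: "\<And>n. bm B (m n)" "bm B m0" and lim: "AE \<omega> in lebesgue. (\<lambda>n. m n \<omega>) \<longlonglongrightarrow> m0 \<omega>" and f: "f \<in> Lr 2"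
  shows "(\<lambda>n. Lr_norm 2 (\<lambda>x. mult k (m n) f x - mult k m0 f x)) \<longlonglongrightarrow> 0"
  unfolding mult_def
proof (rule lbd_tendsto[OF FF_lbd[OF k'] bm_L2[OF m(1) FF_L2[OF k f]] bm_L2[OF m(2) FF_L2[OF k f]]])
  have [measurable]: "FF k f \<in> borel_measurable lebesgue" "m n \<in> borel_measurable lebesgue" "m0 \<in> borel_measurable lebesgue" for n
    using FF_L2[OF k f] m by (auto simp: Lr_def bm_def)
  have B: "0 \<le> B" by (rule bm_nonneg[OF m(2)])
  show "(\<lambda>n. Lr_norm 2 (\<lambda>x. m n x * FF k f x - m0 x * FF k f x)) \<longlonglongrightarrow> 0"
  proof (rule dominated_Lr_norm[where g="\<lambda>x. of_real (2 * B) * FF k f x"])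
    show "AE x in lebesgue. (\<lambda>n. m n x * FF k f x - m0 x * FF k f x) \<longlonglongrightarrow> 0"
      using lim by eventually_elim (simp add: LIM_zero_iff tendsto_mult_right)
    show "AE x in lebesgue. cmod (m n x * FF k f x - m0 x * FF k f x) \<le> cmod (of_real (2 * B) * FF k f x)" for n
    proof (rule AE_I2)
      fix x
      have "cmod (m n x - m0 x) \<le> 2 * B"
        using m norm_triangle_ineq4[of "m n x" "m0 x"] by (smt (verit) bm_def)
      then show "cmod (m n x * FF k f x - m0 x * FF k f x) \<le> cmod (of_real (2 * B) * FF k f x)"
        unfolding left_diff_distrib[symmetric] norm_mult using B by (intro mult_right_mono) auto
    qed
    show "(\<lambda>x. of_real (2 * B) * FF k f x) \<in> Lr 2" by (intro Lr_cmult FF_L2 k f) simp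
  qed auto
qed

end

section \<open>Translations, and multipliers bounded on L^p\<close>

lemma lebesgue_translation_measurable [measurable]: "(\<lambda>x. t + x) \<in> (lebesgue :: real measure) \<rightarrow>\<^sub>M lebesgue"
  using lebesgue_affine_measurable[of "\<lambda>_::real. 1" t] by simp

lemma AE_lebesgue_translation:
  assumes "AE x in (lebesgue :: real measure). P x" shows "AE x in lebesgue. P (t + x)"
proof -
  have "lebesgue = distr lebesgue lebesgue (\<lambda>x::real. t + x)"
    using lebesgue_real_affine[of 1 t] by (simp add: density_1)
  from subst[of _ _ "\<lambda>M. AE x in M. P x", OF this assms]
  have "AE x in distr lebesgue lebesgue (\<lambda>x::real. t + x). P x" .
  then show ?thesis by (rule AE_distrD[rotated]) measurable
qed

lemma Lr_norm_translation:
  assumes "f \<in> borel_measurable lebesgue" shows "Lr_norm p (\<lambda>x. f (t + x)) = Lr_norm p f"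
proof -
  have "(\<lambda>x. ennreal (cmod (f x) powr p)) \<in> borel_measurable lebesgue" using assms by measurable
  from nn_integral_real_affine_lebesgue[OF this, of 1 t] show ?thesis by (simp add: Lr_norm_En En_def)
qed

lemma translation_measurable: "f \<in> borel_measurable lebesgue \<Longrightarrow> (\<lambda>x::real. f (t + x)) \<in> borel_measurable lebesgue"
  by (rule measurable_compose[OF lebesgue_translation_measurable])

lemma Fatou_Lr_norm_lim:
  assumes u: "\<And>n. u n \<in> borel_measurable lebesgue"
    and lim: "AE x in lebesgue. (\<lambda>n. u n x) \<longlonglongrightarrow> f x" and p: "0 < p"
    and b: "\<And>n. Lr_norm p (u n) \<le> c + d n" and d: "d \<longlonglongrightarrow> 0"
  shows "Lr_norm p f \<le> c"
proof (rule ennreal_le_epsilon)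
  fix e :: real assume e: "0 < e"
  have "eventually (\<lambda>n. d n < ennreal e) sequentially"
    by (rule order_tendstoD[OF d]) (use e in simp)
  then obtain N where N: "\<And>n. n \<ge> N \<Longrightarrow> d n < ennreal e" by (auto simp: eventually_sequentially)
  show "Lr_norm p f \<le> c + ennreal e"
  proof (rule Fatou_Lr_norm[where u="\<lambda>n. u (n + N)"])
    show "AE x in lebesgue. (\<lambda>n. u (n + N) x) \<longlonglongrightarrow> f x"
      using lim by eventually_elim (rule LIMSEQ_ignore_initial_segment)
    show "Lr_norm p (u (n + N)) \<le> c + ennreal e" for n
      using b[of "n + N"] N[of "n + N"] by (meson add_left_mono le_add2 less_imp_le order_trans)
  qed (use u p in auto)
qed

text \<open>\<open>mult\<close> is an operator on L^2, so an L^p bound is stated on the intersection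
  of L^2 and L^p.\<close>

definition Lmult :: "real \<Rightarrow> real \<Rightarrow> (real \<Rightarrow> complex) \<Rightarrow> real \<Rightarrow> bool"
  where "Lmult k p m C \<longleftrightarrow> (\<forall>f. f \<in> Lr 2 \<longrightarrow> f \<in> Lr p \<longrightarrow> Lr_norm p (mult k m f) \<le> ennreal C * Lr_norm p f)"

lemma LmultD: "Lmult k p m C \<Longrightarrow> f \<in> Lr 2 \<Longrightarrow> f \<in> Lr p \<Longrightarrow> Lr_norm p (mult k m f) \<le> ennreal C * Lr_norm p f"
  by (simp add: Lmult_def)

context
  fixes k :: real
  assumes k: "k \<noteq> 0"
begin

lemma Lmult_Lr: "Lmult k p m C \<Longrightarrow> bm B m \<Longrightarrow> f \<in> Lr 2 \<Longrightarrow> f \<in> Lr p \<Longrightarrow> mult k m f \<in> Lr p"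
  using LmultD[of k p m C f] mult_L2[OF k, of B m f]
  by (auto simp: Lr_def ennreal_mult_less_top elim!: le_less_trans)

text \<open>Step functions approximate f in L^2 and L^p simultaneously. Their images converge in
  L^2, hence almost everywhere along a subsequence, and Fatou's lemma gives the L^p bound for the
  limit.\<close>

lemma Lmult_stepfsI:
  assumes m: "bm B m" and p: "1 \<le> p"
    and le: "\<And>u. u \<in> stepfs \<Longrightarrow> Lr_norm p (mult k m u) \<le> ennreal C * Lr_norm p u"
  shows "Lmult k p m C"
  unfolding Lmult_def
proof (intro allI impI)
  fix f assume f: "f \<in> Lr 2" "f \<in> Lr p"
  obtain u where u: "\<And>n. u n \<in> stepfs" "(\<lambda>n. Lr_norm 2 (\<lambda>x. u n x - f x)) \<longlonglongrightarrow> 0"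
      "(\<lambda>n. Lr_norm p (\<lambda>x. u n x - f x)) \<longlonglongrightarrow> 0"
    by (rule stepfs_dense[OF f]) (use p in auto)
  have uL: "u n \<in> Lr r" for n r by (rule stepfs_Lr[OF u(1)])
  have meas: "mult k m (u n) \<in> borel_measurable lebesgue" "mult k m f \<in> borel_measurable lebesgue" for n
    by (intro Lr_measurable[OF mult_L2[OF k m]] uL f)+
  have "(\<lambda>n. Lr_norm 2 (\<lambda>x. mult k m (u n) x - mult k m f x)) \<longlonglongrightarrow> 0"
    by (rule lbd_tendsto[OF mult_lbd[OF k m] uL f(1) u(2)])
  from Lr_tendsto_AE_subseq[OF meas this] obtain s :: "nat \<Rightarrow> nat" where s: "strict_mono s"
    "AE x in lebesgue. (\<lambda>n. mult k m (u (s n)) x) \<longlonglongrightarrow> mult k m f x" by auto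
  show "Lr_norm p (mult k m f) \<le> ennreal C * Lr_norm p f"
  proof (rule Fatou_Lr_norm_lim[where u="\<lambda>n. mult k m (u (s n))", OF meas(1) s(2)])
    fix n
    have "Lr_norm p (mult k m (u (s n))) \<le> ennreal C * Lr_norm p (u (s n))" by (rule le[OF u(1)])
    also have "\<dots> \<le> ennreal C * (Lr_norm p f + Lr_norm p (\<lambda>x. u (s n) x - f x))"
      by (intro mult_left_mono Lr_norm_le_diff Lr_measurable[OF uL] Lr_measurable[OF f(1)] p) simp
    finally show "Lr_norm p (mult k m (u (s n))) \<le> ennreal C * Lr_norm p f + ennreal C * Lr_norm p (\<lambda>x. u (s n) x - f x)"
      by (simp add: distrib_left)
  next
    have "(\<lambda>n. Lr_norm p (\<lambda>x. u (s n) x - f x)) \<longlonglongrightarrow> 0" using LIMSEQ_subseq_LIMSEQ[OF u(3) s(1)] by (simp add: o_def)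
    from ennreal_tendsto_cmult[OF _ this, of "ennreal C"]
    show "(\<lambda>n. ennreal C * Lr_norm p (\<lambda>x. u (s n) x - f x)) \<longlonglongrightarrow> 0" by simp
  qed (use p in simp)
qed

text \<open>A constant common to all \<open>m n\<close> survives the limit: the images converge in
  L^2, hence almost everywhere along a subsequence, and Fatou's lemma applies. This is how
  regularised symbols are removed.\<close>

lemma Lmult_limit:
  assumes m: "\<And>n. bm B (m n)" "bm B m0" and lim: "AE \<omega> in lebesgue. (\<lambda>n. m n \<omega>) \<longlonglongrightarrow> m0 \<omega>"
    and L: "\<And>n. Lmult k p (m n) C" and p: "1 \<le> p"
  shows "Lmult k p m0 C"
  unfolding Lmult_def
proof (intro allI impI)
  fix f assume f: "f \<in> Lr 2" "f \<in> Lr p"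
  have meas: "mult k (m n) f \<in> borel_measurable lebesgue" "mult k m0 f \<in> borel_measurable lebesgue" for n
    by (intro Lr_measurable[OF mult_L2[OF k m(1)]] Lr_measurable[OF mult_L2[OF k m(2)]] f)+
  from Lr_tendsto_AE_subseq[OF meas mult_tendsto[OF k m lim f(1)]] obtain s :: "nat \<Rightarrow> nat" where s: "strict_mono s"
    "AE x in lebesgue. (\<lambda>n. mult k (m (s n)) f x) \<longlonglongrightarrow> mult k m0 f x" by auto
  show "Lr_norm p (mult k m0 f) \<le> ennreal C * Lr_norm p f"
    by (rule Fatou_Lr_norm[where u="\<lambda>n. mult k (m (s n)) f", OF meas(1) s(2)]) (use p LmultD[OF L f] in auto)
qed

text \<open>The adjoint of a multiplier has the conjugate symbol, and an L^q norm is determined by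
  pairings with L^p functions.\<close>

lemma Lmult_dual:
  assumes m: "bm B m" and L: "Lmult k p (\<lambda>x. cnj (m x)) C" and pq: "1 < p" "1 < q" "1 / p + 1 / q = 1"
  shows "Lmult k q m C"
  unfolding Lmult_def
proof (intro allI impI)
  fix f assume f: "f \<in> Lr 2" "f \<in> Lr q"
  show "Lr_norm q (mult k m f) \<le> ennreal C * Lr_norm q f"
  proof (rule Lr_norm_dual[OF Lr_measurable[OF mult_L2[OF k m f(1)]] pq])
    fix g assume g: "\<And>s. 1 \<le> s \<Longrightarrow> g \<in> Lr s"
    have g2: "g \<in> Lr 2" "g \<in> Lr p" using g pq by auto
    have Tg: "mult k (\<lambda>x. cnj (m x)) g \<in> Lr p" by (rule Lmult_Lr[OF L bm_cnj[OF m] g2])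
    have qp: "1 / q + 1 / p = 1" using pq by simp
    have "ip (mult k m f) g = ip f (mult k (\<lambda>x. cnj (m x)) g)" by (rule mult_adjoint[OF k m f(1) g2(1)])
    then have "ennreal (cmod (ip (mult k m f) g)) \<le> Lr_norm q f * Lr_norm p (mult k (\<lambda>x. cnj (m x)) g)"
      using ip_integrable(2)[OF f(2) Tg pq(2,1) qp] by simp
    also have "\<dots> \<le> Lr_norm q f * (ennreal C * Lr_norm p g)"
      by (intro mult_left_mono LmultD[OF L g2]) simp
    finally show "ennreal (cmod (ip (mult k m f) g)) \<le> ennreal C * Lr_norm q f * Lr_norm p g"
      by (simp add: mult_ac)
  qed
qed

section \<open>Modulations\<close>

text \<open>Multiplication by the character of frequency \<open>a\<close>, measured in the unit
  \<open>k\<close>; on the frequency side it is the translation by \<open>a\<close>.\<close>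

definition md :: "real \<Rightarrow> (real \<Rightarrow> complex) \<Rightarrow> real \<Rightarrow> complex"
  where "md a f x = cis (k * a * x) * f x"

lemma cis_lin_measurable [measurable]: "(\<lambda>x. cis (c * x)) \<in> borel_measurable lebesgue"
  by (rule borel_imp_lebesgue) measurable

lemma cmod_md: "cmod (md a f x) = cmod (f x)"
  by (simp add: md_def norm_mult)

lemma md_measurable: "f \<in> borel_measurable lebesgue \<Longrightarrow> md a f \<in> borel_measurable lebesgue"
  unfolding md_def[abs_def] by measurable

lemma Lr_norm_md: "Lr_norm p (md a f) = Lr_norm p f"
  by (intro Lr_norm_cong_AE AE_I2 cmod_md)

lemma md_Lr: "f \<in> Lr p \<Longrightarrow> md a f \<in> Lr p"
  by (simp add: Lr_def Lr_norm_md md_measurable)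

lemma md_diff: "md a f x - md a g x = md a (\<lambda>x. f x - g x) x"
  by (simp add: md_def right_diff_distrib)

lemma FT_md: "FT k (md a f) \<omega> = FT k f (- a + \<omega>)"
proof -
  have "cis (k * a * t) * cis (- (k * \<omega> * t)) = cis (- (k * (- a + \<omega>) * t))" for t
    unfolding cis_mult by (simp add: algebra_simps)
  then have "cis (k * a * t) * f t * cis (- (k * \<omega> * t)) = f t * cis (- (k * (- a + \<omega>) * t))" for t
    by (metis mult.commute mult.left_commute)
  then show ?thesis by (simp only: FT_def md_def)
qed

lemma FF_md:
  assumes f: "f \<in> Lr 2" shows "AE \<omega> in lebesgue. FF k (md a f) \<omega> = FF k f (- a + \<omega>)"
proof -
  obtain u where u: "\<And>n. u n \<in> stepfs" "(\<lambda>n. Lr_norm 2 (\<lambda>x. u n x - f x)) \<longlonglongrightarrow> 0"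
    by (rule stepfs_dense[OF f f]) auto
  have uL: "u n \<in> Lr r" for n r by (rule stepfs_Lr[OF u(1)])
  have eq: "AE \<omega> in lebesgue. FF k (md a (u n)) \<omega> = FF k (u n) (- a + \<omega>)" for n
  proof -
    have "AE \<omega> in lebesgue. FF k (md a (u n)) \<omega> = FT k (md a (u n)) \<omega>"
      by (intro FF_eq_FT k md_Lr uL)
    moreover have "AE \<omega> in lebesgue. FF k (u n) (- a + \<omega>) = FT k (u n) (- a + \<omega>)"
      by (rule AE_lebesgue_translation[OF FF_eq_FT[OF k uL uL]])
    ultimately show ?thesis by eventually_elim (simp add: FT_md)
  qed
  have m: "FF k (md a (u n)) \<in> borel_measurable lebesgue" "FF k (u n) \<in> borel_measurable lebesgue"
     "FF k f \<in> borel_measurable lebesgue"  "FF k (md a f) \<in> borel_measurable lebesgue" for n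
    by (intro Lr_measurable[OF FF_L2] k md_Lr uL f)+
  show ?thesis
  proof (rule Lr_limit_unique[where r=2 and u="\<lambda>n. FF k (md a (u n))"])
    show "(\<lambda>n. Lr_norm 2 (\<lambda>x. FF k (md a (u n)) x - FF k (md a f) x)) \<longlonglongrightarrow> 0"
      by (rule lbd_tendsto[OF FF_lbd[OF k]]) (auto intro!: md_Lr uL f simp: md_diff Lr_norm_md u)
    have "Lr_norm 2 (\<lambda>x. FF k (md a (u n)) x - FF k f (- a + x)) = Lr_norm 2 (\<lambda>x. FF k (u n) x - FF k f x)" for n
    proof -
      have "Lr_norm 2 (\<lambda>x. FF k (md a (u n)) x - FF k f (- a + x)) = Lr_norm 2 (\<lambda>x. FF k (u n) (- a + x) - FF k f (- a + x))"
        using eq[of n] by (intro Lr_norm_cong_AE) (elim eventually_mono, simp)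
      also have "\<dots> = Lr_norm 2 (\<lambda>x. FF k (u n) x - FF k f x)"
        using m by (intro Lr_norm_translation[where f="\<lambda>x. FF k (u n) x - FF k f x"]) auto
      finally show ?thesis .
    qed
    then show "(\<lambda>n. Lr_norm 2 (\<lambda>x. FF k (md a (u n)) x - FF k f (- a + x))) \<longlonglongrightarrow> 0"
      using lbd_tendsto[OF FF_lbd[OF k] uL f u(2)] by simp
  qed (use m translation_measurable[of "FF k f" "-a"] in auto)
qed

text \<open>Translating the symbol amounts to conjugating the operator by modulations, which leave
  absolute values unchanged.\<close>

lemma mult_md:
  assumes m: "bm B m" and f: "f \<in> Lr 2"
  shows "AE x in lebesgue. mult k (\<lambda>\<omega>. m (- a + \<omega>)) f x = md a (mult k m (md (-a) f)) x"
proof -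
  have m': "bm B (\<lambda>\<omega>. m (- a + \<omega>))" using m translation_measurable[of m "-a"] by (auto simp: bm_def)
  have mf: "md (-a) f \<in> Lr 2" by (intro md_Lr f)
  have "AE \<omega> in lebesgue. FF k (md a (mult k m (md (-a) f))) \<omega> = FF k (mult k m (md (-a) f)) (- a + \<omega>)"
    by (intro FF_md mult_L2[OF k m] mf)
  moreover have "AE \<omega> in lebesgue. FF k (mult k m (md (-a) f)) (- a + \<omega>) = m (- a + \<omega>) * FF k (md (-a) f) (- a + \<omega>)"
    by (rule AE_lebesgue_translation[OF FF_mult[OF k m mf]])
  moreover have "AE \<omega> in lebesgue. FF k (md (-a) f) (- a + \<omega>) = FF k f (- (-a) + (- a + \<omega>))"
    by (rule AE_lebesgue_translation[OF FF_md[OF f]])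
  ultimately have "AE \<omega> in lebesgue. FF k (md a (mult k m (md (-a) f))) \<omega> = m (- a + \<omega>) * FF k f \<omega>"
    by eventually_elim simp
  from mult_eqI[OF k m' f md_Lr[OF mult_L2[OF k m mf]] this]
  show ?thesis by eventually_elim simp
qed

end

section \<open>Calderon-Zygmund theory\<close>

text \<open>Everything is discretised: on step functions of mesh \<open>h\<close> an operator is determined by the images \<open>\<kappa> i\<close> of
  the indicators of the mesh intervals, and the Calderon-Zygmund decomposition is a finite bisection
  of intervals of integers.\<close>

definition czfam :: "(int \<Rightarrow> real) \<Rightarrow> real \<Rightarrow> int set \<Rightarrow> (int \<times> int) set \<Rightarrow> bool"
  where "czfam w t I F \<longleftrightarrow> finite F \<and>
    (\<forall>p\<in>F. fst p < snd p \<and> {fst p..<snd p} \<subseteq> I \<and> t * (snd p - fst p) < sum w {fst p..<snd p} \<and>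
      sum w {fst p..<snd p} \<le> 2 * t * (snd p - fst p)) \<and>
    (\<forall>p\<in>F. \<forall>p'\<in>F. p \<noteq> p' \<longrightarrow> {fst p..<snd p} \<inter> {fst p'..<snd p'} = {}) \<and>
    (\<forall>i\<in>I. (\<forall>p\<in>F. i \<notin> {fst p..<snd p}) \<longrightarrow> w i \<le> t)"

lemma czfamD:
  assumes "czfam w t I F"
  shows "finite F" "p \<in> F \<Longrightarrow> fst p < snd p" "p \<in> F \<Longrightarrow> {fst p..<snd p} \<subseteq> I"
    "p \<in> F \<Longrightarrow> t * (snd p - fst p) < sum w {fst p..<snd p}"
    "p \<in> F \<Longrightarrow> sum w {fst p..<snd p} \<le> 2 * t * (snd p - fst p)"
    "p \<in> F \<Longrightarrow> p' \<in> F \<Longrightarrow> p \<noteq> p' \<Longrightarrow> {fst p..<snd p} \<inter> {fst p'..<snd p'} = {}"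
    "i \<in> I \<Longrightarrow> (\<And>p. p \<in> F \<Longrightarrow> i \<notin> {fst p..<snd p}) \<Longrightarrow> w i \<le> t"
proof -
  note * = assms[unfolded czfam_def]
  note 2 = *[THEN conjunct2, THEN conjunct1, rule_format]
  show "finite F" by (rule *[THEN conjunct1])
  show "p \<in> F \<Longrightarrow> fst p < snd p" by (rule 2[THEN conjunct1])
  show "p \<in> F \<Longrightarrow> {fst p..<snd p} \<subseteq> I" by (rule 2[THEN conjunct2, THEN conjunct1])
  show "p \<in> F \<Longrightarrow> t * (snd p - fst p) < sum w {fst p..<snd p}" by (rule 2[THEN conjunct2, THEN conjunct2, THEN conjunct1])
  show "p \<in> F \<Longrightarrow> sum w {fst p..<snd p} \<le> 2 * t * (snd p - fst p)" by (rule 2[THEN conjunct2, THEN conjunct2, THEN conjunct2])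
  show "p \<in> F \<Longrightarrow> p' \<in> F \<Longrightarrow> p \<noteq> p' \<Longrightarrow> {fst p..<snd p} \<inter> {fst p'..<snd p'} = {}"
    by (rule *[THEN conjunct2, THEN conjunct2, THEN conjunct1, rule_format])
  show "i \<in> I \<Longrightarrow> (\<And>p. p \<in> F \<Longrightarrow> i \<notin> {fst p..<snd p}) \<Longrightarrow> w i \<le> t"
    by (rule *[THEN conjunct2, THEN conjunct2, THEN conjunct2, rule_format])
qed

lemma czfam_Un:
  assumes F: "czfam w t I F" and G: "czfam w t J G" and IJ: "I \<inter> J = {}" shows "czfam w t (I \<union> J) (F \<union> G)"
proof -
  have d: "{fst p..<snd p} \<inter> {fst p'..<snd p'} = {}" if "p \<in> F" "p' \<in> G" for p p'
    using Int_mono[OF czfamD(3)[OF F that(1)] czfamD(3)[OF G that(2)]] IJ by simp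
  show ?thesis
    unfolding czfam_def
  proof (intro conjI ballI impI)
    show "finite (F \<union> G)" using czfamD(1)[OF F] czfamD(1)[OF G] by simp
  next
    fix p assume p: "p \<in> F \<union> G"
    show "fst p < snd p" using p czfamD(2)[OF F] czfamD(2)[OF G] by (elim UnE)
    show "{fst p..<snd p} \<subseteq> I \<union> J" using p
      by (elim UnE) (rule le_supI1[OF czfamD(3)[OF F]] le_supI2[OF czfamD(3)[OF G]], assumption)+
    show "t * (snd p - fst p) < sum w {fst p..<snd p}" using p czfamD(4)[OF F] czfamD(4)[OF G] by (elim UnE)
    show "sum w {fst p..<snd p} \<le> 2 * t * (snd p - fst p)" using p czfamD(5)[OF F] czfamD(5)[OF G] by (elim UnE)
  next
    fix p p' assume p: "p \<in> F \<union> G" "p' \<in> F \<union> G" "p \<noteq> p'"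
    then show "{fst p..<snd p} \<inter> {fst p'..<snd p'} = {}"
      using d[of p p'] d[of p' p] czfamD(6)[OF F, of p p'] czfamD(6)[OF G, of p p']
      by (metis UnE Int_commute)
  next
    fix i assume i: "i \<in> I \<union> J" "\<forall>p\<in>F \<union> G. i \<notin> {fst p..<snd p}"
    then show "w i \<le> t" using czfamD(7)[OF F, of i] czfamD(7)[OF G, of i] by (metis UnE UnI1 UnI2)
  qed
qed

text \<open>Bisection. A half whose average exceeds t is selected as a whole, and its average is at
  most 2t because that of the parent is at most t; any other half is bisected further. At length one
  the average is the value itself.\<close>

lemma czfam_exists:
  assumes w: "\<And>i. 0 \<le> w i"
  shows "sum w {l..<l + 2^n} \<le> t * 2^n \<Longrightarrow> \<exists>F. czfam w t {l..<l + 2^n} F"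
proof (induction n arbitrary: l)
  case 0
  moreover have "{l..<l + 2^0} = {l}" by auto
  ultimately have "czfam w t {l..<l + 2^0} {}" by (auto simp: czfam_def)
  then show ?case by blast
next
  case (Suc n)
  have split: "{l..<l + 2^Suc n} = {l..<l + 2^n} \<union> {l + 2^n..<(l + 2^n) + 2^n}"
    by (auto simp: algebra_simps)
  have half: "\<exists>F. czfam w t {m..<m + 2^n} F" if m: "{m..<m + 2^n} \<subseteq> {l..<l + 2^Suc n}" for m
  proof (cases "sum w {m..<m + 2^n} \<le> t * 2^n")
    case True then show ?thesis by (rule Suc.IH)
  next
    case False
    have "sum w {m..<m + 2^n} \<le> sum w {l..<l + 2^Suc n}" by (intro sum_mono2 m w) auto
    also have "\<dots> \<le> 2 * t * 2^n" using Suc.prems by (simp add: algebra_simps)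
    finally have "czfam w t {m..<m + 2^n} {(m, m + 2^n)}" using False by (auto simp: czfam_def)
    then show ?thesis by blast
  qed
  from half[of l] half[of "l + 2^n"] split obtain F G
    where "czfam w t {l..<l + 2^n} F" "czfam w t {l + 2^n..<(l + 2^n) + 2^n} G" by blast
  from czfam_Un[OF this] show ?case unfolding split by auto
qed

lemma czfam_exists_finite:
  assumes w: "\<And>i. 0 \<le> w i" and fin: "finite {i. w i \<noteq> 0}" and t: "0 < t"
  obtains F where "czfam w t UNIV F"
proof -
  obtain B where B: "\<And>i. w i \<noteq> 0 \<Longrightarrow> \<bar>i\<bar> \<le> B"
  proof
    show "\<bar>i\<bar> \<le> Max (insert 0 (abs ` {i. w i \<noteq> 0}))" if "w i \<noteq> 0" for i
      using fin that by (intro Max_ge) auto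
  qed
  \<comment> \<open>One n meets two demands: the window of length 2^(n+1) contains the support, and
    it is so long that the average of w over it is at most t.\<close>
  obtain n where n: "real_of_int \<bar>B\<bar> + 1 + (\<Sum>i | w i \<noteq> 0. w i) / t < 2^n"
    using real_arch_pow[of 2] by auto
  have N0: "0 \<le> (\<Sum>i | w i \<noteq> 0. w i)" by (simp add: sum_nonneg w)
  then have "0 \<le> (\<Sum>i | w i \<noteq> 0. w i) / t" using t by simp
  then have "real_of_int (\<bar>B\<bar> + 1) < 2^n" using n by simp
  then have Bn: "\<bar>B\<bar> + 1 < 2^n" by (metis of_int_less_numeral_power_cancel_iff)
  have supp: "{i. w i \<noteq> 0} \<subseteq> {- (2^n)..<- (2^n) + 2^Suc n}"
    using B Bn by (force simp: abs_le_iff)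
  have "sum w {- (2^n)..<- (2^n) + 2^Suc n} = (\<Sum>i | w i \<noteq> 0. w i)"
    by (rule sum.mono_neutral_right) (use supp in auto)
  also have "\<dots> \<le> t * 2^Suc n"
  proof -
    have "(\<Sum>i | w i \<noteq> 0. w i) / t \<le> 2^n" using n by linarith
    then have "(\<Sum>i | w i \<noteq> 0. w i) \<le> 2^n * t" using t by (simp only: pos_divide_le_eq)
    also have "\<dots> \<le> t * 2^Suc n" using t by simp
    finally show ?thesis .
  qed
  finally obtain F where F: "czfam w t {- (2^n)..<- (2^n) + 2^Suc n} F" using czfam_exists[of w, OF w] by blast
  have "w i \<le> t" if i: "\<forall>p\<in>F. i \<notin> {fst p..<snd p}" for i
  proof (cases "w i = 0")
    case False
    then have "i \<in> {- (2^n)..<- (2^n) + 2^Suc n}" using supp by blast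
    then show ?thesis using czfamD(7)[OF F] i by metis
  qed (use t in simp)
  then have "czfam w t UNIV F"
    unfolding czfam_def using czfamD[OF F] by (intro conjI ballI impI subset_UNIV) metis+
  then show ?thesis by (rule that)
qed

section \<open>The weak type (1,1) inequality for a discretised operator\<close>

lemma Markov_lborel:
  fixes f :: "real \<Rightarrow> complex"
  assumes [measurable]: "f \<in> borel_measurable borel" "E \<in> sets borel" and s: "0 < s" and q: "0 < q"
    and B: "(\<integral>\<^sup>+x. ennreal (cmod (f x) powr q) * indicator E x \<partial>lborel) \<le> ennreal B" "0 \<le> B"
  shows "emeasure lborel {x \<in> E. s < cmod (f x)} \<le> ennreal (B / s powr q)"
proof -
  have "E \<inter> {x \<in> space borel. 1 \<le> ennreal (1 / s powr q) * ennreal (cmod (f x) powr q)} \<in> sets borel"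
    by (intro sets.Int assms) measurable
  then have m: "{x \<in> E. 1 \<le> ennreal (1 / s powr q) * ennreal (cmod (f x) powr q)} \<in> sets lborel"
    by (simp add: Int_def)
  have "emeasure lborel {x \<in> E. s < cmod (f x)} \<le> emeasure lborel {x \<in> E. 1 \<le> ennreal (1 / s powr q) * ennreal (cmod (f x) powr q)}"
  proof (intro emeasure_mono subsetI)
    fix x assume "x \<in> {x \<in> E. s < cmod (f x)}"
    then have "x \<in> E" "s powr q \<le> cmod (f x) powr q" using s q by (auto intro!: powr_mono2)
    then show "x \<in> {x \<in> E. 1 \<le> ennreal (1 / s powr q) * ennreal (cmod (f x) powr q)}"
      using s by (simp add: ennreal_mult[symmetric])
  qed (rule m)
  also have "\<dots> \<le> ennreal (1 / s powr q) * (\<integral>\<^sup>+x. ennreal (cmod (f x) powr q) * indicator E x \<partial>lborel)"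
    by (rule nn_integral_Markov_inequality) auto
  also have "\<dots> \<le> ennreal (1 / s powr q) * ennreal B" by (intro mult_left_mono B) simp
  also have "\<dots> = ennreal (B / s powr q)" using B(2) by (simp add: ennreal_mult[symmetric])
  finally show ?thesis .
qed

text \<open>Think of \<open>\<kappa> i\<close> as the image of the indicator of [i*h, (i+1)*h), so
  that the sums are images of step functions of mesh h. \<open>A\<close> bounds the square of the
  operator norm on L^2. \<open>Hor\<close> is Hormander's condition for two cells of one interval
  {l..<r}, away from an enlargement of it; the factor h on its right is the length of a
  cell.\<close>

locale cz_operator =
  fixes \<kappa> :: "int \<Rightarrow> real \<Rightarrow> complex" and h A H :: real
  assumes \<kappa>_meas [measurable]: "\<And>i. \<kappa> i \<in> borel_measurable borel"
    and h: "0 < h" and AH: "0 \<le> A" "0 \<le> H"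
    and L2: "\<And>S c. finite S \<Longrightarrow> (\<integral>\<^sup>+x. ennreal ((cmod (\<Sum>i\<in>S. c i * \<kappa> i x))\<^sup>2) \<partial>lborel) \<le> ennreal (A * h * (\<Sum>i\<in>S. (cmod (c i))\<^sup>2))"
    and Hor: "\<And>l r i. l \<le> i \<Longrightarrow> i < r \<Longrightarrow>
      (\<integral>\<^sup>+x. ennreal (cmod (\<kappa> i x - \<kappa> l x)) * indicator {x. 3 * (real_of_int r - real_of_int l) * h \<le> \<bar>x - real_of_int l * h\<bar>} x \<partial>lborel) \<le> ennreal (H * h)"
begin

text \<open>On each selected interval the coefficients are replaced by their mean
  \<open>m p\<close>, which gives the good part \<open>g\<close>. The remainder has mean zero there,
  so \<open>\<kappa> (fst p)\<close> may be subtracted from every term; this produces the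
  differences that Hormander's condition controls.\<close>

lemma czfam_average:
  assumes S: "finite S" and F: "czfam (\<lambda>i. cmod (if i \<in> S then c i else 0)) t UNIV F" and t: "0 < t"
  obtains S' g m where "finite S'" "S \<subseteq> S'" "\<And>p. p \<in> F \<Longrightarrow> {fst p..<snd p} \<subseteq> S'"
    "\<And>i. cmod (g i) \<le> 2 * t" "(\<Sum>i\<in>S'. cmod (g i)) \<le> (\<Sum>i\<in>S. cmod (c i))"
    "\<And>x. (\<Sum>i\<in>S. c i * \<kappa> i x) = (\<Sum>i\<in>S'. g i * \<kappa> i x) + (\<Sum>p\<in>F. \<Sum>i\<in>{fst p..<snd p}. ((if i \<in> S then c i else 0) - m p) * (\<kappa> i x - \<kappa> (fst p) x))"
    "\<And>p. p \<in> F \<Longrightarrow> (\<Sum>i\<in>{fst p..<snd p}. cmod ((if i \<in> S then c i else 0) - m p)) \<le> 2 * (\<Sum>i\<in>{fst p..<snd p}. cmod (if i \<in> S then c i else 0))"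
proof -
  define d where "d i = (if i \<in> S then c i else 0)" for i
  define I where "I p = {fst p..<snd p}" for p :: "int \<times> int"
  have Ffin: "finite F" and Fp: "\<And>p. p \<in> F \<Longrightarrow> fst p < snd p"
    "\<And>p. p \<in> F \<Longrightarrow> (\<Sum>i\<in>I p. cmod (d i)) \<le> 2 * t * (snd p - fst p)"
    and disj: "\<And>p p'. p \<in> F \<Longrightarrow> p' \<in> F \<Longrightarrow> p \<noteq> p' \<Longrightarrow> I p \<inter> I p' = {}"
    and out: "\<And>i. (\<And>p. p \<in> F \<Longrightarrow> i \<notin> I p) \<Longrightarrow> cmod (d i) \<le> t"
    unfolding d_def I_def using czfamD(1,2)[OF F] czfamD(5)[OF F] czfamD(6)[OF F] czfamD(7)[OF F UNIV_I] by metis+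
  have Ifin: "finite (I p)" for p by (simp add: I_def)
  have cardI: "of_nat (card (I p)) = (snd p - fst p)" if "p \<in> F" for p using Fp(1)[OF that] by (simp add: I_def)
  define m where "m p = (\<Sum>i\<in>I p. d i) / of_int (snd p - fst p)" for p :: "int \<times> int"
  define U where "U = (\<Union>p\<in>F. I p)"
  \<comment> \<open>The selected intervals are disjoint, so \<open>THE\<close> denotes the one that
    contains \<open>i\<close>.\<close>
  define g where "g i = (if i \<in> U then m (THE p. p \<in> F \<and> i \<in> I p) else d i)" for i
  have g_in: "g i = m p" if "p \<in> F" "i \<in> I p" for i p
  proof -
    have "p' = p" if "p' \<in> F \<and> i \<in> I p'" for p'
      using disj[of p' p] that \<open>p \<in> F\<close> \<open>i \<in> I p\<close> by (metis IntI empty_iff)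
    then have "(THE p. p \<in> F \<and> i \<in> I p) = p" using that by (intro the_equality conjI) 
    then show ?thesis using that by (auto simp: g_def U_def)
  qed
  define S' where "S' = S \<union> U"
  have S': "finite S'" "S \<subseteq> S'" "\<And>p. p \<in> F \<Longrightarrow> I p \<subseteq> S'" using S Ffin Ifin by (auto simp: S'_def U_def)
  have len: "0 < real_of_int (snd p - fst p)" if "p \<in> F" for p using Fp(1)[OF that] by simp
  have mb: "cmod (m p) * (snd p - fst p) \<le> (\<Sum>i\<in>I p. cmod (d i))" if "p \<in> F" for p
  proof -
    have "cmod (m p) = cmod (\<Sum>i\<in>I p. d i) / \<bar>real_of_int (snd p - fst p)\<bar>"
      unfolding m_def norm_divide norm_of_int ..
    then show ?thesis using len[OF that] norm_sum[of d "I p"] by simp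
  qed
  have g_le: "cmod (g i) \<le> 2 * t" for i
  proof (cases "i \<in> U")
    case True
    then obtain p where p: "p \<in> F" "i \<in> I p" by (auto simp: U_def)
    have "cmod (m p) * (snd p - fst p) \<le> (2 * t) * (snd p - fst p)" using mb[OF p(1)] Fp(2)[OF p(1)] by simp
    then have "cmod (m p) \<le> 2 * t" using len[OF p(1)] by (metis mult_le_cancel_right_pos)
    then show ?thesis using g_in[OF p] by simp
  next
    case False
    then have "cmod (d i) \<le> t" by (intro out) (auto simp: U_def)
    then show ?thesis using False t by (simp add: g_def)
  qed
  have sumU: "(\<Sum>i\<in>U. f i) = (\<Sum>p\<in>F. \<Sum>i\<in>I p. f i)" for f :: "int \<Rightarrow> 'b::comm_monoid_add"
    unfolding U_def using Ffin Ifin disj by (intro sum.UNION_disjoint) auto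
  have Ufin: "finite U" using Ffin Ifin by (simp add: U_def)
  have sumS': "(\<Sum>i\<in>S'. f i) = (\<Sum>i\<in>S' - U. f i) + (\<Sum>i\<in>U. f i)" for f :: "int \<Rightarrow> 'b::comm_monoid_add"
    using sum.subset_diff[of U S' f] S'(1) by (auto simp: S'_def)
  have g_sum: "(\<Sum>i\<in>S'. cmod (g i)) \<le> (\<Sum>i\<in>S. cmod (c i))"
  proof -
    have "(\<Sum>i\<in>U. cmod (g i)) = (\<Sum>p\<in>F. cmod (m p) * (snd p - fst p))"
      unfolding sumU using g_in cardI by (intro sum.cong) (auto simp: mult.commute simp flip: cardI)
    also have "\<dots> \<le> (\<Sum>i\<in>U. cmod (d i))" unfolding sumU by (intro sum_mono mb)
    finally have "(\<Sum>i\<in>S'. cmod (g i)) \<le> (\<Sum>i\<in>S' - U. cmod (d i)) + (\<Sum>i\<in>U. cmod (d i))"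
      unfolding sumS'[of "\<lambda>i. cmod (g i)"] by (simp add: g_def)
    also have "\<dots> = (\<Sum>i\<in>S'. cmod (d i))" by (rule sumS'[symmetric])
    also have "\<dots> = (\<Sum>i\<in>S. cmod (d i))" using S' by (intro sum.mono_neutral_right) (auto simp: d_def)
    also have "\<dots> = (\<Sum>i\<in>S. cmod (c i))" by (simp add: d_def)
    finally show ?thesis .
  qed
  have zero: "(\<Sum>i\<in>I p. d i - m p) = 0" if "p \<in> F" for p
  proof -
    have "(\<Sum>i\<in>I p. d i - m p) = (\<Sum>i\<in>I p. d i) - of_nat (card (I p)) * m p" by (simp add: sum_subtractf)
    also have "(of_nat (card (I p)) :: complex) = of_int (snd p - fst p)" by (metis cardI[OF that] of_int_of_nat_eq)
    finally show ?thesis using Fp(1)[OF that] by (simp add: m_def)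
  qed
  have dec: "(\<Sum>i\<in>S. c i * \<kappa> i x) = (\<Sum>i\<in>S'. g i * \<kappa> i x) + (\<Sum>p\<in>F. \<Sum>i\<in>I p. (d i - m p) * (\<kappa> i x - \<kappa> (fst p) x))" for x
  proof -
    have "(\<Sum>i\<in>S. c i * \<kappa> i x) = (\<Sum>i\<in>S. d i * \<kappa> i x)" by (simp add: d_def)
    also have "\<dots> = (\<Sum>i\<in>S'. d i * \<kappa> i x)" using S' by (intro sum.mono_neutral_left) (auto simp: d_def)
    also have "\<dots> = (\<Sum>i\<in>S'. g i * \<kappa> i x) + (\<Sum>i\<in>S'. (d i - g i) * \<kappa> i x)"
      by (simp add: sum.distrib[symmetric] algebra_simps)
    also have "(\<Sum>i\<in>S'. (d i - g i) * \<kappa> i x) = (\<Sum>i\<in>U. (d i - g i) * \<kappa> i x)"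
      by (subst sumS') (simp add: g_def)
    also have "\<dots> = (\<Sum>p\<in>F. \<Sum>i\<in>I p. (d i - m p) * \<kappa> i x)"
      unfolding sumU using g_in by (intro sum.cong) auto
    also have "\<dots> = (\<Sum>p\<in>F. \<Sum>i\<in>I p. (d i - m p) * (\<kappa> i x - \<kappa> (fst p) x))"
    proof (rule sum.cong[OF refl])
      fix p assume p: "p \<in> F"
      have "(\<Sum>i\<in>I p. (d i - m p) * (\<kappa> i x - \<kappa> (fst p) x)) = (\<Sum>i\<in>I p. (d i - m p) * \<kappa> i x - (d i - m p) * \<kappa> (fst p) x)"
        by (simp only: right_diff_distrib)
      also have "\<dots> = (\<Sum>i\<in>I p. (d i - m p) * \<kappa> i x) - (\<Sum>i\<in>I p. (d i - m p) * \<kappa> (fst p) x)" by (rule sum_subtractf)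
      also have "(\<Sum>i\<in>I p. (d i - m p) * \<kappa> (fst p) x) = (\<Sum>i\<in>I p. d i - m p) * \<kappa> (fst p) x" by (rule sum_distrib_right[symmetric])
      also have "\<dots> = 0" unfolding zero[OF p] by simp
      finally show "(\<Sum>i\<in>I p. (d i - m p) * \<kappa> i x) = (\<Sum>i\<in>I p. (d i - m p) * (\<kappa> i x - \<kappa> (fst p) x))" by simp
    qed
    finally show ?thesis .
  qed
  have b_le: "(\<Sum>i\<in>I p. cmod (d i - m p)) \<le> 2 * (\<Sum>i\<in>I p. cmod (d i))" if "p \<in> F" for p
  proof -
    have "(\<Sum>i\<in>I p. cmod (d i - m p)) \<le> (\<Sum>i\<in>I p. cmod (d i) + cmod (m p))" by (intro sum_mono norm_triangle_ineq4)
    also have "\<dots> = (\<Sum>i\<in>I p. cmod (d i)) + cmod (m p) * (snd p - fst p)"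
    proof -
      have "real (card (I p)) = snd p - fst p" using cardI[OF that] by (metis of_int_of_nat_eq)
      then show ?thesis by (simp add: sum.distrib mult.commute)
    qed
    finally show ?thesis using mb[OF that] by simp
  qed
  show ?thesis
    by (rule that[of S' g m]) (use S' g_le g_sum dec b_le in \<open>auto simp: d_def I_def\<close>)
qed

end

context cz_operator
begin

text \<open>Half of the height t goes to each part. With N the sum of the |c i|, the good part has
  L^2 energy at most 2 * A * h * t * N, which gives 8 * A. The enlarged intervals have total length
  at most 6 * h / t * N. Outside them the bad part has integral at most 2 * H * h * N, which gives 4
  * H.\<close>

lemma weak_type:
  assumes S: "finite S" and t: "0 < t"
  shows "emeasure lborel {x. t < cmod (\<Sum>i\<in>S. c i * \<kappa> i x)} \<le> ennreal ((8 * A + 6 + 4 * H) * h / t * (\<Sum>i\<in>S. cmod (c i)))"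
proof -
  define d where "d i = (if i \<in> S then c i else 0)" for i
  define N where "N = (\<Sum>i\<in>S. cmod (c i))"
  have N0: "0 \<le> N" by (simp add: N_def sum_nonneg)
  have "finite {i. cmod (d i) \<noteq> 0}" by (rule finite_subset[OF _ S]) (auto simp: d_def)
  then obtain F where F: "czfam (\<lambda>i. cmod (d i)) t UNIV F"
    using czfam_exists_finite[of "\<lambda>i. cmod (d i)" t] t by auto
  show ?thesis
  proof (rule czfam_average[OF S F[unfolded d_def] t, folded d_def N_def])
  fix S' :: "int set" and g :: "int \<Rightarrow> complex" and m :: "int \<times> int \<Rightarrow> complex"
  assume S': "finite S'" "S \<subseteq> S'" "\<And>p. p \<in> F \<Longrightarrow> {fst p..<snd p} \<subseteq> S'" and g: "\<And>i. cmod (g i) \<le> 2 * t" "(\<Sum>i\<in>S'. cmod (g i)) \<le> N"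
    and dec: "\<And>x. (\<Sum>i\<in>S. c i * \<kappa> i x) = (\<Sum>i\<in>S'. g i * \<kappa> i x) + (\<Sum>p\<in>F. \<Sum>i\<in>{fst p..<snd p}. (d i - m p) * (\<kappa> i x - \<kappa> (fst p) x))"
    and b: "\<And>p. p \<in> F \<Longrightarrow> (\<Sum>i\<in>{fst p..<snd p}. cmod (d i - m p)) \<le> 2 * (\<Sum>i\<in>{fst p..<snd p}. cmod (d i))"
  define E where "E p = {x. \<bar>x - fst p * h\<bar> < 3 * (snd p - fst p) * h}" for p :: "int \<times> int"
  have E_eq: "E p = {fst p * h - 3 * (snd p - fst p) * h <..< fst p * h + 3 * (snd p - fst p) * h}" for p :: "int \<times> int"
    by (auto simp: E_def abs_less_iff)
  have Em[measurable]: "E p \<in> sets borel" for p :: "int \<times> int" unfolding E_eq by simp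
  let ?G = "\<lambda>x. \<Sum>i\<in>S'. g i * \<kappa> i x"
  let ?B = "\<lambda>x. \<Sum>p\<in>F. \<Sum>i\<in>{fst p..<snd p}. (d i - m p) * (\<kappa> i x - \<kappa> (fst p) x)"
  define V where "V = UNIV - (\<Union>p\<in>F. E p)"
  have Ffin: "finite F" by (rule czfamD(1)[OF F])
  have Vm[measurable]: "V \<in> sets borel" unfolding V_def by (intro sets.Diff sets.finite_UN Ffin Em) simp
  have disjsum: "(\<Sum>p\<in>F. \<Sum>i\<in>{fst p..<snd p}. cmod (d i)) \<le> N"
  proof -
    have "(\<Sum>p\<in>F. \<Sum>i\<in>{fst p..<snd p}. cmod (d i)) = (\<Sum>i\<in>(\<Union>p\<in>F. {fst p..<snd p}). cmod (d i))"
      using Ffin czfamD(6)[OF F] by (intro sum.UNION_disjoint[symmetric]) simp_all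
    also have "\<dots> = (\<Sum>i\<in>(\<Union>p\<in>F. {fst p..<snd p}) \<inter> S. cmod (d i))"
      using Ffin by (intro sum.mono_neutral_right) (auto simp: d_def)
    also have "\<dots> \<le> (\<Sum>i\<in>S. cmod (d i))" using S by (intro sum_mono2) auto
    finally show ?thesis by (simp add: N_def d_def)
  qed
  have 1: "emeasure lborel {x \<in> UNIV. t / 2 < cmod (?G x)} \<le> ennreal (8 * A * h / t * N)"
  proof -
    have "(\<Sum>i\<in>S'. (cmod (g i))\<^sup>2) \<le> (\<Sum>i\<in>S'. 2 * t * cmod (g i))"
      unfolding power2_eq_square by (intro sum_mono mult_right_mono g) simp
    also have "\<dots> \<le> 2 * t * N" unfolding sum_distrib_left[symmetric] using t g by (intro mult_left_mono) auto
    finally have "A * h * (\<Sum>i\<in>S'. (cmod (g i))\<^sup>2) \<le> A * h * (2 * t * N)" using AH h by (intro mult_left_mono) auto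
    then have "(\<integral>\<^sup>+x. ennreal (cmod (?G x) powr 2) * indicator UNIV x \<partial>lborel) \<le> ennreal (A * h * (2 * t * N))"
      using L2[OF S'(1), of g] by (auto simp: powr_numeral intro: order_trans ennreal_leI)
    then have "emeasure lborel {x \<in> UNIV. t / 2 < cmod (?G x)} \<le> ennreal (A * h * (2 * t * N) / (t / 2) powr 2)"
      using t AH h N0 by (intro Markov_lborel) auto
    also have "A * h * (2 * t * N) / (t / 2) powr 2 = 8 * A * h / t * N"
      using t by (simp add: powr_numeral power2_eq_square)
    finally show ?thesis .
  qed
  have 2: "emeasure lborel (\<Union>p\<in>F. E p) \<le> ennreal (6 * h / t * N)"
  proof -
    have "emeasure lborel (\<Union>p\<in>F. E p) \<le> (\<Sum>p\<in>F. emeasure lborel (E p))"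
      by (intro emeasure_subadditive_finite Ffin) (auto simp: Em)
    also have "\<dots> \<le> (\<Sum>p\<in>F. ennreal (6 * h / t * (\<Sum>i\<in>{fst p..<snd p}. cmod (d i))))"
    proof (rule sum_mono)
      fix p assume p: "p \<in> F"
      have lt: "real_of_int (fst p) < snd p" using czfamD(2)[OF F p] by simp
      have "emeasure lborel (E p) = ennreal (6 * h * (snd p - fst p))"
        unfolding E_eq using lt h by (subst emeasure_lborel_Ioo) (auto simp: algebra_simps)
      also have "\<dots> \<le> ennreal (6 * h / t * (\<Sum>i\<in>{fst p..<snd p}. cmod (d i)))"
      proof (rule ennreal_leI)
        have "t * (snd p - fst p) \<le> (\<Sum>i\<in>{fst p..<snd p}. cmod (d i))" using czfamD(4)[OF F p] by simp
        then have "6 * h / t * (t * (snd p - fst p)) \<le> 6 * h / t * (\<Sum>i\<in>{fst p..<snd p}. cmod (d i))"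
          using h t by (intro mult_left_mono) auto
        then show "6 * h * (snd p - fst p) \<le> 6 * h / t * (\<Sum>i\<in>{fst p..<snd p}. cmod (d i))" using t by simp
      qed
      finally show "emeasure lborel (E p) \<le> ennreal (6 * h / t * (\<Sum>i\<in>{fst p..<snd p}. cmod (d i)))" .
    qed
    also have "\<dots> = ennreal (\<Sum>p\<in>F. 6 * h / t * (\<Sum>i\<in>{fst p..<snd p}. cmod (d i)))"
      using h t by (intro sum_ennreal mult_nonneg_nonneg sum_nonneg) auto
    also have "\<dots> \<le> ennreal (6 * h / t * N)"
      unfolding sum_distrib_left[symmetric] using h t disjsum by (intro ennreal_leI mult_left_mono) auto
    finally show ?thesis .
  qed
  have 3: "emeasure lborel {x \<in> V. t / 2 < cmod (?B x)} \<le> ennreal (4 * H * h / t * N)"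
  proof -
    have "(\<integral>\<^sup>+x. ennreal (cmod (?B x) powr 1) * indicator V x \<partial>lborel) \<le>
      (\<integral>\<^sup>+x. (\<Sum>p\<in>F. \<Sum>i\<in>{fst p..<snd p}. ennreal (cmod (d i - m p)) *
        (ennreal (cmod (\<kappa> i x - \<kappa> (fst p) x)) * indicator {x. 3 * (snd p - fst p) * h \<le> \<bar>x - fst p * h\<bar>} x)) \<partial>lborel)"
    proof (rule nn_integral_mono)
      fix x
      show "ennreal (cmod (?B x) powr 1) * indicator V x \<le> (\<Sum>p\<in>F. \<Sum>i\<in>{fst p..<snd p}. ennreal (cmod (d i - m p)) *
        (ennreal (cmod (\<kappa> i x - \<kappa> (fst p) x)) * indicator {x. 3 * (snd p - fst p) * h \<le> \<bar>x - fst p * h\<bar>} x))"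
      proof (cases "x \<in> V")
        case True
        then have ind: "indicator {x. 3 * (snd p - fst p) * h \<le> \<bar>x - fst p * h\<bar>} x = (1::ennreal)" if "p \<in> F" for p :: "int \<times> int"
          using that by (auto simp: V_def E_def)
        have "cmod (?B x) \<le> (\<Sum>p\<in>F. \<Sum>i\<in>{fst p..<snd p}. cmod (d i - m p) * cmod (\<kappa> i x - \<kappa> (fst p) x))"
          by (intro order_trans[OF norm_sum] sum_mono) (simp add: norm_mult)
        then have "ennreal (cmod (?B x)) \<le> ennreal (\<Sum>p\<in>F. \<Sum>i\<in>{fst p..<snd p}. cmod (d i - m p) * cmod (\<kappa> i x - \<kappa> (fst p) x))"
          by (rule ennreal_leI)
        also have "\<dots> = (\<Sum>p\<in>F. \<Sum>i\<in>{fst p..<snd p}. ennreal (cmod (d i - m p)) * ennreal (cmod (\<kappa> i x - \<kappa> (fst p) x)))"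
          by (simp add: sum_ennreal[symmetric] sum_nonneg ennreal_mult)
        finally show ?thesis using True ind by simp
      qed simp
    qed
    also have "\<dots> = (\<Sum>p\<in>F. \<Sum>i\<in>{fst p..<snd p}. ennreal (cmod (d i - m p)) *
        (\<integral>\<^sup>+x. ennreal (cmod (\<kappa> i x - \<kappa> (fst p) x)) * indicator {x. 3 * (snd p - fst p) * h \<le> \<bar>x - fst p * h\<bar>} x \<partial>lborel))"
      by (simp add: nn_integral_sum nn_integral_cmult)
    also have "\<dots> \<le> (\<Sum>p\<in>F. \<Sum>i\<in>{fst p..<snd p}. ennreal (cmod (d i - m p)) * ennreal (H * h))"
    proof (intro sum_mono mult_left_mono)
      fix p i assume "p \<in> F" "i \<in> {fst p..<snd p}"
      then show "(\<integral>\<^sup>+x. ennreal (cmod (\<kappa> i x - \<kappa> (fst p) x)) * indicator {x. 3 * (snd p - fst p) * h \<le> \<bar>x - fst p * h\<bar>} x \<partial>lborel) \<le> ennreal (H * h)"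
        using Hor[of "fst p" i "snd p"] by simp
    qed simp
    also have "\<dots> = ennreal (\<Sum>p\<in>F. (\<Sum>i\<in>{fst p..<snd p}. cmod (d i - m p)) * (H * h))"
      using AH h by (simp add: sum_ennreal[symmetric] sum_nonneg ennreal_mult sum_distrib_right)
    also have "\<dots> \<le> ennreal (\<Sum>p\<in>F. (2 * (\<Sum>i\<in>{fst p..<snd p}. cmod (d i))) * (H * h))"
      using AH h by (intro ennreal_leI sum_mono mult_right_mono b) auto
    also have "\<dots> = ennreal (2 * H * h * (\<Sum>p\<in>F. \<Sum>i\<in>{fst p..<snd p}. cmod (d i)))"
      unfolding sum_distrib_right[symmetric] sum_distrib_left[symmetric] by (simp add: mult_ac)
    also have "\<dots> \<le> ennreal (2 * H * h * N)"
      using AH h disjsum by (intro ennreal_leI mult_left_mono) auto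
    finally have "(\<integral>\<^sup>+x. ennreal (cmod (?B x) powr 1) * indicator V x \<partial>lborel) \<le> ennreal (2 * H * h * N)" .
    then have "emeasure lborel {x \<in> V. t / 2 < cmod (?B x)} \<le> ennreal (2 * H * h * N / (t / 2) powr 1)"
      using t AH h N0 by (intro Markov_lborel) auto
    also have "2 * H * h * N / (t / 2) powr 1 = 4 * H * h / t * N" using t by simp
    finally show ?thesis .
  qed
  have "V \<inter> {x \<in> space borel. t / 2 < cmod (?B x)} \<in> sets borel" by (intro sets.Int Vm) measurable
  then have m1: "{x \<in> V. t / 2 < cmod (?B x)} \<in> sets lborel" by (simp add: Int_def)
  have m2: "(\<Union>p\<in>F. E p) \<in> sets lborel" unfolding sets_lborel by (intro sets.finite_UN Ffin Em)
  have "{x \<in> space borel. t / 2 < cmod (?G x)} \<in> sets borel" by measurable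
  then have m3: "{x \<in> UNIV. t / 2 < cmod (?G x)} \<in> sets lborel" by simp
  have "emeasure lborel {x. t < cmod (\<Sum>i\<in>S. c i * \<kappa> i x)} \<le>
    emeasure lborel ({x \<in> UNIV. t / 2 < cmod (?G x)} \<union> ((\<Union>p\<in>F. E p) \<union> {x \<in> V. t / 2 < cmod (?B x)}))"
  proof (rule emeasure_mono)
    show "{x. t < cmod (\<Sum>i\<in>S. c i * \<kappa> i x)} \<subseteq> {x \<in> UNIV. t / 2 < cmod (?G x)} \<union> ((\<Union>p\<in>F. E p) \<union> {x \<in> V. t / 2 < cmod (?B x)})"
    proof
      fix x assume "x \<in> {x. t < cmod (\<Sum>i\<in>S. c i * \<kappa> i x)}"
      then have "t < cmod (?G x + ?B x)" by (simp add: dec)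
      then have "t / 2 < cmod (?G x) \<or> t / 2 < cmod (?B x)" using norm_triangle_ineq[of "?G x" "?B x"] by linarith
      then show "x \<in> {x \<in> UNIV. t / 2 < cmod (?G x)} \<union> ((\<Union>p\<in>F. E p) \<union> {x \<in> V. t / 2 < cmod (?B x)})"
        unfolding V_def by blast
    qed
    show "{x \<in> UNIV. t / 2 < cmod (?G x)} \<union> ((\<Union>p\<in>F. E p) \<union> {x \<in> V. t / 2 < cmod (?B x)}) \<in> sets lborel"
      by (intro sets.Un m1 m2 m3)
  qed
  also have "\<dots> \<le> emeasure lborel {x \<in> UNIV. t / 2 < cmod (?G x)} + (emeasure lborel (\<Union>p\<in>F. E p) + emeasure lborel {x \<in> V. t / 2 < cmod (?B x)})"
  proof -
    show ?thesis
      by (rule order_trans[OF emeasure_subadditive[OF m3 sets.Un[OF m2 m1]] add_left_mono[OF emeasure_subadditive[OF m2 m1]]])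
  qed
  also have "\<dots> \<le> ennreal (8 * A * h / t * N) + (ennreal (6 * h / t * N) + ennreal (4 * H * h / t * N))"
    by (intro add_mono 1 2 3)
  also have "\<dots> = ennreal ((8 * A + 6 + 4 * H) * h / t * N)"
    using AH h t N0 by (simp add: ennreal_plus[symmetric] algebra_simps add_divide_distrib del: ennreal_plus)
  finally show ?thesis by (simp add: N_def)
  qed
qed

end

section \<open>The layer cake formula and the strong type inequality below 2\<close>

lemma layer_cake:
  fixes F :: "real \<Rightarrow> real"
  assumes [measurable]: "F \<in> borel_measurable borel" and F: "\<And>x. 0 \<le> F x" and p: "0 < p"
  shows "(\<integral>\<^sup>+x. ennreal (F x powr p) \<partial>lborel) =
    (\<integral>\<^sup>+t. ennreal (p * t powr (p - 1)) * indicator {0<..} t * emeasure lborel {x. t < F x} \<partial>lborel)"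
proof -
  have pt: "ennreal (y powr p) = (\<integral>\<^sup>+t. ennreal (p * t powr (p - 1)) * (indicator {0<..} t * indicator {..<y} t) \<partial>lborel)" if "0 \<le> y" for y
  proof -
    have "((\<lambda>t. t powr (p - 1)) has_integral (y powr (p - 1 + 1) / (p - 1 + 1))) {0..y}"
      using p that by (intro has_integral_powr_from_0) auto
    from has_integral_mult_right[OF this, of p]
    have "((\<lambda>t. p * t powr (p - 1)) has_integral (y powr p)) {0..y}" using p by simp
    from nn_integral_has_integral_lebesgue'[OF _ this]
    have "(\<integral>\<^sup>+t. ennreal (p * t powr (p - 1)) * indicator {0..y} t \<partial>lborel) = ennreal (y powr p)" using p by simp
    moreover have "(\<integral>\<^sup>+t. ennreal (p * t powr (p - 1)) * indicator {0..y} t \<partial>lborel) =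
      (\<integral>\<^sup>+t. ennreal (p * t powr (p - 1)) * (indicator {0<..} t * indicator {..<y} t) \<partial>lborel)"
    proof (rule nn_integral_cong_AE)
      show "AE t in lborel. ennreal (p * t powr (p - 1)) * indicator {0..y} t = ennreal (p * t powr (p - 1)) * (indicator {0<..} t * indicator {..<y} t)"
        using AE_lborel_singleton[of 0] AE_lborel_singleton[of y] by eventually_elim (auto simp: indicator_def)
    qed
    ultimately show ?thesis by simp
  qed
  have "(\<integral>\<^sup>+x. ennreal (F x powr p) \<partial>lborel) =
    (\<integral>\<^sup>+x. (\<integral>\<^sup>+t. ennreal (p * t powr (p - 1)) * (indicator {0<..} t * indicator {..<F x} t) \<partial>lborel) \<partial>lborel)"
    by (intro nn_integral_cong pt F)
  also have "\<dots> = (\<integral>\<^sup>+t. (\<integral>\<^sup>+x. ennreal (p * t powr (p - 1)) * (indicator {0<..} t * indicator {..<F x} t) \<partial>lborel) \<partial>lborel)"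
  proof (rule lborel_pair.Fubini')
    have "(\<lambda>(t, x). ennreal (p * t powr (p - 1)) * (indicator {0<..} t * (if t < F x then 1 else 0))) \<in> borel_measurable (lborel \<Otimes>\<^sub>M lborel)"
      by measurable
    moreover have "(\<lambda>(t, x). ennreal (p * t powr (p - 1)) * (indicator {0<..} t * indicator {..<F x} t)) =
      (\<lambda>(t, x). ennreal (p * t powr (p - 1)) * (indicator {0<..} t * (if t < F x then 1 else 0)))"
      by (auto simp: fun_eq_iff indicator_def)
    ultimately show "(\<lambda>(t, x). ennreal (p * t powr (p - 1)) * (indicator {0<..} t * indicator {..<F x} t)) \<in> borel_measurable (lborel \<Otimes>\<^sub>M lborel)"
      by simp
  qed
  also have "\<dots> = (\<integral>\<^sup>+t. ennreal (p * t powr (p - 1)) * indicator {0<..} t * emeasure lborel {x. t < F x} \<partial>lborel)"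
  proof (rule nn_integral_cong)
    fix t
    have m: "{x. t < F x} \<in> sets lborel" using borel_measurable_less[of "\<lambda>_. t" borel F] by simp
    have "(\<integral>\<^sup>+x. ennreal (p * t powr (p - 1)) * (indicator {0<..} t * indicator {..<F x} t) \<partial>lborel) =
      (\<integral>\<^sup>+x. (ennreal (p * t powr (p - 1)) * indicator {0<..} t) * indicator {x. t < F x} x \<partial>lborel)"
      by (intro nn_integral_cong) (auto simp: indicator_def)
    also have "\<dots> = ennreal (p * t powr (p - 1)) * indicator {0<..} t * emeasure lborel {x. t < F x}"
      by (rule nn_integral_cmult_indicator[OF m])
    finally show "(\<integral>\<^sup>+x. ennreal (p * t powr (p - 1)) * (indicator {0<..} t * indicator {..<F x} t) \<partial>lborel) =
      ennreal (p * t powr (p - 1)) * indicator {0<..} t * emeasure lborel {x. t < F x}" .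
  qed
  finally show ?thesis .
qed

lemma nn_integral_powr_below:
  assumes "-1 < a" "0 \<le> y"
  shows "(\<integral>\<^sup>+t. ennreal (t powr a) * indicator {0<..<y} t \<partial>lborel) = ennreal (y powr (a + 1) / (a + 1))"
proof -
  from nn_integral_has_integral_lebesgue'[OF _ has_integral_powr_from_0[OF assms]]
  have "(\<integral>\<^sup>+t. ennreal (t powr a) * indicator {0..y} t \<partial>lborel) = ennreal (y powr (a + 1) / (a + 1))" by simp
  moreover have "(\<integral>\<^sup>+t. ennreal (t powr a) * indicator {0..y} t \<partial>lborel) = (\<integral>\<^sup>+t. ennreal (t powr a) * indicator {0<..<y} t \<partial>lborel)"
  proof (rule nn_integral_cong_AE)
    show "AE t in lborel. ennreal (t powr a) * indicator {0..y} t = ennreal (t powr a) * indicator {0<..<y} t"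
      using AE_lborel_singleton[of 0] AE_lborel_singleton[of y] by eventually_elim (auto simp: indicator_def)
  qed
  ultimately show ?thesis by simp
qed

lemma nn_integral_powr_above:
  assumes "a < -1" "0 < y"
  shows "(\<integral>\<^sup>+t. ennreal (t powr a) * indicator {y..} t \<partial>lborel) = ennreal (- (y powr (a + 1)) / (a + 1))"
  by (rule nn_integral_has_integral_lebesgue'[OF _ has_integral_powr_to_inf[OF assms]]) simp

lemma sum_ennreal_mult:
  assumes "\<And>i. i \<in> S \<Longrightarrow> 0 \<le> a i" "0 \<le> y"
  shows "(\<Sum>i\<in>S. ennreal (a i) * ennreal y) = ennreal (\<Sum>i\<in>S. a i * y)"
proof -
  have "ennreal (\<Sum>i\<in>S. a i * y) = (\<Sum>i\<in>S. ennreal (a i * y))" using assms by (intro sum_ennreal[symmetric]) simp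
  also have "\<dots> = (\<Sum>i\<in>S. ennreal (a i) * ennreal y)" using assms by (intro sum.cong refl ennreal_mult) auto
  finally show ?thesis by simp
qed

context cz_operator
begin

definition "cz_weak = 8 * A + 6 + 4 * H"

text \<open>Arises by integrating \<open>distribution_split\<close> against p * t^(p-1). The first
  summand is from t^(p-2) over (0, |c i|), where p > 1 is needed, the second from t^(p-3) over [|c
  i|, infinity), where p < 2 is needed.\<close>

definition "cz_const p = 2 * cz_weak * p / (p - 1) + 4 * A * p / (2 - p)"

lemma cz_const_nonneg: "1 < p \<Longrightarrow> p < 2 \<Longrightarrow> 0 \<le> cz_const p"
  using AH by (simp add: cz_const_def cz_weak_def)

text \<open>Marcinkiewicz interpolation carried out on coefficients, split at the very height t:
  those above it are handled by the weak type inequality, the others by the L^2 bound and Markov's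
  inequality.\<close>

lemma distribution_split:
  assumes S: "finite S" and t: "0 < t"
  shows "emeasure lborel {x. t < cmod (\<Sum>i\<in>S. c i * \<kappa> i x)} \<le>
    (\<Sum>i\<in>S. ennreal (2 * cz_weak * h * cmod (c i)) * (ennreal (1 / t) * indicator {0<..<cmod (c i)} t) +
      ennreal (4 * A * h * (cmod (c i))\<^sup>2) * (ennreal (1 / t\<^sup>2) * indicator {cmod (c i)..} t))"
proof -
  define S1 where "S1 = {i \<in> S. t < cmod (c i)}"
  define S2 where "S2 = {i \<in> S. cmod (c i) \<le> t}"
  have fin: "finite S1" "finite S2" using S by (auto simp: S1_def S2_def)
  have w0: "0 \<le> cz_weak" using AH by (simp add: cz_weak_def)
  let ?T = "\<lambda>S x. \<Sum>i\<in>S. c i * \<kappa> i x"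
  have split: "?T S x = ?T S1 x + ?T S2 x" for x
  proof -
    have "S = S1 \<union> S2" "S1 \<inter> S2 = {}" by (auto simp: S1_def S2_def)
    then show ?thesis using fin by (simp add: sum.union_disjoint)
  qed
  have m: "{x. t / 2 < cmod (?T S' x)} \<in> sets lborel" for S'
  proof -
    have "{x \<in> space borel. t / 2 < cmod (?T S' x)} \<in> sets borel" by measurable
    then show ?thesis by simp
  qed
  have "emeasure lborel {x. t < cmod (?T S x)} \<le> emeasure lborel ({x. t / 2 < cmod (?T S1 x)} \<union> {x. t / 2 < cmod (?T S2 x)})"
  proof (rule emeasure_mono)
    show "{x. t < cmod (?T S x)} \<subseteq> {x. t / 2 < cmod (?T S1 x)} \<union> {x. t / 2 < cmod (?T S2 x)}"
    proof
      fix x assume "x \<in> {x. t < cmod (?T S x)}"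
      then have "t < cmod (?T S1 x + ?T S2 x)" by (simp add: split)
      then have "t / 2 < cmod (?T S1 x) \<or> t / 2 < cmod (?T S2 x)" using norm_triangle_ineq[of "?T S1 x" "?T S2 x"] by linarith
      then show "x \<in> {x. t / 2 < cmod (?T S1 x)} \<union> {x. t / 2 < cmod (?T S2 x)}" by simp
    qed
  qed (intro sets.Un m)
  also have "\<dots> \<le> emeasure lborel {x. t / 2 < cmod (?T S1 x)} + emeasure lborel {x. t / 2 < cmod (?T S2 x)}"
    by (intro emeasure_subadditive m)
  also have "\<dots> \<le> ennreal (cz_weak * h / (t / 2) * (\<Sum>i\<in>S1. cmod (c i))) + ennreal (A * h * (\<Sum>i\<in>S2. (cmod (c i))\<^sup>2) / (t / 2) powr 2)"
  proof (rule add_mono)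
    show "emeasure lborel {x. t / 2 < cmod (?T S1 x)} \<le> ennreal (cz_weak * h / (t / 2) * (\<Sum>i\<in>S1. cmod (c i)))"
      using weak_type[OF fin(1), of "t/2" c] t unfolding cz_weak_def by simp
    have "emeasure lborel {x \<in> UNIV. t / 2 < cmod (?T S2 x)} \<le> ennreal (A * h * (\<Sum>i\<in>S2. (cmod (c i))\<^sup>2) / (t / 2) powr 2)"
      using t AH h L2[OF fin(2), of c] by (intro Markov_lborel) (auto simp: powr_numeral sum_nonneg)
    then show "emeasure lborel {x. t / 2 < cmod (?T S2 x)} \<le> ennreal (A * h * (\<Sum>i\<in>S2. (cmod (c i))\<^sup>2) / (t / 2) powr 2)" by simp
  qed
  also have "\<dots> = ennreal (\<Sum>i\<in>S1. 2 * cz_weak * h * cmod (c i) * (1 / t)) + ennreal (\<Sum>i\<in>S2. 4 * A * h * (cmod (c i))\<^sup>2 * (1 / t\<^sup>2))"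
    using t by (simp add: powr_numeral power_divide sum_distrib_left sum_divide_distrib mult_ac)
  also have "\<dots> = (\<Sum>i\<in>S1. ennreal (2 * cz_weak * h * cmod (c i)) * ennreal (1 / t)) + (\<Sum>i\<in>S2. ennreal (4 * A * h * (cmod (c i))\<^sup>2) * ennreal (1 / t\<^sup>2))"
    using t w0 AH h by (intro arg_cong2[where f="(+)"] sum_ennreal_mult[symmetric]) auto
  also have "(\<Sum>i\<in>S1. ennreal (2 * cz_weak * h * cmod (c i)) * ennreal (1 / t)) =
     (\<Sum>i\<in>S. ennreal (2 * cz_weak * h * cmod (c i)) * (ennreal (1 / t) * indicator {0<..<cmod (c i)} t))"
    using S t by (intro sum.mono_neutral_cong_left) (auto simp: S1_def indicator_def)
  also have "(\<Sum>i\<in>S2. ennreal (4 * A * h * (cmod (c i))\<^sup>2) * ennreal (1 / t\<^sup>2)) =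
     (\<Sum>i\<in>S. ennreal (4 * A * h * (cmod (c i))\<^sup>2) * (ennreal (1 / t\<^sup>2) * indicator {cmod (c i)..} t))"
    using S t by (intro sum.mono_neutral_cong_left) (auto simp: S2_def indicator_def)
  finally show ?thesis by (simp add: sum.distrib)
qed

theorem strong_type:
  assumes S: "finite S" and p: "1 < p" "p < 2"
  shows "(\<integral>\<^sup>+x. ennreal (cmod (\<Sum>i\<in>S. c i * \<kappa> i x) powr p) \<partial>lborel) \<le> ennreal (cz_const p * h * (\<Sum>i\<in>S. cmod (c i) powr p))"
proof -
  \<comment> \<open>Zero coefficients are dropped because t^(p-3) is not integrable down to
    0.\<close>
  define S0 where "S0 = {i \<in> S. c i \<noteq> 0}"
  have fin: "finite S0" using S by (simp add: S0_def)
  have w0: "0 \<le> cz_weak" using AH by (simp add: cz_weak_def)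
  have eq: "(\<Sum>i\<in>S. c i * \<kappa> i x) = (\<Sum>i\<in>S0. c i * \<kappa> i x)" for x
    using S by (intro sum.mono_neutral_right) (auto simp: S0_def)
  let ?F = "\<lambda>x. cmod (\<Sum>i\<in>S0. c i * \<kappa> i x)"
  have "(\<integral>\<^sup>+x. ennreal (?F x powr p) \<partial>lborel) =
     (\<integral>\<^sup>+t. ennreal (p * t powr (p - 1)) * indicator {0<..} t * emeasure lborel {x. t < ?F x} \<partial>lborel)"
    using p by (intro layer_cake) auto
  also have "\<dots> \<le> (\<integral>\<^sup>+t. (\<Sum>i\<in>S0. ennreal (2 * cz_weak * h * cmod (c i) * p) * (ennreal (t powr (p - 2)) * indicator {0<..<cmod (c i)} t) +
      ennreal (4 * A * h * (cmod (c i))\<^sup>2 * p) * (ennreal (t powr (p - 3)) * indicator {cmod (c i)..} t)) \<partial>lborel)"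
  proof (rule nn_integral_mono)
    fix t :: real
    show "ennreal (p * t powr (p - 1)) * indicator {0<..} t * emeasure lborel {x. t < ?F x} \<le>
      (\<Sum>i\<in>S0. ennreal (2 * cz_weak * h * cmod (c i) * p) * (ennreal (t powr (p - 2)) * indicator {0<..<cmod (c i)} t) +
      ennreal (4 * A * h * (cmod (c i))\<^sup>2 * p) * (ennreal (t powr (p - 3)) * indicator {cmod (c i)..} t))"
    proof (cases "0 < t")
      case True
      have e1: "ennreal (p * t powr (p - 1)) * (ennreal a * (ennreal (1 / t) * I)) = ennreal (a * p) * (ennreal (t powr (p - 2)) * I)"
        if "0 \<le> a" for a I
      proof -
        have "t powr (p - 2) = t powr (p - 1) * (1 / t)" using True powr_diff[of t "p - 1" 1] by simp
        then have "ennreal (t powr (p - 2)) = ennreal (t powr (p - 1)) * ennreal (1 / t)"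
          using True by (simp add: ennreal_mult[symmetric])
        then show ?thesis using that p by (simp add: ennreal_mult mult_ac)
      qed
      have e2: "ennreal (p * t powr (p - 1)) * (ennreal a * (ennreal (1 / t\<^sup>2) * I)) = ennreal (a * p) * (ennreal (t powr (p - 3)) * I)"
        if "0 \<le> a" for a I
      proof -
        have "t powr (p - 3) = t powr (p - 1) * (1 / t\<^sup>2)" using True powr_diff[of t "p - 1" 2] by (simp add: powr_numeral)
        then have "ennreal (t powr (p - 3)) = ennreal (t powr (p - 1)) * ennreal (1 / t\<^sup>2)"
          using True by (simp add: ennreal_mult[symmetric])
        then show ?thesis using that p by (simp add: ennreal_mult mult_ac)
      qed
      have "ennreal (p * t powr (p - 1)) * emeasure lborel {x. t < ?F x} \<le> ennreal (p * t powr (p - 1)) *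
        (\<Sum>i\<in>S0. ennreal (2 * cz_weak * h * cmod (c i)) * (ennreal (1 / t) * indicator {0<..<cmod (c i)} t) +
      ennreal (4 * A * h * (cmod (c i))\<^sup>2) * (ennreal (1 / t\<^sup>2) * indicator {cmod (c i)..} t))"
        by (intro mult_left_mono distribution_split fin True) simp
      also have "\<dots> = (\<Sum>i\<in>S0. ennreal (2 * cz_weak * h * cmod (c i) * p) * (ennreal (t powr (p - 2)) * indicator {0<..<cmod (c i)} t) +
      ennreal (4 * A * h * (cmod (c i))\<^sup>2 * p) * (ennreal (t powr (p - 3)) * indicator {cmod (c i)..} t))"
        unfolding sum_distrib_left distrib_left using w0 AH h by (intro sum.cong refl arg_cong2[where f="(+)"] e1 e2) auto
      finally show ?thesis using True by simp
    qed simp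
  qed
  also have "\<dots> = (\<Sum>i\<in>S0. ennreal (2 * cz_weak * h * cmod (c i) * p) * (\<integral>\<^sup>+t. ennreal (t powr (p - 2)) * indicator {0<..<cmod (c i)} t \<partial>lborel) +
      ennreal (4 * A * h * (cmod (c i))\<^sup>2 * p) * (\<integral>\<^sup>+t. ennreal (t powr (p - 3)) * indicator {cmod (c i)..} t \<partial>lborel))"
    by (simp add: nn_integral_sum nn_integral_add nn_integral_cmult)
  also have "\<dots> = (\<Sum>i\<in>S0. ennreal (cz_const p * h * cmod (c i) powr p))"
  proof (rule sum.cong[OF refl])
    fix i assume i: "i \<in> S0"
    then have c: "0 < cmod (c i)" by (simp add: S0_def)
    have i1: "(\<integral>\<^sup>+t. ennreal (t powr (p - 2)) * indicator {0<..<cmod (c i)} t \<partial>lborel) = ennreal (cmod (c i) powr (p - 1) / (p - 1))"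
      using nn_integral_powr_below[of "p - 2" "cmod (c i)"] p by simp
    have i2: "(\<integral>\<^sup>+t. ennreal (t powr (p - 3)) * indicator {cmod (c i)..} t \<partial>lborel) = ennreal (cmod (c i) powr (p - 2) / (2 - p))"
    proof -
      have "- (cmod (c i) powr (p - 3 + 1)) / (p - 3 + 1) = cmod (c i) powr (p - 2) / (2 - p)" using p by (simp add: field_simps)
      then show ?thesis using nn_integral_powr_above[of "p - 3" "cmod (c i)"] p c by simp
    qed
    have q1: "cmod (c i) * cmod (c i) powr (p - 1) = cmod (c i) powr p" using c powr_add[of "cmod (c i)" 1 "p - 1"] by simp
    have q2: "(cmod (c i))\<^sup>2 * cmod (c i) powr (p - 2) = cmod (c i) powr p" using c powr_add[of "cmod (c i)" 2 "p - 2"] by (simp add: powr_numeral)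
    have "ennreal (2 * cz_weak * h * cmod (c i) * p) * ennreal (cmod (c i) powr (p - 1) / (p - 1)) +
      ennreal (4 * A * h * (cmod (c i))\<^sup>2 * p) * ennreal (cmod (c i) powr (p - 2) / (2 - p)) =
      ennreal (2 * cz_weak * h * p / (p - 1) * (cmod (c i) * cmod (c i) powr (p - 1)) + 4 * A * h * p / (2 - p) * ((cmod (c i))\<^sup>2 * cmod (c i) powr (p - 2)))"
      using w0 AH h p by (simp add: ennreal_mult[symmetric] ennreal_plus[symmetric] mult_ac del: ennreal_plus)
    also have "\<dots> = ennreal (cz_const p * h * cmod (c i) powr p)"
      unfolding q1 q2 cz_const_def by (simp add: algebra_simps)
    finally show "ennreal (2 * cz_weak * h * cmod (c i) * p) * (\<integral>\<^sup>+t. ennreal (t powr (p - 2)) * indicator {0<..<cmod (c i)} t \<partial>lborel) +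
      ennreal (4 * A * h * (cmod (c i))\<^sup>2 * p) * (\<integral>\<^sup>+t. ennreal (t powr (p - 3)) * indicator {cmod (c i)..} t \<partial>lborel) =
      ennreal (cz_const p * h * cmod (c i) powr p)" unfolding i1 i2 .
  qed
  also have "\<dots> = ennreal (\<Sum>i\<in>S0. cz_const p * h * cmod (c i) powr p)"
    using cz_const_nonneg[OF p] h by (intro sum_ennreal) auto
  also have "(\<Sum>i\<in>S0. cz_const p * h * cmod (c i) powr p) = cz_const p * h * (\<Sum>i\<in>S0. cmod (c i) powr p)"
    by (simp add: sum_distrib_left)
  also have "(\<Sum>i\<in>S0. cmod (c i) powr p) = (\<Sum>i\<in>S. cmod (c i) powr p)"
    using S by (intro sum.mono_neutral_left) (auto simp: S0_def)
  finally show ?thesis unfolding eq .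
qed

end

declare cis_lin_measurable [measurable del] id_lebesgue [measurable del]

section \<open>From convolution kernels to multipliers on L^p\<close>

lemma lbd_sum:
  assumes T: "lbd r (Lr r) T C" and r: "1 \<le> r" and S: "finite S" and f: "\<And>i. i \<in> S \<Longrightarrow> f i \<in> Lr r"
  shows "AE x in lebesgue. T (\<lambda>x. \<Sum>i\<in>S. c i * f i x) x = (\<Sum>i\<in>S. c i * T (f i) x)"
  using S f
proof (induction S rule: finite_induct)
  case empty
  have "AE x in lebesgue. T (\<lambda>x. 0 * (0::complex)) x = 0 * T (\<lambda>x. 0) x"
    using lbd_cmult[OF T Lr_zero Lr_zero, of 0] r by simp
  then show ?case by simp
next
  case (insert i S)
  have "(\<lambda>x. \<Sum>i\<in>S. c i * f i x) \<in> Lr r" using insert r by (intro Lr_sum Lr_cmult) auto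
  from lbdD(2)[OF T this insert.prems[of i], of "c i"]
  have "AE x in lebesgue. T (\<lambda>x. (\<Sum>i\<in>S. c i * f i x) + c i * f i x) x = T (\<lambda>x. \<Sum>i\<in>S. c i * f i x) x + c i * T (f i) x" by simp
  moreover have "AE x in lebesgue. T (\<lambda>x. \<Sum>i\<in>S. c i * f i x) x = (\<Sum>i\<in>S. c i * T (f i) x)"
    using insert by simp
  ultimately have "AE x in lebesgue. T (\<lambda>x. (\<Sum>i\<in>S. c i * f i x) + c i * f i x) x = (\<Sum>i\<in>S. c i * T (f i) x) + c i * T (f i) x"
    by eventually_elim simp
  moreover have "(\<Sum>i\<in>insert i S. g i) = (\<Sum>i\<in>S. g i) + g i" for g :: "'a \<Rightarrow> complex"
    unfolding sum.insert[OF insert(1,2)] by (rule add.commute)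
  ultimately show ?case by simp
qed

text \<open>The inverse Fourier transform in the unit \<open>k\<close>, scaled for convolution: |k|
  / (2 * pi) is the product of the normalising constants of the transform and its inverse.\<close>

definition kernel :: "real \<Rightarrow> (real \<Rightarrow> complex) \<Rightarrow> real \<Rightarrow> complex"
  where "kernel k m x = of_real (\<bar>k\<bar> / (2 * pi)) * (LINT \<omega>|lborel. m \<omega> * cis (k * \<omega> * x))"

lemma kernel_measurable [measurable]:
  assumes [measurable]: "m \<in> borel_measurable borel" shows "kernel k m \<in> borel_measurable borel"
  unfolding kernel_def[abs_def] by measurable

text \<open>The multiplier acts on an interval as convolution with its kernel. Integrability of
  \<open>m\<close> makes the inverse transform an ordinary integral and permits Fubini.\<close>

lemma mult_interval_kernel:
  assumes k: "k \<noteq> 0" and m: "integrable lborel m" "bm B m" and lr: "l < r"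
  shows "AE x in lebesgue. mult k m (indicator {l..<r}) x = (LINT y|lborel. indicator {l..<r} y * kernel k m (x - y))"
proof -
  have [measurable]: "m \<in> borel_measurable borel" using borel_measurable_integrable[OF m(1)] by simp
  let ?I = "indicator {l..<r} :: real \<Rightarrow> complex"
  let ?\<kappa> = "complex_of_real (sqrt (\<bar>k\<bar> / (2 * pi)))"
  let ?g = "\<lambda>\<omega>. m \<omega> * FT k ?I \<omega>"
  have I2: "?I \<in> Lr 2" "?I \<in> Lr 1" by (rule interval_Lr)+
  have k': "- k \<noteq> 0" using k by simp
  have g2: "?g \<in> Lr 2" by (intro bm_L2[OF m(2)] FT_interval_L2 k lr)
  have [measurable]: "FT k ?I \<in> borel_measurable borel" unfolding FT_interval[abs_def] by measurable
  have g1: "?g \<in> Lr 1"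
  proof -
    have "integrable lborel ?g"
    proof (rule Bochner_Integration.integrable_bound[where f="\<lambda>\<omega>. of_real (cmod ?\<kappa> * (r - l)) * m \<omega>"])
      show "AE \<omega> in lborel. norm (?g \<omega>) \<le> norm (of_real (cmod ?\<kappa> * (r - l)) * m \<omega>)"
      proof (rule AE_I2)
        fix \<omega>
        define q where "q = cmod ?\<kappa> * (r - l)"
        have q: "0 \<le> q" using lr by (simp add: q_def)
        have "cmod (FT k ?I \<omega>) \<le> q"
          unfolding FT_interval norm_mult q_def using lr by (intro mult_left_mono cint_bound1) auto
        then show "norm (?g \<omega>) \<le> norm (of_real (cmod ?\<kappa> * (r - l)) * m \<omega>)"
          unfolding q_def[symmetric] norm_mult
          using q mult_right_mono[of "cmod (FT k ?I \<omega>)" q "cmod (m \<omega>)"] by (simp add: mult.commute)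
      qed
    qed (use m in auto)
    then have "integrable lebesgue ?g" by (simp add: integrable_completion)
    then show ?thesis by (simp add: Lr_1_integrable)
  qed
  have e1: "AE x in lebesgue. FF (-k) (\<lambda>\<omega>. m \<omega> * FF k ?I \<omega>) x = FF (-k) ?g x"
  proof (rule lbd_cong_AE[OF FF_lbd[OF k']])
    show "AE \<omega> in lebesgue. m \<omega> * FF k ?I \<omega> = ?g \<omega>" using FF_eq_FT[OF k I2(2,1)] by eventually_elim simp
  qed (auto intro!: bm_L2[OF m(2)] FF_L2 k I2 g2)
  have e2: "AE x in lebesgue. FF (-k) ?g x = FT (-k) ?g x" by (rule FF_eq_FT[OF k' g1 g2])
  have e3: "FT (-k) ?g x = (LINT y|lborel. ?I y * kernel k m (x - y))" for x
  proof -
    let ?f = "\<lambda>\<omega> y. ?I y * (m \<omega> * cis (k * \<omega> * (x - y)))"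
    have sq: "?\<kappa> * ?\<kappa> = of_real (\<bar>k\<bar> / (2 * pi))"
      unfolding of_real_mult[symmetric] by simp
    have "FT (-k) ?g x = ?\<kappa> * (LINT \<omega>|lborel. ?g \<omega> * cis (k * \<omega> * x))"
      unfolding FT_def[of "-k"] by (subst integral_completion) (auto simp: mult_ac)
    also have "(LINT \<omega>|lborel. ?g \<omega> * cis (k * \<omega> * x)) = (LINT \<omega>|lborel. ?\<kappa> * (LINT y|lborel. ?f \<omega> y))"
    proof (rule Bochner_Integration.integral_cong[OF refl])
      fix \<omega>
      have "?\<kappa> * (LINT y|lborel. ?f \<omega> y) = ?\<kappa> * (LINT y|lborel. (?I y * cis (- (k * \<omega> * y))) * (m \<omega> * cis (k * \<omega> * x)))"
      proof -
        have "cis (k * \<omega> * (x - y)) = cis (- (k * \<omega> * y)) * cis (k * \<omega> * x)" for y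
          unfolding cis_mult by (simp add: algebra_simps)
        then show ?thesis by (simp add: mult_ac)
      qed
      also have "\<dots> = ?\<kappa> * (cint l r (k * \<omega>) * (m \<omega> * cis (k * \<omega> * x)))"
        unfolding cint_def by simp
      also have "\<dots> = ?g \<omega> * cis (k * \<omega> * x)" by (simp add: FT_interval)
      finally show "?g \<omega> * cis (k * \<omega> * x) = ?\<kappa> * (LINT y|lborel. ?f \<omega> y)" by simp
    qed
    also have "\<dots> = ?\<kappa> * (LINT \<omega>|lborel. (LINT y|lborel. ?f \<omega> y))" by simp
    also have "(LINT \<omega>|lborel. (LINT y|lborel. ?f \<omega> y)) = (LINT y|lborel. (LINT \<omega>|lborel. ?f \<omega> y))"
    proof (rule lborel_pair.Fubini_integral[symmetric])
      show "integrable (lborel \<Otimes>\<^sub>M lborel) (\<lambda>(\<omega>, y). ?f \<omega> y)"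
      proof (rule integrableI_bounded)
        have "(\<integral>\<^sup>+z. ennreal (norm (case z of (\<omega>, y) \<Rightarrow> ?f \<omega> y)) \<partial>(lborel \<Otimes>\<^sub>M lborel)) =
          (\<integral>\<^sup>+\<omega>. \<integral>\<^sup>+y. ennreal (norm (?f \<omega> y)) \<partial>lborel \<partial>lborel)"
          by (subst lborel.nn_integral_fst[symmetric]) auto
        also have "\<dots> = (\<integral>\<^sup>+\<omega>. ennreal (cmod (m \<omega>)) * emeasure lborel {l..<r} \<partial>lborel)"
        proof (intro nn_integral_cong)
          fix \<omega>
          have "(\<integral>\<^sup>+y. ennreal (norm (?f \<omega> y)) \<partial>lborel) = (\<integral>\<^sup>+y. ennreal (cmod (m \<omega>)) * indicator {l..<r} y \<partial>lborel)"
            by (intro nn_integral_cong) (auto simp: norm_mult indicator_def)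
          then show "(\<integral>\<^sup>+y. ennreal (norm (?f \<omega> y)) \<partial>lborel) = ennreal (cmod (m \<omega>)) * emeasure lborel {l..<r}"
            by (simp add: nn_integral_cmult_indicator)
        qed
        also have "\<dots> = (\<integral>\<^sup>+\<omega>. ennreal (cmod (m \<omega>)) \<partial>lborel) * emeasure lborel {l..<r}"
          by (rule nn_integral_multc) measurable
        also have "\<dots> < \<infinity>" using m(1) lr by (simp add: integrable_iff_bounded ennreal_mult_less_top)
        finally show "(\<integral>\<^sup>+z. ennreal (norm (case z of (\<omega>, y) \<Rightarrow> ?f \<omega> y)) \<partial>(lborel \<Otimes>\<^sub>M lborel)) < \<infinity>" .
      qed measurable
    qed
    also have "(LINT y|lborel. (LINT \<omega>|lborel. ?f \<omega> y)) = (LINT y|lborel. ?I y * (LINT \<omega>|lborel. m \<omega> * cis (k * \<omega> * (x - y))))"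
      by (simp only: Bochner_Integration.integral_mult_right_zero)
    also have "?\<kappa> * (?\<kappa> * (LINT y|lborel. ?I y * (LINT \<omega>|lborel. m \<omega> * cis (k * \<omega> * (x - y))))) = (LINT y|lborel. ?I y * kernel k m (x - y))"
      unfolding kernel_def mult.assoc[symmetric] sq
      unfolding mult.left_commute[of "?I _"] mult.assoc Bochner_Integration.integral_mult_right_zero[symmetric]
      by (intro Bochner_Integration.integral_cong refl)
    finally show ?thesis .
  qed
  from e1 e2 show ?thesis unfolding mult_def by eventually_elim (simp add: e3)
qed

text \<open>An instance of the discretised theory, with \<open>\<kappa> i\<close> the convolution of
  the kernel with the i-th cell. The constant depends on B, H and p alone, so it survives
  approximation by regularised multipliers whose pointwise kernel bounds \<open>M\<close> blow
  up.\<close>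

theorem CZ_multiplier:
  assumes k: "k \<noteq> 0" and m: "integrable lborel m" "bm B m" and p: "1 < p" "p < 2" and H: "0 \<le> H"
    and Kb: "\<And>x. cmod (kernel k m x) \<le> M"
    and Hor: "\<And>y. (\<integral>\<^sup>+x. ennreal (cmod (kernel k m (x - y) - kernel k m x)) * indicator {x. 2 * \<bar>y\<bar> \<le> \<bar>x\<bar>} x \<partial>lborel) \<le> ennreal H"
  shows "Lmult k p m ((2 * (8 * B\<^sup>2 + 6 + 4 * H) * p / (p - 1) + 4 * B\<^sup>2 * p / (2 - p)) powr (1 / p))"
proof (rule Lmult_stepfsI[OF k m(2)])
  let ?K = "kernel k m"
  have [measurable]: "m \<in> borel_measurable borel" using borel_measurable_integrable[OF m(1)] by simp
  have B: "0 \<le> B" by (rule bm_nonneg[OF m(2)])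
  fix u :: "real \<Rightarrow> complex" assume "u \<in> stepfs"
  then obtain n c where u: "u = stepf ((1/2)^n) c" and fin: "finite {i. c i \<noteq> 0}" by (auto simp: stepfs_def)
  define h :: real where "h = (1/2)^n"
  have h: "0 < h" by (simp add: h_def)
  define I where "I i = {of_int i * h ..< (of_int i + 1) * h}" for i :: int
  define \<kappa> where "\<kappa> i x = (LINT y|lborel. indicator (I i) y * ?K (x - y))" for i :: int and x
  have [measurable]: "\<kappa> i \<in> borel_measurable borel" for i unfolding \<kappa>_def[abs_def] I_def by measurable
  have Ilt: "of_int i * h < (of_int i + 1) * h" for i :: int using h by (simp add: algebra_simps)
  have mult_eq: "AE x in lebesgue. mult k m (\<lambda>x. \<Sum>i\<in>S. c i * indicator (I i) x) x = (\<Sum>i\<in>S. c i * \<kappa> i x)" if "finite S" for S c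
  proof -
    have "AE x in lebesgue. mult k m (indicator (I i)) x = \<kappa> i x" for i
      unfolding \<kappa>_def I_def by (rule mult_interval_kernel[OF k m Ilt])
    then have "AE x in lebesgue. \<forall>i\<in>S. mult k m (indicator (I i)) x = \<kappa> i x" using that by (intro AE_finite_allI) auto
    moreover have "AE x in lebesgue. mult k m (\<lambda>x. \<Sum>i\<in>S. c i * indicator (I i) x) x = (\<Sum>i\<in>S. c i * mult k m (indicator (I i)) x)"
      by (rule lbd_sum[OF mult_lbd[OF k m(2)] _ that]) (auto simp: I_def interval_Lr)
    ultimately show ?thesis by eventually_elim simp
  qed
  have step_eq: "(\<lambda>x. \<Sum>i\<in>S. c i * indicator (I i) x) = stepf h (\<lambda>i. if i \<in> S then c i else 0)" if "finite S" for S c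
  proof
    fix x
    have "stepf h (\<lambda>i. if i \<in> S then c i else 0) x = (\<Sum>i\<in>S. (if i \<in> S then c i else 0) * indicator {of_int i * h ..< (of_int i + 1) * h} x)"
      by (rule stepf_eq_sum[OF that _ h]) auto
    then show "(\<Sum>i\<in>S. c i * indicator (I i) x) = stepf h (\<lambda>i. if i \<in> S then c i else 0) x" by (simp add: I_def)
  qed
  have En_eq: "En q (mult k m (\<lambda>x. \<Sum>i\<in>S. c i * indicator (I i) x)) = (\<integral>\<^sup>+x. ennreal (cmod (\<Sum>i\<in>S. c i * \<kappa> i x) powr q) \<partial>lborel)" if "finite S" for S c q
  proof -
    have "En q (mult k m (\<lambda>x. \<Sum>i\<in>S. c i * indicator (I i) x)) = En q (\<lambda>x. \<Sum>i\<in>S. c i * \<kappa> i x)"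
      using mult_eq[OF that, of c] by (intro En_cong_AE) (elim eventually_mono, simp)
    then show ?thesis by (simp add: En_def nn_integral_completion)
  qed
  interpret cz_operator \<kappa> h "B\<^sup>2" H
  proof
    fix S :: "int set" and c assume S: "finite S"
    have L: "(\<lambda>x. \<Sum>i\<in>S. c i * indicator (I i) x) \<in> Lr 2"
      unfolding I_def by (intro Lr_sum Lr_cmult interval_Lr) auto
    have e2: "En 2 (stepf h (\<lambda>i. if i \<in> S then c i else 0)) = ennreal (h * (\<Sum>i\<in>S. (cmod (c i))\<^sup>2))"
    proof -
      have sub: "{i. (if i \<in> S then c i else 0) \<noteq> 0} \<subseteq> S" by auto
      show ?thesis using En_stepf[OF S sub h, of 2] by (simp add: powr_numeral)
    qed
    have "(\<integral>\<^sup>+x. ennreal ((cmod (\<Sum>i\<in>S. c i * \<kappa> i x))\<^sup>2) \<partial>lborel) = En 2 (mult k m (\<lambda>x. \<Sum>i\<in>S. c i * indicator (I i) x))"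
      unfolding En_eq[OF S] by (simp add: powr_numeral)
    also have "\<dots> \<le> ennreal_powr (ennreal B * Lr_norm 2 (\<lambda>x. \<Sum>i\<in>S. c i * indicator (I i) x)) 2"
      by (subst En_Lr_norm) (auto intro!: ennreal_powr_mono lbdD(5)[OF mult_lbd[OF k m(2)]] L)
    also have "\<dots> = ennreal (B powr 2) * En 2 (stepf h (\<lambda>i. if i \<in> S then c i else 0))"
      using B by (simp add: ennreal_powr_mult step_eq[OF S] En_Lr_norm)
    also have "\<dots> = ennreal (B\<^sup>2 * h * (\<Sum>i\<in>S. (cmod (c i))\<^sup>2))"
      unfolding e2 using B h by (simp add: ennreal_mult[symmetric] sum_nonneg powr_numeral mult.assoc)
    finally show "(\<integral>\<^sup>+x. ennreal ((cmod (\<Sum>i\<in>S. c i * \<kappa> i x))\<^sup>2) \<partial>lborel) \<le> ennreal (B\<^sup>2 * h * (\<Sum>i\<in>S. (cmod (c i))\<^sup>2))" .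
  next
    fix l r i :: int assume i: "l \<le> i" "i < r"
    let ?V = "{x. 3 * (real_of_int r - real_of_int l) * h \<le> \<bar>x - real_of_int l * h\<bar>}"
    have Vm: "?V \<in> sets borel" by (intro borel_closed closed_Collect_le continuous_intros)
    \<comment> \<open>Moving every cell to [0, h) bounds the difference of two images by an integral
      over y in [0, h) of kernel differences with one common shift (i - l) * h.\<close>
    have shift: "\<kappa> j x = (LINT y|lborel. indicator {0..<h} y * ?K (x - j * h - y))" for j x
    proof -
      have "\<kappa> j x = (LINT y|lborel. indicator (I j) (of_int j * h + 1 * y) * ?K (x - (of_int j * h + 1 * y)))"
        unfolding \<kappa>_def by (subst lborel_integral_real_affine[of 1 _ "of_int j * h"]) auto
      also have "\<dots> = (LINT y|lborel. indicator {0..<h} y * ?K (x - j * h - y))"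
        by (intro Bochner_Integration.integral_cong) (auto simp: I_def indicator_def algebra_simps)
      finally show ?thesis .
    qed
    have int: "integrable lborel (\<lambda>y. indicator {0..<h} y * ?K (z - y))" for z
    proof (rule integrableI_bounded_set[where A="{0..<h}" and B=M])
      show "emeasure lborel {0..<h} < \<infinity>" using h by simp
    qed (use Kb in \<open>auto simp: norm_mult indicator_def\<close>)
    have pt: "ennreal (cmod (\<kappa> i x - \<kappa> l x)) \<le> (\<integral>\<^sup>+y. ennreal (cmod (?K (x - i * h - y) - ?K (x - l * h - y))) * indicator {0..<h} y \<partial>lborel)" for x
    proof -
      have "\<kappa> i x - \<kappa> l x = (LINT y|lborel. indicator {0..<h} y * ?K (x - i * h - y) - indicator {0..<h} y * ?K (x - l * h - y))"
        unfolding shift by (rule Bochner_Integration.integral_diff[symmetric]) (rule int)+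
      then have "ennreal (cmod (\<kappa> i x - \<kappa> l x)) \<le> (\<integral>\<^sup>+y. ennreal (norm (indicator {0..<h} y * ?K (x - i * h - y) - indicator {0..<h} y * ?K (x - l * h - y))) \<partial>lborel)"
        using integral_norm_bound_ennreal[OF Bochner_Integration.integrable_diff[OF int int], of "x - i * h" "x - l * h"] by simp
      also have "\<dots> = (\<integral>\<^sup>+y. ennreal (cmod (?K (x - i * h - y) - ?K (x - l * h - y))) * indicator {0..<h} y \<partial>lborel)"
        by (intro nn_integral_cong) (auto simp: indicator_def)
      finally show ?thesis .
    qed
    have "(\<integral>\<^sup>+x. ennreal (cmod (\<kappa> i x - \<kappa> l x)) * indicator ?V x \<partial>lborel) \<le>
      (\<integral>\<^sup>+x. (\<integral>\<^sup>+y. ennreal (cmod (?K (x - i * h - y) - ?K (x - l * h - y))) * indicator {0..<h} y * indicator ?V x \<partial>lborel) \<partial>lborel)"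
      using pt by (intro nn_integral_mono) (simp add: nn_integral_multc mult_right_mono)
    also have "\<dots> = (\<integral>\<^sup>+y. (\<integral>\<^sup>+x. ennreal (cmod (?K (x - i * h - y) - ?K (x - l * h - y))) * indicator {0..<h} y * indicator ?V x \<partial>lborel) \<partial>lborel)"
      using Vm by (intro lborel_pair.Fubini'[symmetric]) measurable
    also have "\<dots> \<le> (\<integral>\<^sup>+y. ennreal H * indicator {0..<h} y \<partial>lborel)"
    proof (rule nn_integral_mono)
      fix y :: real
      show "(\<integral>\<^sup>+x. ennreal (cmod (?K (x - i * h - y) - ?K (x - l * h - y))) * indicator {0..<h} y * indicator ?V x \<partial>lborel) \<le> ennreal H * indicator {0..<h} y"
      proof (cases "y \<in> {0..<h}")
        case True
        let ?s = "(i - l) * h"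
        have "(\<integral>\<^sup>+x. ennreal (cmod (?K (x - i * h - y) - ?K (x - l * h - y))) * indicator {0..<h} y * indicator ?V x \<partial>lborel)
          = (\<integral>\<^sup>+x. ennreal (cmod (?K (x - i * h - y) - ?K (x - l * h - y))) * indicator ?V x \<partial>lborel)" using True by simp
        also have "\<dots> = (\<integral>\<^sup>+x. ennreal (cmod (?K ((l * h + y) + 1 * x - i * h - y) - ?K ((l * h + y) + 1 * x - l * h - y))) * indicator ?V ((l * h + y) + 1 * x) \<partial>lborel)"
          using Vm by (subst nn_integral_real_affine[where c=1 and t="l * h + y"]) auto
        also have "\<dots> \<le> (\<integral>\<^sup>+x. ennreal (cmod (?K (x - ?s) - ?K x)) * indicator {x. 2 * \<bar>?s\<bar> \<le> \<bar>x\<bar>} x \<partial>lborel)"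
        proof (rule nn_integral_mono)
          fix x
          have e: "(l * h + y) + 1 * x - i * h - y = x - ?s" "(l * h + y) + 1 * x - l * h - y = x" by (simp_all add: algebra_simps)
          have "x \<in> {x. 2 * \<bar>?s\<bar> \<le> \<bar>x\<bar>}" if "(l * h + y) + 1 * x \<in> ?V"
          proof -
            \<comment> \<open>Here the factor 3 is spent: 0 <= y < h <= (r - l) * h costs one length
              of the interval, and twice the shift remains below |x|.\<close>
            have a: "3 * (real_of_int r - l) * h \<le> \<bar>y + x\<bar>" using that by simp
            have "(real_of_int i - l) * h \<le> (real_of_int r - l) * h" using i h by (intro mult_right_mono) auto
            moreover have "h \<le> (real_of_int r - l) * h"
            proof -
              have "1 \<le> real_of_int r - l" using i by linarith
              then show ?thesis using h mult_right_mono[of 1 "real_of_int r - l" h] by simp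
            qed
            moreover have "0 \<le> (real_of_int i - l) * h" using i h by simp
            moreover have "3 * ((real_of_int r - l) * h) \<le> \<bar>y + x\<bar>" using a by (simp only: mult.assoc)
            moreover have "0 \<le> y" "y < h" using True by auto
            ultimately have "2 * ((real_of_int i - l) * h) \<le> \<bar>x\<bar>" by linarith
            then show ?thesis using \<open>0 \<le> (real_of_int i - l) * h\<close> by simp
          qed
          then show "ennreal (cmod (?K ((l * h + y) + 1 * x - i * h - y) - ?K ((l * h + y) + 1 * x - l * h - y))) * indicator ?V ((l * h + y) + 1 * x) \<le>
            ennreal (cmod (?K (x - ?s) - ?K x)) * indicator {x. 2 * \<bar>?s\<bar> \<le> \<bar>x\<bar>} x"
            unfolding e by (auto simp: indicator_def)
        qed
        also have "\<dots> \<le> ennreal H" by (rule Hor)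
        finally show ?thesis using True by simp
      qed simp
    qed
    also have "\<dots> = ennreal (H * h)" using h H by (simp add: nn_integral_cmult_indicator ennreal_mult)
    finally show "(\<integral>\<^sup>+x. ennreal (cmod (\<kappa> i x - \<kappa> l x)) * indicator ?V x \<partial>lborel) \<le> ennreal (H * h)" .
  qed (use h H in auto)
  let ?S = "{i. c i \<noteq> 0}"
  have u_eq: "u = (\<lambda>x. \<Sum>i\<in>?S. c i * indicator (I i) x)"
    using stepf_eq_sum[OF fin order_refl h] by (simp add: u I_def h_def fun_eq_iff)
  have "En p (mult k m u) \<le> ennreal (cz_const p * h * (\<Sum>i\<in>?S. cmod (c i) powr p))"
    unfolding u_eq En_eq[OF fin] by (rule strong_type[OF fin p])
  also have "\<dots> = ennreal (cz_const p) * En p u"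
    unfolding u h_def[symmetric] En_stepf[OF fin order_refl h] using cz_const_nonneg[OF p] h
    by (simp add: ennreal_mult[symmetric] sum_nonneg mult.assoc)
  finally have "ennreal_powr (En p (mult k m u)) (1/p) \<le> ennreal_powr (ennreal (cz_const p) * En p u) (1/p)"
    using p by (intro ennreal_powr_mono) auto
  then have "Lr_norm p (mult k m u) \<le> ennreal (cz_const p powr (1/p)) * Lr_norm p u"
    using cz_const_nonneg[OF p] by (simp add: Lr_norm_En ennreal_powr_mult)
  then show "Lr_norm p (mult k m u) \<le> ennreal ((2 * (8 * B\<^sup>2 + 6 + 4 * H) * p / (p - 1) + 4 * B\<^sup>2 * p / (2 - p)) powr (1 / p)) * Lr_norm p u"
    by (simp add: cz_const_def cz_weak_def)
qed (use p in simp)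

lemma norm_cis_diff_le: "cmod (cis a - cis b) \<le> \<bar>a - b\<bar>"
proof -
  have "cmod (cis a - cis b) = cmod (cis b * (cis (a - b) - 1))"
    by (simp add: right_diff_distrib cis_mult)
  also have "\<dots> = cmod (iexp (a - b) - 1)" by (simp add: norm_mult cis_conv_exp)
  also have "\<dots> \<le> \<bar>a - b\<bar>" using iexp_approx1[of "a - b" 0] by simp
  finally show ?thesis .
qed

lemma bm_indicator: "A \<in> sets lebesgue \<Longrightarrow> bm 1 (indicator A)"
  unfolding bm_def by (intro conjI borel_measurable_indicator) (auto simp: indicator_def)

section \<open>Half-line multipliers\<close>

text \<open>The indicator of the half-line is not integrable, so it is damped by an exponential. The
  damped kernel is explicit and its Hormander bound does not depend on d.\<close>

definition half :: "real \<Rightarrow> real \<Rightarrow> complex"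
  where "half d \<omega> = of_real (indicator {0<..} \<omega> * exp (- d * \<omega>))"

lemma half_measurable [measurable]: "half d \<in> borel_measurable borel"
  unfolding half_def[abs_def] by measurable

lemma half_bm: "0 \<le> d \<Longrightarrow> bm 1 (half d)"
  by (auto simp: bm_def half_def norm_mult indicator_def borel_imp_lebesgue)

lemma half_cis_integrable: 
  assumes "0 < d" shows "integrable lborel (\<lambda>\<omega>. half d \<omega> * cis (u * \<omega>))"
proof (rule integrableI_bounded)
  have "(\<integral>\<^sup>+\<omega>. ennreal (norm (half d \<omega> * cis (u * \<omega>))) \<partial>lborel) \<le> (\<integral>\<^sup>+\<omega>. ennreal (exp (- d * \<omega>)) * indicator {0..} \<omega> \<partial>lborel)"
    by (intro nn_integral_mono) (auto simp: half_def norm_mult indicator_def)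
  also have "\<dots> = ennreal (0 - (- exp (- d * 0) / d))"
  proof (rule nn_integral_FTC_atLeast)
    show "DERIV (\<lambda>\<omega>. - exp (- d * \<omega>) / d) \<omega> :> exp (- d * \<omega>)" for \<omega>
      using assms by (auto intro!: derivative_eq_intros)
    show "((\<lambda>\<omega>. - exp (- d * \<omega>) / d) \<longlongrightarrow> 0) at_top" using assms by real_asymp
  qed auto
  also have "\<dots> < \<infinity>" by simp
  finally show "(\<integral>\<^sup>+\<omega>. ennreal (norm (half d \<omega> * cis (u * \<omega>))) \<partial>lborel) < \<infinity>" .
qed measurable

lemma half_integrable: "0 < d \<Longrightarrow> integrable lborel (half d)"
  using half_cis_integrable[of d 0] by simp

lemma half_integral:
  assumes d: "0 < d" shows "(LINT \<omega>|lborel. half d \<omega> * cis (u * \<omega>)) = 1 / (of_real d - \<i> * of_real u)"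
proof -
  let ?z = "complex_of_real d - \<i> * of_real u"
  have z: "?z \<noteq> 0" using d by (auto simp: complex_eq_iff)
  have gen: "((\<lambda>w. - exp (- (w * z)) / z) has_field_derivative exp (- (w * z))) (at w)" if "z \<noteq> 0" for w z :: complex
    using that by (auto intro!: derivative_eq_intros)
  let ?F = "\<lambda>\<omega>::real. - exp (- (of_real \<omega> * ?z)) / ?z"
  let ?f = "\<lambda>\<omega>::real. exp (- (of_real \<omega> * ?z))"
  have f_eq: "?f \<omega> = of_real (exp (- d * \<omega>)) * cis (u * \<omega>)" for \<omega>
    by (simp add: cis_conv_exp exp_add[symmetric] exp_of_real[symmetric] algebra_simps)
  have seq: "(LINT \<omega>|lborel. indicator {0..real n} \<omega> *\<^sub>R ?f \<omega>) = ?F (real n) - ?F 0" for n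
  proof (rule integral_FTC_atLeastAtMost)
    show "(?F has_vector_derivative ?f \<omega>) (at \<omega> within {0..real n})" for \<omega>
    proof (rule has_vector_derivative_real_field)
      show "((\<lambda>w. - exp (- (w * ?z)) / ?z) has_field_derivative ?f \<omega>) (at (of_real \<omega>))"
        using gen[OF z] .
    qed
  qed (auto intro!: continuous_intros)
  have eq0: "(LINT \<omega>|lborel. indicator {0..real n} \<omega> *\<^sub>R ?f \<omega>) = (LINT \<omega>|lborel. indicator {..real n} \<omega> *\<^sub>R (half d \<omega> * cis (u * \<omega>)))" for n
  proof (rule integral_cong_AE)
    show "AE \<omega> in lborel. indicator {0..real n} \<omega> *\<^sub>R ?f \<omega> = indicator {..real n} \<omega> *\<^sub>R (half d \<omega> * cis (u * \<omega>))"
      using AE_lborel_singleton[of 0] by eventually_elim (auto simp: f_eq half_def indicator_def)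
  qed measurable
  have "(\<lambda>n. LINT \<omega>|lborel. indicator {..real n} \<omega> *\<^sub>R (half d \<omega> * cis (u * \<omega>))) \<longlonglongrightarrow> (LINT \<omega>|lborel. half d \<omega> * cis (u * \<omega>))"
  proof (rule integral_dominated_convergence[where w="\<lambda>\<omega>. norm (half d \<omega> * cis (u * \<omega>))"])
    show "AE \<omega> in lborel. (\<lambda>n. indicator {..real n} \<omega> *\<^sub>R (half d \<omega> * cis (u * \<omega>))) \<longlonglongrightarrow> half d \<omega> * cis (u * \<omega>)"
    proof (rule AE_I2, rule tendsto_eventually)
      fix \<omega> :: real
      show "\<forall>\<^sub>F n in sequentially. indicator {..real n} \<omega> *\<^sub>R (half d \<omega> * cis (u * \<omega>)) = half d \<omega> * cis (u * \<omega>)"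
        using eventually_ge_at_top[of "nat \<lceil>\<bar>\<omega>\<bar>\<rceil>"] by eventually_elim (auto simp: indicator_def; linarith)
    qed
  qed (use half_cis_integrable[OF d, of u] in \<open>auto simp: indicator_def\<close>)
  then have l1: "(\<lambda>n. ?F (real n) - ?F 0) \<longlonglongrightarrow> (LINT \<omega>|lborel. half d \<omega> * cis (u * \<omega>))"
    by (simp only: eq0[symmetric] seq)
  have "(\<lambda>n. ?F (real n)) \<longlonglongrightarrow> 0"
  proof (rule tendsto_norm_zero_cancel)
    have "(\<lambda>n. exp (- d * real n) / cmod ?z) \<longlonglongrightarrow> 0" using d by real_asymp
    then show "(\<lambda>n. norm (?F (real n))) \<longlonglongrightarrow> 0" by (simp add: norm_divide mult.commute)
  qed
  then have "(\<lambda>n. ?F (real n) - ?F 0) \<longlonglongrightarrow> 0 - ?F 0" by (intro tendsto_diff tendsto_const)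
  from LIMSEQ_unique[OF l1 this] show ?thesis by simp
qed

context
  fixes k :: real
  assumes k: "k \<noteq> 0"
begin

lemma half_kernel:
  assumes d: "0 < d" shows "kernel k (half d) x = of_real (\<bar>k\<bar> / (2 * pi)) / (of_real d - \<i> * of_real (k * x))"
  unfolding kernel_def using half_integral[OF d, of "k * x"] by (simp add: mult_ac)

lemma half_kernel_bound:
  assumes d: "0 < d" shows "cmod (kernel k (half d) x) \<le> \<bar>k\<bar> / (2 * pi) / d"
proof -
  have "d \<le> cmod (of_real d - \<i> * of_real (k * x))"
    using abs_Re_le_cmod[of "of_real d - \<i> * of_real (k * x)"] d by simp
  moreover have "cmod (complex_of_real (\<bar>k\<bar> / (2 * pi))) = \<bar>k\<bar> / (2 * pi)" unfolding norm_of_real by simp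
  ultimately show ?thesis
    unfolding half_kernel[OF d] norm_divide[of "complex_of_real (\<bar>k\<bar> / (2 * pi))"] using d by (intro frac_le) auto
qed

text \<open>The kernel is a multiple of 1 / (d - i*k*x). Two of its values differ by at most |y| /
  x^2 when 2|y| <= |x|, and 1 / x^2 has integral 1 / |y| over that region; so the bound is free of
  k, d and y.\<close>

lemma half_kernel_Hor:
  assumes d: "0 < d"
  shows "(\<integral>\<^sup>+x. ennreal (cmod (kernel k (half d) (x - y) - kernel k (half d) x)) * indicator {x. 2 * \<bar>y\<bar> \<le> \<bar>x\<bar>} x \<partial>lborel) \<le> ennreal 1"
proof (cases "y = 0")
  case False
  have "cmod (kernel k (half d) (x - y) - kernel k (half d) x) \<le> \<bar>y\<bar> * (1 / x\<^sup>2)" if x: "2 * \<bar>y\<bar> \<le> \<bar>x\<bar>" for x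
  proof -
    let ?z = "complex_of_real d - \<i> * of_real (k * x)" and ?w = "complex_of_real d - \<i> * of_real (k * (x - y))"
    let ?c = "complex_of_real (\<bar>k\<bar> / (2 * pi))"
    have nz: "?z \<noteq> 0" "?w \<noteq> 0" using d by (auto simp: complex_eq_iff)
    have gen: "c / w - c / z = c * (z - w) / (w * z)" if "w \<noteq> 0" "z \<noteq> 0" for c w z :: complex
      using that by (simp add: field_simps)
    have x0: "0 < \<bar>x\<bar>" using x False by linarith
    have xy: "\<bar>x\<bar> / 2 \<le> \<bar>x - y\<bar>" using x by linarith
    have bz: "\<bar>k\<bar> * \<bar>x\<bar> \<le> cmod ?z" using abs_Im_le_cmod[of ?z] by (simp add: abs_mult)
    have bw: "\<bar>k\<bar> * (\<bar>x\<bar> / 2) \<le> cmod ?w"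
    proof -
      have "\<bar>k\<bar> * (\<bar>x\<bar> / 2) \<le> \<bar>k\<bar> * \<bar>x - y\<bar>" using xy by (intro mult_left_mono) auto
      also have "\<dots> \<le> cmod ?w" using abs_Im_le_cmod[of ?w] by (simp add: abs_mult)
      finally show ?thesis .
    qed
    have "kernel k (half d) (x - y) - kernel k (half d) x = ?c * (?z - ?w) / (?w * ?z)"
      unfolding half_kernel[OF d] by (rule gen[OF nz(2,1)])
    also have "?z - ?w = - \<i> * of_real (k * y)" by (simp add: algebra_simps)
    finally have "cmod (kernel k (half d) (x - y) - kernel k (half d) x) = (\<bar>k\<bar> / (2 * pi)) * (\<bar>k\<bar> * \<bar>y\<bar>) / (cmod ?w * cmod ?z)"
      by (simp add: norm_mult norm_divide abs_mult)
    also have "\<dots> \<le> (\<bar>k\<bar> / (2 * pi)) * (\<bar>k\<bar> * \<bar>y\<bar>) / ((\<bar>k\<bar> * (\<bar>x\<bar> / 2)) * (\<bar>k\<bar> * \<bar>x\<bar>))"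
      using k x0 by (intro divide_left_mono mult_mono bw bz mult_pos_pos) (use nz in auto)
    also have "\<dots> = (1 / pi) * (\<bar>y\<bar> * (1 / x\<^sup>2))" using k x0 by (simp add: power2_eq_square)
    also have "\<dots> \<le> 1 * (\<bar>y\<bar> * (1 / x\<^sup>2))" using pi_gt3 by (intro mult_right_mono) auto
    finally show ?thesis by simp
  qed
  then have "(\<integral>\<^sup>+x. ennreal (cmod (kernel k (half d) (x - y) - kernel k (half d) x)) * indicator {x. 2 * \<bar>y\<bar> \<le> \<bar>x\<bar>} x \<partial>lborel)
     \<le> (\<integral>\<^sup>+x. ennreal \<bar>y\<bar> * (ennreal (1 / x\<^sup>2) * indicator {x. 2 * \<bar>y\<bar> \<le> \<bar>x\<bar>} x) \<partial>lborel)"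
    by (intro nn_integral_mono) (auto simp: indicator_def ennreal_mult[symmetric] ennreal_leI)
  also have "\<dots> = ennreal \<bar>y\<bar> * ennreal (2 / (2 * \<bar>y\<bar>))"
    using False by (subst nn_integral_cmult) (auto simp: nn_integral_inverse_square_tail)
  also have "\<dots> = ennreal 1" using False by (simp add: ennreal_mult[symmetric])
  finally show ?thesis .
qed simp

text \<open>Boundedness of the Riesz projection below 2: the damping 1 / (n + 1) is sent to 0 in
  \<open>CZ_multiplier\<close> with B = 1 and H = 1.\<close>

lemma half_line_Lmult_below:
  assumes p: "1 < p" "p < 2" shows "\<exists>C\<ge>0. Lmult k p (indicator {0<..}) C"
proof -
  define C where "C = (2 * (8 * 1\<^sup>2 + 6 + 4 * 1) * p / (p - 1) + 4 * 1\<^sup>2 * p / (2 - p)) powr (1 / p)"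
  have L: "Lmult k p (half (1 / Suc n)) C" for n
    unfolding C_def
    by (rule CZ_multiplier[OF k half_integrable half_bm p _ half_kernel_bound half_kernel_Hor]) auto
  have "Lmult k p (indicator {0<..}) C"
  proof (rule Lmult_limit[OF k _ _ _ L])
    show "bm 1 (half (1 / Suc n))" for n by (rule half_bm) simp
    show "bm 1 (indicator {0<..})" by (rule bm_indicator) simp
    show "AE \<omega> in lebesgue. (\<lambda>n. half (1 / Suc n) \<omega>) \<longlonglongrightarrow> indicator {0<..} \<omega>"
    proof (rule AE_I2)
      fix \<omega> :: real
      have "(\<lambda>n. exp (- (1 / Suc n) * \<omega>)) \<longlonglongrightarrow> exp (- 0 * \<omega>)"
        by (intro tendsto_intros LIMSEQ_Suc[OF lim_inverse_n'])
      from tendsto_of_real[OF tendsto_mult[OF tendsto_const this, of "indicator {0<..} \<omega>"], where 'a=complex]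
      show "(\<lambda>n. half (1 / Suc n) \<omega>) \<longlonglongrightarrow> indicator {0<..} \<omega>"
        by (cases "0 < \<omega>") (simp_all add: half_def)
    qed
  qed (use p in simp)
  then show ?thesis by (intro exI[of _ C]) (simp add: C_def)
qed

lemma Lmult_2: "bm B m \<Longrightarrow> Lmult k 2 m B"
  unfolding Lmult_def using lbdD(5)[OF mult_lbd[OF k]] by blast

text \<open>Exponents above 2 reduce to their conjugates, since the symbol is real and hence its own
  adjoint symbol.\<close>

lemma half_line_Lmult:
  assumes p: "1 < p" shows "\<exists>C\<ge>0. Lmult k p (indicator {0<..}) C"
proof -
  have bm1: "bm 1 (indicator {0<..})" by (rule bm_indicator) simp
  consider "p < 2" | "p = 2" | "2 < p" by linarith
  then show ?thesis
  proof cases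
    case 1 then show ?thesis using half_line_Lmult_below p by blast
  next
    case 2 then show ?thesis using Lmult_2[OF bm1] by (intro exI[of _ 1]) simp
  next
    case 3
    define q where "q = p / (p - 1)"
    have q: "1 < q" "q < 2" "1 / q + 1 / p = 1" using 3 by (auto simp: q_def field_simps)
    obtain C where C: "0 \<le> C" "Lmult k q (indicator {0<..}) C" using half_line_Lmult_below[OF q(1,2)] by blast
    have "(\<lambda>x. cnj (indicator {0<..} x)) = (indicator {0<..} :: real \<Rightarrow> complex)" by (auto simp: indicator_def fun_eq_iff)
    then have "Lmult k p (indicator {0<..}) C"
      using C by (intro Lmult_dual[OF k bm1 _ q(1) p q(3)]) simp
    then show ?thesis using C by blast
  qed
qed

end

section \<open>Trapezoidal multipliers\<close>

text \<open>A triangle of height and half-width a. Differences of two such triangles are trapezoids,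
  and the kernel of a triangle is a Fejer kernel, decaying like 1 / x^2.\<close>

definition tri :: "real \<Rightarrow> real \<Rightarrow> complex"
  where "tri a \<omega> = of_real (max 0 (a - \<bar>\<omega>\<bar>))"

lemma tri_measurable [measurable]: "tri a \<in> borel_measurable borel"
  unfolding tri_def[abs_def] by measurable

lemma tri_cis_integrable: 
  assumes "0 \<le> a" shows "integrable lborel (\<lambda>\<omega>. tri a \<omega> * cis (u * \<omega>))"
proof (rule integrableI_bounded_set[where A="{-a..a}" and B=a])
  show "emeasure lborel {-a..a} < \<infinity>" using assms by simp
  show "AE \<omega> in lborel. \<omega> \<in> {-a..a} \<longrightarrow> norm (tri a \<omega> * cis (u * \<omega>)) \<le> a"
    using assms by (intro AE_I2) (auto simp: norm_mult tri_def)
qed (auto simp: tri_def)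

lemma tri_integrable: "0 \<le> a \<Longrightarrow> integrable lborel (tri a)"
  using tri_cis_integrable[of a 0] by simp

lemma half_tri_integral:
  assumes a: "0 \<le> a" and u: "u \<noteq> 0"
  shows "(LINT \<omega>|lborel. indicator {0..a} \<omega> *\<^sub>R (of_real (a - \<omega>) * cis (u * \<omega>))) = (1 - cis (u * a)) / (of_real u)\<^sup>2 + \<i> * of_real a / of_real u"
proof -
  let ?F = "\<lambda>\<omega>. - \<i> * of_real (a - \<omega>) * cis (u * \<omega>) / of_real u - cis (u * \<omega>) / (of_real u)\<^sup>2"
  have "(LINT \<omega>|lborel. indicator {0..a} \<omega> *\<^sub>R (of_real (a - \<omega>) * cis (u * \<omega>))) = ?F a - ?F 0"
  proof (rule integral_FTC_atLeastAtMost[OF a])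
    show "(?F has_vector_derivative of_real (a - \<omega>) * cis (u * \<omega>)) (at \<omega> within {0..a})" for \<omega>
      unfolding has_vector_derivative_def
      using u by (auto intro!: derivative_eq_intros simp: scaleR_conv_of_real field_simps power2_eq_square)
  qed (auto intro!: continuous_intros)
  also have "?F a - ?F 0 = (1 - cis (u * a)) / (of_real u)\<^sup>2 + \<i> * of_real a / of_real u"
    by (simp add: diff_divide_distrib)
  finally show ?thesis .
qed

text \<open>The line is folded at 0. The terms of order 1 / u cancel between the two halves, which
  leaves the decay 1 / u^2.\<close>

lemma tri_integral:
  assumes a: "0 \<le> a" and u: "u \<noteq> 0"
  shows "(LINT \<omega>|lborel. tri a \<omega> * cis (u * \<omega>)) = of_real (2 * (1 - cos (u * a)) / u\<^sup>2)"
proof -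
  let ?g = "\<lambda>u \<omega>. indicator {0..a} \<omega> *\<^sub>R (complex_of_real (a - \<omega>) * cis (u * \<omega>))"
  have gi: "integrable lborel (?g u)" for u
  proof (rule integrableI_bounded_set[where A="{0..a}" and B=a])
    show "emeasure lborel {0..a} < \<infinity>" using a by simp
    show "AE \<omega> in lborel. \<omega> \<in> {0..a} \<longrightarrow> norm (?g u \<omega>) \<le> a"
    proof (intro AE_I2 impI)
      fix \<omega> assume "\<omega> \<in> {0..a}"
      then show "norm (?g u \<omega>) \<le> a" by (simp add: norm_mult del: of_real_diff)
    qed
  qed auto
  have gi': "integrable lborel (\<lambda>\<omega>. ?g (-u) (- \<omega>))"
    using lborel_integrable_real_affine[OF gi[of "-u"], of "-1" 0] by simp
  have "(LINT \<omega>|lborel. tri a \<omega> * cis (u * \<omega>)) = (LINT \<omega>|lborel. ?g u \<omega> + ?g (-u) (- \<omega>))"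
  proof (rule integral_cong_AE)
    show "AE \<omega> in lborel. tri a \<omega> * cis (u * \<omega>) = ?g u \<omega> + ?g (-u) (- \<omega>)"
      using AE_lborel_singleton[of 0] by eventually_elim (auto simp: tri_def indicator_def)
  qed measurable
  also have "\<dots> = (LINT \<omega>|lborel. ?g u \<omega>) + (LINT \<omega>|lborel. ?g (-u) (- \<omega>))"
    by (rule Bochner_Integration.integral_add[OF gi gi'])
  also have "(LINT \<omega>|lborel. ?g (-u) (- \<omega>)) = (LINT \<omega>|lborel. ?g (-u) \<omega>)"
    using lborel_integral_real_affine[of "-1" "?g (-u)" 0] by simp
  also have "(LINT \<omega>|lborel. ?g u \<omega>) + (LINT \<omega>|lborel. ?g (-u) \<omega>) =
     ((1 - cis (u * a)) / (of_real u)\<^sup>2 + \<i> * of_real a / of_real u) + ((1 - cis (- u * a)) / (of_real (-u))\<^sup>2 + \<i> * of_real a / of_real (-u))"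
    using half_tri_integral[OF a u] half_tri_integral[OF a, of "-u"] u by simp
  also have "\<dots> = (2 - (cis (u * a) + cis (- (u * a)))) / (of_real u)\<^sup>2"
    by (simp add: add_divide_distrib diff_divide_distrib)
  also have "cis (u * a) + cis (- (u * a)) = of_real (2 * cos (u * a))" by (simp add: complex_eq_iff)
  finally show ?thesis by (simp add: algebra_simps)
qed

text \<open>Size, Lipschitz and decay bounds at unit scale. The last one decays only like 1 / x^2,
  as the derivative of a Fejer kernel does; summation over dyadic dilations asks for no
  more.\<close>

definition good_kernel :: "real \<Rightarrow> (real \<Rightarrow> complex) \<Rightarrow> bool"
  where "good_kernel D K \<longleftrightarrow> 0 \<le> D \<and> K \<in> borel_measurable borel \<and> (\<forall>x. x \<noteq> 0 \<longrightarrow> cmod (K x) \<le> D / x\<^sup>2) \<and>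
    (\<forall>x y. cmod (K (x - y) - K x) \<le> D * \<bar>y\<bar>) \<and>
    (\<forall>x y. 1 \<le> \<bar>x\<bar> \<longrightarrow> 2 * \<bar>y\<bar> \<le> \<bar>x\<bar> \<longrightarrow> cmod (K (x - y) - K x) \<le> D * \<bar>y\<bar> / x\<^sup>2)"

lemma good_kernel_lincomb:
  assumes K: "good_kernel D K" and L: "good_kernel D' L"
  shows "good_kernel (D + cmod c * D') (\<lambda>x. K x + c * L x)"
  unfolding good_kernel_def
proof (intro conjI allI impI)
  show "0 \<le> D + cmod c * D'" using K L by (simp add: good_kernel_def)
  have [measurable]: "K \<in> borel_measurable borel" "L \<in> borel_measurable borel" using K L by (simp_all add: good_kernel_def)
  show "(\<lambda>x. K x + c * L x) \<in> borel_measurable borel" by measurable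
  have *: "cmod (a + c * b) \<le> (D + cmod c * D') * z" if "cmod a \<le> D * z" "cmod b \<le> D' * z" for a b z
  proof -
    have "cmod (a + c * b) \<le> cmod a + cmod c * cmod b" using norm_triangle_ineq[of a "c * b"] by (simp add: norm_mult)
    also have "\<dots> \<le> D * z + cmod c * (D' * z)" using that by (intro add_mono mult_left_mono) auto
    finally show ?thesis by (simp add: algebra_simps)
  qed
  have e: "K (x - y) + c * L (x - y) - (K x + c * L x) = (K (x - y) - K x) + c * (L (x - y) - L x)" for x y
    by (simp add: algebra_simps)
  show "cmod (K x + c * L x) \<le> (D + cmod c * D') / x\<^sup>2" if "x \<noteq> 0" for x
    using *[of "K x" "1 / x\<^sup>2" "L x"] K L that by (simp add: good_kernel_def)
  show "cmod (K (x - y) + c * L (x - y) - (K x + c * L x)) \<le> (D + cmod c * D') * \<bar>y\<bar>" for x y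
    unfolding e using K L by (intro *) (auto simp: good_kernel_def)
  show "cmod (K (x - y) + c * L (x - y) - (K x + c * L x)) \<le> (D + cmod c * D') * \<bar>y\<bar> / x\<^sup>2" if "1 \<le> \<bar>x\<bar>" "2 * \<bar>y\<bar> \<le> \<bar>x\<bar>" for x y
    unfolding e using *[of "K (x - y) - K x" "\<bar>y\<bar> / x\<^sup>2" "L (x - y) - L x"] K L that by (simp add: good_kernel_def)
qed

text \<open>The constant 10 is 5/2, from |u + v| <= 5/2 * |u|, times 4, from 1 / v^2 <= 4 /
  u^2.\<close>

lemma inverse_square_diff_le:
  fixes u v :: real
  assumes "u \<noteq> 0" "\<bar>u\<bar> / 2 \<le> \<bar>v\<bar>" "\<bar>v\<bar> \<le> 3 * \<bar>u\<bar> / 2"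
  shows "\<bar>1 / v\<^sup>2 - 1 / u\<^sup>2\<bar> \<le> 10 * \<bar>u - v\<bar> / \<bar>u\<bar>^3" "1 / v\<^sup>2 \<le> 4 / u\<^sup>2"
proof -
  have v: "v \<noteq> 0" using assms by auto
  have uv: "u\<^sup>2 / 4 \<le> v\<^sup>2"
    using power_mono[OF assms(2), of 2] by (simp add: power_divide)
  then show "1 / v\<^sup>2 \<le> 4 / u\<^sup>2" using assms(1) v by (simp add: field_simps)
  have "1 / v\<^sup>2 - 1 / u\<^sup>2 = (u - v) * (u + v) * (1 / u\<^sup>2) * (1 / v\<^sup>2)"
    using assms(1) v by (simp add: field_simps power2_eq_square)
  then have "\<bar>1 / v\<^sup>2 - 1 / u\<^sup>2\<bar> = \<bar>u - v\<bar> * \<bar>u + v\<bar> * (1 / u\<^sup>2) * (1 / v\<^sup>2)"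
    by (simp add: abs_mult)
  also have "\<dots> \<le> \<bar>u - v\<bar> * (5 / 2 * \<bar>u\<bar>) * (1 / u\<^sup>2) * (4 / u\<^sup>2)"
  proof (intro mult_mono)
    show "\<bar>u + v\<bar> \<le> 5 / 2 * \<bar>u\<bar>" using assms(3) by linarith
  qed (use \<open>1 / v\<^sup>2 \<le> 4 / u\<^sup>2\<close> in auto)
  also have "\<dots> = 10 * \<bar>u - v\<bar> / \<bar>u\<bar>^3"
  proof -
    have "u\<^sup>2 = \<bar>u\<bar>\<^sup>2" by simp
    then show ?thesis using assms(1) by (simp add: power2_eq_square power3_eq_cube field_simps)
  qed
  finally show "\<bar>1 / v\<^sup>2 - 1 / u\<^sup>2\<bar> \<le> 10 * \<bar>u - v\<bar> / \<bar>u\<bar>^3" .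
qed

context
  fixes k :: real
  assumes k: "k \<noteq> 0"
begin

lemma tri_kernel:
  "0 \<le> a \<Longrightarrow> x \<noteq> 0 \<Longrightarrow> kernel k (tri a) x = of_real (\<bar>k\<bar> / (2 * pi) * (2 * (1 - cos (k * x * a)) / (k * x)\<^sup>2))"
  unfolding kernel_def using tri_integral[of a "k * x"] k by (simp add: mult_ac)

lemma good_kernel_tri:
  assumes a: "0 \<le> a" shows "\<exists>D. good_kernel D (kernel k (tri a))"
proof -
  define q where "q = \<bar>k\<bar> / (2 * pi)"
  have q: "0 \<le> q" by (simp add: q_def)
  \<comment> \<open>The sum of three constants: for the size, Lipschitz and decay clauses of
    \<open>good_kernel\<close>, in this order.\<close>
  define D where "D = q * (4 / k\<^sup>2) + (q * (\<bar>k\<bar> * (2 * a^3)) + q * (8 * a / \<bar>k\<bar> + 40 / k\<^sup>2))"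
  have nn: "0 \<le> q * (4 / k\<^sup>2)" "0 \<le> q * (\<bar>k\<bar> * (2 * a^3))" "0 \<le> q * (8 * a / \<bar>k\<bar> + 40 / k\<^sup>2)" using q a by auto
  then have D: "0 \<le> D" "q * (4 / k\<^sup>2) \<le> D" "q * (\<bar>k\<bar> * (2 * a^3)) \<le> D" "q * (8 * a / \<bar>k\<bar> + 40 / k\<^sup>2) \<le> D"
    unfolding D_def by linarith+
  have c: "0 \<le> 1 - cos z" "1 - cos z \<le> 2" for z :: real using cos_le_one[of z] cos_ge_minus_one[of z] by auto
  have 1: "cmod (kernel k (tri a) x) \<le> D / x\<^sup>2" if "x \<noteq> 0" for x
  proof -
    have "cmod (kernel k (tri a) x) = q * (2 * (1 - cos (k * x * a)) / (k * x)\<^sup>2)"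
      unfolding tri_kernel[OF a that] q_def norm_of_real using c[of "k * x * a"] by simp
    also have "\<dots> \<le> q * (2 * 2 / (k * x)\<^sup>2)" using q c by (intro mult_left_mono divide_right_mono) auto
    also have "\<dots> = q * (4 / k\<^sup>2) / x\<^sup>2" by (simp add: power_mult_distrib)
    also have "\<dots> \<le> D / x\<^sup>2" using D by (intro divide_right_mono) auto
    finally show ?thesis .
  qed
  have 2: "cmod (kernel k (tri a) (x - y) - kernel k (tri a) x) \<le> D * \<bar>y\<bar>" for x y
  proof -
    have i: "integrable lborel (\<lambda>\<omega>. tri a \<omega> * cis (k * \<omega> * z))" for z
      using tri_cis_integrable[OF a, of "k * z"] by (simp add: mult_ac)
    have "kernel k (tri a) (x - y) - kernel k (tri a) x = of_real q * (LINT \<omega>|lborel. tri a \<omega> * cis (k * \<omega> * (x - y)) - tri a \<omega> * cis (k * \<omega> * x))"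
      by (simp only: kernel_def q_def Bochner_Integration.integral_diff[OF i i] right_diff_distrib[of "complex_of_real _"])
    then have "cmod (kernel k (tri a) (x - y) - kernel k (tri a) x) = q * cmod (LINT \<omega>|lborel. tri a \<omega> * cis (k * \<omega> * (x - y)) - tri a \<omega> * cis (k * \<omega> * x))"
      using q by (simp add: norm_mult)
    also have "\<dots> \<le> q * (LINT \<omega>|lborel. indicator {-a..a} \<omega> * (a * (\<bar>k\<bar> * a * \<bar>y\<bar>)))"
    proof (intro mult_left_mono q order_trans[OF integral_norm_bound] integral_mono)
      show "integrable lborel (\<lambda>\<omega>. cmod (tri a \<omega> * cis (k * \<omega> * (x - y)) - tri a \<omega> * cis (k * \<omega> * x)))"
        using i by (intro integrable_norm Bochner_Integration.integrable_diff)
      show "integrable lborel (\<lambda>\<omega>. indicator {-a..a} \<omega> * (a * (\<bar>k\<bar> * a * \<bar>y\<bar>)))"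
        using a by (intro integrable_mult_left) simp
      show "cmod (tri a \<omega> * cis (k * \<omega> * (x - y)) - tri a \<omega> * cis (k * \<omega> * x)) \<le> indicator {-a..a} \<omega> * (a * (\<bar>k\<bar> * a * \<bar>y\<bar>))" for \<omega>
      proof (cases "\<omega> \<in> {-a..a}")
        case True
        have "\<bar>k * \<omega> * (x - y) - k * \<omega> * x\<bar> = \<bar>k\<bar> * \<bar>\<omega>\<bar> * \<bar>y\<bar>"
          by (simp add: right_diff_distrib abs_mult)
        also have "\<dots> \<le> \<bar>k\<bar> * a * \<bar>y\<bar>" using True by (intro mult_right_mono mult_left_mono) auto
        finally have "cmod (cis (k * \<omega> * (x - y)) - cis (k * \<omega> * x)) \<le> \<bar>k\<bar> * a * \<bar>y\<bar>"
          using norm_cis_diff_le order_trans by blast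
        moreover have "cmod (tri a \<omega>) \<le> a" using True a by (auto simp: tri_def)
        ultimately have "cmod (tri a \<omega>) * cmod (cis (k * \<omega> * (x - y)) - cis (k * \<omega> * x)) \<le> a * (\<bar>k\<bar> * a * \<bar>y\<bar>)"
          using a by (intro mult_mono) auto
        then show ?thesis using True by (simp add: right_diff_distrib[symmetric] norm_mult)
      next
        case False
        then have "tri a \<omega> = 0" by (auto simp: tri_def)
        then show ?thesis using False by simp
      qed
    qed
    also have "(LINT \<omega>|lborel. indicator {-a..a} \<omega> * (a * (\<bar>k\<bar> * a * \<bar>y\<bar>))) = \<bar>k\<bar> * (2 * a^3) * \<bar>y\<bar>"
      using a by (simp add: power3_eq_cube)
    also have "q * (\<bar>k\<bar> * (2 * a^3) * \<bar>y\<bar>) = q * (\<bar>k\<bar> * (2 * a^3)) * \<bar>y\<bar>" by simp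
    also have "\<dots> \<le> D * \<bar>y\<bar>" by (intro mult_right_mono D) simp
    finally show ?thesis .
  qed
  have 3: "cmod (kernel k (tri a) (x - y) - kernel k (tri a) x) \<le> D * \<bar>y\<bar> / x\<^sup>2" if x: "1 \<le> \<bar>x\<bar>" and xy: "2 * \<bar>y\<bar> \<le> \<bar>x\<bar>" for x y
  proof -
    define u v where "u = k * x" and "v = k * (x - y)"
    have x0: "x \<noteq> 0" "x - y \<noteq> 0" using x xy by auto
    have u0: "u \<noteq> 0" "v \<noteq> 0" using k x0 by (auto simp: u_def v_def)
    have "\<bar>x\<bar> / 2 \<le> \<bar>x - y\<bar>" "\<bar>x - y\<bar> \<le> 3 * \<bar>x\<bar> / 2" using xy by linarith+
    then have "\<bar>k\<bar> * (\<bar>x\<bar> / 2) \<le> \<bar>k\<bar> * \<bar>x - y\<bar>" "\<bar>k\<bar> * \<bar>x - y\<bar> \<le> \<bar>k\<bar> * (3 * \<bar>x\<bar> / 2)"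
      by (simp_all only: mult_left_mono[OF _ abs_ge_zero])
    then have uv: "\<bar>u\<bar> / 2 \<le> \<bar>v\<bar>" "\<bar>v\<bar> \<le> 3 * \<bar>u\<bar> / 2" by (simp_all add: u_def v_def abs_mult)
    note inv = inverse_square_diff_le[OF u0(1) uv]
    have diff: "\<bar>u - v\<bar> = \<bar>k\<bar> * \<bar>y\<bar>" by (simp add: u_def v_def right_diff_distrib abs_mult)
    have cosd: "\<bar>cos (u * a) - cos (v * a)\<bar> \<le> a * (\<bar>k\<bar> * \<bar>y\<bar>)"
    proof -
      have "\<bar>cos (u * a) - cos (v * a)\<bar> \<le> cmod (cis (u * a) - cis (v * a))"
        using abs_Re_le_cmod[of "cis (u * a) - cis (v * a)"] by simp
      also have "\<dots> \<le> \<bar>u * a - v * a\<bar>" by (rule norm_cis_diff_le)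
      also have "\<dots> = a * (\<bar>k\<bar> * \<bar>y\<bar>)" using a by (simp add: left_diff_distrib[symmetric] abs_mult diff)
      finally show ?thesis .
    qed
    \<comment> \<open>A product rule for differences: the cosine varies by at most a * |k| * |y|,
      the inverse square according to \<open>inverse_square_diff_le\<close>.\<close>
    have "(1 - cos (v * a)) / v\<^sup>2 - (1 - cos (u * a)) / u\<^sup>2 = (cos (u * a) - cos (v * a)) * (1 / v\<^sup>2) + (1 - cos (u * a)) * (1 / v\<^sup>2 - 1 / u\<^sup>2)"
      by (simp add: algebra_simps add_divide_distrib diff_divide_distrib)
    then have "\<bar>(1 - cos (v * a)) / v\<^sup>2 - (1 - cos (u * a)) / u\<^sup>2\<bar> \<le> \<bar>cos (u * a) - cos (v * a)\<bar> * (1 / v\<^sup>2) + (1 - cos (u * a)) * \<bar>1 / v\<^sup>2 - 1 / u\<^sup>2\<bar>"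
      using abs_triangle_ineq[of "(cos (u * a) - cos (v * a)) * (1 / v\<^sup>2)" "(1 - cos (u * a)) * (1 / v\<^sup>2 - 1 / u\<^sup>2)"] c[of "u * a"]
      by (simp add: abs_mult)
    also have "\<dots> \<le> a * (\<bar>k\<bar> * \<bar>y\<bar>) * (4 / u\<^sup>2) + 2 * (10 * (\<bar>k\<bar> * \<bar>y\<bar>) / \<bar>u\<bar>^3)"
      using cosd inv c[of "u * a"] a unfolding diff by (intro add_mono mult_mono) auto
    also have "\<dots> \<le> a * (\<bar>k\<bar> * \<bar>y\<bar>) * (4 / u\<^sup>2) + 2 * (10 * (\<bar>k\<bar> * \<bar>y\<bar>) / (\<bar>k\<bar> * u\<^sup>2))"
    proof -
      \<comment> \<open>The assumption 1 <= |x| trades one power of |u| for |k|, so that both terms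
        decay like 1 / x^2.\<close>
      have "\<bar>k\<bar> * u\<^sup>2 \<le> \<bar>u\<bar>^3"
      proof -
        have "\<bar>k\<bar> * 1 \<le> \<bar>u\<bar>" unfolding u_def abs_mult using x by (intro mult_left_mono) auto
        then have "\<bar>k\<bar> * u\<^sup>2 \<le> \<bar>u\<bar> * u\<^sup>2" by (intro mult_right_mono) auto
        also have "\<dots> = \<bar>u\<bar>^3" by (simp add: power3_eq_cube power2_eq_square abs_mult)
        finally show ?thesis .
      qed
      then show ?thesis using u0 k by (intro add_left_mono mult_left_mono divide_left_mono) auto
    qed
    also have "\<dots> = \<bar>y\<bar> / x\<^sup>2 * (4 * a / \<bar>k\<bar> + 20 / k\<^sup>2)"
    proof -
      have kk: "k\<^sup>2 = \<bar>k\<bar> * \<bar>k\<bar>" by (simp add: power2_eq_square abs_mult[symmetric])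
      show ?thesis unfolding u_def power_mult_distrib kk using k x0(1) by (simp add: field_simps power2_eq_square)
    qed
    finally have A: "\<bar>(1 - cos (v * a)) / v\<^sup>2 - (1 - cos (u * a)) / u\<^sup>2\<bar> \<le> \<bar>y\<bar> / x\<^sup>2 * (4 * a / \<bar>k\<bar> + 20 / k\<^sup>2)" .
    have "kernel k (tri a) (x - y) - kernel k (tri a) x = of_real (2 * q * ((1 - cos (v * a)) / v\<^sup>2 - (1 - cos (u * a)) / u\<^sup>2))"
      unfolding tri_kernel[OF a x0(1)] tri_kernel[OF a x0(2)] u_def[symmetric] v_def[symmetric] q_def[symmetric] of_real_diff[symmetric]
      by (simp add: algebra_simps)
    then have "cmod (kernel k (tri a) (x - y) - kernel k (tri a) x) = 2 * q * \<bar>(1 - cos (v * a)) / v\<^sup>2 - (1 - cos (u * a)) / u\<^sup>2\<bar>"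
      using q by (simp only: norm_of_real abs_mult abs_of_nonneg abs_numeral)
    also have "\<dots> \<le> 2 * q * (\<bar>y\<bar> / x\<^sup>2 * (4 * a / \<bar>k\<bar> + 20 / k\<^sup>2))" using A q by (intro mult_left_mono) auto
    also have "\<dots> = (q * (8 * a / \<bar>k\<bar> + 40 / k\<^sup>2)) * (\<bar>y\<bar> / x\<^sup>2)" by (simp add: algebra_simps)
    also have "\<dots> \<le> D * (\<bar>y\<bar> / x\<^sup>2)" by (intro mult_right_mono D) simp
    finally show ?thesis by simp
  qed
  have "good_kernel D (kernel k (tri a))"
    unfolding good_kernel_def using D(1) 1 2 3 by (auto intro: kernel_measurable)
  then show ?thesis by blast
qed

end

text \<open>Two estimates of one integral. Smoothness gives 2D|y| on [-1, 1] and 2D|y| from the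
  tail. Size alone, with 1 / (x-y)^2 <= 4 / x^2, gives 5D / |y|. Having both is what makes the sum
  over dyadic scales converge.\<close>

lemma good_kernel_Hor:
  assumes K: "good_kernel D K"
  shows "(\<integral>\<^sup>+x. ennreal (cmod (K (x - y) - K x)) * indicator {x. 2 * \<bar>y\<bar> \<le> \<bar>x\<bar>} x \<partial>lborel) \<le> ennreal (5 * D * min \<bar>y\<bar> (1 / \<bar>y\<bar>))"
    (is "?I \<le> _")
proof (cases "y = 0")
  case True then show ?thesis by simp
next
  case False
  have D: "0 \<le> D" and K1: "\<And>x. x \<noteq> 0 \<Longrightarrow> cmod (K x) \<le> D / x\<^sup>2"
    and K2: "\<And>x y. cmod (K (x - y) - K x) \<le> D * \<bar>y\<bar>"
    and K3: "\<And>x y. 1 \<le> \<bar>x\<bar> \<Longrightarrow> 2 * \<bar>y\<bar> \<le> \<bar>x\<bar> \<Longrightarrow> cmod (K (x - y) - K x) \<le> D * \<bar>y\<bar> / x\<^sup>2"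
    using K by (simp_all add: good_kernel_def)
  have "?I \<le> (\<integral>\<^sup>+x. ennreal (D * \<bar>y\<bar>) * indicator {-1..1} x + ennreal (D * \<bar>y\<bar>) * (ennreal (1 / x\<^sup>2) * indicator {x. 1 \<le> \<bar>x\<bar>} x) \<partial>lborel)"
  proof (rule nn_integral_mono)
    fix x :: real
    show "ennreal (cmod (K (x - y) - K x)) * indicator {x. 2 * \<bar>y\<bar> \<le> \<bar>x\<bar>} x \<le>
      ennreal (D * \<bar>y\<bar>) * indicator {-1..1} x + ennreal (D * \<bar>y\<bar>) * (ennreal (1 / x\<^sup>2) * indicator {x. 1 \<le> \<bar>x\<bar>} x)"
    proof (cases "2 * \<bar>y\<bar> \<le> \<bar>x\<bar>")
      case xy: True
      show ?thesis
      proof (cases "\<bar>x\<bar> < 1")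
        case True
        then show ?thesis using K2[of x y] xy by (auto simp: indicator_def abs_less_iff ennreal_leI)
      next
        case False
        have "ennreal (cmod (K (x - y) - K x)) \<le> ennreal (D * \<bar>y\<bar>) * ennreal (1 / x\<^sup>2)"
          using K3[of x y] False xy D by (simp add: ennreal_mult[symmetric] ennreal_leI)
        moreover have "indicator {x. 1 \<le> \<bar>x\<bar>} x = (1::ennreal)" "indicator {x. 2 * \<bar>y\<bar> \<le> \<bar>x\<bar>} x = (1::ennreal)"
          using False xy by auto
        ultimately show ?thesis by (simp only: mult_1_right add_increasing zero_le)
      qed
    qed simp
  qed
  also have "\<dots> = ennreal (D * \<bar>y\<bar>) * emeasure lborel {-1..1::real} + ennreal (D * \<bar>y\<bar>) * ennreal (2 / 1)"
    by (subst nn_integral_add) (auto simp: nn_integral_cmult nn_integral_inverse_square_tail nn_integral_cmult_indicator)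
  also have "\<dots> = ennreal (4 * D * \<bar>y\<bar>)"
  proof -
    have "ennreal (4 * D * \<bar>y\<bar>) = ennreal 4 * ennreal (D * \<bar>y\<bar>)" using D by (simp add: ennreal_mult[symmetric] mult.assoc flip: ennreal_numeral)
    also have "\<dots> = ennreal (D * \<bar>y\<bar>) * (2 + 2)" by (simp add: mult.commute)
    finally show ?thesis by (simp only: distrib_left) simp
  qed
  also have "\<dots> \<le> ennreal (5 * D * \<bar>y\<bar>)" using D by (intro ennreal_leI mult_right_mono) auto
  finally have A: "?I \<le> ennreal (5 * D * \<bar>y\<bar>)" .
  have "?I \<le> (\<integral>\<^sup>+x. ennreal (5 * D) * (ennreal (1 / x\<^sup>2) * indicator {x. 2 * \<bar>y\<bar> \<le> \<bar>x\<bar>} x) \<partial>lborel)"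
  proof (rule nn_integral_mono)
    fix x :: real
    show "ennreal (cmod (K (x - y) - K x)) * indicator {x. 2 * \<bar>y\<bar> \<le> \<bar>x\<bar>} x \<le> ennreal (5 * D) * (ennreal (1 / x\<^sup>2) * indicator {x. 2 * \<bar>y\<bar> \<le> \<bar>x\<bar>} x)"
    proof (cases "2 * \<bar>y\<bar> \<le> \<bar>x\<bar>")
      case True
      have x0: "x \<noteq> 0" "x - y \<noteq> 0" using True False by auto
      have "\<bar>x\<bar> / 2 \<le> \<bar>x - y\<bar>" "\<bar>x - y\<bar> \<le> 3 * \<bar>x\<bar> / 2" using True by linarith+
      then have inv: "1 / (x - y)\<^sup>2 \<le> 4 / x\<^sup>2" by (intro inverse_square_diff_le x0)
      have "cmod (K (x - y) - K x) \<le> cmod (K (x - y)) + cmod (K x)" by (rule norm_triangle_ineq4)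
      also have "\<dots> \<le> D * (1 / (x - y)\<^sup>2) + D * (1 / x\<^sup>2)" using K1[OF x0(1)] K1[OF x0(2)] by simp
      also have "\<dots> \<le> D * (4 / x\<^sup>2) + D * (1 / x\<^sup>2)" using inv D by (intro add_right_mono mult_left_mono) auto
      also have "\<dots> = 5 * D * (1 / x\<^sup>2)" by simp
      finally show ?thesis using True D by (simp add: ennreal_mult[symmetric] ennreal_leI)
    qed simp
  qed
  also have "\<dots> = ennreal (5 * D) * ennreal (2 / (2 * \<bar>y\<bar>))"
    using False by (subst nn_integral_cmult) (auto simp: nn_integral_inverse_square_tail)
  also have "\<dots> = ennreal (5 * D * (1 / \<bar>y\<bar>))" using D by (simp add: ennreal_mult[symmetric])
  finally have B: "?I \<le> ennreal (5 * D * (1 / \<bar>y\<bar>))" .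
  from A B show ?thesis by (simp add: min_def)
qed

text \<open>The dilated kernel has unchanged L^1 size, so a substitution only replaces y by s *
  y.\<close>

lemma scaled_kernel_Hor:
  assumes K: "good_kernel D K" and s: "0 < s"
  shows "(\<integral>\<^sup>+x. ennreal (cmod (of_real s * K (s * (x - y)) - of_real s * K (s * x))) * indicator {x. 2 * \<bar>y\<bar> \<le> \<bar>x\<bar>} x \<partial>lborel)
     \<le> ennreal (5 * D * min (s * \<bar>y\<bar>) (1 / (s * \<bar>y\<bar>)))"
proof -
  have [measurable]: "K \<in> borel_measurable borel" using K by (simp add: good_kernel_def)
  have Vm: "{x. 2 * \<bar>s * y\<bar> \<le> \<bar>x\<bar>} \<in> sets borel" by (intro borel_closed closed_Collect_le continuous_intros)
  have "(\<integral>\<^sup>+x. ennreal (cmod (of_real s * K (s * (x - y)) - of_real s * K (s * x))) * indicator {x. 2 * \<bar>y\<bar> \<le> \<bar>x\<bar>} x \<partial>lborel)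
    = (\<integral>\<^sup>+x. ennreal s * (ennreal (cmod (K (0 + s * x - s * y) - K (0 + s * x))) * indicator {x. 2 * \<bar>s * y\<bar> \<le> \<bar>x\<bar>} (0 + s * x)) \<partial>lborel)"
  proof (intro nn_integral_cong)
    fix x
    have "cmod (of_real s * K (s * (x - y)) - of_real s * K (s * x)) = s * cmod (K (0 + s * x - s * y) - K (0 + s * x))"
      unfolding right_diff_distrib[symmetric] norm_mult using s by (simp add: right_diff_distrib)
    moreover have "indicator {x. 2 * \<bar>y\<bar> \<le> \<bar>x\<bar>} x = (indicator {x. 2 * \<bar>s * y\<bar> \<le> \<bar>x\<bar>} (0 + s * x) :: ennreal)"
      using s by (auto simp: indicator_def abs_mult)
    ultimately show "ennreal (cmod (of_real s * K (s * (x - y)) - of_real s * K (s * x))) * indicator {x. 2 * \<bar>y\<bar> \<le> \<bar>x\<bar>} x =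
      ennreal s * (ennreal (cmod (K (0 + s * x - s * y) - K (0 + s * x))) * indicator {x. 2 * \<bar>s * y\<bar> \<le> \<bar>x\<bar>} (0 + s * x))"
      using s by (simp add: ennreal_mult mult.assoc)
  qed
  also have "\<dots> = ennreal \<bar>s\<bar> * (\<integral>\<^sup>+x. ennreal (cmod (K (0 + s * x - s * y) - K (0 + s * x))) * indicator {x. 2 * \<bar>s * y\<bar> \<le> \<bar>x\<bar>} (0 + s * x) \<partial>lborel)"
    using s Vm by (subst nn_integral_cmult) auto
  also have "\<dots> = (\<integral>\<^sup>+x. ennreal (cmod (K (x - s * y) - K x)) * indicator {x. 2 * \<bar>s * y\<bar> \<le> \<bar>x\<bar>} x \<partial>lborel)"
    using s Vm by (intro nn_integral_real_affine[symmetric]) auto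
  also have "\<dots> \<le> ennreal (5 * D * min \<bar>s * y\<bar> (1 / \<bar>s * y\<bar>))" by (rule good_kernel_Hor[OF K])
  finally show ?thesis using s by (simp add: abs_mult)
qed

lemma sum_half_powers_le: "finite A \<Longrightarrow> (\<Sum>n\<in>A. (1/2::real)^n) \<le> 2"
proof -
  assume "finite A"
  then obtain N where "A \<subseteq> {..<N}" using finite_nat_bounded by blast
  then have "(\<Sum>n\<in>A. (1/2::real)^n) \<le> (\<Sum>n<N. (1/2)^n)" by (intro sum_mono2) auto
  also have "\<dots> \<le> 2" by (subst geometric_sum) (auto simp: field_simps)
  finally show ?thesis .
qed

text \<open>With i0 the integer part of the binary logarithm of t, the j-th term is at most twice
  (1/2)^|j + i0|. The constant 8 is this factor 2 times 2 + 2 for the geometric series on the two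
  sides.\<close>

lemma dyadic_min_sum:
  assumes J: "finite (J :: int set)" and t: "0 < t"
  shows "(\<Sum>j\<in>J. min (2 powi j * t) (1 / (2 powi j * t))) \<le> (8::real)"
proof -
  define i0 where "i0 = \<lfloor>log 2 t\<rfloor>"
  have t1: "2 powi i0 \<le> t" "t < 2 * 2 powi i0"
  proof -
    have "2 powr (real_of_int i0) \<le> 2 powr (log 2 t)" by (intro powr_mono) (auto simp: i0_def)
    then show "2 powi i0 \<le> t" using t by (simp add: powr_real_of_int')
    have "2 powr (log 2 t) < 2 powr (real_of_int i0 + 1)" by (intro powr_less_mono) (auto simp: i0_def)
    then show "t < 2 * 2 powi i0" using t by (simp add: powr_add powr_real_of_int')
  qed
  have le: "min (2 powi j * t) (1 / (2 powi j * t)) \<le> 2 * (1/2)^nat \<bar>j + i0\<bar>" for j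
  proof (cases "0 \<le> j + i0")
    case True
    have "(2::real)^nat (j + i0) = 2 powi (j + i0)" using True by (simp add: power_int_def)
    also have "\<dots> \<le> 2 powi j * t" using t1(1) by (simp add: power_int_add)
    finally have "1 / (2 powi j * t) \<le> 1 / 2^nat (j + i0)" by (intro divide_left_mono) (auto simp: t)
    also have "\<dots> \<le> 2 * (1/2)^nat \<bar>j + i0\<bar>" using True by (simp add: power_divide divide_right_mono)
    finally show ?thesis by (simp add: min.coboundedI2)
  next
    case False
    have "2 powi j * t \<le> 2 * 2 powi (j + i0)" using t1(2) by (simp add: power_int_add)
    also have "2 powi (j + i0) = (1/2::real)^nat \<bar>j + i0\<bar>" using False by (simp add: power_int_def inverse_eq_divide)
    finally show ?thesis by (simp add: min.coboundedI1)
  qed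
  have part: "(\<Sum>j\<in>A. (1/2::real)^nat \<bar>j + i0\<bar>) \<le> 2" if "finite A" "inj_on (\<lambda>j. nat \<bar>j + i0\<bar>) A" for A
    using sum.reindex[OF that(2), of "\<lambda>n. (1/2::real)^n"] sum_half_powers_le[of "(\<lambda>j. nat \<bar>j + i0\<bar>) ` A"] that(1) by simp
  have "(\<Sum>j\<in>J. min (2 powi j * t) (1 / (2 powi j * t))) \<le> (\<Sum>j\<in>J. 2 * (1/2)^nat \<bar>j + i0\<bar>)"
    by (intro sum_mono le)
  also have "\<dots> = 2 * (\<Sum>j\<in>J. (1/2)^nat \<bar>j + i0\<bar>)" by (simp add: sum_distrib_left)
  also have "(\<Sum>j\<in>J. (1/2::real)^nat \<bar>j + i0\<bar>) = (\<Sum>j\<in>{j\<in>J. 0 \<le> j + i0}. (1/2)^nat \<bar>j + i0\<bar>) + (\<Sum>j\<in>{j\<in>J. j + i0 < 0}. (1/2)^nat \<bar>j + i0\<bar>)"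
    using J by (subst sum.union_disjoint[symmetric]) (auto intro!: sum.cong)
  also have "\<dots> \<le> 2 + 2" using J by (intro add_mono part) (auto simp: inj_on_def)
  finally show ?thesis by simp
qed

section \<open>Smoothed dyadic annuli and their signed sums\<close>

definition psi1 :: "real \<Rightarrow> complex"
  where "psi1 \<omega> = (tri 4 \<omega> - tri 2 \<omega>) / 2 - 2 * (tri 1 \<omega> - tri (1/2) \<omega>)"

definition psi :: "real \<Rightarrow> real \<Rightarrow> complex"
  where "psi s \<omega> = psi1 (\<omega> / s)"

definition bump :: "real \<Rightarrow> real"
  where "bump \<omega> = 2 * (max 0 (1 - \<bar>\<omega>\<bar>) - max 0 (1/2 - \<bar>\<omega>\<bar>))"

text \<open>As \<open>bump\<close> is 1 for |w| <= 1/2 and 0 for |w| >= 1, \<open>psi1\<close> is 1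
  for 1 <= |w| <= 2 and vanishes unless 1/2 < |w| < 4. The difference of two dilates of one bump
  telescopes over dyadic scales, whereas the definition by triangles gives access to the
  kernel.\<close>

lemma psi1_bump: "psi1 \<omega> = of_real (bump (\<omega> / 4) - bump \<omega>)"
proof -
  have e: "(max 0 (4 - \<bar>\<omega>\<bar>) - max 0 (2 - \<bar>\<omega>\<bar>)) / 2 = bump (\<omega> / 4)"
    by (auto simp: bump_def max_def abs_divide field_simps)
  have "psi1 \<omega> = of_real ((max 0 (4 - \<bar>\<omega>\<bar>) - max 0 (2 - \<bar>\<omega>\<bar>)) / 2 - bump \<omega>)"
    by (simp add: psi1_def tri_def bump_def)
  then show ?thesis unfolding e .
qed

lemma bump_eq: "\<bar>z\<bar> \<le> 1/2 \<Longrightarrow> bump z = 1" "1 \<le> \<bar>z\<bar> \<Longrightarrow> bump z = 0"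
  by (auto simp: bump_def max_def)

lemma bump_range: "0 \<le> bump \<omega>" "bump \<omega> \<le> 1"
  by (auto simp: bump_def max_def)

lemma bump_mono: "\<bar>u\<bar> \<le> \<bar>v\<bar> \<Longrightarrow> bump v \<le> bump u"
  by (auto simp: bump_def max_def)

lemma psi_eq_1:
  assumes "0 < s" "s \<le> \<bar>\<omega>\<bar>" "\<bar>\<omega>\<bar> \<le> 2 * s" shows "psi s \<omega> = 1"
proof -
  have "1 \<le> \<bar>\<omega> / s\<bar>" "\<bar>\<omega> / s\<bar> \<le> 2" using assms by (auto simp: abs_divide pos_le_divide_eq pos_divide_le_eq)
  then have "bump (\<omega> / s / 4) = 1" "bump (\<omega> / s) = 0" by (auto intro!: bump_eq simp: abs_divide)
  then show ?thesis by (simp add: psi_def psi1_bump)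
qed

lemma psi_measurable [measurable]: "psi s \<in> borel_measurable borel"
  unfolding psi_def[abs_def] psi1_def[abs_def] by measurable

text \<open>Each term is w (j + 2) - w j, which is nonnegative. Coefficients of modulus at most 1
  only shrink the sum of absolute values, and the sum over a full range telescopes in steps of two,
  leaving two values of \<open>bump\<close> at each end.\<close>

lemma psi_dyadic_sum:
  assumes J: "finite J" and s: "0 < s" and e: "\<And>j. \<bar>\<epsilon> j\<bar> \<le> (1::real)"
  shows "cmod (\<Sum>j\<in>J. of_real (\<epsilon> j) * psi (s * 2 powi j) \<omega>) \<le> 2"
proof -
  define w where "w j = bump (\<omega> / (s * 2 powi j))" for j
  have wm: "w j \<le> w (j + 2)" for j
    unfolding w_def
  proof (rule bump_mono)
    have "\<bar>\<omega>\<bar> / (s * 2 powi (j + 2)) \<le> \<bar>\<omega>\<bar> / (s * 2 powi j)"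
      using s by (intro divide_left_mono) (auto simp: power_int_add)
    then show "\<bar>\<omega> / (s * 2 powi (j + 2))\<bar> \<le> \<bar>\<omega> / (s * 2 powi j)\<bar>" using s by (simp add: abs_divide abs_mult)
  qed
  have psi_w: "psi (s * 2 powi j) \<omega> = of_real (w (j + 2) - w j)" for j
    by (simp add: psi_def psi1_bump w_def power_int_add mult.assoc)
  obtain N where N: "J \<subseteq> {- int N..int N}"
  proof -
    have "\<bar>j\<bar> \<le> Max (insert 0 (abs ` J))" if "j \<in> J" for j using J that by (intro Max_ge) auto
    then have "J \<subseteq> {- int (nat (Max (insert 0 (abs ` J))))..int (nat (Max (insert 0 (abs ` J))))}"
      by (force simp: abs_le_iff)
    then show ?thesis by (rule that)
  qed
  have tel: "(\<Sum>j\<in>{- int N..int N}. w (j + 2) - w j) = w (int N + 2) + w (int N + 1) - w (- int N) - w (- int N + 1)" for N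
  proof (induction N)
    case (Suc N)
    have "{- int (Suc N)..int (Suc N)} = insert (- 1 - int N) (insert (int N + 1) {- int N..int N})" by auto
    then have A: "(\<Sum>j\<in>{- int (Suc N)..int (Suc N)}. w (j + 2) - w j) =
      (w (- 1 - int N + 2) - w (- 1 - int N)) + ((w (int N + 1 + 2) - w (int N + 1)) + (\<Sum>j\<in>{- int N..int N}. w (j + 2) - w j))"
      by simp
    show ?case unfolding A Suc.IH by (simp add: algebra_simps)
  qed (simp add: algebra_simps)
  have "cmod (\<Sum>j\<in>J. of_real (\<epsilon> j) * psi (s * 2 powi j) \<omega>) \<le> (\<Sum>j\<in>J. \<bar>\<epsilon> j\<bar> * (w (j + 2) - w j))"
    by (intro order_trans[OF norm_sum] sum_mono) (simp add: norm_mult psi_w wm del: of_real_diff)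
  also have "\<dots> \<le> (\<Sum>j\<in>J. 1 * (w (j + 2) - w j))" using e wm by (intro sum_mono mult_right_mono) auto
  also have "\<dots> \<le> (\<Sum>j\<in>{- int N..int N}. w (j + 2) - w j)" using N wm by simp (intro sum_mono2, auto)
  also have "\<dots> \<le> 2" unfolding tel using bump_range unfolding w_def by (smt (verit))
  finally show ?thesis .
qed

lemma psi_bm: "0 < s \<Longrightarrow> bm 2 (psi s)"
  using psi_dyadic_sum[of "{0}" s "\<lambda>_. 1"] by (simp add: bm_def borel_imp_lebesgue)

lemma psi1_integrable: "integrable lborel psi1"
  unfolding psi1_def[abs_def] by (intro Bochner_Integration.integrable_diff integrable_divide_zero integrable_mult_right tri_integrable) auto

lemma psi_integrable: "0 < s \<Longrightarrow> integrable lborel (psi s)"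
  unfolding psi_def[abs_def] using lborel_integrable_real_affine[OF psi1_integrable, of "1 / s" 0] by simp

context
  fixes k :: real
  assumes k: "k \<noteq> 0"
begin

lemma kernel_lincomb:
  assumes "integrable lborel m" "integrable lborel n"
  shows "kernel k (\<lambda>\<omega>. m \<omega> + a * n \<omega>) x = kernel k m x + a * kernel k n x"
proof -
  have i: "integrable lborel (\<lambda>\<omega>. m \<omega> * cis (k * \<omega> * x))" if "integrable lborel m" for m
  proof (rule Bochner_Integration.integrable_bound[OF that])
    have [measurable]: "m \<in> borel_measurable borel" using borel_measurable_integrable[OF that] by simp
    show "(\<lambda>\<omega>. m \<omega> * cis (k * \<omega> * x)) \<in> borel_measurable lborel" by measurable
  qed (simp add: norm_mult)
  have "(LINT \<omega>|lborel. (m \<omega> + a * n \<omega>) * cis (k * \<omega> * x)) = (LINT \<omega>|lborel. m \<omega> * cis (k * \<omega> * x) + a * (n \<omega> * cis (k * \<omega> * x)))"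
    by (simp add: algebra_simps)
  also have "\<dots> = (LINT \<omega>|lborel. m \<omega> * cis (k * \<omega> * x)) + a * (LINT \<omega>|lborel. n \<omega> * cis (k * \<omega> * x))"
    using i[OF assms(1)] i[OF assms(2)] by (subst Bochner_Integration.integral_add) auto
  finally show ?thesis by (simp add: kernel_def algebra_simps)
qed

lemma kernel_sum:
  assumes "finite J" "\<And>j. j \<in> J \<Longrightarrow> integrable lborel (m j)"
  shows "integrable lborel (\<lambda>\<omega>. \<Sum>j\<in>J. a j * m j \<omega>) \<and> kernel k (\<lambda>\<omega>. \<Sum>j\<in>J. a j * m j \<omega>) x = (\<Sum>j\<in>J. a j * kernel k (m j) x)"
  using assms
proof (induction J rule: finite_induct)
  case empty then show ?case by (simp add: kernel_def)
next
  case (insert i J)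
  then have "integrable lborel (\<lambda>\<omega>. \<Sum>j\<in>J. a j * m j \<omega>)" "integrable lborel (m i)" by auto
  from kernel_lincomb[OF this, of "a i" x] this insert show ?case by (simp add: add.commute)
qed

text \<open>Dilating the symbol by s dilates the kernel inversely, so a single kernel governs all
  scales.\<close>

lemma kernel_psi:
  assumes s: "0 < s" shows "kernel k (psi s) x = of_real s * kernel k psi1 (s * x)"
proof -
  have "(LINT \<omega>|lborel. psi s \<omega> * cis (k * \<omega> * x)) = \<bar>s\<bar> *\<^sub>R (LINT \<omega>|lborel. psi s (0 + s * \<omega>) * cis (k * (0 + s * \<omega>) * x))"
    using s by (intro lborel_integral_real_affine) auto
  also have "\<dots> = of_real s * (LINT \<omega>|lborel. psi1 \<omega> * cis (k * \<omega> * (s * x)))"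
    using s by (simp add: psi_def scaleR_conv_of_real mult_ac)
  finally show ?thesis by (simp add: kernel_def)
qed

lemma good_kernel_psi1: "\<exists>D. good_kernel D (kernel k psi1)"
proof -
  obtain D4 D2 D1 Dh where D: "good_kernel D4 (kernel k (tri 4))" "good_kernel D2 (kernel k (tri 2))"
    "good_kernel D1 (kernel k (tri 1))" "good_kernel Dh (kernel k (tri (1/2)))"
    using good_kernel_tri[OF k, of 4] good_kernel_tri[OF k, of 2] good_kernel_tri[OF k, of 1] good_kernel_tri[OF k, of "1/2"] by auto
  have z: "good_kernel 0 (\<lambda>x. 0)" by (simp add: good_kernel_def)
  define a :: "nat \<Rightarrow> real" where "a n = [4, 2, 1, 1/2] ! n" for n
  define c :: "nat \<Rightarrow> complex" where "c n = [1/2, -1/2, -2, 2] ! n" for n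
  have set4: "{..<4::nat} = {0, 1, 2, 3}" by auto
  have psi1_eq: "psi1 = (\<lambda>\<omega>. \<Sum>n\<in>{..<4}. c n * tri (a n) \<omega>)"
    by (simp add: fun_eq_iff psi1_def set4 c_def a_def diff_divide_distrib algebra_simps)
  have ker: "kernel k psi1 x = (\<Sum>n\<in>{..<4}. c n * kernel k (tri (a n)) x)" for x
    unfolding psi1_eq by (rule kernel_sum[THEN conjunct2]) (auto simp: a_def set4 intro!: tri_integrable)
  have "kernel k psi1 = (\<lambda>x. (((0 + (1/2) * kernel k (tri 4) x) + (-1/2) * kernel k (tri 2) x) + (-2) * kernel k (tri 1) x) + 2 * kernel k (tri (1/2)) x)"
    by (simp add: fun_eq_iff ker set4 a_def c_def algebra_simps)
  then show ?thesis
    using good_kernel_lincomb[OF good_kernel_lincomb[OF good_kernel_lincomb[OF good_kernel_lincomb[OF z D(1), of "1/2"] D(2), of "-1/2"] D(3), of "-2"] D(4), of 2] by auto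
qed

lemma kernel_bound:
  assumes "integrable lborel m" shows "cmod (kernel k m x) \<le> \<bar>k\<bar> / (2 * pi) * (LINT \<omega>|lborel. cmod (m \<omega>))"
proof -
  have "cmod (LINT \<omega>|lborel. m \<omega> * cis (k * \<omega> * x)) \<le> (LINT \<omega>|lborel. cmod (m \<omega>))"
    using integral_norm_bound[of lborel "\<lambda>\<omega>. m \<omega> * cis (k * \<omega> * x)"] by (simp add: norm_mult)
  moreover have "cmod (complex_of_real (\<bar>k\<bar> / (2 * pi))) = \<bar>k\<bar> / (2 * pi)" unfolding norm_of_real by simp
  ultimately show ?thesis unfolding kernel_def norm_mult by (simp only:) (intro mult_left_mono, auto)
qed

text \<open>\<open>CZ_multiplier\<close> with B = 2 from \<open>psi_dyadic_sum\<close> and H = 40 *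
  D: each scale contributes 5 * D times a minimum to Hormander's integral, and
  \<open>dyadic_min_sum\<close> bounds the sum of the minima by 8, whatever the finite set
  \<open>J\<close> and the coefficients.\<close>

lemma psi_sum_Lmult_below:
  assumes p: "1 < p" "p < 2"
  shows "\<exists>C\<ge>0. \<forall>s J \<epsilon>. 0 < s \<longrightarrow> finite J \<longrightarrow> (\<forall>j. \<bar>\<epsilon> j\<bar> \<le> 1) \<longrightarrow>
    Lmult k p (\<lambda>\<omega>. \<Sum>j\<in>J. of_real (\<epsilon> j) * psi (s * 2 powi j) \<omega>) C"
proof -
  obtain D where D: "good_kernel D (kernel k psi1)" using good_kernel_psi1 by blast
  have D0: "0 \<le> D" using D by (simp add: good_kernel_def)
  define C where "C = (2 * (8 * 2\<^sup>2 + 6 + 4 * (40 * D)) * p / (p - 1) + 4 * 2\<^sup>2 * p / (2 - p)) powr (1 / p)"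
  have "Lmult k p (\<lambda>\<omega>. \<Sum>j\<in>J. of_real (\<epsilon> j) * psi (s * 2 powi j) \<omega>) C"
    if s: "0 < s" and J: "finite J" and e: "\<And>j. \<bar>\<epsilon> j\<bar> \<le> 1" for s J and \<epsilon> :: "int \<Rightarrow> real"
  proof -
    let ?m = "\<lambda>\<omega>. \<Sum>j\<in>J. of_real (\<epsilon> j) * psi (s * 2 powi j) \<omega>"
    have sj: "0 < s * 2 powi j" for j using s by simp
    have ks: "integrable lborel ?m \<and> kernel k ?m x = (\<Sum>j\<in>J. of_real (\<epsilon> j) * kernel k (psi (s * 2 powi j)) x)" for x
      by (rule kernel_sum[OF J psi_integrable[OF sj]])
    note im = ks[THEN conjunct1] and km = ks[THEN conjunct2]
    have bm: "bm 2 ?m"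
      unfolding bm_def using psi_dyadic_sum[OF J s e] by (auto intro!: borel_imp_lebesgue)
    have [measurable]: "kernel k psi1 \<in> borel_measurable borel" using D by (simp add: good_kernel_def)
    have Hor: "(\<integral>\<^sup>+x. ennreal (cmod (kernel k ?m (x - y) - kernel k ?m x)) * indicator {x. 2 * \<bar>y\<bar> \<le> \<bar>x\<bar>} x \<partial>lborel) \<le> ennreal (40 * D)" for y
    proof (cases "y = 0")
      case False
      let ?V = "{x. 2 * \<bar>y\<bar> \<le> \<bar>x\<bar>}"
      have Vm[measurable]: "?V \<in> sets borel" by (intro borel_closed closed_Collect_le continuous_intros)
      let ?f = "\<lambda>j x. of_real (s * 2 powi j) * kernel k psi1 (s * 2 powi j * (x - y)) - of_real (s * 2 powi j) * kernel k psi1 (s * 2 powi j * x)"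
      have "(\<integral>\<^sup>+x. ennreal (cmod (kernel k ?m (x - y) - kernel k ?m x)) * indicator ?V x \<partial>lborel) \<le>
        (\<integral>\<^sup>+x. (\<Sum>j\<in>J. ennreal (cmod (?f j x)) * indicator ?V x) \<partial>lborel)"
      proof (rule nn_integral_mono)
        fix x
        have "kernel k ?m (x - y) - kernel k ?m x = (\<Sum>j\<in>J. of_real (\<epsilon> j) * ?f j x)"
          unfolding km kernel_psi[OF sj] by (simp only: sum_subtractf[symmetric] right_diff_distrib)
        then have "cmod (kernel k ?m (x - y) - kernel k ?m x) \<le> (\<Sum>j\<in>J. \<bar>\<epsilon> j\<bar> * cmod (?f j x))"
          by (simp only:) (intro order_trans[OF norm_sum] sum_mono, simp add: norm_mult)
        also have "\<dots> \<le> (\<Sum>j\<in>J. 1 * cmod (?f j x))" by (intro sum_mono mult_right_mono e) auto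
        finally have "ennreal (cmod (kernel k ?m (x - y) - kernel k ?m x)) \<le> ennreal (\<Sum>j\<in>J. cmod (?f j x))"
          by (intro ennreal_leI) simp
        also have "\<dots> = (\<Sum>j\<in>J. ennreal (cmod (?f j x)))" by (rule sum_ennreal[symmetric]) simp
        finally show "ennreal (cmod (kernel k ?m (x - y) - kernel k ?m x)) * indicator ?V x \<le> (\<Sum>j\<in>J. ennreal (cmod (?f j x)) * indicator ?V x)"
          unfolding sum_distrib_right[symmetric] by (rule mult_right_mono) simp
      qed
      also have "\<dots> = (\<Sum>j\<in>J. (\<integral>\<^sup>+x. ennreal (cmod (?f j x)) * indicator ?V x \<partial>lborel))"
        by (rule nn_integral_sum) measurable
      also have "\<dots> \<le> (\<Sum>j\<in>J. ennreal (5 * D * min (s * 2 powi j * \<bar>y\<bar>) (1 / (s * 2 powi j * \<bar>y\<bar>))))"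
        by (intro sum_mono scaled_kernel_Hor D sj)
      also have "\<dots> = ennreal (\<Sum>j\<in>J. 5 * D * min (2 powi j * (s * \<bar>y\<bar>)) (1 / (2 powi j * (s * \<bar>y\<bar>))))"
        using D0 s by (subst sum_ennreal) (auto simp: mult_ac)
      also have "\<dots> \<le> ennreal (5 * D * 8)"
        unfolding sum_distrib_left[symmetric] using D0 s False J by (intro ennreal_leI mult_left_mono dyadic_min_sum) auto
      finally show ?thesis by simp
    qed simp
    show ?thesis
      unfolding C_def by (rule CZ_multiplier[OF k im bm p _ kernel_bound[OF im] Hor]) (use D0 in simp)
  qed
  moreover have "0 \<le> C" by (simp add: C_def)
  ultimately show ?thesis by blast
qed

lemma psi_sum_Lmult:
  assumes p: "1 < p"
  shows "\<exists>C\<ge>0. \<forall>s J \<epsilon>. 0 < s \<longrightarrow> finite J \<longrightarrow> (\<forall>j. \<bar>\<epsilon> j\<bar> \<le> 1) \<longrightarrow>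
    Lmult k p (\<lambda>\<omega>. \<Sum>j\<in>J. of_real (\<epsilon> j) * psi (s * 2 powi j) \<omega>) C"
proof -
  have bm: "bm 2 (\<lambda>\<omega>. \<Sum>j\<in>J. of_real (\<epsilon> j) * psi (s * 2 powi j) \<omega>)"
    if s: "0 < s" and J: "finite J" and e: "\<And>j. \<bar>\<epsilon> j\<bar> \<le> 1" for s J and \<epsilon> :: "int \<Rightarrow> real"
    unfolding bm_def using psi_dyadic_sum[OF J s e] by (auto intro!: borel_imp_lebesgue)
  consider "p < 2" | "p = 2" | "2 < p" by linarith
  then show ?thesis
  proof cases
    case 1 then show ?thesis using psi_sum_Lmult_below p by blast
  next
    case 2 then show ?thesis using Lmult_2[OF k bm] by (intro exI[of _ 2]) simp
  next
    case 3
    define q where "q = p / (p - 1)"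
    have q: "1 < q" "q < 2" "1 / q + 1 / p = 1" using 3 by (auto simp: q_def field_simps)
    obtain C where C: "0 \<le> C" "\<forall>s J \<epsilon>. 0 < s \<longrightarrow> finite J \<longrightarrow> (\<forall>j. \<bar>\<epsilon> j\<bar> \<le> 1) \<longrightarrow>
      Lmult k q (\<lambda>\<omega>. \<Sum>j\<in>J. of_real (\<epsilon> j) * psi (s * 2 powi j) \<omega>) C" using psi_sum_Lmult_below[OF q(1,2)] by (elim exE conjE)
    have "Lmult k p (\<lambda>\<omega>. \<Sum>j\<in>J. of_real (\<epsilon> j) * psi (s * 2 powi j) \<omega>) C"
      if s: "0 < s" and J: "finite J" and e: "\<And>j. \<bar>\<epsilon> j\<bar> \<le> 1" for s J and \<epsilon> :: "int \<Rightarrow> real"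
    proof (rule Lmult_dual[OF k bm[OF that] _ q(1) p q(3)])
      have "cnj (psi s \<omega>) = psi s \<omega>" for s \<omega> by (simp add: psi_def psi1_bump)
      then show "Lmult k q (\<lambda>\<omega>. cnj (\<Sum>j\<in>J. of_real (\<epsilon> j) * psi (s * 2 powi j) \<omega>)) C"
        using C(2)[rule_format, OF s J e] by simp
    qed
    then show ?thesis using C(1) by blast
  qed
qed

end

section \<open>Khintchine's inequality\<close>

text \<open>A choice of signs is encoded by the set \<open>A\<close> of indices with sign +1, so
  that expectations over independent signs are finite averages over \<open>Pow J\<close>.\<close>

definition sgn_of :: "int set \<Rightarrow> int \<Rightarrow> real"
  where "sgn_of A j = (if j \<in> A then 1 else -1)"

definition rad :: "int set \<Rightarrow> (int \<Rightarrow> complex) \<Rightarrow> int set \<Rightarrow> complex"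
  where "rad J a A = (\<Sum>j\<in>J. of_real (sgn_of A j) * a j)"

definition avg :: "int set \<Rightarrow> (int set \<Rightarrow> real) \<Rightarrow> real"
  where "avg J f = (\<Sum>A\<in>Pow J. f A) / 2 ^ card J"

lemma avg_insert:
  assumes "finite J" "i \<notin> J" shows "avg (insert i J) f = avg J (\<lambda>A. (f A + f (insert i A)) / 2)"
proof -
  have "(\<Sum>A\<in>Pow (insert i J). f A) = (\<Sum>A\<in>Pow J. f A) + (\<Sum>A\<in>insert i ` Pow J. f A)"
    unfolding Pow_insert using assms by (intro sum.union_disjoint) auto
  also have "(\<Sum>A\<in>insert i ` Pow J. f A) = (\<Sum>A\<in>Pow J. f (insert i A))"
    using assms by (subst sum.reindex) (auto simp: inj_on_def)
  finally have "(\<Sum>A\<in>Pow (insert i J). f A) = (\<Sum>A\<in>Pow J. f A + f (insert i A))" by (simp add: sum.distrib)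
  then show ?thesis using assms by (simp add: avg_def sum_divide_distrib[symmetric])
qed

lemma avg_mono: "(\<And>A. A \<subseteq> J \<Longrightarrow> f A \<le> g A) \<Longrightarrow> avg J f \<le> avg J g"
  unfolding avg_def by (intro divide_right_mono sum_mono) auto

lemma avg_add: "avg J (\<lambda>A. f A + g A) = avg J f + avg J g"
  by (simp add: avg_def sum.distrib add_divide_distrib)

lemma avg_cmult: "avg J (\<lambda>A. c * f A) = c * avg J f"
  by (simp add: avg_def sum_distrib_left)

lemma avg_const: "finite J \<Longrightarrow> avg J (\<lambda>A. c) = c"
  by (simp add: avg_def card_Pow)

lemma avg_cong: "(\<And>A. A \<subseteq> J \<Longrightarrow> f A = g A) \<Longrightarrow> avg J f = avg J g"
  unfolding avg_def by (intro arg_cong2[where f="(/)"] sum.cong) auto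

lemma rad_insert:
  assumes "finite J" "i \<notin> J" "A \<subseteq> J"
  shows "rad (insert i J) a A = rad J a A - a i" "rad (insert i J) a (insert i A) = rad J a A + a i"
proof -
  have "i \<notin> A" using assms by auto
  then show "rad (insert i J) a A = rad J a A - a i" using assms by (simp add: rad_def sgn_of_def)
  have "(\<Sum>j\<in>J. of_real (sgn_of (insert i A) j) * a j) = (\<Sum>j\<in>J. of_real (sgn_of A j) * a j)"
    using assms by (intro sum.cong refl) (auto simp: sgn_of_def)
  then show "rad (insert i J) a (insert i A) = rad J a A + a i" using assms by (simp add: rad_def sgn_of_def)
qed

lemma cmod_add_diff_squares:
  fixes z w :: complex
  shows "(cmod (z - w))\<^sup>2 + (cmod (z + w))\<^sup>2 = 2 * ((cmod z)\<^sup>2 + (cmod w)\<^sup>2)"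
  unfolding cmod_power2 by (simp add: power2_eq_square algebra_simps)

text \<open>The two squared moduli are s - t and s + t, where t is twice the real part of z * cnj w,
  so t^2 <= 4 |z|^2 |w|^2.\<close>

lemma cmod_add_diff_fourth:
  fixes z w :: complex
  shows "(cmod (z - w))^4 + (cmod (z + w))^4 \<le> 2 * ((cmod z)^4 + 6 * (cmod z)\<^sup>2 * (cmod w)\<^sup>2 + (cmod w)^4)"
proof -
  define s t where "s = (cmod z)\<^sup>2 + (cmod w)\<^sup>2" and "t = 2 * Re (z * cnj w)"
  have 1: "(cmod (z - w))\<^sup>2 = s - t" "(cmod (z + w))\<^sup>2 = s + t"
    unfolding s_def t_def cmod_power2 by (simp_all add: power2_eq_square algebra_simps)
  have f: "x^4 = (x\<^sup>2)\<^sup>2" for x :: real by simp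
  have "\<bar>Re (z * cnj w)\<bar> \<le> cmod z * cmod w" using abs_Re_le_cmod[of "z * cnj w"] by (simp add: norm_mult)
  then have "(Re (z * cnj w))\<^sup>2 \<le> (cmod z * cmod w)\<^sup>2" by (simp add: abs_le_square_iff[symmetric])
  moreover define R where "R = Re (z * cnj w)"
  ultimately have "R\<^sup>2 \<le> (cmod z)\<^sup>2 * (cmod w)\<^sup>2" by (simp only: power_mult_distrib)
  then have t: "t\<^sup>2 \<le> 4 * ((cmod z)\<^sup>2 * (cmod w)\<^sup>2)" 
    unfolding t_def R_def[symmetric] by (simp add: power_mult_distrib)
  have "(cmod (z - w))^4 + (cmod (z + w))^4 = 2 * (s\<^sup>2 + t\<^sup>2)"
    unfolding f 1 by (simp add: power2_eq_square algebra_simps)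
  also have "\<dots> \<le> 2 * (s\<^sup>2 + 4 * ((cmod z)\<^sup>2 * (cmod w)\<^sup>2))" using t by (simp only: mult_le_cancel_left_pos zero_less_numeral add_le_cancel_left)
  also have "\<dots> = 2 * ((cmod z)^4 + 6 * (cmod z)\<^sup>2 * (cmod w)\<^sup>2 + (cmod w)^4)"
    unfolding s_def f by (simp add: power2_eq_square algebra_simps)
  finally show ?thesis .
qed

lemma avg_rad_square: "finite J \<Longrightarrow> avg J (\<lambda>A. (cmod (rad J a A))\<^sup>2) = (\<Sum>j\<in>J. (cmod (a j))\<^sup>2)"
proof (induction J rule: finite_induct)
  case empty then show ?case by (simp add: avg_def rad_def)
next
  case (insert i J)
  have "avg (insert i J) (\<lambda>A. (cmod (rad (insert i J) a A))\<^sup>2) = avg J (\<lambda>A. (cmod (rad J a A))\<^sup>2 + (cmod (a i))\<^sup>2)"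
    unfolding avg_insert[OF insert(1,2)]
    by (intro avg_cong) (simp add: rad_insert[OF insert(1,2)] cmod_add_diff_squares)
  then show ?case using insert by (simp add: avg_add avg_const)
qed

text \<open>One sign is averaged out at a time. With S the sum of squares so far, the mixed term 6
  |a i|^2 S is exactly the one in 3 (|a i|^2 + S)^2, so the constant 3 reproduces itself.\<close>

lemma avg_rad_fourth: "finite J \<Longrightarrow> avg J (\<lambda>A. (cmod (rad J a A))^4) \<le> 3 * (\<Sum>j\<in>J. (cmod (a j))\<^sup>2)\<^sup>2"
proof (induction J rule: finite_induct)
  case empty then show ?case by (simp add: avg_def rad_def)
next
  case (insert i J)
  let ?S = "\<Sum>j\<in>J. (cmod (a j))\<^sup>2"
  have "avg (insert i J) (\<lambda>A. (cmod (rad (insert i J) a A))^4) \<le>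
     avg J (\<lambda>A. ((cmod (rad J a A))^4 + (6 * (cmod (a i))\<^sup>2) * (cmod (rad J a A))\<^sup>2) + (cmod (a i))^4)"
    unfolding avg_insert[OF insert(1,2)]
  proof (rule avg_mono)
    fix A assume A: "A \<subseteq> J"
    show "((cmod (rad (insert i J) a A))^4 + (cmod (rad (insert i J) a (insert i A)))^4) / 2 \<le>
      (cmod (rad J a A))^4 + (6 * (cmod (a i))\<^sup>2) * (cmod (rad J a A))\<^sup>2 + (cmod (a i))^4"
      unfolding rad_insert[OF insert(1,2) A] using cmod_add_diff_fourth[of "rad J a A" "a i"] by (simp add: mult_ac)
  qed
  also have "\<dots> = avg J (\<lambda>A. (cmod (rad J a A))^4) + (6 * (cmod (a i))\<^sup>2) * ?S + (cmod (a i))^4"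
    using insert(1) by (simp only: avg_add avg_cmult avg_const avg_rad_square)
  also have "\<dots> \<le> 3 * ?S\<^sup>2 + (6 * (cmod (a i))\<^sup>2) * ?S + 3 * (cmod (a i))^4"
    using insert.IH by (intro add_mono) auto
  also have "\<dots> = 3 * ((cmod (a i))\<^sup>2 + ?S)\<^sup>2" by (simp add: power2_eq_square power4_eq_xxxx algebra_simps)
  finally show ?case using insert by simp
qed

text \<open>A sub-Gaussian bound. The exponent x^2 in place of x^2 / 2 leaves enough room for
  quadratic bounds of exp on [0, 1], and beyond 1 for x <= x^2.\<close>

lemma cosh_le_exp_square: "(exp (- x) + exp x) / 2 \<le> exp ((x::real)\<^sup>2)"
proof -
  have main: "(exp (- x) + exp x) / 2 \<le> exp (x\<^sup>2)" if x: "0 \<le> x" for x :: real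
  proof (cases "x \<le> 1")
    case True
    have "exp x \<le> 1 + x + x\<^sup>2" using exp_bound[OF x True] by simp
    moreover have "exp (- x) \<le> 1 - x + x\<^sup>2"
    proof -
      have "exp (- x) \<le> 1 / (1 + x)" using exp_ge_add_one_self[of x] x
        by (simp add: exp_minus inverse_eq_divide frac_le)
      also have "\<dots> \<le> 1 - x + x\<^sup>2"
      proof -
        have "1 \<le> (1 - x + x\<^sup>2) * (1 + x)" using x by (simp add: algebra_simps power2_eq_square)
        then show ?thesis using x by (simp add: pos_divide_le_eq)
      qed
      finally show ?thesis .
    qed
    ultimately have "(exp (- x) + exp x) / 2 \<le> 1 + x\<^sup>2" by simp
    then show ?thesis using exp_ge_add_one_self[of "x\<^sup>2"] by linarith
  next
    case False
    have "x \<le> x\<^sup>2" using False by (simp add: power2_eq_square)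
    moreover have "exp (- x) \<le> exp x" using x by simp
    ultimately have "(exp (- x) + exp x) / 2 \<le> exp x" "exp x \<le> exp (x\<^sup>2)" by (simp_all add: field_simps)
    then show ?thesis by linarith
  qed
  show ?thesis
  proof (cases "0 \<le> x")
    case False
    then show ?thesis using main[of "- x"] by (simp add: add.commute)
  qed (rule main)
qed

text \<open>Independence in finite form: averaging out one sign splits off a factor cosh (b
  i).\<close>

lemma avg_exp_le:
  fixes b :: "int \<Rightarrow> real"
  shows "finite J \<Longrightarrow> avg J (\<lambda>A. exp (\<Sum>j\<in>J. sgn_of A j * b j)) \<le> exp (\<Sum>j\<in>J. (b j)\<^sup>2)"
proof (induction J rule: finite_induct)
  case empty then show ?case by (simp add: avg_def)
next
  case (insert i J)
  have "avg (insert i J) (\<lambda>A. exp (\<Sum>j\<in>insert i J. sgn_of A j * b j)) =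
      avg J (\<lambda>A. ((exp (- b i) + exp (b i)) / 2) * exp (\<Sum>j\<in>J. sgn_of A j * b j))"
    unfolding avg_insert[OF insert(1,2)]
  proof (rule avg_cong)
    fix A assume A: "A \<subseteq> J"
    have i: "i \<notin> A" using A insert by auto
    have "(\<Sum>j\<in>J. sgn_of (insert i A) j * b j) = (\<Sum>j\<in>J. sgn_of A j * b j)"
      using insert(2) by (intro sum.cong refl) (auto simp: sgn_of_def)
    then show "(exp (\<Sum>j\<in>insert i J. sgn_of A j * b j) + exp (\<Sum>j\<in>insert i J. sgn_of (insert i A) j * b j)) / 2 =
      ((exp (- b i) + exp (b i)) / 2) * exp (\<Sum>j\<in>J. sgn_of A j * b j)"
      using insert(1,2) i by (simp add: exp_add sgn_of_def algebra_simps exp_diff exp_minus field_simps)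
  qed
  also have "\<dots> = ((exp (- b i) + exp (b i)) / 2) * avg J (\<lambda>A. exp (\<Sum>j\<in>J. sgn_of A j * b j))" by (rule avg_cmult)
  also have "\<dots> \<le> exp ((b i)\<^sup>2) * exp (\<Sum>j\<in>J. (b j)\<^sup>2)"
    using cosh_le_exp_square[of "b i"] insert.IH by (intro mult_mono) (auto simp: avg_def intro!: divide_nonneg_nonneg sum_nonneg)
  finally show ?case using insert by (simp add: exp_add)
qed

text \<open>The inequality x / p <= exp (x / p), raised to the power p.\<close>

lemma powr_le_exp: "0 \<le> x \<Longrightarrow> 0 < p \<Longrightarrow> x powr p \<le> p powr p * exp (x::real)"
proof -
  assume x: "0 \<le> x" and p: "0 < p"
  have "x / p \<le> exp (x / p)" using exp_ge_add_one_self[of "x / p"] by linarith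
  then have "(x / p) powr p \<le> exp (x / p) powr p" using x p by (intro powr_mono2) auto
  also have "exp (x / p) powr p = exp x" using p by (simp add: powr_def)
  finally have "p powr p * (x / p) powr p \<le> p powr p * exp x" by (intro mult_left_mono) auto
  then show ?thesis using x p by (simp add: powr_divide)
qed

text \<open>After normalisation each inequality reduces to averaging a pointwise inequality between powers.\<close>

theorem khintchine:
  assumes p: "0 < p"
  shows "\<exists>c\<ge>0. \<forall>J a. finite J \<longrightarrow>
    avg J (\<lambda>A. cmod (rad J a A) powr p) \<le> c * (L2_set (\<lambda>j. cmod (a j)) J) powr p \<and>
    (L2_set (\<lambda>j. cmod (a j)) J) powr p \<le> c * avg J (\<lambda>A. cmod (rad J a A) powr p)"
proof -
  define cu where "cu = (if p \<le> 2 then 2 else 2 powr p * (2 * (p powr p * (2 * exp 1))))"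
  define cl where "cl = (if p \<le> 2 then 2 * sqrt 6 powr (2 - p) else 2 * (1/2) powr (1 - p / 2))"
  have unit: "avg J (\<lambda>A. cmod (rad J a A) powr p) \<le> cu \<and> 1 \<le> cl * avg J (\<lambda>A. cmod (rad J a A) powr p)"
    if J: "finite J" and s: "(\<Sum>j\<in>J. (cmod (a j))\<^sup>2) = 1" for J a
  proof (cases "p \<le> 2")
    case True
    let ?X = "\<lambda>A. cmod (rad J a A)"
    have "avg J (\<lambda>A. ?X A powr p) \<le> avg J (\<lambda>A. 1 + (?X A)\<^sup>2)"
    proof (rule avg_mono)
      fix A
      show "?X A powr p \<le> 1 + (?X A)\<^sup>2"
      proof (cases "?X A \<le> 1")
        case True
        then have "?X A powr p \<le> 1 powr p" using p by (intro powr_mono2) auto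
        then show ?thesis by (simp add: add_increasing2)
      next
        case False
        then have "?X A powr p \<le> ?X A powr 2" using \<open>p \<le> 2\<close> by (intro powr_mono) auto
        then show ?thesis using False by (simp add: powr_numeral)
      qed
    qed
    also have "\<dots> = 2" using J s by (simp add: avg_add avg_const avg_rad_square)
    finally have U: "avg J (\<lambda>A. ?X A powr p) \<le> cu" using True by (simp add: cu_def)
    \<comment> \<open>Above the level N the square is at most 1/6 of the fourth power. The fourth
      moment is at most 3, so this part takes at most half of the second moment 1 and leaves at
      least half for the p-th moment.\<close>
    define N where "N = sqrt (6::real)"
    have N: "0 < N" "N\<^sup>2 = 6" by (auto simp: N_def)
    have "1 = avg J (\<lambda>A. (?X A)\<^sup>2)" using avg_rad_square[OF J] s by simp
    also have "\<dots> \<le> avg J (\<lambda>A. N powr (2 - p) * ?X A powr p + (1 / 6) * (?X A)^4)"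
    proof (rule avg_mono)
      fix A
      show "(?X A)\<^sup>2 \<le> N powr (2 - p) * ?X A powr p + (1 / 6) * (?X A)^4"
      proof (cases "?X A \<le> N")
        case True
        have "(?X A)\<^sup>2 = ?X A powr (2 - p) * ?X A powr p"
          by (cases "rad J a A = 0") (auto simp: powr_add[symmetric] powr_numeral)
        also have "\<dots> \<le> N powr (2 - p) * ?X A powr p" using True \<open>p \<le> 2\<close> by (intro mult_right_mono powr_mono2) auto
        finally show ?thesis by (simp add: add_increasing2)
      next
        case False
        then have "6 \<le> (?X A)\<^sup>2" using N power_mono[of N "?X A" 2] by auto
        then have "6 * (?X A)\<^sup>2 \<le> (?X A)\<^sup>2 * (?X A)\<^sup>2" by (intro mult_right_mono) auto
        then have "(?X A)\<^sup>2 \<le> (1 / 6) * (?X A)^4" by (simp add: power2_eq_square power4_eq_xxxx)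
        then show ?thesis by (simp add: add_increasing)
      qed
    qed
    also have "\<dots> = N powr (2 - p) * avg J (\<lambda>A. ?X A powr p) + (1 / 6) * avg J (\<lambda>A. (?X A)^4)" by (simp only: avg_add avg_cmult)
    also have "\<dots> \<le> N powr (2 - p) * avg J (\<lambda>A. ?X A powr p) + (1 / 6) * (3 * 1)"
      using avg_rad_fourth[OF J, of a] s by (intro add_left_mono mult_left_mono) auto
    finally have "1 \<le> cl * avg J (\<lambda>A. ?X A powr p)" using True by (simp add: cl_def N_def)
    with U show ?thesis by simp
  next
    case False
    let ?X = "\<lambda>A. cmod (rad J a A)"
    \<comment> \<open>For p > 2 the upper bound comes from exponential moments, separately for real
      and imaginary parts.\<close>
    have part: "avg J (\<lambda>A. \<bar>\<Sum>j\<in>J. sgn_of A j * b j\<bar> powr p) \<le> p powr p * (2 * exp 1)" if b: "(\<Sum>j\<in>J. (b j)\<^sup>2) \<le> 1" for b :: "int \<Rightarrow> real"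
    proof -
      let ?Y = "\<lambda>A. \<Sum>j\<in>J. sgn_of A j * b j"
      have "avg J (\<lambda>A. \<bar>?Y A\<bar> powr p) \<le> avg J (\<lambda>A. p powr p * (exp (?Y A) + exp (\<Sum>j\<in>J. sgn_of A j * (- b j))))"
      proof (rule avg_mono)
        fix A
        have "\<bar>?Y A\<bar> powr p \<le> p powr p * exp \<bar>?Y A\<bar>" using p by (intro powr_le_exp) auto
        also have "exp \<bar>?Y A\<bar> \<le> exp (?Y A) + exp (- ?Y A)" by (cases "0 \<le> ?Y A") auto
        finally show "\<bar>?Y A\<bar> powr p \<le> p powr p * (exp (?Y A) + exp (\<Sum>j\<in>J. sgn_of A j * (- b j)))"
          by (simp add: sum_negf mult_left_mono)
      qed
      also have "\<dots> = p powr p * (avg J (\<lambda>A. exp (?Y A)) + avg J (\<lambda>A. exp (\<Sum>j\<in>J. sgn_of A j * (- b j))))" by (simp only: avg_add avg_cmult)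
      also have "\<dots> \<le> p powr p * (exp (\<Sum>j\<in>J. (b j)\<^sup>2) + exp (\<Sum>j\<in>J. (- b j)\<^sup>2))"
        by (intro mult_left_mono add_mono avg_exp_le J) auto
      also have "\<dots> \<le> p powr p * (exp 1 + exp 1)" using b by (intro mult_left_mono add_mono) auto
      finally show ?thesis by simp
    qed
    have re: "Re (rad J a A) = (\<Sum>j\<in>J. sgn_of A j * Re (a j))" "Im (rad J a A) = (\<Sum>j\<in>J. sgn_of A j * Im (a j))" for A
      by (simp_all add: rad_def)
    have b1: "(\<Sum>j\<in>J. (Re (a j))\<^sup>2) \<le> 1" "(\<Sum>j\<in>J. (Im (a j))\<^sup>2) \<le> 1"
      unfolding s[symmetric] by (auto intro!: sum_mono simp: cmod_power2)
    have "avg J (\<lambda>A. ?X A powr p) \<le> avg J (\<lambda>A. 2 powr p * (\<bar>Re (rad J a A)\<bar> powr p + \<bar>Im (rad J a A)\<bar> powr p))"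
    proof (rule avg_mono)
      fix A
      define u v where "u = \<bar>Re (rad J a A)\<bar>" and "v = \<bar>Im (rad J a A)\<bar>"
      have "?X A \<le> 2 * max u v" using cmod_le[of "rad J a A"] by (simp add: u_def v_def)
      then have "?X A powr p \<le> (2 * max u v) powr p" using p by (intro powr_mono2) auto
      also have "\<dots> = 2 powr p * max u v powr p" by (simp add: powr_mult u_def v_def)
      also have "\<dots> \<le> 2 powr p * (u powr p + v powr p)" by (intro mult_left_mono) (auto simp: max_def)
      finally show "?X A powr p \<le> 2 powr p * (u powr p + v powr p)" .
    qed
    also have "\<dots> = 2 powr p * (avg J (\<lambda>A. \<bar>Re (rad J a A)\<bar> powr p) + avg J (\<lambda>A. \<bar>Im (rad J a A)\<bar> powr p))" by (simp only: avg_add avg_cmult)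
    also have "\<dots> \<le> 2 powr p * (p powr p * (2 * exp 1) + p powr p * (2 * exp 1))"
      unfolding re by (intro mult_left_mono add_mono part b1) auto
    finally have U: "avg J (\<lambda>A. ?X A powr p) \<le> cu" using False by (simp add: cu_def mult_ac)
    have "1 = avg J (\<lambda>A. (?X A)\<^sup>2)" using avg_rad_square[OF J] s by simp
    \<comment> \<open>Where the square is at most 1/2 the first term suffices. Elsewhere it is at
      most (1/2)^(1 - p/2) times the p-th power, because 1 - p/2 is negative.\<close>
    also have "\<dots> \<le> avg J (\<lambda>A. 1 / 2 + (1/2) powr (1 - p / 2) * ?X A powr p)"
    proof (rule avg_mono)
      fix A
      show "(?X A)\<^sup>2 \<le> 1 / 2 + (1/2) powr (1 - p / 2) * ?X A powr p"
      proof (cases "(?X A)\<^sup>2 \<le> 1 / 2")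
        case True then show ?thesis by (simp add: add_increasing2)
      next
        case False
        then have x0: "0 < ?X A" by auto
        have "(?X A)\<^sup>2 = ((?X A)\<^sup>2) powr (1 - p / 2) * ?X A powr p"
        proof -
          have "(?X A)\<^sup>2 = ?X A powr 2" using x0 by (simp add: powr_numeral)
          then have "((?X A)\<^sup>2) powr (1 - p / 2) = ?X A powr (2 * (1 - p / 2))"
            by (simp only: powr_powr)
          then show ?thesis using x0 by (simp add: powr_add[symmetric] powr_numeral)
        qed
        also have "\<dots> \<le> (1/2) powr (1 - p / 2) * ?X A powr p"
          using False \<open>\<not> p \<le> 2\<close> by (intro mult_right_mono powr_mono2') auto
        finally show ?thesis by simp
      qed
    qed
    also have "\<dots> = 1 / 2 + (1/2) powr (1 - p / 2) * avg J (\<lambda>A. ?X A powr p)" using J by (simp only: avg_add avg_cmult avg_const)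
    finally have "1 \<le> cl * avg J (\<lambda>A. ?X A powr p)" using False by (simp add: cl_def)
    with U show ?thesis by simp
  qed
  define c where "c = max cu cl"
  have "0 \<le> cu" by (simp add: cu_def)
  then have c: "0 \<le> c" by (simp add: c_def le_max_iff_disj)
  have "avg J (\<lambda>A. cmod (rad J a A) powr p) \<le> c * (L2_set (\<lambda>j. cmod (a j)) J) powr p \<and>
    (L2_set (\<lambda>j. cmod (a j)) J) powr p \<le> c * avg J (\<lambda>A. cmod (rad J a A) powr p)" if J: "finite J" for J a
  proof (cases "L2_set (\<lambda>j. cmod (a j)) J = 0")
    case True
    then have "\<And>j. j \<in> J \<Longrightarrow> a j = 0" using J by (auto simp: L2_set_eq_0_iff)
    then have "rad J a A = 0" for A by (simp add: rad_def)
    then show ?thesis using True p J by (simp add: avg_const)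
  next
    case False
    define s where "s = L2_set (\<lambda>j. cmod (a j)) J"
    have s: "0 < s" using False by (simp add: s_def L2_set_nonneg less_le)
    define b where "b j = a j / of_real s" for j
    have "(\<Sum>j\<in>J. (cmod (b j))\<^sup>2) = (\<Sum>j\<in>J. (cmod (a j))\<^sup>2) / s\<^sup>2"
      using s by (simp add: b_def norm_divide power_divide sum_divide_distrib)
    also have "(\<Sum>j\<in>J. (cmod (a j))\<^sup>2) = s\<^sup>2" by (simp add: s_def L2_set_def sum_nonneg)
    finally have b1: "(\<Sum>j\<in>J. (cmod (b j))\<^sup>2) = 1" using s by simp
    have "rad J a A = of_real s * rad J b A" for A using s by (simp add: rad_def b_def sum_distrib_left)
    then have "avg J (\<lambda>A. cmod (rad J a A) powr p) = s powr p * avg J (\<lambda>A. cmod (rad J b A) powr p)"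
      using s by (simp add: norm_mult powr_mult avg_cmult)
    moreover have "avg J (\<lambda>A. cmod (rad J b A) powr p) \<le> c" using unit[OF J b1] by (auto simp: c_def le_max_iff_disj)
    moreover have "1 \<le> c * avg J (\<lambda>A. cmod (rad J b A) powr p)"
    proof -
      have "0 \<le> avg J (\<lambda>A. cmod (rad J b A) powr p)" by (auto simp: avg_def intro!: divide_nonneg_nonneg sum_nonneg)
      then have "cl * avg J (\<lambda>A. cmod (rad J b A) powr p) \<le> c * avg J (\<lambda>A. cmod (rad J b A) powr p)"
        by (intro mult_right_mono) (auto simp: c_def)
      then show ?thesis using unit[OF J b1] by linarith
    qed
    ultimately show ?thesis unfolding s_def[symmetric]
      using mult_left_mono[of "avg J (\<lambda>A. cmod (rad J b A) powr p)" c "s powr p"]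
        mult_left_mono[of 1 "c * avg J (\<lambda>A. cmod (rad J b A) powr p)" "s powr p"] by (simp add: mult_ac)
  qed
  then show ?thesis using c by blast
qed

section \<open>Square functions\<close>

text \<open>The square function over an index set, taken complex-valued so that
  \<open>Lr_norm\<close> and its inequalities apply.\<close>

definition sq :: "int set \<Rightarrow> (int \<Rightarrow> real \<Rightarrow> complex) \<Rightarrow> real \<Rightarrow> complex"
  where "sq J F x = complex_of_real (L2_set (\<lambda>j. cmod (F j x)) J)"

lemma cmod_sq: "cmod (sq J F x) = L2_set (\<lambda>j. cmod (F j x)) J"
  by (simp add: sq_def L2_set_nonneg)

lemma sq_measurable:
  assumes "\<And>j. j \<in> J \<Longrightarrow> F j \<in> borel_measurable lebesgue" shows "sq J F \<in> borel_measurable lebesgue"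
proof -
  have [measurable]: "(\<lambda>x. \<Sum>j\<in>J. (cmod (F j x))\<^sup>2) \<in> borel_measurable lebesgue"
    by (intro borel_measurable_sum borel_measurable_power measurable_compose[OF _ borel_measurable_norm] assms)
  show ?thesis unfolding sq_def[abs_def] L2_set_def by measurable
qed

lemma Lr_norm_sq_cong_AE:
  assumes "finite J" "\<And>j. j \<in> J \<Longrightarrow> AE x in lebesgue. cmod (F j x) = cmod (G j x)"
  shows "Lr_norm p (sq J F) = Lr_norm p (sq J G)"
proof (rule Lr_norm_cong_AE)
  have "AE x in lebesgue. \<forall>j\<in>J. cmod (F j x) = cmod (G j x)" using assms by (rule AE_finite_allI)
  then show "AE x in lebesgue. cmod (sq J F x) = cmod (sq J G x)"
    unfolding cmod_sq by (rule eventually_mono) (auto intro: L2_set_cong)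
qed

text \<open>Minkowski's inequality twice: pointwise for the l^2 norm over j, then in L^p.\<close>

lemma Lr_norm_sq_triangle:
  assumes F: "\<And>j. j \<in> J \<Longrightarrow> F j \<in> borel_measurable lebesgue" and G: "\<And>j. j \<in> J \<Longrightarrow> G j \<in> borel_measurable lebesgue"
    and p: "1 \<le> p" and a: "cmod a = 1"
  shows "Lr_norm p (sq J (\<lambda>j x. F j x + a * G j x)) \<le> Lr_norm p (sq J F) + Lr_norm p (sq J G)"
proof -
  have "Lr_norm p (sq J (\<lambda>j x. F j x + a * G j x)) \<le> Lr_norm p (\<lambda>x. sq J F x + sq J G x)"
  proof (rule Lr_norm_mono_AE)
    have "cmod (sq J (\<lambda>j x. F j x + a * G j x) x) \<le> cmod (sq J F x + sq J G x)" for x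
    proof -
      have "L2_set (\<lambda>j. cmod (F j x + a * G j x)) J \<le> L2_set (\<lambda>j. cmod (F j x) + cmod (G j x)) J"
        using a by (intro L2_set_mono) (auto intro: norm_triangle_mono[THEN order_trans] simp: norm_mult
            intro!: order_trans[OF norm_triangle_ineq])
      also have "\<dots> \<le> L2_set (\<lambda>j. cmod (F j x)) J + L2_set (\<lambda>j. cmod (G j x)) J" by (rule L2_set_triangle_ineq)
      also have "\<dots> = cmod (sq J F x + sq J G x)"
        unfolding sq_def of_real_add[symmetric] norm_of_real by (simp add: L2_set_nonneg)
      finally show ?thesis unfolding cmod_sq .
    qed
    then show "AE x in lebesgue. cmod (sq J (\<lambda>j x. F j x + a * G j x) x) \<le> cmod (sq J F x + sq J G x)" by simp
  qed (use p in simp)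
  also have "\<dots> \<le> Lr_norm p (sq J F) + Lr_norm p (sq J G)"
    using F G p by (intro Lr_norm_triangle sq_measurable) auto
  finally show ?thesis .
qed

lemma rad_measurable:
  assumes "\<And>j. j \<in> J \<Longrightarrow> F j \<in> borel_measurable lebesgue" shows "(\<lambda>x. rad J (\<lambda>j. F j x) A) \<in> borel_measurable lebesgue"
  unfolding rad_def by (intro borel_measurable_sum borel_measurable_times borel_measurable_const assms)

lemma sum_En_rad:
  assumes J: "finite J" and F: "\<And>j. j \<in> J \<Longrightarrow> F j \<in> borel_measurable lebesgue"
  shows "(\<Sum>A\<in>Pow J. En p (\<lambda>x. rad J (\<lambda>j. F j x) A)) =
    (\<integral>\<^sup>+x. ennreal (2 ^ card J * avg J (\<lambda>A. cmod (rad J (\<lambda>j. F j x) A) powr p)) \<partial>lebesgue)"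
proof -
  note [measurable] = rad_measurable[OF F]
  have "(\<Sum>A\<in>Pow J. En p (\<lambda>x. rad J (\<lambda>j. F j x) A)) =
     (\<integral>\<^sup>+x. (\<Sum>A\<in>Pow J. ennreal (cmod (rad J (\<lambda>j. F j x) A) powr p)) \<partial>lebesgue)"
    unfolding En_def by (intro nn_integral_sum[symmetric]) measurable
  also have "\<dots> = (\<integral>\<^sup>+x. ennreal (2 ^ card J * avg J (\<lambda>A. cmod (rad J (\<lambda>j. F j x) A) powr p)) \<partial>lebesgue)"
    by (intro nn_integral_cong) (simp add: sum_ennreal avg_def)
  finally show ?thesis .
qed

text \<open>Khintchine's inequality integrated over x. The average over signs becomes a sum of
  2^card J integrals, whence the powers of two.\<close>

lemma khintchine_En:
  assumes p: "0 < p"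
  shows "\<exists>c\<ge>0. \<forall>J F. finite J \<longrightarrow> (\<forall>j\<in>J. F j \<in> borel_measurable lebesgue) \<longrightarrow>
    En p (sq J F) \<le> ennreal (c / 2 ^ card J) * (\<Sum>A\<in>Pow J. En p (\<lambda>x. rad J (\<lambda>j. F j x) A)) \<and>
    (\<Sum>A\<in>Pow J. En p (\<lambda>x. rad J (\<lambda>j. F j x) A)) \<le> ennreal (c * 2 ^ card J) * En p (sq J F)"
proof -
  obtain c where c: "0 \<le> c" and kh: "\<And>J a. finite J \<Longrightarrow>
      avg J (\<lambda>A. cmod (rad J a A) powr p) \<le> c * (L2_set (\<lambda>j. cmod (a j)) J) powr p"
      "\<And>J a. finite J \<Longrightarrow> (L2_set (\<lambda>j. cmod (a j)) J) powr p \<le> c * avg J (\<lambda>A. cmod (rad J a A) powr p)"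
    using khintchine[OF p] by blast
  have "En p (sq J F) \<le> ennreal (c / 2 ^ card J) * (\<Sum>A\<in>Pow J. En p (\<lambda>x. rad J (\<lambda>j. F j x) A)) \<and>
    (\<Sum>A\<in>Pow J. En p (\<lambda>x. rad J (\<lambda>j. F j x) A)) \<le> ennreal (c * 2 ^ card J) * En p (sq J F)"
    if J: "finite J" and F: "\<forall>j\<in>J. F j \<in> borel_measurable lebesgue" for J F
  proof
    have F': "\<And>j. j \<in> J \<Longrightarrow> F j \<in> borel_measurable lebesgue" using F by blast
    note [measurable] = rad_measurable[OF F'] sq_measurable[OF F']
    have S: "(\<Sum>A\<in>Pow J. En p (\<lambda>x. rad J (\<lambda>j. F j x) A)) =
        (\<integral>\<^sup>+x. ennreal (2 ^ card J * avg J (\<lambda>A. cmod (rad J (\<lambda>j. F j x) A) powr p)) \<partial>lebesgue)"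
      by (rule sum_En_rad[OF J]) (rule F')
    let ?a = "\<lambda>x. avg J (\<lambda>A. cmod (rad J (\<lambda>j. F j x) A) powr p)"
    have [measurable]: "?a \<in> borel_measurable lebesgue" unfolding avg_def by measurable
    have a0: "0 \<le> ?a x" for x by (auto simp: avg_def intro!: divide_nonneg_nonneg sum_nonneg)
    have "En p (sq J F) \<le> (\<integral>\<^sup>+x. ennreal (c / 2 ^ card J) * ennreal (2 ^ card J * ?a x) \<partial>lebesgue)"
      unfolding En_def cmod_sq
      by (intro nn_integral_mono) (use kh(2)[OF J] c in \<open>simp add: ennreal_mult'[symmetric] ennreal_leI\<close>)
    also have "\<dots> = ennreal (c / 2 ^ card J) * (\<Sum>A\<in>Pow J. En p (\<lambda>x. rad J (\<lambda>j. F j x) A))"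
      unfolding S by (rule nn_integral_cmult) measurable
    finally show "En p (sq J F) \<le> ennreal (c / 2 ^ card J) * (\<Sum>A\<in>Pow J. En p (\<lambda>x. rad J (\<lambda>j. F j x) A))" .
    have "(\<Sum>A\<in>Pow J. En p (\<lambda>x. rad J (\<lambda>j. F j x) A)) \<le>
        (\<integral>\<^sup>+x. ennreal (c * 2 ^ card J) * ennreal (cmod (sq J F x) powr p) \<partial>lebesgue)"
      unfolding S cmod_sq
      by (intro nn_integral_mono) (use kh(1)[OF J] c in \<open>simp add: ennreal_mult'[symmetric] ennreal_leI mult_ac\<close>)
    also have "\<dots> = ennreal (c * 2 ^ card J) * En p (sq J F)" unfolding En_def by (rule nn_integral_cmult) measurable
    finally show "(\<Sum>A\<in>Pow J. En p (\<lambda>x. rad J (\<lambda>j. F j x) A)) \<le> ennreal (c * 2 ^ card J) * En p (sq J F)" .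
  qed
  then show ?thesis using c by blast
qed

lemma Lr_norm_le_iff_En:
  assumes "0 < p" "0 \<le> c" shows "Lr_norm p f \<le> ennreal c * X \<longleftrightarrow> En p f \<le> ennreal (c powr p) * ennreal_powr X p"
proof -
  have "Lr_norm p f \<le> ennreal c * X \<longleftrightarrow> ennreal_powr (Lr_norm p f) p \<le> ennreal_powr (ennreal c * X) p"
    using assms by (simp add: ennreal_powr_le_iff)
  then show ?thesis using assms by (simp add: En_Lr_norm ennreal_powr_mult)
qed

text \<open>Only the half of Khintchine's inequality that dominates the square function by the
  average enters.\<close>

lemma Lr_norm_sq_le_random_signs:
  assumes p: "0 < p"
  shows "\<exists>c\<ge>0. \<forall>J F X. finite J \<longrightarrow> (\<forall>j\<in>J. F j \<in> borel_measurable lebesgue) \<longrightarrow>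
    (\<forall>A. Lr_norm p (\<lambda>x. rad J (\<lambda>j. F j x) A) \<le> X) \<longrightarrow> Lr_norm p (sq J F) \<le> ennreal c * X"
proof -
  obtain c where c: "0 \<le> c" and kh: "\<And>J F. finite J \<Longrightarrow> (\<forall>j\<in>J. F j \<in> borel_measurable lebesgue) \<Longrightarrow>
    En p (sq J F) \<le> ennreal (c / 2 ^ card J) * (\<Sum>A\<in>Pow J. En p (\<lambda>x. rad J (\<lambda>j. F j x) A))"
    using khintchine_En[OF p] by blast
  have "Lr_norm p (sq J F) \<le> ennreal (c powr (1 / p)) * X"
    if J: "finite J" and F: "\<forall>j\<in>J. F j \<in> borel_measurable lebesgue"
      and X: "\<And>A. Lr_norm p (\<lambda>x. rad J (\<lambda>j. F j x) A) \<le> X" for J F X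
  proof -
    have "En p (\<lambda>x. rad J (\<lambda>j. F j x) A) \<le> ennreal_powr X p" for A
      using X[of A] p by (simp add: En_Lr_norm ennreal_powr_le_iff)
    then have "(\<Sum>A\<in>Pow J. En p (\<lambda>x. rad J (\<lambda>j. F j x) A)) \<le> (\<Sum>A\<in>Pow J. ennreal_powr X p)" by (intro sum_mono) auto
    also have "\<dots> = ennreal (2 ^ card J) * ennreal_powr X p" using J by (simp add: card_Pow ennreal_power[symmetric])
    finally have "ennreal (c / 2 ^ card J) * (\<Sum>A\<in>Pow J. En p (\<lambda>x. rad J (\<lambda>j. F j x) A)) \<le>
       ennreal (c / 2 ^ card J) * (ennreal (2 ^ card J) * ennreal_powr X p)" by (rule mult_left_mono) simp
    also have "\<dots> = ennreal c * ennreal_powr X p" using c by (simp add: mult.assoc[symmetric] ennreal_mult'[symmetric])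
    finally have "En p (sq J F) \<le> ennreal c * ennreal_powr X p" using kh[OF J F] by (rule order_trans[rotated])
    then show ?thesis using p c by (simp add: Lr_norm_le_iff_En powr_powr)
  qed
  then show ?thesis by (intro exI[of _ "c powr (1 / p)"]) auto
qed

text \<open>Introduce signs on the left, apply the estimate to each signed sum, remove the signs on
  the right. A linear operator bounded on L^p thereby extends to square functions, with a constant
  independent of \<open>J\<close>.\<close>

lemma Lr_norm_sq_le_sq:
  assumes p: "0 < p"
  shows "\<exists>c\<ge>0. \<forall>J F G C. finite J \<longrightarrow> (\<forall>j\<in>J. F j \<in> borel_measurable lebesgue) \<longrightarrow> (\<forall>j\<in>J. G j \<in> borel_measurable lebesgue) \<longrightarrow>
    0 \<le> C \<longrightarrow> (\<forall>A. Lr_norm p (\<lambda>x. rad J (\<lambda>j. F j x) A) \<le> ennreal C * Lr_norm p (\<lambda>x. rad J (\<lambda>j. G j x) A)) \<longrightarrow>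
    Lr_norm p (sq J F) \<le> ennreal (c * C) * Lr_norm p (sq J G)"
proof -
  obtain c where c: "0 \<le> c" and kh1: "\<And>J F. finite J \<Longrightarrow> (\<forall>j\<in>J. F j \<in> borel_measurable lebesgue) \<Longrightarrow>
    En p (sq J F) \<le> ennreal (c / 2 ^ card J) * (\<Sum>A\<in>Pow J. En p (\<lambda>x. rad J (\<lambda>j. F j x) A))"
    and kh2: "\<And>J F. finite J \<Longrightarrow> (\<forall>j\<in>J. F j \<in> borel_measurable lebesgue) \<Longrightarrow>
    (\<Sum>A\<in>Pow J. En p (\<lambda>x. rad J (\<lambda>j. F j x) A)) \<le> ennreal (c * 2 ^ card J) * En p (sq J F)"
    using khintchine_En[OF p] by blast
  have "Lr_norm p (sq J F) \<le> ennreal ((c * c) powr (1 / p) * C) * Lr_norm p (sq J G)"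
    if J: "finite J" and F: "\<forall>j\<in>J. F j \<in> borel_measurable lebesgue" and G: "\<forall>j\<in>J. G j \<in> borel_measurable lebesgue"
      and C: "0 \<le> C" and le: "\<And>A. Lr_norm p (\<lambda>x. rad J (\<lambda>j. F j x) A) \<le> ennreal C * Lr_norm p (\<lambda>x. rad J (\<lambda>j. G j x) A)" for J F G C
  proof -
    have "En p (\<lambda>x. rad J (\<lambda>j. F j x) A) \<le> ennreal (C powr p) * En p (\<lambda>x. rad J (\<lambda>j. G j x) A)" for A
      using le[of A] p C by (simp add: Lr_norm_le_iff_En En_Lr_norm[symmetric])
    then have "(\<Sum>A\<in>Pow J. En p (\<lambda>x. rad J (\<lambda>j. F j x) A)) \<le> ennreal (C powr p) * (\<Sum>A\<in>Pow J. En p (\<lambda>x. rad J (\<lambda>j. G j x) A))"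
      unfolding sum_distrib_left by (intro sum_mono) auto
    also have "\<dots> \<le> ennreal (C powr p) * (ennreal (c * 2 ^ card J) * En p (sq J G))"
      using kh2[OF J G] by (rule mult_left_mono) simp
    finally have "ennreal (c / 2 ^ card J) * (\<Sum>A\<in>Pow J. En p (\<lambda>x. rad J (\<lambda>j. F j x) A)) \<le>
       ennreal (c / 2 ^ card J) * (ennreal (C powr p) * (ennreal (c * 2 ^ card J) * En p (sq J G)))" by (rule mult_left_mono) simp
    also have "\<dots> = ennreal (c / 2 ^ card J * (C powr p * (c * 2 ^ card J))) * En p (sq J G)"
      using c by (simp add: mult.assoc[symmetric] ennreal_mult'[symmetric])
    also have "c / 2 ^ card J * (C powr p * (c * 2 ^ card J)) = ((c * c) powr (1 / p) * C) powr p"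
      using c C p by (simp add: powr_mult powr_powr)
    finally have "En p (sq J F) \<le> ennreal (((c * c) powr (1 / p) * C) powr p) * En p (sq J G)"
      using kh1[OF J F] by (rule order_trans[rotated])
    then show ?thesis using p c C by (subst Lr_norm_le_iff_En) (auto simp: En_Lr_norm[symmetric])
  qed
  then show ?thesis by (intro exI[of _ "(c * c) powr (1 / p)"]) auto
qed

section \<open>Dyadic annuli\<close>

text \<open>Half-open, so that these sets partition the nonzero reals; \<open>Delta j\<close> has
  the two outer endpoints in addition.\<close>

definition annulus :: "int \<Rightarrow> real set"
  where "annulus j = {\<omega>. 2 powi j \<le> \<bar>\<omega>\<bar> \<and> \<bar>\<omega>\<bar> < 2 powi (j + 1)}"

lemma annulus_measurable [measurable]: "annulus j \<in> sets borel"
  unfolding annulus_def by measurable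

lemma annulus_lebesgue: "annulus j \<in> sets lebesgue"
  using annulus_measurable[of j] by simp

lemma annulus_iff:
  assumes "\<omega> \<noteq> 0" shows "\<omega> \<in> annulus j \<longleftrightarrow> j = \<lfloor>log 2 \<bar>\<omega>\<bar>\<rfloor>"
proof -
  have a: "(2::real) powi i = 2 powr of_int i" for i by (simp add: powr_real_of_int')
  have "\<omega> \<in> annulus j \<longleftrightarrow> of_int j \<le> log 2 \<bar>\<omega>\<bar> \<and> log 2 \<bar>\<omega>\<bar> < of_int (j + 1)"
    unfolding annulus_def mem_Collect_eq a using assms by (simp add: le_log_iff log_less_iff)
  also have "\<dots> \<longleftrightarrow> j = \<lfloor>log 2 \<bar>\<omega>\<bar>\<rfloor>" by (simp add: eq_commute[of j] floor_eq_iff)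
  finally show ?thesis .
qed

lemma sum_annulus:
  assumes "finite J" "\<omega> \<noteq> 0"
  shows "(\<Sum>j\<in>J. indicator (annulus j) \<omega>) = (if \<lfloor>log 2 \<bar>\<omega>\<bar>\<rfloor> \<in> J then 1 else (0::complex))"
proof -
  have "(\<Sum>j\<in>J. indicator (annulus j) \<omega>) = (\<Sum>j\<in>J. if j = \<lfloor>log 2 \<bar>\<omega>\<bar>\<rfloor> then 1 else (0::complex))"
    using annulus_iff[OF assms(2)] by (intro sum.cong refl) (auto simp: indicator_def)
  then show ?thesis using assms by (simp add: sum.delta)
qed

lemma sum_annulus_bm:
  assumes "finite J" shows "bm 1 (\<lambda>\<omega>. \<Sum>j\<in>J. 1 * indicator (annulus j) \<omega>)"
proof -
  have [measurable]: "annulus j \<in> sets lebesgue" for j by (rule annulus_lebesgue)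
  have "cmod (\<Sum>j\<in>J. indicator (annulus j) \<omega>) \<le> 1" for \<omega>
  proof (cases "\<omega> = 0")
    case True
    have "0 \<notin> annulus j" for j by (simp add: annulus_def not_le)
    then show ?thesis using True by (simp add: indicator_def)
  next
    case False then show ?thesis using assms by (simp add: sum_annulus)
  qed
  then show ?thesis unfolding bm_def by simp
qed

text \<open>\<open>psi s\<close> is 1 on the annulus, so the sharp symbol factors into a smooth one
  and a combination of four half-line cut-offs. The endpoints are left out because the half-lines
  are open; the factors 1 and -1 match the shape of \<open>mult_lincomb\<close>.\<close>

lemma annulus_psi:
  assumes s: "0 < s" and "\<omega> \<noteq> s" "\<omega> \<noteq> 2 * s" "\<omega> \<noteq> - s" "\<omega> \<noteq> - (2 * s)"
  shows "(if s \<le> \<bar>\<omega>\<bar> \<and> \<bar>\<omega>\<bar> < 2 * s then 1 else 0) =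
    ((indicator {0<..} (- s + \<omega>) + (- 1) * indicator {0<..} (- (2 * s) + \<omega>)) +
     1 * (indicator {0<..} (- (- (2 * s)) + \<omega>) + (- 1) * indicator {0<..} (- (- s) + \<omega>))) * psi s \<omega>"
proof (cases "s \<le> \<bar>\<omega>\<bar> \<and> \<bar>\<omega>\<bar> \<le> 2 * s")
  case True
  then have "psi s \<omega> = 1" using s by (intro psi_eq_1) auto
  then show ?thesis using True assms by (auto simp: indicator_def abs_if split: if_splits)
next
  case False
  then show ?thesis using assms by (auto simp: indicator_def abs_if split: if_splits)
qed

context
  fixes k :: real
  assumes k: "k \<noteq> 0"
begin

lemma mult_cong_AE:
  assumes m: "bm B m" and n: "bm C n" and f: "f \<in> Lr 2" and e: "AE \<omega> in lebesgue. m \<omega> = n \<omega>"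
  shows "AE x in lebesgue. mult k m f x = mult k n f x"
proof (rule mult_eqI[OF k n f mult_L2[OF k m f]])
  show "AE \<omega> in lebesgue. FF k (mult k m f) \<omega> = n \<omega> * FF k f \<omega>"
    using FF_mult[OF k m f] e by eventually_elim simp
qed

lemma half_line_bm: "bm 1 (\<lambda>\<omega>. indicator {0<..} (- a + \<omega>))"
proof -
  have "(\<lambda>\<omega>. indicator {0<..} (- a + \<omega>) :: complex) \<in> borel_measurable lebesgue"
    by (rule borel_imp_lebesgue) measurable
  then show ?thesis by (simp add: bm_def indicator_def)
qed

text \<open>The projections with different endpoints \<open>a j\<close> are one fixed projection
  conjugated by modulations. The modulations are invisible to absolute values, and the fixed
  operator passes to square functions by \<open>Lr_norm_sq_le_sq\<close>.\<close>

lemma half_lines_sq: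
  assumes p: "1 < p"
  shows "\<exists>C\<ge>0. \<forall>J a g. finite J \<longrightarrow> (\<forall>j\<in>J. g j \<in> Lr 2) \<longrightarrow> (\<forall>j\<in>J. g j \<in> Lr p) \<longrightarrow>
    Lr_norm p (sq J (\<lambda>j. mult k (\<lambda>\<omega>. indicator {0<..} (- a j + \<omega>)) (g j))) \<le> ennreal C * Lr_norm p (sq J g)"
proof -
  let ?h = "indicator {0<..} :: real \<Rightarrow> complex"
  have h: "bm 1 ?h" using bm_indicator[of "{0<..}"] by simp
  obtain C where C: "0 \<le> C" "Lmult k p ?h C" using half_line_Lmult[OF k p] by blast
  obtain c where c: "0 \<le> c" and le: "\<And>J F G C. finite J \<Longrightarrow> (\<forall>j\<in>J. F j \<in> borel_measurable lebesgue) \<Longrightarrow>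
      (\<forall>j\<in>J. G j \<in> borel_measurable lebesgue) \<Longrightarrow> 0 \<le> C \<Longrightarrow>
      (\<forall>A. Lr_norm p (\<lambda>x. rad J (\<lambda>j. F j x) A) \<le> ennreal C * Lr_norm p (\<lambda>x. rad J (\<lambda>j. G j x) A)) \<Longrightarrow>
      Lr_norm p (sq J F) \<le> ennreal (c * C) * Lr_norm p (sq J G)"
    using Lr_norm_sq_le_sq[of p] p by fastforce
  have "Lr_norm p (sq J (\<lambda>j. mult k (\<lambda>\<omega>. ?h (- a j + \<omega>)) (g j))) \<le> ennreal (c * C) * Lr_norm p (sq J g)"
    if J: "finite J" and g: "\<forall>j\<in>J. g j \<in> Lr 2" "\<forall>j\<in>J. g j \<in> Lr p" for J g and a :: "int \<Rightarrow> real"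
  proof -
    define f where "f j = md k (- a j) (g j)" for j
    have f: "f j \<in> Lr 2" "f j \<in> Lr p" if "j \<in> J" for j
      using g that unfolding f_def by (auto intro: md_Lr[OF k])
    have Tf: "mult k ?h (f j) \<in> Lr 2" if "j \<in> J" for j using mult_L2[OF k h f(1)[OF that]] .
    have "Lr_norm p (sq J (\<lambda>j. mult k (\<lambda>\<omega>. ?h (- a j + \<omega>)) (g j))) = Lr_norm p (sq J (\<lambda>j. mult k ?h (f j)))"
    proof (rule Lr_norm_sq_cong_AE[OF J])
      fix j assume j: "j \<in> J"
      have "AE x in lebesgue. mult k (\<lambda>\<omega>. ?h (- a j + \<omega>)) (g j) x = md k (a j) (mult k ?h (md k (- a j) (g j))) x"
        using mult_md[OF k h] g j by blast
      then show "AE x in lebesgue. cmod (mult k (\<lambda>\<omega>. ?h (- a j + \<omega>)) (g j) x) = cmod (mult k ?h (f j) x)"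
        by (rule eventually_mono) (simp only: cmod_md[OF k] f_def)
    qed
    also have "\<dots> \<le> ennreal (c * C) * Lr_norm p (sq J f)"
    proof (rule le[OF J _ _ C(1)])
      show "\<forall>j\<in>J. mult k ?h (f j) \<in> borel_measurable lebesgue" using Tf by (auto intro: Lr_measurable)
      show "\<forall>j\<in>J. f j \<in> borel_measurable lebesgue" using f by (auto intro: Lr_measurable)
      show "\<forall>A. Lr_norm p (\<lambda>x. rad J (\<lambda>j. mult k ?h (f j) x) A) \<le> ennreal C * Lr_norm p (\<lambda>x. rad J (\<lambda>j. f j x) A)"
      proof
        fix A
        have r: "(\<lambda>x. rad J (\<lambda>j. f j x) A) \<in> Lr 2" "(\<lambda>x. rad J (\<lambda>j. f j x) A) \<in> Lr p"
          unfolding rad_def using f p by (auto intro!: Lr_sum Lr_cmult)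
        have "AE x in lebesgue. mult k ?h (\<lambda>x. rad J (\<lambda>j. f j x) A) x = rad J (\<lambda>j. mult k ?h (f j) x) A"
          unfolding rad_def by (rule lbd_sum[OF mult_lbd[OF k h] _ J]) (use f in auto)
        then have "Lr_norm p (\<lambda>x. rad J (\<lambda>j. mult k ?h (f j) x) A) = Lr_norm p (mult k ?h (\<lambda>x. rad J (\<lambda>j. f j x) A))"
          by (intro Lr_norm_cong_AE) (elim eventually_mono, simp)
        also have "\<dots> \<le> ennreal C * Lr_norm p (\<lambda>x. rad J (\<lambda>j. f j x) A)" by (rule LmultD[OF C(2) r])
        finally show "Lr_norm p (\<lambda>x. rad J (\<lambda>j. mult k ?h (f j) x) A) \<le> ennreal C * Lr_norm p (\<lambda>x. rad J (\<lambda>j. f j x) A)" .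
      qed
    qed
    also have "Lr_norm p (sq J f) = Lr_norm p (sq J g)"
      by (rule Lr_norm_sq_cong_AE[OF J]) (simp add: f_def cmod_md[OF k])
    finally show ?thesis .
  qed
  then show ?thesis using c C by (intro exI[of _ "c * C"]) auto
qed

lemma mult_annulus:
  fixes j defines "s \<equiv> 2 powi j"
  assumes f: "f \<in> Lr 2"
  shows "AE x in lebesgue. mult k (indicator (annulus j)) f x =
    (mult k (\<lambda>\<omega>. indicator {0<..} (- s + \<omega>)) (mult k (psi s) f) x +
     (- 1) * mult k (\<lambda>\<omega>. indicator {0<..} (- (2 * s) + \<omega>)) (mult k (psi s) f) x) +
    1 * (mult k (\<lambda>\<omega>. indicator {0<..} (- (- (2 * s)) + \<omega>)) (mult k (psi s) f) x +
     (- 1) * mult k (\<lambda>\<omega>. indicator {0<..} (- (- s) + \<omega>)) (mult k (psi s) f) x)"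
proof -
  let ?I = "\<lambda>a \<omega>. indicator {0<..} (- a + \<omega>) :: complex"
  have s: "0 < s" by (simp add: s_def)
  define g where "g = mult k (psi s) f"
  have g: "g \<in> Lr 2" unfolding g_def by (rule mult_L2[OF k psi_bm[OF s] f])
  note b1 = bm_lincomb[OF half_line_bm half_line_bm, of "- 1" s "2 * s"]
  note b2 = bm_lincomb[OF half_line_bm half_line_bm, of "- 1" "- (2 * s)" "- s"]
  note b = bm_lincomb[OF b1 b2, of 1]
  let ?M = "\<lambda>\<omega>. (?I s \<omega> + (- 1) * ?I (2 * s) \<omega>) + 1 * (?I (- (2 * s)) \<omega> + (- 1) * ?I (- s) \<omega>)"
  have "finite {s, 2 * s, - s, - (2 * s)}" by simp
  then have "AE \<omega> in lebesgue. \<omega> \<notin> {s, 2 * s, - s, - (2 * s)}"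
    by (intro AE_not_in) (simp add: negligible_iff_null_sets[symmetric] negligible_finite)
  then have e: "AE \<omega> in lebesgue. indicator (annulus j) \<omega> = ?M \<omega> * psi s \<omega>"
  proof (rule eventually_mono)
    fix \<omega> assume \<omega>: "\<omega> \<notin> {s, 2 * s, - s, - (2 * s)}"
    have "2 powi (j + 1) = 2 * s" by (simp add: s_def power_int_add)
    then have "indicator (annulus j) \<omega> = (if s \<le> \<bar>\<omega>\<bar> \<and> \<bar>\<omega>\<bar> < 2 * s then 1 else (0::complex))"
      by (simp add: annulus_def indicator_def s_def)
    then show "indicator (annulus j) \<omega> = ?M \<omega> * psi s \<omega>" using \<omega> by (subst annulus_psi[OF s, symmetric]) auto
  qed
  have "AE x in lebesgue. mult k (indicator (annulus j)) f x = mult k (\<lambda>\<omega>. ?M \<omega> * psi s \<omega>) f x"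
    by (rule mult_cong_AE[OF bm_indicator[OF annulus_lebesgue] bm_mult[OF b psi_bm[OF s]] f e])
  moreover have "AE x in lebesgue. mult k ?M g x = mult k (\<lambda>\<omega>. ?M \<omega> * psi s \<omega>) f x"
    unfolding g_def by (rule mult_comp[OF k b psi_bm[OF s] f])
  moreover note mult_lincomb[OF k b1 b2 g, of 1] mult_lincomb[OF k half_line_bm half_line_bm g, of s "- 1" "2 * s"]
    mult_lincomb[OF k half_line_bm half_line_bm g, of "- (2 * s)" "- 1" "- s"]
  ultimately show ?thesis unfolding g_def[symmetric] by eventually_elim (simp only:)
qed

text \<open>For each choice of signs the signed sum is a single multiplier from the family of
  \<open>psi_sum_Lmult\<close>, taken with s = 1.\<close>

lemma smooth_square_function:
  assumes p: "1 < p"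
  shows "\<exists>C\<ge>0. \<forall>J f. finite J \<longrightarrow> f \<in> Lr 2 \<longrightarrow> f \<in> Lr p \<longrightarrow>
    Lr_norm p (sq J (\<lambda>j. mult k (psi (2 powi j)) f)) \<le> ennreal C * Lr_norm p f"
proof -
  obtain C where C: "0 \<le> C" "\<And>s J \<epsilon>. 0 < s \<Longrightarrow> finite J \<Longrightarrow> (\<forall>j. \<bar>\<epsilon> j\<bar> \<le> 1) \<Longrightarrow>
      Lmult k p (\<lambda>\<omega>. \<Sum>j\<in>J. of_real (\<epsilon> j) * psi (s * 2 powi j) \<omega>) C"
    using psi_sum_Lmult[OF k p] by blast
  obtain c where c: "0 \<le> c" and le: "\<And>J F X. finite J \<Longrightarrow> (\<forall>j\<in>J. F j \<in> borel_measurable lebesgue) \<Longrightarrow>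
      (\<forall>A. Lr_norm p (\<lambda>x. rad J (\<lambda>j. F j x) A) \<le> X) \<Longrightarrow> Lr_norm p (sq J F) \<le> ennreal c * X"
    using Lr_norm_sq_le_random_signs[of p] p by fastforce
  have "Lr_norm p (sq J (\<lambda>j. mult k (psi (2 powi j)) f)) \<le> ennreal (c * C) * Lr_norm p f"
    if J: "finite J" and f: "f \<in> Lr 2" "f \<in> Lr p" for J f
  proof -
    have b: "bm 2 (psi (2 powi j))" for j :: int by (rule psi_bm) simp
    have "Lr_norm p (sq J (\<lambda>j. mult k (psi (2 powi j)) f)) \<le> ennreal c * (ennreal C * Lr_norm p f)"
    proof (rule le[OF J])
      show "\<forall>j\<in>J. mult k (psi (2 powi j)) f \<in> borel_measurable lebesgue"
        using mult_L2[OF k b f(1)] by (blast intro: Lr_measurable)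
      show "\<forall>A. Lr_norm p (\<lambda>x. rad J (\<lambda>j. mult k (psi (2 powi j)) f x) A) \<le> ennreal C * Lr_norm p f"
      proof
        fix A
        have "AE x in lebesgue. mult k (\<lambda>\<omega>. \<Sum>j\<in>J. of_real (sgn_of A j) * psi (2 powi j) \<omega>) f x =
           rad J (\<lambda>j. mult k (psi (2 powi j)) f x) A"
          unfolding rad_def by (rule mult_sum[OF k J _ f(1)]) (use b in blast)
        then have "Lr_norm p (\<lambda>x. rad J (\<lambda>j. mult k (psi (2 powi j)) f x) A) =
            Lr_norm p (mult k (\<lambda>\<omega>. \<Sum>j\<in>J. of_real (sgn_of A j) * psi (2 powi j) \<omega>) f)"
          by (intro Lr_norm_cong_AE) (elim eventually_mono, simp)
        also have "\<dots> \<le> ennreal C * Lr_norm p f"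
          using C(2)[of 1 J "sgn_of A"] J by (intro LmultD[OF _ f]) (simp add: sgn_of_def)
        finally show "Lr_norm p (\<lambda>x. rad J (\<lambda>j. mult k (psi (2 powi j)) f x) A) \<le> ennreal C * Lr_norm p f" .
      qed
    qed
    then show ?thesis using c C by (simp add: ennreal_mult' mult.assoc)
  qed
  then show ?thesis using c C by (intro exI[of _ "c * C"]) auto
qed

lemma psi_mult_Lr:
  assumes p: "1 < p" and f: "f \<in> Lr 2" "f \<in> Lr p" and s: "0 < s" shows "mult k (psi s) f \<in> Lr p"
proof -
  obtain C where C: "\<And>s J \<epsilon>. 0 < s \<Longrightarrow> finite J \<Longrightarrow> (\<forall>j. \<bar>\<epsilon> j\<bar> \<le> 1) \<Longrightarrow>
      Lmult k p (\<lambda>\<omega>. \<Sum>j\<in>J. of_real (\<epsilon> j) * psi (s * 2 powi j) \<omega>) C"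
    using psi_sum_Lmult[OF k p] by blast
  have "Lmult k p (psi s) C" using C[of s "{0}" "\<lambda>_. 1"] s by simp
  then show ?thesis by (rule Lmult_Lr[OF k _ psi_bm[OF s] f])
qed

text \<open>Four half-line projections act on the pieces of the smooth square function, hence the
  factor 4 in the constant.\<close>

theorem square_function_upper:
  assumes p: "1 < p"
  shows "\<exists>C\<ge>0. \<forall>J f. finite J \<longrightarrow> f \<in> Lr 2 \<longrightarrow> f \<in> Lr p \<longrightarrow>
    Lr_norm p (sq J (\<lambda>j. mult k (indicator (annulus j)) f)) \<le> ennreal C * Lr_norm p f"
proof -
  let ?I = "\<lambda>a \<omega>. indicator {0<..} (- a + \<omega>) :: complex"
  obtain C where C: "0 \<le> C" and smooth: "\<And>J f. finite J \<Longrightarrow> f \<in> Lr 2 \<Longrightarrow> f \<in> Lr p \<Longrightarrow>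
      Lr_norm p (sq J (\<lambda>j. mult k (psi (2 powi j)) f)) \<le> ennreal C * Lr_norm p f"
    using smooth_square_function[OF p] by blast
  obtain c where c: "0 \<le> c" and half: "\<And>J a g. finite J \<Longrightarrow> (\<forall>j\<in>J. g j \<in> Lr 2) \<Longrightarrow> (\<forall>j\<in>J. g j \<in> Lr p) \<Longrightarrow>
      Lr_norm p (sq J (\<lambda>j. mult k (\<lambda>\<omega>. ?I (a j) \<omega>) (g j))) \<le> ennreal c * Lr_norm p (sq J g)"
    using half_lines_sq[OF p] by blast
  have "Lr_norm p (sq J (\<lambda>j. mult k (indicator (annulus j)) f)) \<le> ennreal (4 * c * C) * Lr_norm p f"
    if J: "finite J" and f: "f \<in> Lr 2" "f \<in> Lr p" for J f
  proof -
    define g where "g j = mult k (psi (2 powi j)) f" for j :: int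
    define H where "H a j = mult k (?I (a j)) (g j)" for a :: "int \<Rightarrow> real" and j
    have g: "g j \<in> Lr 2" "g j \<in> Lr p" for j
      unfolding g_def using mult_L2[OF k psi_bm f(1)] psi_mult_Lr[OF p f] by auto
    have Hm: "H a j \<in> borel_measurable lebesgue" for a j
      unfolding H_def by (rule Lr_measurable[OF mult_L2[OF k half_line_bm g(1)]])
    have Hm': "(\<lambda>x. H a j x + (- 1) * H a' j x) \<in> borel_measurable lebesgue" for a a' j
      using Hm by (intro borel_measurable_add borel_measurable_times) auto
    define Y where "Y = ennreal c * (ennreal C * Lr_norm p f)"
    have Y: "Lr_norm p (sq J (H a)) \<le> Y" for a
    proof -
      have "Lr_norm p (sq J (H a)) \<le> ennreal c * Lr_norm p (sq J g)"
        unfolding H_def[abs_def] using half[OF J, of g a] g by simp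
      also have "\<dots> \<le> Y" unfolding Y_def g_def[abs_def] by (intro mult_left_mono smooth J f) simp
      finally show ?thesis .
    qed
    have p1: "1 \<le> p" using p by simp
    let ?s = "\<lambda>j. 2 powi j :: real"
    have "Lr_norm p (sq J (\<lambda>j. mult k (indicator (annulus j)) f)) =
        Lr_norm p (sq J (\<lambda>j x. (H ?s j x + (- 1) * H (\<lambda>j. 2 * ?s j) j x) +
          1 * (H (\<lambda>j. - (2 * ?s j)) j x + (- 1) * H (\<lambda>j. - ?s j) j x)))"
    proof (rule Lr_norm_sq_cong_AE[OF J])
      fix j
      show "AE x in lebesgue. cmod (mult k (indicator (annulus j)) f x) =
        cmod ((H ?s j x + (- 1) * H (\<lambda>j. 2 * ?s j) j x) + 1 * (H (\<lambda>j. - (2 * ?s j)) j x + (- 1) * H (\<lambda>j. - ?s j) j x))"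
        using mult_annulus[OF f(1), of j] unfolding H_def g_def by (elim eventually_mono) (simp only:)
    qed
    also have "\<dots> \<le> Lr_norm p (sq J (\<lambda>j x. H ?s j x + (- 1) * H (\<lambda>j. 2 * ?s j) j x)) +
        Lr_norm p (sq J (\<lambda>j x. H (\<lambda>j. - (2 * ?s j)) j x + (- 1) * H (\<lambda>j. - ?s j) j x))"
      by (rule Lr_norm_sq_triangle[OF Hm' Hm' p1]) simp
    also have "\<dots> \<le> (Lr_norm p (sq J (H ?s)) + Lr_norm p (sq J (H (\<lambda>j. 2 * ?s j)))) +
        (Lr_norm p (sq J (H (\<lambda>j. - (2 * ?s j)))) + Lr_norm p (sq J (H (\<lambda>j. - ?s j))))"
      by (intro add_mono Lr_norm_sq_triangle[OF Hm Hm p1]) simp_all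
    also have "\<dots> \<le> (Y + Y) + (Y + Y)" by (intro add_mono Y)
    also have "\<dots> = ennreal (4 * c * C) * Lr_norm p f"
    proof -
      have "(Y + Y) + (Y + Y) = ennreal 4 * Y" by (simp add: mult_2[symmetric] mult.assoc[symmetric])
      then show ?thesis unfolding Y_def using c C by (simp add: ennreal_mult' mult.assoc)
    qed
    finally show ?thesis .
  qed
  then show ?thesis using c C by (intro exI[of _ "4 * c * C"]) auto
qed

end

section \<open>The lower bound\<close>

lemma ip_sum:
  assumes "\<And>j. j \<in> J \<Longrightarrow> f j \<in> Lr 2" "\<And>j. j \<in> J \<Longrightarrow> g j \<in> Lr 2"
  shows "(\<Sum>j\<in>J. ip (f j) (g j)) = (LINT x|lebesgue. (\<Sum>j\<in>J. f j x * cnj (g j x)))"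
    "integrable lebesgue (\<lambda>x. \<Sum>j\<in>J. f j x * cnj (g j x))"
proof -
  have i: "integrable lebesgue (\<lambda>x. f j x * cnj (g j x))" if "j \<in> J" for j
    by (rule ip_integrable(1)[OF assms(1)[OF that] assms(2)[OF that]]) simp_all
  show "(\<Sum>j\<in>J. ip (f j) (g j)) = (LINT x|lebesgue. (\<Sum>j\<in>J. f j x * cnj (g j x)))"
    unfolding ip_def by (rule Bochner_Integration.integral_sum[symmetric]) (rule i)
  show "integrable lebesgue (\<lambda>x. \<Sum>j\<in>J. f j x * cnj (g j x))"
    by (rule Bochner_Integration.integrable_sum) (rule i)
qed

text \<open>Cauchy-Schwarz in j, then Hoelder in x.\<close>

lemma sum_ip_le_sq:
  assumes f: "\<And>j. j \<in> J \<Longrightarrow> f j \<in> Lr 2" and g: "\<And>j. j \<in> J \<Longrightarrow> g j \<in> Lr 2"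
    and pq: "1 < p" "1 < q" "1 / p + 1 / q = 1"
  shows "ennreal (cmod (\<Sum>j\<in>J. ip (f j) (g j))) \<le> Lr_norm p (sq J f) * Lr_norm q (sq J g)"
proof -
  have "ennreal (cmod (\<Sum>j\<in>J. ip (f j) (g j))) \<le> (\<integral>\<^sup>+x. ennreal (cmod (\<Sum>j\<in>J. f j x * cnj (g j x))) \<partial>lebesgue)"
    unfolding ip_sum(1)[of J f g, OF f g, simplified] by (rule integral_norm_bound_ennreal, rule ip_sum(2)) (use f g in auto)
  also have "\<dots> \<le> (\<integral>\<^sup>+x. ennreal (cmod (sq J f x) * cmod (sq J g x)) \<partial>lebesgue)"
  proof (intro nn_integral_mono ennreal_leI)
    fix x
    have "cmod (\<Sum>j\<in>J. f j x * cnj (g j x)) \<le> (\<Sum>j\<in>J. \<bar>cmod (f j x)\<bar> * \<bar>cmod (g j x)\<bar>)"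
      by (rule order_trans[OF norm_sum]) (simp add: norm_mult)
    also have "\<dots> \<le> cmod (sq J f x) * cmod (sq J g x)" unfolding cmod_sq by (rule L2_set_mult_ineq)
    finally show "cmod (\<Sum>j\<in>J. f j x * cnj (g j x)) \<le> cmod (sq J f x) * cmod (sq J g x)" .
  qed
  also have "\<dots> \<le> Lr_norm p (sq J f) * Lr_norm q (sq J g)"
    using f g by (intro Holder_Lr sq_measurable pq) (auto intro: Lr_measurable)
  finally show ?thesis .
qed

context
  fixes k :: real
  assumes k: "k \<noteq> 0"
begin

text \<open>The annulus multiplier is an orthogonal projection: its symbol is real and
  idempotent.\<close>

lemma ip_annulus:
  assumes f: "f \<in> Lr 2" and g: "g \<in> Lr 2"
  shows "ip (mult k (indicator (annulus j)) f) g = ip (mult k (indicator (annulus j)) f) (mult k (indicator (annulus j)) g)"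
proof -
  let ?m = "indicator (annulus j) :: real \<Rightarrow> complex"
  have m: "bm 1 ?m" by (rule bm_indicator[OF annulus_lebesgue])
  have mm: "(\<lambda>\<omega>. ?m \<omega> * ?m \<omega>) = ?m" and mc: "(\<lambda>\<omega>. cnj (?m \<omega>)) = ?m" by (auto simp: indicator_def)
  note mf = mult_L2[OF k m f]
  have "AE x in lebesgue. mult k ?m f x = mult k ?m (mult k ?m f) x"
    using mult_comp[OF k m m f] unfolding mm by (rule eventually_mono) simp
  then have "ip (mult k ?m f) g = ip (mult k ?m (mult k ?m f)) g"
    by (intro ip_cong_AE) (use mf g mult_L2[OF k m mf] in \<open>auto intro: Lr_measurable\<close>)
  also have "\<dots> = ip (mult k ?m f) (mult k ?m g)" using mult_adjoint[OF k m mf g] unfolding mc .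
  finally show ?thesis .
qed

text \<open>At every nonzero frequency the symbols of the partial sums are eventually 1.\<close>

lemma sum_annuli_tendsto:
  assumes f: "f \<in> Lr 2"
  shows "(\<lambda>N. Lr_norm 2 (\<lambda>x. (\<Sum>j\<in>{- int N..int N}. mult k (indicator (annulus j)) f x) - f x)) \<longlonglongrightarrow> 0"
proof -
  let ?M = "\<lambda>N \<omega>. \<Sum>j\<in>{- int N..int N}. 1 * indicator (annulus j) \<omega> :: complex"
  have b1: "bm 1 (\<lambda>\<omega>. 1)" by (simp add: bm_def)
  have "AE \<omega> in lebesgue. \<omega> \<notin> {0::real}"
    by (intro AE_not_in) (simp add: negligible_iff_null_sets[symmetric])
  then have "AE \<omega> in lebesgue. (\<lambda>N. ?M N \<omega>) \<longlonglongrightarrow> 1"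
  proof (rule eventually_mono)
    fix \<omega> :: real assume w: "\<omega> \<notin> {0}"
    have "eventually (\<lambda>N. ?M N \<omega> = 1) sequentially"
    proof (rule eventually_sequentiallyI[of "nat \<bar>\<lfloor>log 2 \<bar>\<omega>\<bar>\<rfloor>\<bar>"])
      fix N assume "nat \<bar>\<lfloor>log 2 \<bar>\<omega>\<bar>\<rfloor>\<bar> \<le> N"
      then have "\<lfloor>log 2 \<bar>\<omega>\<bar>\<rfloor> \<in> {- int N..int N}" by auto
      then show "?M N \<omega> = 1" using w by (simp add: sum_annulus)
    qed
    then show "(\<lambda>N. ?M N \<omega>) \<longlonglongrightarrow> 1" by (rule tendsto_eventually)
  qed
  then have "(\<lambda>N. Lr_norm 2 (\<lambda>x. mult k (?M N) f x - mult k (\<lambda>\<omega>. 1) f x)) \<longlonglongrightarrow> 0"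
    by (intro mult_tendsto[OF k _ b1 _ f] sum_annulus_bm) auto
  moreover have "Lr_norm 2 (\<lambda>x. mult k (?M N) f x - mult k (\<lambda>\<omega>. 1) f x) =
      Lr_norm 2 (\<lambda>x. (\<Sum>j\<in>{- int N..int N}. mult k (indicator (annulus j)) f x) - f x)" for N
  proof (rule Lr_norm_cong_AE)
    have "AE x in lebesgue. mult k (?M N) f x = (\<Sum>j\<in>{- int N..int N}. 1 * mult k (indicator (annulus j)) f x)"
      by (rule mult_sum[OF k _ _ f]) (auto intro: bm_indicator[OF annulus_lebesgue])
    moreover have "AE x in lebesgue. f x = mult k (\<lambda>\<omega>. 1) f x"
      by (rule mult_eqI[OF k b1 f f]) simp
    ultimately show "AE x in lebesgue. cmod (mult k (?M N) f x - mult k (\<lambda>\<omega>. 1) f x) =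
        cmod ((\<Sum>j\<in>{- int N..int N}. mult k (indicator (annulus j)) f x) - f x)"
      by eventually_elim simp
  qed
  ultimately show ?thesis by simp
qed

text \<open>Duality: the lower bound for \<open>p\<close> follows from the upper bound for the conjugate exponent.\<close>

theorem square_function_lower:
  assumes p: "1 < p"
  shows "\<exists>C\<ge>0. \<forall>f X. f \<in> Lr 2 \<longrightarrow> f \<in> Lr p \<longrightarrow>
    (\<forall>N::nat. Lr_norm p (sq {- int N..int N} (\<lambda>j. mult k (indicator (annulus j)) f)) \<le> X) \<longrightarrow> Lr_norm p f \<le> ennreal C * X"
proof -
  define q where "q = p / (p - 1)"
  have q: "1 < q" "1 / p + 1 / q = 1" "1 / q + 1 / p = 1" using p by (simp_all add: q_def field_simps)
  obtain C where C: "0 \<le> C" and upper: "\<And>J f. finite J \<Longrightarrow> f \<in> Lr 2 \<Longrightarrow> f \<in> Lr q \<Longrightarrow>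
      Lr_norm q (sq J (\<lambda>j. mult k (indicator (annulus j)) f)) \<le> ennreal C * Lr_norm q f"
    using square_function_upper[OF k q(1)] by blast
  have "Lr_norm p f \<le> ennreal C * X"
    if f: "f \<in> Lr 2" "f \<in> Lr p"
      and X: "\<And>N::nat. Lr_norm p (sq {- int N..int N} (\<lambda>j. mult k (indicator (annulus j)) f)) \<le> X" for f X
  proof (rule Lr_norm_dual[OF Lr_measurable[OF f(1)] q(1) p q(3)])
    fix g assume g': "\<And>s. 1 \<le> s \<Longrightarrow> g \<in> Lr s"
    have g: "g \<in> Lr 2" "g \<in> Lr q" using g' q(1) by simp_all
    let ?P = "\<lambda>j. mult k (indicator (annulus j))"
    let ?S = "\<lambda>N x. \<Sum>j\<in>{- int N..int N}. ?P j f x"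
    have P: "?P j h \<in> Lr 2" if "h \<in> Lr 2" for j h by (rule mult_L2[OF k bm_indicator[OF annulus_lebesgue] that])
    have S: "?S N \<in> Lr 2" for N by (intro Lr_sum P f) simp
    \<comment> \<open>With both factors projected, the upper bound for q disposes of the square
      function of the test function \<open>g\<close>, and only that of \<open>f\<close>
      remains.\<close>
    have le: "ennreal (cmod (ip (?S N) g)) \<le> ennreal C * X * Lr_norm q g" for N
    proof -
      let ?J = "{- int N..int N}"
      have "ip (?S N) g = (\<Sum>j\<in>?J. ip (?P j f) g)"
        using ip_sum(1)[of ?J "\<lambda>j. ?P j f" "\<lambda>j. g"] P[OF f(1)] g(1) by (simp add: ip_def sum_distrib_right)
      also have "\<dots> = (\<Sum>j\<in>?J. ip (?P j f) (?P j g))" by (intro sum.cong refl ip_annulus f g)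
      finally have "ennreal (cmod (ip (?S N) g)) = ennreal (cmod (\<Sum>j\<in>?J. ip (?P j f) (?P j g)))" by simp
      also have "\<dots> \<le> Lr_norm p (sq ?J (\<lambda>j. ?P j f)) * Lr_norm q (sq ?J (\<lambda>j. ?P j g))"
        by (rule sum_ip_le_sq[OF P[OF f(1)] P[OF g(1)] p q(1,2)])
      also have "\<dots> \<le> X * (ennreal C * Lr_norm q g)" by (intro mult_mono X upper g) auto
      finally show ?thesis by (simp add: mult_ac)
    qed
    have "(\<lambda>N. ip (?S N) g) \<longlonglongrightarrow> ip f g"
      by (rule ip_tendsto[OF S f(1) sum_annuli_tendsto[OF f(1)] g(1) g(1)]) simp_all
    then have "(\<lambda>N. ennreal (cmod (ip (?S N) g))) \<longlonglongrightarrow> ennreal (cmod (ip f g))" by (intro tendsto_ennrealI tendsto_norm)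
    then show "ennreal (cmod (ip f g)) \<le> ennreal C * X * Lr_norm q g"
      by (rule LIMSEQ_le_const2) (use le in blast)
  qed
  then show ?thesis using C by blast
qed

end

section \<open>The special affine Fourier transform\<close>

text \<open>A quadratic phase of modulus one; one instance multiplies the input of the Fourier
  transform, another its output.\<close>

definition chirp :: "real \<Rightarrow> real \<Rightarrow> real \<Rightarrow> complex"
  where "chirp \<alpha> \<beta> t = cis (\<alpha> * t\<^sup>2 + \<beta> * t)"

lemma cmod_chirp [simp]: "cmod (chirp \<alpha> \<beta> t) = 1"
  by (simp add: chirp_def)

lemma chirp_neq_0 [simp]: "chirp \<alpha> \<beta> t \<noteq> 0"
  by (simp add: chirp_def)

lemma chirp_cnj: "chirp \<alpha> \<beta> t * cnj (chirp \<alpha> \<beta> t) = 1"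
  by (simp add: chirp_def cis_cnj cis_mult)

lemma chirp_measurable: "chirp \<alpha> \<beta> \<in> borel_measurable lebesgue"
  unfolding chirp_def[abs_def] by (rule borel_imp_lebesgue) measurable

lemma chirp_mult_measurable: "f \<in> borel_measurable lebesgue \<Longrightarrow> (\<lambda>x. chirp \<alpha> \<beta> x * f x) \<in> borel_measurable lebesgue"
  by (rule borel_measurable_times[OF chirp_measurable])

lemma Lr_norm_chirp_mult: "Lr_norm r (\<lambda>x. chirp \<alpha> \<beta> x * f x) = Lr_norm r f"
  by (rule Lr_norm_cong_AE) (simp add: norm_mult)

lemma chirp_mult_Lr: "f \<in> Lr r \<Longrightarrow> (\<lambda>x. chirp \<alpha> \<beta> x * f x) \<in> Lr r"
  unfolding Lr_def by (simp add: chirp_mult_measurable Lr_norm_chirp_mult)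

lemma lbd_chirp:
  assumes T: "lbd r D T C" and D: "\<And>f. f \<in> D \<Longrightarrow> (\<lambda>x. chirp \<alpha> \<beta> x * f x) \<in> D"
    and D2: "\<And>f g a. f \<in> D \<Longrightarrow> g \<in> D \<Longrightarrow> (\<lambda>x. f x + a * g x) \<in> D" and DL: "D \<subseteq> Lr r"
  shows "lbd r D (\<lambda>f x. chirp \<gamma> \<delta> x * T (\<lambda>t. chirp \<alpha> \<beta> t * f t) x) C"
  unfolding lbd_def
proof (intro conjI ballI allI)
  fix u v a assume uv: "u \<in> D" "v \<in> D"
  show "(\<lambda>x. u x + a * v x) \<in> D" by (rule D2[OF uv])
  have e: "(\<lambda>t. chirp \<alpha> \<beta> t * (u t + a * v t)) = (\<lambda>t. chirp \<alpha> \<beta> t * u t + a * (chirp \<alpha> \<beta> t * v t))"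
    by (simp add: algebra_simps)
  show "AE x in lebesgue. chirp \<gamma> \<delta> x * T (\<lambda>t. chirp \<alpha> \<beta> t * (u t + a * v t)) x =
     chirp \<gamma> \<delta> x * T (\<lambda>t. chirp \<alpha> \<beta> t * u t) x + a * (chirp \<gamma> \<delta> x * T (\<lambda>t. chirp \<alpha> \<beta> t * v t) x)"
    using lbdD(2)[OF T D[OF uv(1)] D[OF uv(2)], of a] unfolding e
    by (rule eventually_mono) (simp add: algebra_simps)
next
  fix u assume u: "u \<in> D"
  show "u \<in> Lr r" using u DL by blast
  show "(\<lambda>x. chirp \<gamma> \<delta> x * T (\<lambda>t. chirp \<alpha> \<beta> t * u t) x) \<in> Lr r"
    by (rule chirp_mult_Lr[OF lbdD(4)[OF T D[OF u]]])
  show "Lr_norm r (\<lambda>x. chirp \<gamma> \<delta> x * T (\<lambda>t. chirp \<alpha> \<beta> t * u t) x) \<le> ennreal C * Lr_norm r u"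
    using lbdD(5)[OF T D[OF u]] by (simp add: Lr_norm_chirp_mult)
qed

lemma Lr_dense_2r: "1 \<le> r \<Longrightarrow> Lr_dense r (Lr 2 \<inter> Lr r)"
  unfolding Lr_dense_def
proof
  fix f assume r: "1 \<le> r" and f: "f \<in> Lr r"
  obtain u where u: "\<And>n. u n \<in> stepfs" "(\<lambda>n. Lr_norm r (\<lambda>x. u n x - f x)) \<longlonglongrightarrow> 0"
    using stepfs_dense[OF f f r r] by blast
  have "u n \<in> Lr 2 \<inter> Lr r" for n using stepfs_Lr[OF u(1)] by blast
  then show "\<exists>u. (\<forall>n. u n \<in> Lr 2 \<inter> Lr r) \<and> (\<lambda>n. Lr_norm r (\<lambda>x. u n x - f x)) \<longlonglongrightarrow> 0" using u(2) by blast
qed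

lemma Delta_annulus_AE: "AE \<omega> in lebesgue. indicator (Delta j) \<omega> = (indicator (annulus j) \<omega> :: complex)"
proof -
  have "AE \<omega> in lebesgue. \<omega> \<notin> {2 powi (j + 1), - (2 powi (j + 1)) :: real}"
    by (intro AE_not_in) (simp add: negligible_iff_null_sets[symmetric])
  then show ?thesis
  proof (rule eventually_mono)
    fix \<omega> :: real assume w: "\<omega> \<notin> {2 powi (j + 1), - (2 powi (j + 1))}"
    have *: "0 < x \<Longrightarrow> 0 < y \<Longrightarrow> \<omega> \<noteq> y \<Longrightarrow> \<omega> \<noteq> - y \<Longrightarrow>
        \<omega> \<in> {- y..- x} \<union> {x..y} \<longleftrightarrow> x \<le> \<bar>\<omega>\<bar> \<and> \<bar>\<omega>\<bar> < y" for x y :: real by auto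
    have "\<omega> \<in> Delta j \<longleftrightarrow> \<omega> \<in> annulus j" unfolding Delta_def annulus_def mem_Collect_eq using w by (intro *) auto
    then show "indicator (Delta j) \<omega> = (indicator (annulus j) \<omega> :: complex)" by (simp add: indicator_def)
  qed
qed

text \<open>Crude in the size of \<open>J\<close>, but sufficient to send approximation errors to 0
  for a fixed finite \<open>J\<close>.\<close>

lemma Lr_norm_sq_le_sum:
  assumes r: "1 \<le> r" shows "finite J \<Longrightarrow> (\<And>j. j \<in> J \<Longrightarrow> F j \<in> borel_measurable lebesgue) \<Longrightarrow>
    Lr_norm r (sq J F) \<le> (\<Sum>j\<in>J. Lr_norm r (F j))"
proof (induction J rule: finite_induct)
  case empty
  have "sq {} F = (\<lambda>x. 0)" by (simp add: sq_def fun_eq_iff)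
  then show ?case by simp
next
  case (insert i J)
  have n: "(\<lambda>x. complex_of_real (cmod (F i x))) \<in> borel_measurable lebesgue"
    using insert.prems[of i] by simp
  have "Lr_norm r (sq (insert i J) F) \<le> Lr_norm r (\<lambda>x. complex_of_real (cmod (F i x)) + sq J F x)"
  proof (rule Lr_norm_mono_AE)
    have "cmod (sq (insert i J) F x) \<le> cmod (complex_of_real (cmod (F i x)) + sq J F x)" for x
    proof -
      have "cmod (sq (insert i J) F x) \<le> cmod (F i x) + L2_set (\<lambda>j. cmod (F j x)) J"
        using insert(1,2) by (simp add: cmod_sq L2_set_nonneg sqrt_sum_squares_le_sum)
      also have "\<dots> = cmod (complex_of_real (cmod (F i x)) + sq J F x)"
        unfolding sq_def of_real_add[symmetric] norm_of_real by (simp add: L2_set_nonneg)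
      finally show ?thesis .
    qed
    then show "AE x in lebesgue. cmod (sq (insert i J) F x) \<le> cmod (complex_of_real (cmod (F i x)) + sq J F x)" by simp
  qed (use r in simp)
  also have "\<dots> \<le> Lr_norm r (\<lambda>x. complex_of_real (cmod (F i x))) + Lr_norm r (sq J F)"
    using insert.prems by (intro Lr_norm_triangle n sq_measurable r) auto
  also have "Lr_norm r (\<lambda>x. complex_of_real (cmod (F i x))) = Lr_norm r (F i)" by (rule Lr_norm_cong_AE) simp
  also have "Lr_norm r (F i) + Lr_norm r (sq J F) \<le> Lr_norm r (F i) + (\<Sum>j\<in>J. Lr_norm r (F j))"
    using insert.IH insert.prems by (intro add_left_mono) auto
  finally show ?case using insert(1,2) by simp
qed

text \<open>Symmetric ranges are cofinal among the finite sets of integers.\<close>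

lemma infsum_int_SUP:
  fixes f :: "int \<Rightarrow> ennreal"
  shows "(\<Sum>\<^sub>\<infinity>j\<in>UNIV. f j) = (SUP N::nat. \<Sum>j\<in>{- int N..int N}. f j)"
proof -
  have "(\<Sum>\<^sub>\<infinity>j\<in>UNIV. f j) = (SUP F\<in>{F. finite F \<and> F \<subseteq> UNIV}. sum f F)" by (rule nonneg_infsum_complete) simp
  also have "\<dots> = (SUP N::nat. \<Sum>j\<in>{- int N..int N}. f j)"
  proof (rule antisym)
    show "(SUP F\<in>{F. finite F \<and> F \<subseteq> UNIV}. sum f F) \<le> (SUP N::nat. \<Sum>j\<in>{- int N..int N}. f j)"
    proof (rule SUP_least)
      fix F :: "int set" assume "F \<in> {F. finite F \<and> F \<subseteq> UNIV}"
      then have F: "finite F" by simp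
      obtain N :: nat where N: "\<And>j. j \<in> F \<Longrightarrow> \<bar>j\<bar> \<le> int N"
      proof
        fix j assume "j \<in> F"
        then have "nat \<bar>j\<bar> \<le> (\<Sum>i\<in>F. nat \<bar>i\<bar>)" using F by (intro member_le_sum) auto
        then show "\<bar>j\<bar> \<le> int (\<Sum>i\<in>F. nat \<bar>i\<bar>)" by linarith
      qed
      have "sum f F \<le> (\<Sum>j\<in>{- int N..int N}. f j)" by (intro sum_mono2) (auto dest!: N)
      then show "sum f F \<le> (SUP N::nat. \<Sum>j\<in>{- int N..int N}. f j)" by (rule order_trans) (rule SUP_upper, simp)
    qed
    show "(SUP N::nat. \<Sum>j\<in>{- int N..int N}. f j) \<le> (SUP F\<in>{F. finite F \<and> F \<subseteq> UNIV}. sum f F)"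
      by (intro SUP_least SUP_upper) simp
  qed
  finally show ?thesis .
qed

text \<open>Monotone convergence: bounds for the finite square functions that are uniform in N
  amount to bounds for the full one.\<close>

lemma nn_norm_square_sum:
  assumes F: "\<And>j. F j \<in> borel_measurable lebesgue" and r: "0 < r"
  shows "nn_norm r (\<lambda>x. ennreal_powr (\<Sum>\<^sub>\<infinity>j\<in>UNIV. ennreal ((cmod (F j x))\<^sup>2)) (1 / 2)) =
    (SUP N::nat. Lr_norm r (sq {- int N..int N} F))"
proof -
  let ?q = "\<lambda>N. sq {- int N..int N} F"
  have [measurable]: "?q N \<in> borel_measurable lebesgue" for N by (rule sq_measurable[OF F])
  have e: "ennreal_powr (ennreal_powr (\<Sum>\<^sub>\<infinity>j\<in>UNIV. ennreal ((cmod (F j x))\<^sup>2)) (1 / 2)) r =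
      (SUP N. ennreal (cmod (?q N x) powr r))" for x
  proof -
    have "ennreal_powr (ennreal (\<Sum>j\<in>{- int N..int N}. (cmod (F j x))\<^sup>2)) (1 / 2) = ennreal (cmod (?q N x))" for N
      by (simp add: cmod_sq L2_set_def powr_half_sqrt sum_nonneg)
    then show ?thesis using r by (simp add: infsum_int_SUP ennreal_powr_SUP sum_ennreal)
  qed
  have "(\<integral>\<^sup>+x. (SUP N. ennreal (cmod (?q N x) powr r)) \<partial>lebesgue) = (SUP N. En r (?q N))"
    unfolding En_def
  proof (rule nn_integral_monotone_convergence_SUP)
    show "incseq (\<lambda>N x. ennreal (cmod (?q N x) powr r))"
    proof (intro incseq_SucI le_funI ennreal_leI powr_mono2)
      fix N x
      show "cmod (?q N x) \<le> cmod (?q (Suc N) x)"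
        unfolding cmod_sq L2_set_def by (intro real_sqrt_le_mono sum_mono2) auto
    qed (use r in auto)
  qed measurable
  then show ?thesis unfolding nn_norm_def e using r by (simp add: ennreal_powr_SUP Lr_norm_En)
qed

locale saft =
  fixes a b c d p q :: real
  assumes b: "b \<noteq> 0"
begin

definition k where "k = 2 * pi / b"
abbreviation chi where "chi \<equiv> chirp (pi / b * a) (pi / b * (2 * p))"
abbreviation phase where "phase \<equiv> chirp (pi / b * d) (pi / b * (2 * (b * q - d * p)))"
abbreviation A where "A \<equiv> (a, b, c, d, p, q)"

lemma k: "k \<noteq> 0" using b by (simp add: k_def)

text \<open>The exponent separates into a quadratic in t, a quadratic in omega and the cross term,
  which is the Fourier kernel with frequency unit 2 * pi / b.\<close>

lemma SAFT_L1_FT: "SAFT_L1 A f \<omega> = phase \<omega> * FT k (\<lambda>t. chi t * f t) \<omega>"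
proof -
  have e: "f t * exp (\<i> * complex_of_real (pi / b * (a * t\<^sup>2 + 2 * p * t - 2 * \<omega> * t + 2 * (b * q - d * p) * \<omega> + d * \<omega>\<^sup>2))) =
      phase \<omega> * ((chi t * f t) * cis (- (k * \<omega> * t)))" for t
  proof -
    have "pi / b * (a * t\<^sup>2 + 2 * p * t - 2 * \<omega> * t + 2 * (b * q - d * p) * \<omega> + d * \<omega>\<^sup>2) =
       (pi / b * d * \<omega>\<^sup>2 + pi / b * (2 * (b * q - d * p)) * \<omega>) +
       ((pi / b * a * t\<^sup>2 + pi / b * (2 * p) * t) + (- (k * \<omega> * t)))"
      by (simp add: k_def algebra_simps)
    then show ?thesis unfolding cis_conv_exp[symmetric] chirp_def by (simp only: cis_mult[symmetric] mult_ac)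
  qed
  have "\<bar>k\<bar> / (2 * pi) = 1 / \<bar>b\<bar>" by (simp add: k_def abs_divide)
  then have "sqrt (\<bar>k\<bar> / (2 * pi)) = 1 / sqrt \<bar>b\<bar>" by (simp only: real_sqrt_divide real_sqrt_one)
  then show ?thesis unfolding SAFT_L1.simps e integral_mult_right_zero FT_def by (simp only: mult_ac)
qed

lemma SAFT_L1_lbd: "lbd 2 (Lr 1 \<inter> Lr 2) (SAFT_L1 A) 1"
proof -
  have "SAFT_L1 A = (\<lambda>f x. phase x * FT k (\<lambda>t. chi t * f t) x)" by (intro ext SAFT_L1_FT)
  moreover have "lbd 2 (Lr 1 \<inter> Lr 2) (\<lambda>f x. phase x * FT k (\<lambda>t. chi t * f t) x) 1"
    by (rule lbd_chirp[OF FT_lbd[OF k]]) (auto intro: chirp_mult_Lr Lr_lincomb)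
  ultimately show ?thesis by simp
qed

text \<open>Multiplication by chirps is isometric on L^2, so the factorisation passes from step
  functions to their limits.\<close>

lemma SAFT_FF:
  assumes f: "f \<in> Lr 2" shows "AE \<omega> in lebesgue. SAFT A f \<omega> = phase \<omega> * FF k (\<lambda>t. chi t * f t) \<omega>"
  unfolding SAFT_def
proof -
  obtain u where u: "\<And>n. u n \<in> stepfs" "(\<lambda>n. Lr_norm 2 (\<lambda>x. u n x - f x)) \<longlonglongrightarrow> 0"
    using stepfs_dense[OF f f] by auto
  have D: "u n \<in> Lr 1 \<inter> Lr 2" for n using stepfs_Lr[OF u(1)] by blast
  have cD: "(\<lambda>t. chi t * u n t) \<in> Lr 1" "(\<lambda>t. chi t * u n t) \<in> Lr 2" for n using D by (auto intro: chirp_mult_Lr)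
  note cf = chirp_mult_Lr[OF f, of "pi / b * a" "pi / b * (2 * p)"]
  have g: "(\<lambda>\<omega>. phase \<omega> * FF k (\<lambda>t. chi t * f t) \<omega>) \<in> Lr 2" by (rule chirp_mult_Lr[OF FF_L2[OF k cf]])
  have lim: "(\<lambda>n. Lr_norm 2 (\<lambda>x. SAFT_L1 A (u n) x - phase x * FF k (\<lambda>t. chi t * f t) x)) \<longlonglongrightarrow> 0"
  proof (rule ennreal_tendsto_0_le[OF _ u(2)])
    fix n
    have "AE x in lebesgue. cmod (SAFT_L1 A (u n) x - phase x * FF k (\<lambda>t. chi t * f t) x) =
        cmod (FF k (\<lambda>t. chi t * u n t) x - FF k (\<lambda>t. chi t * f t) x)"
      using FF_eq_FT[OF k cD(1)[of n] cD(2)[of n]]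
      by (rule eventually_mono) (simp only: SAFT_L1_FT right_diff_distrib[symmetric] norm_mult cmod_chirp mult_1)
    then have "Lr_norm 2 (\<lambda>x. SAFT_L1 A (u n) x - phase x * FF k (\<lambda>t. chi t * f t) x) =
        Lr_norm 2 (\<lambda>x. FF k (\<lambda>t. chi t * u n t) x - FF k (\<lambda>t. chi t * f t) x)" by (rule Lr_norm_cong_AE)
    also have "\<dots> \<le> ennreal 1 * Lr_norm 2 (\<lambda>x. chi x * u n x - chi x * f x)" by (rule lbd_diff[OF FF_lbd[OF k] cD(2) cf])
    also have "\<dots> = Lr_norm 2 (\<lambda>x. u n x - f x)" 
      by (simp only: right_diff_distrib[symmetric] Lr_norm_chirp_mult ennreal_1 mult_1)
    finally show "Lr_norm 2 (\<lambda>x. SAFT_L1 A (u n) x - phase x * FF k (\<lambda>t. chi t * f t) x) \<le> Lr_norm 2 (\<lambda>x. u n x - f x)" .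
  qed
  have "(1::real) \<le> 2" by simp
  then show "AE \<omega> in lebesgue. continuous_ext 2 (Lr 1 \<inter> Lr 2) (SAFT_L1 A) f \<omega> = phase \<omega> * FF k (\<lambda>t. chi t * f t) \<omega>"
    by (rule continuous_ext_eqI[OF SAFT_L1_lbd Lr_dense_2 _ f g D u(2) lim])
qed

abbreviation P where "P j \<equiv> mult k (indicator (annulus j))"

lemma annulus_bm: "bm 1 (indicator (annulus j))"
  by (rule bm_indicator[OF annulus_lebesgue])

text \<open>The factor \<open>phase\<close> stands on both sides of the defining equation and
  cancels; what remains identifies chi * S_j f as the annulus multiplier applied to chi * f. A
  solution for \<open>SOME\<close> to choose is obtained by multiplying that image with the
  conjugate of chi.\<close>

lemma S_L2_eq:
  assumes f: "f \<in> Lr 2"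
  shows "S_L2 A j f \<in> Lr 2" "AE x in lebesgue. chi x * S_L2 A j f x = P j (\<lambda>t. chi t * f t) x"
proof -
  note cf = chirp_mult_Lr[OF f, of "pi / b * a" "pi / b * (2 * p)"]
  let ?ok = "\<lambda>h. h \<in> Lr 2 \<and> (AE \<omega> in lebesgue. SAFT A h \<omega> = indicator (Delta j) \<omega> * SAFT A f \<omega>)"
  have iff: "?ok h \<longleftrightarrow> h \<in> Lr 2 \<and> (AE \<omega> in lebesgue. FF k (\<lambda>t. chi t * h t) \<omega> = indicator (annulus j) \<omega> * FF k (\<lambda>t. chi t * f t) \<omega>)" for h
  proof (rule conj_cong[OF refl])
    assume h: "h \<in> Lr 2"
    show "(AE \<omega> in lebesgue. SAFT A h \<omega> = indicator (Delta j) \<omega> * SAFT A f \<omega>) \<longleftrightarrow>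
      (AE \<omega> in lebesgue. FF k (\<lambda>t. chi t * h t) \<omega> = indicator (annulus j) \<omega> * FF k (\<lambda>t. chi t * f t) \<omega>)"
    proof (rule eventually_cong)
      show "AE \<omega> in lebesgue. (SAFT A h \<omega> = phase \<omega> * FF k (\<lambda>t. chi t * h t) \<omega> \<and>
          SAFT A f \<omega> = phase \<omega> * FF k (\<lambda>t. chi t * f t) \<omega>) \<and> indicator (Delta j) \<omega> = (indicator (annulus j) \<omega> :: complex)"
        by (intro eventually_conj SAFT_FF h f Delta_annulus_AE)
    qed (auto simp: mult.left_commute[of _ "phase _"])
  qed
  define h where "h t = cnj (chi t) * P j (\<lambda>t. chi t * f t) t" for t
  have Pf: "P j (\<lambda>t. chi t * f t) \<in> Lr 2" by (rule mult_L2[OF k annulus_bm cf])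
  have hP: "chi t * h t = P j (\<lambda>t. chi t * f t) t" for t
    by (simp add: h_def mult.assoc[symmetric] chirp_cnj)
  have "h \<in> Lr 2"
  proof (rule Lr_bounded_by[OF _ Pf])
    show "h \<in> borel_measurable lebesgue" unfolding h_def[abs_def]
      by (intro borel_measurable_times cnj_measurable chirp_measurable Lr_measurable[OF Pf])
  qed (simp_all add: h_def norm_mult)
  moreover have "AE \<omega> in lebesgue. FF k (\<lambda>t. chi t * h t) \<omega> = indicator (annulus j) \<omega> * FF k (\<lambda>t. chi t * f t) \<omega>"
    unfolding hP by (rule FF_mult[OF k annulus_bm cf])
  ultimately have "?ok h" unfolding iff by (rule conjI)
  then have ok: "?ok (S_L2 A j f)" unfolding S_L2_def by (rule someI[of ?ok])
  then show S: "S_L2 A j f \<in> Lr 2" by (rule conjunct1)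
  show "AE x in lebesgue. chi x * S_L2 A j f x = P j (\<lambda>t. chi t * f t) x"
    by (rule mult_eqI[OF k annulus_bm cf chirp_mult_Lr[OF S]]) (use ok in \<open>simp only: iff\<close>)
qed

lemma cmod_S_L2:
  assumes f: "f \<in> Lr 2" shows "AE x in lebesgue. cmod (S_L2 A j f x) = cmod (P j (\<lambda>t. chi t * f t) x)"
  using S_L2_eq(2)[OF f, of j]
proof (rule eventually_mono)
  fix x assume "chi x * S_L2 A j f x = P j (\<lambda>t. chi t * f t) x"
  then have "cmod (chi x * S_L2 A j f x) = cmod (P j (\<lambda>t. chi t * f t) x)" by (rule arg_cong)
  then show "cmod (S_L2 A j f x) = cmod (P j (\<lambda>t. chi t * f t) x)" by (simp add: norm_mult)
qed

lemma S_L2_lincomb: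
  assumes u: "u \<in> Lr 2" and v: "v \<in> Lr 2"
  shows "AE x in lebesgue. S_L2 A j (\<lambda>x. u x + e * v x) x = S_L2 A j u x + e * S_L2 A j v x"
proof -
  note w = Lr_lincomb[OF u v, of e, simplified]
  note cu = chirp_mult_Lr[OF u, of "pi / b * a" "pi / b * (2 * p)"]
  note cv = chirp_mult_Lr[OF v, of "pi / b * a" "pi / b * (2 * p)"]
  have eq: "(\<lambda>t. chi t * (u t + e * v t)) = (\<lambda>t. chi t * u t + e * (chi t * v t))" by (simp add: algebra_simps)
  have "AE x in lebesgue. chi x * S_L2 A j (\<lambda>x. u x + e * v x) x = chi x * (S_L2 A j u x + e * S_L2 A j v x)"
    using S_L2_eq(2)[OF w, of j] S_L2_eq(2)[OF u, of j] S_L2_eq(2)[OF v, of j]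
      lbdD(2)[OF mult_lbd[OF k annulus_bm[of j]] cu cv, of e] unfolding eq
    by eventually_elim (simp add: algebra_simps)
  then show ?thesis by (rule eventually_mono) simp
qed

end

section \<open>Square function bounds for the extended operators on L^r\<close>

context saft
begin

context
  fixes r :: real
  assumes r: "1 < r"
begin

lemma r1: "1 \<le> r" using r by simp

text \<open>The upper square function bound is applied with the single index j.\<close>

lemma S_L2_lbd: "\<exists>C. lbd r (Lr 2 \<inter> Lr r) (S_L2 A j) C"
proof -
  obtain C where C: "0 \<le> C" and upper: "\<And>J f. finite J \<Longrightarrow> f \<in> Lr 2 \<Longrightarrow> f \<in> Lr r \<Longrightarrow>
      Lr_norm r (sq J (\<lambda>j. P j f)) \<le> ennreal C * Lr_norm r f"
    using square_function_upper[OF k r] by blast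
  have le: "Lr_norm r (S_L2 A j u) \<le> ennreal C * Lr_norm r u" if u: "u \<in> Lr 2" "u \<in> Lr r" for u
  proof -
    have "Lr_norm r (S_L2 A j u) = Lr_norm r (sq {j} (\<lambda>j. P j (\<lambda>t. chi t * u t)))"
      using cmod_S_L2[OF u(1), of j] by (intro Lr_norm_cong_AE) (elim eventually_mono, simp add: cmod_sq)
    also have "\<dots> \<le> ennreal C * Lr_norm r (\<lambda>t. chi t * u t)" by (intro upper chirp_mult_Lr u) simp
    finally show ?thesis by (simp only: Lr_norm_chirp_mult)
  qed
  have mem: "S_L2 A j u \<in> Lr r" if u: "u \<in> Lr 2" "u \<in> Lr r" for u
    unfolding Lr_def mem_Collect_eq
  proof
    show "S_L2 A j u \<in> borel_measurable lebesgue" by (rule Lr_measurable[OF S_L2_eq(1)[OF u(1)]])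
    have "ennreal C * Lr_norm r u < \<top>" using Lr_norm_lt_top[OF u(2)] by (simp add: ennreal_mult_less_top)
    then show "Lr_norm r (S_L2 A j u) < \<infinity>" using le[OF u] by (simp add: le_less_trans)
  qed
  have "lbd r (Lr 2 \<inter> Lr r) (S_L2 A j) C"
    unfolding lbd_def using r
    by (intro conjI ballI allI IntI) (auto intro: Lr_lincomb S_L2_lincomb le mem)
  then show ?thesis by (rule exI)
qed

abbreviation S where "S \<equiv> S_op A r"

lemma S_lbd: "\<exists>C. lbd r (Lr r) (S j) C"
  using S_L2_lbd[of j] continuous_ext_lbd[OF _ Lr_dense_2r[OF r1] r1] unfolding S_op_def by blast

lemma S_Lr: "f \<in> Lr r \<Longrightarrow> S j f \<in> Lr r"
  using S_lbd[of j] lbdD(4) by blast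

lemma S_measurable: "f \<in> Lr r \<Longrightarrow> S j f \<in> borel_measurable lebesgue"
  by (rule Lr_measurable[OF S_Lr])

lemma S_eq:
  assumes f: "f \<in> Lr 2" "f \<in> Lr r" shows "AE x in lebesgue. S j f x = S_L2 A j f x"
proof -
  obtain C where "lbd r (Lr 2 \<inter> Lr r) (S_L2 A j) C" using S_L2_lbd by blast
  then show ?thesis unfolding S_op_def using f by (intro continuous_ext_eq[OF _ Lr_dense_2r[OF r1] r1]) auto
qed

lemma sq_S_eq:
  assumes f: "f \<in> Lr 2" "f \<in> Lr r" and J: "finite J"
  shows "Lr_norm r (sq J (\<lambda>j. S j f)) = Lr_norm r (sq J (\<lambda>j. P j (\<lambda>t. chi t * f t)))"
proof (rule Lr_norm_sq_cong_AE[OF J])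
  fix j
  show "AE x in lebesgue. cmod (S j f x) = cmod (P j (\<lambda>t. chi t * f t) x)"
    using S_eq[OF f, of j] cmod_S_L2[OF f(1), of j] by eventually_elim simp
qed

text \<open>For functions that also lie in L^2 the bound is known. With \<open>J\<close> finite and
  fixed the square function is continuous in L^r, so the bound passes along step functions, with a
  constant that does not depend on \<open>J\<close>.\<close>

lemma S_upper:
  "\<exists>C\<ge>0. \<forall>J f. finite J \<longrightarrow> f \<in> Lr r \<longrightarrow> Lr_norm r (sq J (\<lambda>j. S j f)) \<le> ennreal C * Lr_norm r f"
proof -
  obtain C where C: "0 \<le> C" and upper: "\<And>J f. finite J \<Longrightarrow> f \<in> Lr 2 \<Longrightarrow> f \<in> Lr r \<Longrightarrow>
      Lr_norm r (sq J (\<lambda>j. P j f)) \<le> ennreal C * Lr_norm r f"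
    using square_function_upper[OF k r] by blast
  have "Lr_norm r (sq J (\<lambda>j. S j f)) \<le> ennreal C * Lr_norm r f" if J: "finite J" and f: "f \<in> Lr r" for J f
  proof -
    obtain u where u: "\<And>n. u n \<in> stepfs" "(\<lambda>n. Lr_norm r (\<lambda>x. u n x - f x)) \<longlonglongrightarrow> 0"
      using stepfs_dense[OF f f r1 r1] by blast
    have uL: "u n \<in> Lr 2" "u n \<in> Lr r" for n using stepfs_Lr[OF u(1)] by blast+
    define e where "e n = Lr_norm r (\<lambda>x. u n x - f x)" for n
    define d where "d n = (\<Sum>j\<in>J. Lr_norm r (\<lambda>x. S j f x - S j (u n) x))" for n
    have d0: "d \<longlonglongrightarrow> 0"
    proof -
      have "(\<lambda>n. Lr_norm r (\<lambda>x. S j f x - S j (u n) x)) \<longlonglongrightarrow> 0" for j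
      proof -
        obtain C where "lbd r (Lr r) (S j) C" using S_lbd by blast
        from lbd_tendsto[OF this uL(2) f u(2)] show ?thesis by (subst Lr_norm_minus_commute)
      qed
      then have "(\<lambda>n. \<Sum>j\<in>J. Lr_norm r (\<lambda>x. S j f x - S j (u n) x)) \<longlonglongrightarrow> (\<Sum>j\<in>J. 0)" by (intro tendsto_sum)
      then show ?thesis unfolding d_def[abs_def] by simp
    qed
    have le: "Lr_norm r (sq J (\<lambda>j. S j f)) \<le> ennreal C * Lr_norm r f + (ennreal C * e n + d n)" for n
    proof -
      let ?D = "\<lambda>j x. S j f x - S j (u n) x"
      have Dm: "?D j \<in> borel_measurable lebesgue" for j
        by (intro borel_measurable_diff S_measurable f uL)
      have "Lr_norm r (sq J (\<lambda>j. S j f)) = Lr_norm r (sq J (\<lambda>j x. S j (u n) x + 1 * ?D j x))" by simp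
      also have "\<dots> \<le> Lr_norm r (sq J (\<lambda>j. S j (u n))) + Lr_norm r (sq J ?D)"
        by (rule Lr_norm_sq_triangle[OF S_measurable[OF uL(2)] Dm r1]) simp
      also have "\<dots> \<le> ennreal C * Lr_norm r (u n) + d n"
      proof (rule add_mono)
        have "Lr_norm r (sq J (\<lambda>j. S j (u n))) \<le> ennreal C * Lr_norm r (\<lambda>t. chi t * u n t)"
          unfolding sq_S_eq[OF uL J] by (intro upper J chirp_mult_Lr uL)
        then show "Lr_norm r (sq J (\<lambda>j. S j (u n))) \<le> ennreal C * Lr_norm r (u n)" by (simp only: Lr_norm_chirp_mult)
        show "Lr_norm r (sq J ?D) \<le> d n" unfolding d_def by (rule Lr_norm_sq_le_sum[OF r1 J Dm])
      qed
      also have "\<dots> \<le> ennreal C * (Lr_norm r f + e n) + d n"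
        unfolding e_def by (intro add_right_mono mult_left_mono Lr_norm_le_diff r1 Lr_measurable[OF uL(1)] Lr_measurable[OF f]) simp
      finally show ?thesis by (simp add: distrib_left add.assoc)
    qed
    have "(\<lambda>n. ennreal C * e n + d n) \<longlonglongrightarrow> 0"
      by (rule ennreal_squeeze_0[where C="ennreal C" and b=e and d=d, OF order_refl _ d0]) (use u(2) in \<open>simp_all add: e_def[abs_def]\<close>)
    from ennreal_le_lim_0[OF le this] show ?thesis .
  qed
  then show ?thesis using C by blast
qed

text \<open>The step function \<open>u n\<close> lies in L^2, where the lower bound is known. Its
  square functions are at most \<open>X\<close> plus those of the error u n - f, and the upper bound
  controls the latter by M * e n.\<close>

lemma S_lower:
  "\<exists>C\<ge>0. \<forall>f X. f \<in> Lr r \<longrightarrow> (\<forall>N::nat. Lr_norm r (sq {- int N..int N} (\<lambda>j. S j f)) \<le> X) \<longrightarrow>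
    Lr_norm r f \<le> ennreal C * X"
proof -
  obtain M where M: "0 \<le> M" and up: "\<And>J f. finite J \<Longrightarrow> f \<in> Lr r \<Longrightarrow>
      Lr_norm r (sq J (\<lambda>j. S j f)) \<le> ennreal M * Lr_norm r f"
    using S_upper by blast
  obtain C where C: "0 \<le> C" and low: "\<And>f X. f \<in> Lr 2 \<Longrightarrow> f \<in> Lr r \<Longrightarrow>
    (\<And>N::nat. Lr_norm r (sq {- int N..int N} (\<lambda>j. P j f)) \<le> X) \<Longrightarrow> Lr_norm r f \<le> ennreal C * X"
    using square_function_lower[OF k r] by blast
  have "Lr_norm r f \<le> ennreal C * X" if f: "f \<in> Lr r"
    and X: "\<And>N::nat. Lr_norm r (sq {- int N..int N} (\<lambda>j. S j f)) \<le> X" for f X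
  proof -
    obtain u where u: "\<And>n. u n \<in> stepfs" "(\<lambda>n. Lr_norm r (\<lambda>x. u n x - f x)) \<longlonglongrightarrow> 0"
      using stepfs_dense[OF f f r1 r1] by blast
    have uL: "u n \<in> Lr 2" "u n \<in> Lr r" for n using stepfs_Lr[OF u(1)] by blast+
    define e where "e n = Lr_norm r (\<lambda>x. u n x - f x)" for n
    have e0: "e \<longlonglongrightarrow> 0" using u(2) by (simp add: e_def[abs_def])
    have le: "Lr_norm r f \<le> ennreal C * X + (ennreal (C * M) * e n + e n)" for n
    proof -
      have df: "(\<lambda>x. u n x - f x) \<in> Lr r" by (rule Lr_diff[OF uL(2) f r1])
      have "Lr_norm r (sq {- int N..int N} (\<lambda>j. P j (\<lambda>t. chi t * u n t))) \<le> X + ennreal M * e n" for N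
      proof -
        let ?J = "{- int N..int N}"
        have "Lr_norm r (sq ?J (\<lambda>j. P j (\<lambda>t. chi t * u n t))) = Lr_norm r (sq ?J (\<lambda>j. S j (u n)))"
          using sq_S_eq[OF uL, of ?J] by simp
        also have "\<dots> = Lr_norm r (sq ?J (\<lambda>j x. S j f x + 1 * S j (\<lambda>x. u n x - f x) x))"
        proof (rule Lr_norm_sq_cong_AE)
          fix j
          obtain C where "lbd r (Lr r) (S j) C" using S_lbd by blast
          from lbdD(2)[OF this f df, of 1]
          show "AE x in lebesgue. cmod (S j (u n) x) = cmod (S j f x + 1 * S j (\<lambda>x. u n x - f x) x)"
            by (rule eventually_mono) simp
        qed simp
        also have "\<dots> \<le> Lr_norm r (sq ?J (\<lambda>j. S j f)) + Lr_norm r (sq ?J (\<lambda>j. S j (\<lambda>x. u n x - f x)))"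
          by (rule Lr_norm_sq_triangle[OF S_measurable[OF f] S_measurable[OF df] r1]) simp
        also have "\<dots> \<le> X + ennreal M * e n" unfolding e_def by (intro add_mono X up df) simp
        finally show ?thesis .
      qed
      then have "Lr_norm r (\<lambda>t. chi t * u n t) \<le> ennreal C * (X + ennreal M * e n)"
        by (intro low chirp_mult_Lr uL)
      then have un: "Lr_norm r (u n) \<le> ennreal C * (X + ennreal M * e n)" by (simp only: Lr_norm_chirp_mult)
      have "Lr_norm r f \<le> Lr_norm r (u n) + e n"
        unfolding e_def using Lr_norm_le_diff[OF Lr_measurable[OF f] Lr_measurable[OF uL(2)] r1]
        by (subst Lr_norm_minus_commute)
      also have "\<dots> \<le> ennreal C * (X + ennreal M * e n) + e n" by (rule add_right_mono[OF un])
      finally show ?thesis using C by (simp add: distrib_left add.assoc ennreal_mult' mult.assoc)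
    qed
    have "(\<lambda>n. ennreal (C * M) * e n + e n) \<longlonglongrightarrow> 0"
      by (rule ennreal_squeeze_0[OF order_refl e0 e0]) simp
    from ennreal_le_lim_0[OF le this] show ?thesis .
  qed
  then show ?thesis using C by blast
qed

lemma square_fun_bounds:
  "\<exists>m M. 0 < m \<and> 0 < M \<and> (\<forall>f\<in>Lr r. ennreal m * Lr_norm r f \<le> nn_norm r (square_fun A r f) \<and>
    nn_norm r (square_fun A r f) \<le> ennreal M * Lr_norm r f)"
proof -
  obtain M where M: "0 \<le> M" and up: "\<And>J f. finite J \<Longrightarrow> f \<in> Lr r \<Longrightarrow>
      Lr_norm r (sq J (\<lambda>j. S j f)) \<le> ennreal M * Lr_norm r f"
    using S_upper by blast
  obtain C where C: "0 \<le> C" and low: "\<And>f X. f \<in> Lr r \<Longrightarrow>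
    (\<And>N::nat. Lr_norm r (sq {- int N..int N} (\<lambda>j. S j f)) \<le> X) \<Longrightarrow> Lr_norm r f \<le> ennreal C * X"
    using S_lower by blast
  \<comment> \<open>Both C and M may be 0; adding 1 makes the final constants positive.\<close>
  have "ennreal (1 / (C + 1)) * Lr_norm r f \<le> nn_norm r (square_fun A r f) \<and>
      nn_norm r (square_fun A r f) \<le> ennreal (M + 1) * Lr_norm r f" if f: "f \<in> Lr r" for f
  proof -
    have "nn_norm r (square_fun A r f) = (SUP N::nat. Lr_norm r (sq {- int N..int N} (\<lambda>j. S j f)))"
      unfolding square_fun_def[abs_def] by (rule nn_norm_square_sum[OF S_measurable[OF f]]) (use r in simp)
    moreover define X where "X = (SUP N::nat. Lr_norm r (sq {- int N..int N} (\<lambda>j. S j f)))"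
    ultimately have sf: "nn_norm r (square_fun A r f) = X" by simp
    have "Lr_norm r f \<le> ennreal C * X" unfolding X_def by (intro low f SUP_upper) simp
    also have "\<dots> \<le> ennreal (C + 1) * X" by (intro mult_right_mono ennreal_leI) auto
    finally have "ennreal (1 / (C + 1)) * Lr_norm r f \<le> ennreal (1 / (C + 1)) * (ennreal (C + 1) * X)"
      by (rule mult_left_mono) simp
    also have "ennreal (1 / (C + 1)) * (ennreal (C + 1) * X) = X"
    proof -
      have "ennreal (1 / (C + 1)) * ennreal (C + 1) = 1" using C by (subst ennreal_mult'[symmetric]) auto
      then show ?thesis by (simp only: mult.assoc[symmetric] mult_1)
    qed
    finally have 1: "ennreal (1 / (C + 1)) * Lr_norm r f \<le> X" .
    have "X \<le> ennreal M * Lr_norm r f" unfolding X_def by (intro SUP_least up f) simp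
    also have "\<dots> \<le> ennreal (M + 1) * Lr_norm r f" by (intro mult_right_mono ennreal_leI) auto
    finally show ?thesis using 1 unfolding sf by simp
  qed
  then show ?thesis using C M by (intro exI[of _ "1 / (C + 1)"] exI[of _ "M + 1"]) auto
qed

end

end

theorem theorem6p4:
  fixes a b c d p q :: real
  assumes "a * d - b * c = 1" and "b \<noteq> 0"
  defines "A \<equiv> (a, b, c, d, p, q)"
  shows "\<forall>r::real. 1 < r \<longrightarrow>
    (\<exists>m M :: real. 0 < m \<and> 0 < M \<and>
      (\<forall>f\<in>Lr r.
        ennreal m * Lr_norm r f \<le> nn_norm r (square_fun A r f) \<and>
        nn_norm r (square_fun A r f) \<le> ennreal M * Lr_norm r f))"
proof (intro allI impI)
  fix r :: real assume r: "1 < r"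
  interpret saft a b c d p q by unfold_locales (rule assms(2))
  show "\<exists>m M :: real. 0 < m \<and> 0 < M \<and> (\<forall>f\<in>Lr r. ennreal m * Lr_norm r f \<le> nn_norm r (square_fun A r f) \<and>
      nn_norm r (square_fun A r f) \<le> ennreal M * Lr_norm r f)"
    unfolding A_def by (rule square_fun_bounds[OF r])
qed

end
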